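(* Let $n\geq3$, $0\leq s<2$ and $\gamma<\frac{(n-2)^2}{4}$. Then the best constant $\mu_{\gamma,s}(\mathbb{R}^n)$ is attained if either $s>0$ or $\{s=0$ and $\gamma\geq0\}$. On the other hand, if $s=0$ and $\gamma<0$, then $\mu_{\gamma,s}(\mathbb{R}^n)$ is not attained.
   Context: $D^{1,2}(\mathbb{R}^n)$ is the completion of $C_c^\infty(\mathbb{R}^n)$ for $\|u\|^2=\int|\nabla u|^2dx$, $2^*(s)=\frac{2(n-s)}{n-2}$, and $$\mu_{\gamma,s}(\mathbb{R}^n)=\inf_{u\in D^{1,2}(\mathbb{R}^n)\setminus\{0\}}\frac{\int_{\mathbb{R}^n}|\nabla u|^2dx-\gamma\int_{\mathbb{R}^n}\frac{u^2}{|x|^2}dx}{\left(\int_{\mathbb{R}^n}\frac{|u|^{2^*(s)}}{|x|^s}dx\right)^{2/2^*(s)}}.$$ It is attained if some $u\in D^{1,2}(\mathbb{R}^n)\setminus\{0\}$ realizes the infimum. *)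

theory Defs
  imports "HOL-Analysis.Analysis"
begin

definition partial :: "'n \<Rightarrow> (real^'n \<Rightarrow> real) \<Rightarrow> real^'n \<Rightarrow> real" where
  "partial i f x = frechet_derivative f (at x) (axis i 1)"

definition grad :: "(real^'n \<Rightarrow> real) \<Rightarrow> real^'n \<Rightarrow> real^'n" where
  "grad f x = (\<chi> i. partial i f x)"

primrec C_k :: "nat \<Rightarrow> (real^'n \<Rightarrow> real) \<Rightarrow> bool" where
  "C_k 0 f \<longleftrightarrow> continuous_on UNIV f"
| "C_k (Suc k) f \<longleftrightarrow> f differentiable_on UNIV \<and> (\<forall>i. C_k k (partial i f))"

definition test_functions :: "(real^'n \<Rightarrow> real) set" where
  "test_functions = {f. (\<forall>k. C_k k f) \<and> compact (closure {x. f x \<noteq> 0})}"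

definition crit_exp :: "'n::finite itself \<Rightarrow> real \<Rightarrow> real" where
  "crit_exp _ s = 2 * (real CARD('n) - s) / (real CARD('n) - 2)"

text \<open>
  The completion of the test functions for the norm \<open>(\<integral>|\<nabla>u|\<^sup>2)\<^sup>1\<^sup>/\<^sup>2\<close> is realized, as usual for
  \<open>n \<ge> 3\<close>, as a space of functions: by the Sobolev inequality a sequence of test functions that is
  Cauchy for this norm also converges in \<open>L\<^sup>p\<close> with \<open>p = 2n/(n-2)\<close>, and the limit \<open>u\<close>
  determines the class of the sequence. \<open>is_D12_grad u G\<close> says that \<open>u\<close> is the function
  represented by such a sequence and that \<open>G\<close>, the \<open>L\<^sup>2\<close> limit of the gradients, is its (weak)
  gradient; \<open>G\<close> is determined by \<open>u\<close> up to null sets. The limits are phrased with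
  \<^emph>\<open>nonnegative\<close> integrals because the Bochner integral of a non-integrable function is 0.
  Elements are functions rather than classes modulo null sets; every class has a Borel
  representative.
\<close>

definition is_D12_grad :: "(real^'n::finite \<Rightarrow> real) \<Rightarrow> (real^'n \<Rightarrow> real^'n) \<Rightarrow> bool" where
  "is_D12_grad u G \<longleftrightarrow>
     u \<in> borel_measurable lborel \<and> G \<in> borel_measurable lborel \<and>
     (\<exists>\<phi> :: nat \<Rightarrow> real^'n \<Rightarrow> real.
        (\<forall>k. \<phi> k \<in> test_functions) \<and>
        (\<lambda>k. \<integral>\<^sup>+x. ennreal ((norm (grad (\<phi> k) x - G x))\<^sup>2) \<partial>lborel) \<longlonglongrightarrow> 0 \<and>
        (\<lambda>k. \<integral>\<^sup>+x. ennreal (\<bar>\<phi> k x - u x\<bar> powr crit_exp TYPE('n) 0) \<partial>lborel) \<longlonglongrightarrow> 0)"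

definition D12 :: "(real^'n::finite \<Rightarrow> real) set" where
  "D12 = {u. \<exists>G. is_D12_grad u G}"

definition D12_grad :: "(real^'n::finite \<Rightarrow> real) \<Rightarrow> real^'n \<Rightarrow> real^'n" where
  "D12_grad u = (SOME G. is_D12_grad u G)"

definition D12_nonzero :: "(real^'n::finite \<Rightarrow> real) set" where
  "D12_nonzero = {u \<in> D12. \<not> (AE x in lborel. u x = 0)}"

text \<open>
  For \<open>u \<in> D12\<close>, \<open>n \<ge> 3\<close> and \<open>0 \<le> s \<le> 2\<close> all three integrands are integrable (Hardy and
  Hardy-Sobolev inequalities), so the Bochner integrals below have their usual meaning. The point
  \<open>x = 0\<close>, where the division is by 0 (also for \<open>s = 0\<close>, as \<open>0 powr 0 = 0\<close>), is a null set.
\<close>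

definition HS_quotient :: "real \<Rightarrow> real \<Rightarrow> (real^'n::finite \<Rightarrow> real) \<Rightarrow> real" where
  "HS_quotient \<gamma> s u =
     ((\<integral>x. (norm (D12_grad u x))\<^sup>2 \<partial>lborel) - \<gamma> * (\<integral>x. (u x)\<^sup>2 / (norm x)\<^sup>2 \<partial>lborel)) /
     (\<integral>x. \<bar>u x\<bar> powr crit_exp TYPE('n) s / norm x powr s \<partial>lborel)
       powr (2 / crit_exp TYPE('n) s)"

text \<open>
  For \<open>\<gamma> < (n-2)\<^sup>2/4\<close> the Hardy inequality bounds the quotients below by 0, so the real-valued
  infimum is the genuine one.
\<close>

definition HS_mu :: "'n::finite itself \<Rightarrow> real \<Rightarrow> real \<Rightarrow> real" where
  "HS_mu _ \<gamma> s = (INF u \<in> (D12_nonzero :: (real^'n \<Rightarrow> real) set). HS_quotient \<gamma> s u)"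

definition HS_mu_attained :: "'n::finite itself \<Rightarrow> real \<Rightarrow> real \<Rightarrow> bool" where
  "HS_mu_attained N \<gamma> s \<longleftrightarrow>
     (\<exists>u \<in> (D12_nonzero :: (real^'n \<Rightarrow> real) set). HS_quotient \<gamma> s u = HS_mu N \<gamma> s)"

end

theory Submission
  imports Defs "HOL-Real_Asymp.Real_Asymp" "HOL-Complex_Analysis.Great_Picard"
begin

text \<open>Extremals are found by concentration compactness. By convexity of the energy (Mazur) and
  the Brezis-Lieb splitting, a minimizing sequence of test functions either yields a minimizer or
  vanishes locally in $L^2$. Dilations (and translations, if $s = \gamma = 0$) normalize the
  sequence, and localizing by $\sin^2 + \cos^2 = 1$ together with the Minkowski
  inequality rules vanishing out: for $s > 0$ the mass in an annulus is subcritical, for $s = 0 < \gamma$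
  it is controlled by the gap to the Sobolev constant, which is itself attained.
  For $s = 0 > \gamma$, translating test functions to infinity shows that the infimum is at most the
  Sobolev constant, while the Hardy term makes the quotient strictly larger.\<close>

text \<open>The obstacle is the dilation invariance of numerator and denominator: a bounded sequence
  converges locally in L^2 but may lose critical mass by concentrating or spreading. What prevents
  the loss is that q = 2 / \<open>crit_exp\<close> lies strictly between 0 and 1: parts of mass m
  and 1 - m cost m^q + (1-m)^q times the infimum, which exceeds the infimum unless m is 0 or 1. For
  the a.e. limit u of a minimizing sequence \<open>U\<close>, energy is compared along combinations
  (1-r) \<open>U k\<close> + r w, with w in the convex hull of a tail and close to u in Dirichlet
  norm. Dividing by 1-r and letting r tend to 1 gives energy(u) + mu (1-m)^q \<le> mu. The pair sin,
  cos is chosen because the Hardy term then splits exactly and the Dirichlet cross terms cancel; the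
  only error is local L^2 mass, which vanishes. One estimate, the L^2 size of f(x+h) - f(x), yields
  both the Faber-Krahn inequality, hence Sobolev by dyadic truncation, and Rellich compactness by
  averages over cubes.\<close>

section \<open>Smooth functions of one variable and a smooth step\<close>

text \<open>The class C^k on the line, the outer functions for compositions with \<open>C_k\<close>
  functions. The derivative is bound existentially, so that an induction step only has to exhibit
  one.\<close>

primrec S_k :: "nat \<Rightarrow> (real \<Rightarrow> real) \<Rightarrow> bool" where
  "S_k 0 F \<longleftrightarrow> continuous_on UNIV F"
| "S_k (Suc k) F \<longleftrightarrow> (\<exists>F'. (\<forall>t. (F has_real_derivative F' t) (at t)) \<and> S_k k F')"

lemma S_k_SucI:
  "(\<And>t. (F has_real_derivative F' t) (at t)) \<Longrightarrow> S_k k F' \<Longrightarrow> S_k (Suc k) F"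
  by auto

lemma S_k_continuous: "S_k k F \<Longrightarrow> continuous_on UNIV F"
proof (cases k)
  case (Suc m)
  moreover assume "S_k k F"
  ultimately obtain F' where "\<And>t. (F has_real_derivative F' t) (at t)" by auto
  then show ?thesis by (intro continuous_at_imp_continuous_on ballI DERIV_isCont)
qed simp

lemma S_k_SucD: "S_k (Suc k) F \<Longrightarrow> S_k k F"
proof (induction k arbitrary: F)
  case 0 then show ?case using S_k_continuous[of "Suc 0" F] by simp
next
  case (Suc k) then show ?case by (metis S_k.simps(2))
qed

lemma S_k_const: "S_k k (\<lambda>_. c)"
proof (induction k arbitrary: c)
  case (Suc k) show ?case by (rule S_k_SucI[where F'="\<lambda>_. 0"]) (auto simp: Suc)
qed auto

lemma S_k_add: "S_k k F \<Longrightarrow> S_k k G \<Longrightarrow> S_k k (\<lambda>t. F t + G t)"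
proof (induction k arbitrary: F G)
  case (Suc k)
  then obtain F' G' where "\<And>t. (F has_real_derivative F' t) (at t)" "S_k k F'"
     "\<And>t. (G has_real_derivative G' t) (at t)" "S_k k G'" by auto
  then show ?case
    by (intro S_k_SucI[where F'="\<lambda>t. F' t + G' t"]) (auto intro!: derivative_eq_intros Suc.IH)
qed (auto intro: continuous_intros)

lemma S_k_mult: "S_k k F \<Longrightarrow> S_k k G \<Longrightarrow> S_k k (\<lambda>t. F t * G t)"
proof (induction k arbitrary: F G)
  case (Suc k)
  then obtain F' G' where *: "\<And>t. (F has_real_derivative F' t) (at t)" "S_k k F'"
     "\<And>t. (G has_real_derivative G' t) (at t)" "S_k k G'" by auto
  show ?case
    by (rule S_k_SucI[where F'="\<lambda>t. F' t * G t + G' t * F t"])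
       (use * Suc.prems in \<open>auto intro!: derivative_eq_intros S_k_add Suc.IH dest: S_k_SucD simp del: S_k.simps\<close>)
qed (auto intro: continuous_intros)

lemma S_k_inverse: "S_k k F \<Longrightarrow> (\<And>t. F t \<noteq> 0) \<Longrightarrow> S_k k (\<lambda>t. inverse (F t))"
proof (induction k arbitrary: F)
  case (Suc k)
  then obtain F' where *: "\<And>t. (F has_real_derivative F' t) (at t)" "S_k k F'" by auto
  have i: "S_k k (\<lambda>t. inverse (F t))" using Suc S_k_SucD by blast
  show ?case
  proof (rule S_k_SucI[where F'="\<lambda>t. (-1) * (inverse (F t) * (F' t * inverse (F t)))"])
    show "((\<lambda>t. inverse (F t)) has_real_derivative (-1) * (inverse (F t) * (F' t * inverse (F t)))) (at t)" for t
      using DERIV_inverse'[OF *(1) Suc.prems(2), of t] by (simp add: mult_ac)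
  qed (intro S_k_mult S_k_const i *)
qed (auto intro!: continuous_intros)

lemma S_k_affine: "S_k k F \<Longrightarrow> S_k k (\<lambda>t. F (a * t + b))"
proof (induction k arbitrary: F)
  case 0 then show ?case
    by (auto intro!: continuous_on_compose2[of UNIV F] continuous_intros)
next
  case (Suc k)
  then obtain F' where *: "\<And>t. (F has_real_derivative F' t) (at t)" "S_k k F'" by auto
  show ?case
  proof (rule S_k_SucI[where F'="\<lambda>t. F' (a * t + b) * a"])
    show "((\<lambda>t. F (a * t + b)) has_real_derivative F' (a * t + b) * a) (at t)" for t
      by (rule DERIV_chain2[of F, OF *(1)]) (auto intro!: derivative_eq_intros)
  qed (intro S_k_mult S_k_const Suc.IH *)
qed

lemma S_k_sin_cos: "S_k k sin" "S_k k cos"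
proof -
  have "S_k k sin \<and> S_k k cos"
  proof (induction k)
    case (Suc k)
    have "S_k k (\<lambda>t. (-1) * sin t)" by (intro S_k_mult S_k_const) (use Suc in auto)
    then have "S_k (Suc k) cos"
      by (intro S_k_SucI[where F'="\<lambda>t. (-1) * sin t"]) (auto intro!: derivative_eq_intros)
    moreover have "S_k (Suc k) sin"
      using Suc by (intro S_k_SucI[where F'=cos]) (auto intro!: derivative_eq_intros)
    ultimately show ?case by blast
  qed (auto intro!: continuous_intros)
  then show "S_k k sin" "S_k k cos" by auto
qed

text \<open>The standard flat function exp(-1/t) is embedded in a family with a power of t in the
  denominator, because the family is closed under differentiation up to linear combinations.
  Smoothness is then an induction on the order with \<open>m\<close> arbitrary.\<close>

definition flat :: "nat \<Rightarrow> real \<Rightarrow> real" where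
  "flat m t = (if t \<le> 0 then 0 else exp (- 1 / t) / t ^ m)"

lemma flat_over_t_tendsto: "((\<lambda>t. flat m t / t) \<longlongrightarrow> 0) (at 0)"
proof -
  have "((\<lambda>t::real. exp (- 1 / t) / t ^ m / t) \<longlongrightarrow> 0) (at_right 0)"
    by real_asymp
  then have "((\<lambda>t. flat m t / t) \<longlongrightarrow> 0) (at_right 0)"
    by (rule filterlim_cong[THEN iffD1, rotated -1])
       (auto simp: flat_def eventually_at_filter)
  moreover have "((\<lambda>t. flat m t / t) \<longlongrightarrow> 0) (at_left 0)"
    by (rule tendsto_eventually) (auto simp: flat_def eventually_at_filter)
  ultimately show ?thesis by (simp add: filterlim_split_at)
qed

lemma flat_has_derivative:
  "(flat m has_real_derivative (- real m) * flat (Suc m) t + flat (Suc (Suc m)) t) (at t)"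
proof -
  consider "t < 0" | "t = 0" | "t > 0" by linarith
  then show ?thesis
  proof cases
    case 1
    have "((\<lambda>_. 0) has_real_derivative 0) (at t)" by simp
    then have "(flat m has_real_derivative 0) (at t)"
      by (rule has_field_derivative_transform_within_open[where S="{..<0}"]) (use 1 in \<open>auto simp: flat_def\<close>)
    then show ?thesis using 1 by (simp add: flat_def)
  next
    case 2
    \<comment> \<open>As \<open>flat m 0\<close> is 0, the limit just computed is that of the
      difference quotient; the claimed derivative also vanishes at 0.\<close>
    then show ?thesis using flat_over_t_tendsto[of m] by (simp add: DERIV_def flat_def[of _ 0])
  next
    case 3
    have "((\<lambda>t. exp (- 1 / t) / t ^ m) has_real_derivative
        (exp (- 1 / t) * (1 / (t*t)) * t ^ m - exp (- 1 / t) * (real m * t ^ (m - 1))) / (t^m * t^m)) (at t)"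
      using 3 by (auto intro!: derivative_eq_intros simp: power2_eq_square)
    moreover have "(exp (- 1 / t) * (1 / (t*t)) * t ^ m - exp (- 1 / t) * (real m * t ^ (m - 1))) / (t^m * t^m)
       = (- real m) * flat (Suc m) t + flat (Suc (Suc m)) t"
      using 3 by (cases m) (auto simp: flat_def field_simps)
    ultimately have "((\<lambda>t. exp (- 1 / t) / t ^ m) has_real_derivative
        (- real m) * flat (Suc m) t + flat (Suc (Suc m)) t) (at t)" by simp
    then show ?thesis
      by (rule has_field_derivative_transform_within_open[where S="{0<..}"]) (use 3 in \<open>auto simp: flat_def\<close>)
  qed
qed

lemma S_k_flat: "S_k k (flat m)"
proof (induction k arbitrary: m)
  case 0
  show ?case
    by (simp, intro continuous_at_imp_continuous_on ballI DERIV_isCont[OF flat_has_derivative])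
next
  case (Suc k)
  show ?case
    by (rule S_k_SucI[OF flat_has_derivative]) (intro S_k_add S_k_mult S_k_const Suc)
qed

text \<open>The usual quotient f(t) / (f(t) + f(1-t)). The denominator is positive because t and 1-t
  are never both nonpositive; 1-t is spelled as an affine expression to fit
  \<open>S_k_affine\<close>.\<close>

definition smooth_step :: "real \<Rightarrow> real" where
  "smooth_step t = flat 0 t * inverse (flat 0 t + flat 0 ((-1) * t + 1))"

lemma smooth_step_denominator: "flat 0 t + flat 0 ((-1) * t + 1) > 0"
  by (auto simp: flat_def add_pos_pos)

lemma smooth_step_props:
  "t \<le> 0 \<Longrightarrow> smooth_step t = 0" "t \<ge> 1 \<Longrightarrow> smooth_step t = 1" "0 \<le> smooth_step t" "smooth_step t \<le> 1"
  using smooth_step_denominator[of t]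
  by (auto simp: smooth_step_def flat_def field_simps not_le intro!: mult_nonneg_nonneg split: if_splits)

lemma S_k_smooth_step: "S_k k smooth_step"
  unfolding smooth_step_def[abs_def]
  by (intro S_k_mult S_k_inverse S_k_add S_k_affine S_k_flat) (use smooth_step_denominator in \<open>metis less_irrefl\<close>)

section \<open>Calculus of \<open>C_k\<close> functions and of test functions\<close>

lemma partial_eqI: "(f has_derivative f') (at x) \<Longrightarrow> partial i f x = f' (axis i 1)"
  by (metis partial_def frechet_derivative_at)

text \<open>\<open>C_k\<close> speaks of \<open>partial\<close>, that is, of a chosen Frechet
  derivative. This rule and \<open>C_k_SucE\<close> trade the choice for an explicit derivative map,
  and the closure proofs below run through the pair.\<close>

lemma C_k_SucI:
  assumes "\<And>x. (f has_derivative f' x) (at x)" "\<And>i. C_k k (\<lambda>x. f' x (axis i 1))"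
  shows "C_k (Suc k) f"
proof -
  have "partial i f = (\<lambda>x. f' x (axis i 1))" for i using partial_eqI[OF assms(1)] by auto
  then show ?thesis using assms
    by (auto simp: differentiable_on_def differentiable_def intro: has_derivative_at_withinI)
qed

lemma C_k_SucE:
  assumes "C_k (Suc k) f"
  obtains f' where "\<And>x. (f has_derivative f' x) (at x)" "\<And>i. C_k k (\<lambda>x. f' x (axis i 1))"
proof
  show *: "(f has_derivative frechet_derivative f (at x)) (at x)" for x
    using assms by (simp add: differentiable_on_def frechet_derivative_works[symmetric])
  show "C_k k (\<lambda>x. frechet_derivative f (at x) (axis i 1))" for i
    using assms partial_eqI[OF *] by (simp add: partial_def[abs_def])
qed

lemma C_k_continuous: "C_k k f \<Longrightarrow> continuous_on UNIV f"
  by (cases k) (auto intro: differentiable_imp_continuous_on)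

lemma C_k_SucD: "C_k (Suc k) f \<Longrightarrow> C_k k f"
proof (induction k arbitrary: f)
  case 0 then show ?case using C_k_continuous[of "Suc 0" f] by simp
qed auto

lemma C_k_const: "C_k k (\<lambda>_. c)"
proof (induction k arbitrary: c)
  case (Suc k) show ?case by (rule C_k_SucI[where f'="\<lambda>_ _. 0"]) (auto simp: Suc)
qed auto

lemma C_k_add: "C_k k f \<Longrightarrow> C_k k g \<Longrightarrow> C_k k (\<lambda>x. f x + g x)"
proof (induction k arbitrary: f g)
  case (Suc k)
  obtain f' where f': "\<And>x. (f has_derivative f' x) (at x)" "\<And>i. C_k k (\<lambda>x. f' x (axis i 1))"
    using C_k_SucE[OF Suc.prems(1)] by blast
  obtain g' where g': "\<And>x. (g has_derivative g' x) (at x)" "\<And>i. C_k k (\<lambda>x. g' x (axis i 1))"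
    using C_k_SucE[OF Suc.prems(2)] by blast
  show ?case
    by (rule C_k_SucI[where f'="\<lambda>x h. f' x h + g' x h"]) (intro has_derivative_add f' g' Suc.IH)+
qed (auto intro: continuous_intros)

lemma C_k_mult: "C_k k f \<Longrightarrow> C_k k g \<Longrightarrow> C_k k (\<lambda>x. f x * g x)"
proof (induction k arbitrary: f g)
  case (Suc k)
  obtain f' where f': "\<And>x. (f has_derivative f' x) (at x)" "\<And>i. C_k k (\<lambda>x. f' x (axis i 1))"
    using C_k_SucE[OF Suc.prems(1)] by blast
  obtain g' where g': "\<And>x. (g has_derivative g' x) (at x)" "\<And>i. C_k k (\<lambda>x. g' x (axis i 1))"
    using C_k_SucE[OF Suc.prems(2)] by blast
  show ?case
    by (rule C_k_SucI[where f'="\<lambda>x h. f x * g' x h + f' x h * g x"])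
       (intro has_derivative_mult f' g' Suc.IH C_k_add C_k_SucD[OF Suc.prems(1)] C_k_SucD[OF Suc.prems(2)])+
qed (auto intro: continuous_intros)

lemma C_k_component: "C_k k (\<lambda>x::real^'n::finite. x $ i)"
proof (cases k)
  case (Suc m)
  show ?thesis unfolding Suc
    by (rule C_k_SucI[where f'="\<lambda>x h. h $ i"]) (intro bounded_linear_imp_has_derivative bounded_linear_vec_nth C_k_const)+
qed (auto intro!: continuous_intros)

lemma C_k_compose: "S_k k F \<Longrightarrow> C_k k f \<Longrightarrow> C_k k (\<lambda>x. F (f x))"
proof (induction k arbitrary: F f)
  case 0 then show ?case by (auto intro: continuous_on_compose2[of UNIV F])
next
  case (Suc k)
  obtain f' where f': "\<And>x. (f has_derivative f' x) (at x)" "\<And>i. C_k k (\<lambda>x. f' x (axis i 1))"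
    using C_k_SucE[OF Suc.prems(2)] by blast
  obtain F' where F': "\<And>t. (F has_real_derivative F' t) (at t)" "S_k k F'" using Suc.prems by auto
  show ?case
  proof (rule C_k_SucI[where f'="\<lambda>x h. F' (f x) * f' x h"])
    show "((\<lambda>x. F (f x)) has_derivative (\<lambda>h. F' (f x) * f' x h)) (at x)" for x
      using has_derivative_compose[OF f'(1) F'(1)[unfolded has_field_derivative_def]] .
    show "C_k k (\<lambda>x. F' (f x) * f' x (axis i 1))" for i
      by (rule C_k_mult[OF Suc.IH[OF F'(2) C_k_SucD[OF Suc.prems(2)]] f'(2)])
  qed
qed

lemma C_k_affine: "C_k k f \<Longrightarrow> C_k k (\<lambda>x::real^'n::finite. f (a *\<^sub>R x + b))"
proof (induction k arbitrary: f)
  case 0 then show ?case by (auto intro!: continuous_on_compose2[of UNIV f] continuous_intros)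
next
  case (Suc k)
  obtain f' where f': "\<And>x. (f has_derivative f' x) (at x)" "\<And>i. C_k k (\<lambda>x. f' x (axis i 1))"
    using C_k_SucE[OF Suc.prems(1)] by blast
  have d: "((\<lambda>x. f (a *\<^sub>R x + b)) has_derivative (\<lambda>h. a * f' (a *\<^sub>R x + b) h)) (at x)" for x
  proof -
    have "((\<lambda>x. f (a *\<^sub>R x + b)) has_derivative (\<lambda>h. f' (a *\<^sub>R x + b) (a *\<^sub>R h))) (at x)"
      by (rule has_derivative_compose[where g=f, OF _ f'(1)]) (auto intro!: derivative_eq_intros)
    then show ?thesis
      using linear_scale[OF has_derivative_linear[OF f'(1)]] by simp
  qed
  show ?case
    by (rule C_k_SucI[OF d]) (rule C_k_mult[OF C_k_const Suc.IH[OF f'(2)]])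
qed

lemma test_functionsI:
  "(\<And>k. C_k k f) \<Longrightarrow> compact K \<Longrightarrow> (\<And>x. x \<notin> K \<Longrightarrow> f x = 0) \<Longrightarrow> f \<in> test_functions"
  by (auto simp: test_functions_def intro!: bounded_subset[OF compact_imp_bounded])

lemma test_functions_C_k: "f \<in> test_functions \<Longrightarrow> C_k k f"
  by (simp add: test_functions_def)

lemma test_functions_support:
  assumes "f \<in> test_functions"
  obtains K where "compact K" "\<And>x. x \<notin> K \<Longrightarrow> f x = 0"
proof
  show "compact (closure {x. f x \<noteq> 0})" using assms unfolding test_functions_def by blast
  show "f x = 0" if "x \<notin> closure {x. f x \<noteq> 0}" for x 
    using that closure_subset[of "{x. f x \<noteq> 0}"] by (metis (mono_tags) mem_Collect_eq subsetD)
qed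

lemma test_functions_add:
  assumes "f \<in> test_functions" "g \<in> test_functions"
  shows "(\<lambda>x. f x + g x) \<in> test_functions"
proof -
  obtain K where "compact K" "\<And>x. x \<notin> K \<Longrightarrow> f x = 0"
    using test_functions_support[OF assms(1)] by blast
  moreover obtain L where "compact L" "\<And>x. x \<notin> L \<Longrightarrow> g x = 0"
    using test_functions_support[OF assms(2)] by blast
  ultimately show ?thesis
    by (intro test_functionsI[where K="K \<union> L"] compact_Un
        C_k_add[OF test_functions_C_k[OF assms(1)] test_functions_C_k[OF assms(2)]]) simp_all
qed

lemma smooth_mult_test_functions:
  assumes "\<And>k. C_k k g" "f \<in> test_functions"
  shows "(\<lambda>x. g x * f x) \<in> test_functions"
proof -
  obtain K where "compact K" "\<And>x. x \<notin> K \<Longrightarrow> f x = 0"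
    using test_functions_support[OF assms(2)] by blast
  then show ?thesis
    by (intro test_functionsI[where K=K] C_k_mult[OF assms(1) test_functions_C_k[OF assms(2)]]) simp_all
qed

lemma test_functions_cmult: "f \<in> test_functions \<Longrightarrow> (\<lambda>x. c * f x) \<in> test_functions"
  by (rule smooth_mult_test_functions[OF C_k_const])

lemma test_functions_diff:
  "f \<in> test_functions \<Longrightarrow> g \<in> test_functions \<Longrightarrow> (\<lambda>x. f x - g x) \<in> test_functions"
  using test_functions_add[of f "\<lambda>x. (-1) * g x"] test_functions_cmult[of g "-1"] by simp

lemma test_functions_affine:
  fixes f :: "real^'n::finite \<Rightarrow> real"
  assumes "f \<in> test_functions" "a \<noteq> 0"
  shows "(\<lambda>x. f (a *\<^sub>R x + b)) \<in> test_functions"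
proof -
  obtain K where K: "compact K" "\<And>x. x \<notin> K \<Longrightarrow> f x = 0"
    using test_functions_support[OF assms(1)] by blast
  show ?thesis
  proof (rule test_functionsI[where K="(\<lambda>y. inverse a *\<^sub>R (y - b)) ` K"])
    show "compact ((\<lambda>y. inverse a *\<^sub>R (y - b)) ` K)"
      by (intro compact_continuous_image continuous_intros K)
    fix x assume "x \<notin> (\<lambda>y. inverse a *\<^sub>R (y - b)) ` K"
    moreover have "x = inverse a *\<^sub>R ((a *\<^sub>R x + b) - b)" using assms(2) by simp
    ultimately have "a *\<^sub>R x + b \<notin> K" by (metis image_eqI)
    then show "f (a *\<^sub>R x + b) = 0" by (rule K)
  qed (rule C_k_affine[OF test_functions_C_k[OF assms(1)]])
qed

lemma C_k_power2_norm: "C_k k (\<lambda>x::real^'n::finite. (norm x)\<^sup>2)"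
proof -
  have sum: "C_k k (\<lambda>x. \<Sum>i\<in>I. f i x)" if "finite I" "\<And>i. C_k k (f i)" for I :: "'n set" and f :: "'n \<Rightarrow> real^'n \<Rightarrow> real"
    using that by (induction I) (auto intro: C_k_const C_k_add)
  have "(\<lambda>x::real^'n. (norm x)\<^sup>2) = (\<lambda>x. \<Sum>i\<in>UNIV. x $ i * x $ i)"
    by (auto simp: power2_norm_eq_inner inner_vec_def)
  then show ?thesis by (auto intro!: sum C_k_mult C_k_component)
qed

text \<open>A bump around \<open>y\<close> that is 1 up to distance \<open>r\<close> and 0 from
  distance 2r on. The squared norm is used because the norm is not smooth at its centre, and the
  shape a x + b matches \<open>C_k_affine\<close>.\<close>

definition cutoff :: "real^'n::finite \<Rightarrow> real \<Rightarrow> real^'n \<Rightarrow> real" where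
  "cutoff y r x = smooth_step ((-1) * (norm (inverse r *\<^sub>R x + (- inverse r *\<^sub>R y)))\<^sup>2 + 2)"

lemma C_k_cutoff: "C_k k (cutoff y r)"
proof -
  have "C_k k (\<lambda>x. (norm (inverse r *\<^sub>R x + (- inverse r *\<^sub>R y)))\<^sup>2)"
    using C_k_affine[OF C_k_power2_norm] .
  then show ?thesis unfolding cutoff_def[abs_def]
    by (intro C_k_compose[OF S_k_smooth_step] C_k_add C_k_mult C_k_const)
qed

lemma cutoff_alt:
  assumes "r > 0" shows "cutoff y r x = smooth_step (2 - (norm (x - y) / r)\<^sup>2)"
proof -
  have "inverse r *\<^sub>R x + (- inverse r *\<^sub>R y) = inverse r *\<^sub>R (x - y)" by (simp add: algebra_simps)
  then show ?thesis using assms by (simp add: cutoff_def divide_inverse mult.commute)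
qed

lemma cutoff_eq_1: "r > 0 \<Longrightarrow> norm (x - y) \<le> r \<Longrightarrow> cutoff y r x = 1"
  by (simp add: cutoff_alt smooth_step_props(2) power_le_one)

lemma cutoff_eq_0:
  assumes "r > 0" "norm (x - y) \<ge> 2 * r" shows "cutoff y r x = 0"
proof -
  have "2 \<le> norm (x - y) / r" using assms by (simp add: field_simps)
  then have "2\<^sup>2 \<le> (norm (x - y) / r)\<^sup>2" by (intro power_mono) auto
  then show ?thesis using assms by (simp add: cutoff_alt smooth_step_props(1))
qed

lemma cutoff_test: "r > 0 \<Longrightarrow> cutoff y r \<in> test_functions"
  by (rule test_functionsI[where K="cball y (2*r)"])
     (auto simp: C_k_cutoff dist_norm norm_minus_commute intro!: cutoff_eq_0)

section \<open>Affine changes of variables\<close>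

lemma nn_integral_affine:
  fixes f :: "'a::euclidean_space \<Rightarrow> ennreal"
  assumes [measurable]: "f \<in> borel_measurable borel" and c: "c \<noteq> 0"
  shows "(\<integral>\<^sup>+x. f x \<partial>lborel) = ennreal (\<bar>c\<bar> ^ DIM('a)) * (\<integral>\<^sup>+x. f (t + c *\<^sub>R x) \<partial>lborel)"
  by (subst lborel_affine[OF c, of t])
     (simp add: nn_integral_density nn_integral_distr nn_integral_cmult)

lemma integral_affine:
  fixes f :: "'a::euclidean_space \<Rightarrow> real"
  assumes [measurable]: "f \<in> borel_measurable borel" and c: "c \<noteq> 0"
  shows "(\<integral>x. f x \<partial>lborel) = \<bar>c\<bar> ^ DIM('a) * (\<integral>x. f (t + c *\<^sub>R x) \<partial>lborel)"
  by (subst lborel_affine[OF c, of t]) (simp add: integral_density integral_distr)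

lemma nn_integral_translate:
  fixes f :: "'a::euclidean_space \<Rightarrow> ennreal"
  assumes "f \<in> borel_measurable borel"
  shows "(\<integral>\<^sup>+x. f (x + t) \<partial>lborel) = (\<integral>\<^sup>+x. f x \<partial>lborel)"
  using nn_integral_affine[OF assms, of 1 t] by (simp add: add.commute)

lemma integral_translate:
  fixes f :: "'a::euclidean_space \<Rightarrow> real"
  assumes "f \<in> borel_measurable borel"
  shows "(\<integral>x. f (x + t) \<partial>lborel) = (\<integral>x. f x \<partial>lborel)"
  using integral_affine[OF assms, of 1 t] by (simp add: add.commute)

lemma integrable_continuous_bounded_support:
  fixes f :: "'a::euclidean_space \<Rightarrow> 'b::{banach, second_countable_topology}"
  assumes "continuous_on UNIV f" "\<And>x. norm x > R \<Longrightarrow> f x = 0"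
  shows "integrable lborel f"
proof -
  have "integrable lborel (\<lambda>x. indicator (cball 0 R) x *\<^sub>R f x)"
    by (intro borel_integrable_compact continuous_on_subset[OF assms(1)]) auto
  also have "(\<lambda>x. indicator (cball 0 R) x *\<^sub>R f x) = f"
    using assms(2) by (auto simp: indicator_def fun_eq_iff)
  finally show ?thesis .
qed

section \<open>Compactly supported C^1 functions\<close>

text \<open>Carries the gradient \<open>g\<close> along with \<open>f\<close>. The Sobolev and Hardy
  inequalities are proved in this class, since it contains the truncations and the vector field
  components that occur there and keeps their gradients explicit.\<close>

definition C1c :: "('a::euclidean_space \<Rightarrow> real) \<Rightarrow> ('a \<Rightarrow> 'a) \<Rightarrow> bool" where
  "C1c f g \<longleftrightarrow> (\<forall>x. (f has_derivative (\<lambda>h. g x \<bullet> h)) (at x)) \<and> continuous_on UNIV g \<and>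
     (\<exists>R. \<forall>x. norm x > R \<longrightarrow> f x = 0)"

lemma C1c_derivative: "C1c f g \<Longrightarrow> (f has_derivative (\<lambda>h. g x \<bullet> h)) (at x)"
  by (simp add: C1c_def)

lemma C1c_continuous: "C1c f g \<Longrightarrow> continuous_on UNIV f" "C1c f g \<Longrightarrow> continuous_on UNIV g"
  unfolding C1c_def by (metis has_derivative_continuous continuous_at_imp_continuous_on) auto

lemma C1c_measurable:
  assumes "C1c f g" shows "f \<in> borel_measurable borel" "g \<in> borel_measurable borel"
  using C1c_continuous[OF assms] borel_measurable_continuous_onI by auto

text \<open>Outside a large ball \<open>f\<close> is locally zero, so its gradient vanishes there
  too and one radius serves both.\<close>

lemma C1c_support:
  assumes "C1c f g"
  shows "\<exists>R>0. \<forall>x. norm x > R \<longrightarrow> f x = 0 \<and> g x = 0"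
proof -
  obtain R0 where R0: "\<And>x. norm x > R0 \<Longrightarrow> f x = 0" using assms unfolding C1c_def by blast
  have "g x = 0" if "norm x > R0" for x
  proof -
    have "((\<lambda>_. 0) has_derivative (\<lambda>h. 0)) (at x)" by simp
    moreover have "open {x::'a. norm x > R0}" by (intro open_Collect_less continuous_intros)
    ultimately have "(f has_derivative (\<lambda>h. 0)) (at x)"
      by (rule has_derivative_transform_within_open) (use that R0 in auto)
    then have "(\<lambda>h. g x \<bullet> h) = (\<lambda>h. 0)" using C1c_derivative[OF assms] has_derivative_unique by blast
    then show "g x = 0" by (metis inner_eq_zero_iff)
  qed
  then show ?thesis using R0 by (intro exI[of _ "max R0 1"]) auto
qed

lemma C1c_integrable:
  fixes F :: "real \<Rightarrow> 'a::euclidean_space \<Rightarrow> 'b::{banach, second_countable_topology}"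
  assumes "C1c f g" "continuous_on UNIV (\<lambda>(a, b). F a b)" "F 0 0 = 0"
  shows "integrable lborel (\<lambda>x. F (f x) (g x))"
proof -
  obtain R where R: "\<And>x. norm x > R \<Longrightarrow> f x = 0" "\<And>x. norm x > R \<Longrightarrow> g x = 0"
    using C1c_support[OF assms(1)] by blast
  show ?thesis
  proof (rule integrable_continuous_bounded_support[where R=R])
    show "continuous_on UNIV (\<lambda>x. F (f x) (g x))"
      using continuous_on_compose2[OF assms(2), of UNIV "\<lambda>x. (f x, g x)"] C1c_continuous[OF assms(1)]
      by (auto intro: continuous_intros)
  qed (use R assms in auto)
qed

lemma C1c_bounded:
  assumes "C1c f g"
  shows "\<exists>M>0. \<forall>x. \<bar>f x\<bar> \<le> M \<and> norm (g x) \<le> M"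
proof -
  obtain R where R: "\<And>x. norm x > R \<Longrightarrow> f x = 0" "\<And>x. norm x > R \<Longrightarrow> g x = 0"
    using C1c_support[OF assms(1)] by blast
  have "compact ((\<lambda>x. (f x, g x)) ` cball 0 R)"
    by (intro compact_continuous_image continuous_intros continuous_on_subset[OF C1c_continuous(1)[OF assms]]
         continuous_on_subset[OF C1c_continuous(2)[OF assms]]) auto
  then obtain B where B: "\<And>z. z \<in> (\<lambda>x. (f x, g x)) ` cball 0 R \<Longrightarrow> norm z \<le> B"
    using compact_imp_bounded bounded_iff by metis
  have *: "norm (f x, g x) \<le> max B 1" for x
  proof (cases "norm x > R")
    case True then show ?thesis using R by auto
  next
    case False
    then have "norm (f x, g x) \<le> B" by (intro B) auto
    then show ?thesis by simp
  qed
  have "\<bar>f x\<bar> \<le> max B 1" for x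
    by (rule order_trans[OF _ *[of x]]) (metis fst_conv norm_fst_le real_norm_def)
  moreover have "norm (g x) \<le> max B 1" for x
    by (rule order_trans[OF _ *[of x]]) (metis snd_conv norm_snd_le)
  ultimately show ?thesis by (intro exI[of _ "max B 1"]) auto
qed

lemma C1c_cmult: "C1c f g \<Longrightarrow> C1c (\<lambda>x. c * f x) (\<lambda>x. c *\<^sub>R g x)"
  unfolding C1c_def by (auto intro!: derivative_eq_intros continuous_intros)

lemma C1c_diff:
  assumes "C1c f g" "C1c f' g'" shows "C1c (\<lambda>x. f x - f' x) (\<lambda>x. g x - g' x)"
proof -
  obtain R where "\<And>x. norm x > R \<Longrightarrow> f x = 0" using C1c_support[OF assms(1)] by blast
  moreover obtain R' where "\<And>x. norm x > R' \<Longrightarrow> f' x = 0" using C1c_support[OF assms(2)] by blast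
  ultimately have "\<forall>x. norm x > max R R' \<longrightarrow> f x - f' x = 0" by simp
  moreover have "((\<lambda>x. f x - f' x) has_derivative (\<lambda>h. (g x - g' x) \<bullet> h)) (at x)" for x
    unfolding inner_diff_left by (intro has_derivative_diff C1c_derivative assms)
  moreover have "continuous_on UNIV (\<lambda>x. g x - g' x)"
    by (intro continuous_intros C1c_continuous(2)[OF assms(1)] C1c_continuous(2)[OF assms(2)])
  ultimately show ?thesis unfolding C1c_def by blast
qed

lemma C1c_mult:
  assumes f: "C1c f g" and h: "\<And>x. (h has_derivative (\<lambda>v. k x \<bullet> v)) (at x)" "continuous_on UNIV k"
  shows "C1c (\<lambda>x. h x * f x) (\<lambda>x. h x *\<^sub>R g x + f x *\<^sub>R k x)"
  unfolding C1c_def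
proof (intro conjI allI)
  show "((\<lambda>x. h x * f x) has_derivative (\<lambda>v. (h x *\<^sub>R g x + f x *\<^sub>R k x) \<bullet> v)) (at x)" for x
    using has_derivative_mult[OF h(1) C1c_derivative[OF f], of x]
    by (simp add: inner_add_left mult.commute)
  have "continuous_on UNIV h"
    using h(1) by (metis has_derivative_continuous continuous_at_imp_continuous_on)
  then show "continuous_on UNIV (\<lambda>x. h x *\<^sub>R g x + f x *\<^sub>R k x)"
    by (intro continuous_intros C1c_continuous[OF f] h)
  show "\<exists>R. \<forall>x. R < norm x \<longrightarrow> h x * f x = 0" using f unfolding C1c_def by fastforce
qed

lemma C1c_compose:
  assumes f: "C1c f g" and T: "\<And>t. (T has_real_derivative T' t) (at t)" "continuous_on UNIV T'" "T 0 = 0"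
  shows "C1c (\<lambda>x. T (f x)) (\<lambda>x. T' (f x) *\<^sub>R g x)"
  unfolding C1c_def
proof (intro conjI allI)
  show "((\<lambda>x. T (f x)) has_derivative (\<lambda>v. (T' (f x) *\<^sub>R g x) \<bullet> v)) (at x)" for x
    using has_derivative_compose[OF C1c_derivative[OF f] T(1)[unfolded has_field_derivative_def]] by simp
  show "continuous_on UNIV (\<lambda>x. T' (f x) *\<^sub>R g x)"
    by (intro continuous_intros continuous_on_compose2[OF T(2)] C1c_continuous[OF f]) auto
  show "\<exists>R. \<forall>x. R < norm x \<longrightarrow> T (f x) = 0" using f T(3) unfolding C1c_def by fastforce
qed

lemma C1c_line_derivative:
  assumes "C1c f g"
  shows "((\<lambda>t. f (x + t *\<^sub>R e)) has_real_derivative (g (x + t *\<^sub>R e) \<bullet> e)) (at t)"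
proof -
  have "((\<lambda>t. f (x + t *\<^sub>R e)) has_derivative (\<lambda>h. g (x + t *\<^sub>R e) \<bullet> (h *\<^sub>R e))) (at t)"
    by (rule has_derivative_compose[where g=f, OF _ C1c_derivative[OF assms]]) (auto intro!: derivative_eq_intros)
  then show ?thesis by (simp add: has_field_derivative_def mult.commute[of _ "_ \<bullet> _"])
qed

lemma C1c_increment_bound:
  assumes "C1c f g" "\<And>x. norm (g x) \<le> M"
  shows "\<bar>f (x + h) - f x\<bar> \<le> M * norm h"
proof -
  have "norm (f (x + h) - f x) \<le> M * norm (x + h - x)"
  proof (rule differentiable_bound[of UNIV f "\<lambda>x h. g x \<bullet> h"])
    show "onorm ((\<bullet>) (g x)) \<le> M" for x
      by (rule onorm_le) (metis assms(2) Cauchy_Schwarz_ineq2 mult_right_mono norm_ge_zero order_trans real_norm_def)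
  qed (use C1c_derivative[OF assms(1)] in auto)
  then show ?thesis by simp
qed

text \<open>Translation invariance kills the integral of every difference quotient.\<close>

lemma C1c_integral_partial:
  assumes fg: "C1c f g"
  shows "(\<integral>x. g x \<bullet> e \<partial>lborel) = 0"
proof -
  obtain R where R: "R > 0" "\<And>x. norm x > R \<Longrightarrow> f x = 0" using C1c_support[OF fg] by blast
  obtain M where M: "M > 0" "\<And>x. norm (g x) \<le> M" using C1c_bounded[OF fg] by blast
  define t where "t k = inverse (real (Suc k))" for k
  have t: "0 < t k" "t k \<le> 1" for k by (auto simp: t_def field_simps)
  define D where "D k x = (f (x + t k *\<^sub>R e) - f x) / t k" for k x
  have [measurable]: "f \<in> borel_measurable borel" using C1c_measurable[OF fg] by simp
  have [measurable]: "g \<in> borel_measurable borel" using C1c_measurable[OF fg] by simp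
  have fint: "integrable lborel f" using C1c_integrable[OF fg, of "\<lambda>a b. a"]
    by (simp add: case_prod_beta continuous_on_fst)
  have fint': "integrable lborel (\<lambda>x. f (x + v))" for v
  proof (rule integrable_continuous_bounded_support[where R="R + norm v"])
    show "continuous_on UNIV (\<lambda>x. f (x + v))"
      by (intro continuous_on_compose2[OF C1c_continuous(1)[OF fg]] continuous_intros) auto
    show "f (x + v) = 0" if "R + norm v < norm x" for x
      by (rule R) (use that norm_triangle_ineq4[of "x+v" v] in auto)
  qed
  have zero: "(\<integral>x. D k x \<partial>lborel) = 0" for k
    using integral_translate[of f "t k *\<^sub>R e"] fint fint' by (simp add: D_def)
  have "(\<lambda>k. \<integral>x. D k x \<partial>lborel) \<longlonglongrightarrow> (\<integral>x. g x \<bullet> e \<partial>lborel)"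
  \<comment> \<open>The steps \<open>t k\<close> are at most 1, so all difference quotients live in
    one ball enlarged by the norm of \<open>e\<close>, where the mean value bound gives a constant
    majorant.\<close>
  proof (rule integral_dominated_convergence[where w="\<lambda>x. indicator (cball 0 (R + norm e)) x * (M * norm e)"])
    show "AE x in lborel. (\<lambda>k. D k x) \<longlonglongrightarrow> g x \<bullet> e"
    proof (rule AE_I2)
      fix x
      have "((\<lambda>h. (f (x + h *\<^sub>R e) - f x) / h) \<longlongrightarrow> g x \<bullet> e) (at 0)"
        using C1c_line_derivative[OF fg, of x e 0] by (simp add: DERIV_def)
      moreover have "filterlim t (at 0) sequentially"
        using LIMSEQ_inverse_real_of_nat t(1) unfolding filterlim_at t_def
        by (auto simp: less_imp_neq[symmetric])
      ultimately show "(\<lambda>k. D k x) \<longlonglongrightarrow> g x \<bullet> e"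
        unfolding D_def by (rule filterlim_compose)
    qed
    show "AE x in lborel. norm (D k x) \<le> indicator (cball 0 (R + norm e)) x * (M * norm e)" for k
    proof (rule AE_I2)
      fix x
      show "norm (D k x) \<le> indicator (cball 0 (R + norm e)) x * (M * norm e)"
      proof (cases "norm x \<le> R + norm e")
        case True
        have "\<bar>f (x + t k *\<^sub>R e) - f x\<bar> \<le> M * norm (t k *\<^sub>R e)" by (rule C1c_increment_bound[OF fg M(2)])
        then show ?thesis using t[of k] True by (simp add: D_def field_simps)
      next
        case False
        have "norm (t k *\<^sub>R e) \<le> norm e" using t[of k] by (simp add: mult_left_le_one_le)
        then have "norm (x + t k *\<^sub>R e) > R"
          using False norm_triangle_ineq4[of "x + t k *\<^sub>R e" "t k *\<^sub>R e"] by simp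
        moreover have "norm x > R" using False norm_ge_zero[of e] by linarith
        ultimately show ?thesis using R(2) M(1) by (simp add: D_def indicator_def)
      qed
    qed
    show "integrable lborel (\<lambda>x. indicator (cball 0 (R + norm e)) x * (M * norm e))"
      using emeasure_bounded_finite[OF bounded_cball, of 0 "R + norm e"]
      by (intro integrable_mult_left integrable_real_indicator) auto
  qed (auto simp: D_def)
  then show ?thesis using zero by (simp add: LIMSEQ_const_iff)
qed

section \<open>Translation estimate and Faber-Krahn inequality\<close>

text \<open>Jensen on the unit interval: expand the integral of (a - m)^2, which is
  nonnegative.\<close>

lemma square_le_integral:
  fixes a :: "real \<Rightarrow> real"
  assumes "continuous_on {0..1} a" "(a has_integral m) {0..1}"
  shows "m\<^sup>2 \<le> integral {0..1} (\<lambda>t. (a t)\<^sup>2)"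
proof -
  have sq: "((\<lambda>t. (a t)\<^sup>2) has_integral integral {0..1} (\<lambda>t. (a t)\<^sup>2)) {0..1}"
    by (intro integrable_integral integrable_continuous_interval continuous_intros assms)
  have "((\<lambda>t. ((a t)\<^sup>2 - (2 * m) * a t) + m\<^sup>2) has_integral
      ((integral {0..1} (\<lambda>t. (a t)\<^sup>2) - (2 * m) * m) + m\<^sup>2)) {0..1}"
    using has_integral_const_real[of "m\<^sup>2" 0 1]
    by (intro has_integral_add has_integral_diff sq has_integral_mult_right assms) auto
  moreover have "(a t)\<^sup>2 - (2 * m) * a t + m\<^sup>2 \<ge> 0" for t
    using zero_le_power2[of "a t - m"] by (simp add: power2_eq_square algebra_simps)
  ultimately have "integral {0..1} (\<lambda>t. (a t)\<^sup>2) - (2 * m) * m + m\<^sup>2 \<ge> 0"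
    by (rule has_integral_nonneg) 
  then show ?thesis by (simp add: power2_eq_square algebra_simps)
qed

text \<open>An increment is the integral of the directional derivative along the segment; Jensen,
  Tonelli and translation invariance do the rest. It is the analytic input both for
  \<open>faber_krahn\<close> and for \<open>cells_poincare\<close>.\<close>

lemma C1c_translation_estimate:
  assumes fg: "C1c f g"
  shows "(\<integral>\<^sup>+x. ennreal ((f (x + h) - f x)\<^sup>2) \<partial>lborel)
    \<le> ennreal ((norm h)\<^sup>2) * (\<integral>\<^sup>+x. ennreal ((norm (g x))\<^sup>2) \<partial>lborel)"
proof -
  have [measurable]: "f \<in> borel_measurable borel" using C1c_measurable[OF fg] by simp
  have [measurable]: "g \<in> borel_measurable borel" using C1c_measurable[OF fg] by simp
  have pt: "ennreal ((f (x + h) - f x)\<^sup>2) \<le>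
      (\<integral>\<^sup>+t. ennreal ((g (x + t *\<^sub>R h) \<bullet> h)\<^sup>2) * indicator {0..1} t \<partial>lborel)" for x
  proof -
    let ?a = "\<lambda>t. g (x + t *\<^sub>R h) \<bullet> h"
    have c: "continuous_on {0..1} ?a"
      by (intro continuous_intros continuous_on_compose2[OF C1c_continuous(2)[OF fg]]) auto
    have "(?a has_integral (f (x + 1 *\<^sub>R h) - f (x + 0 *\<^sub>R h))) {0..1}"
      by (rule fundamental_theorem_of_calculus)
         (auto simp: has_real_derivative_iff_has_vector_derivative[symmetric] intro: has_field_derivative_at_within C1c_line_derivative[OF fg])
    then have "(f (x + h) - f x)\<^sup>2 \<le> integral {0..1} (\<lambda>t. (?a t)\<^sup>2)"
      using square_le_integral[OF c] by simp
    moreover have "((\<lambda>t. (?a t)\<^sup>2) has_integral integral {0..1} (\<lambda>t. (?a t)\<^sup>2)) {0..1}"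
      by (intro integrable_integral integrable_continuous_interval continuous_intros c)
    then have "(\<integral>\<^sup>+t. ennreal ((?a t)\<^sup>2) * indicator {0..1} t \<partial>lborel) = ennreal (integral {0..1} (\<lambda>t. (?a t)\<^sup>2))"
      by (intro nn_integral_has_integral_lebesgue') auto
    ultimately show ?thesis by (simp add: ennreal_leI)
  qed
  have "(\<integral>\<^sup>+x. ennreal ((f (x + h) - f x)\<^sup>2) \<partial>lborel) \<le>
      (\<integral>\<^sup>+x. \<integral>\<^sup>+t. ennreal ((g (x + t *\<^sub>R h) \<bullet> h)\<^sup>2) * indicator {0..1} t \<partial>lborel \<partial>lborel)"
    by (intro nn_integral_mono pt)
  also have "\<dots> = (\<integral>\<^sup>+t. \<integral>\<^sup>+x. ennreal ((g (x + t *\<^sub>R h) \<bullet> h)\<^sup>2) * indicator {0..1} t \<partial>lborel \<partial>lborel)"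
    by (rule lborel_pair.Fubini') measurable
  also have "\<dots> = (\<integral>\<^sup>+(t::real). (\<integral>\<^sup>+x. ennreal ((g x \<bullet> h)\<^sup>2) \<partial>lborel) * indicator {0..1} t \<partial>lborel)"
    using nn_integral_translate[of "\<lambda>x. ennreal ((g x \<bullet> h)\<^sup>2)"] by (simp add: nn_integral_multc)
  also have "\<dots> = (\<integral>\<^sup>+x. ennreal ((g x \<bullet> h)\<^sup>2) \<partial>lborel)"
    by (subst nn_integral_cmult) simp_all
  also have "\<dots> \<le> (\<integral>\<^sup>+x. ennreal ((norm h)\<^sup>2) * ennreal ((norm (g x))\<^sup>2) \<partial>lborel)"
  proof (intro nn_integral_mono)
    fix x
    have "\<bar>g x \<bullet> h\<bar> \<le> norm h * norm (g x)" by (metis Cauchy_Schwarz_ineq2 mult.commute)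
    then have "\<bar>g x \<bullet> h\<bar>\<^sup>2 \<le> (norm h * norm (g x))\<^sup>2" by (intro power_mono) auto
    then show "ennreal ((g x \<bullet> h)\<^sup>2) \<le> ennreal ((norm h)\<^sup>2) * ennreal ((norm (g x))\<^sup>2)"
      by (simp add: power_mult_distrib ennreal_mult'[symmetric] ennreal_leI)
  qed
  also have "\<dots> = ennreal ((norm h)\<^sup>2) * (\<integral>\<^sup>+x. ennreal ((norm (g x))\<^sup>2) \<partial>lborel)"
    by (rule nn_integral_cmult) measurable
  finally show ?thesis .
qed

text \<open>Among the shifts z in a ball of volume 2a, at least volume a move a given x out of
  \<open>A\<close>, where \<open>f\<close> is 0 and the increment is just -f(x). Hence a f(x)^2 is
  at most the integral of squared increments over the ball, and integrating in x brings in the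
  translation estimate.\<close>

lemma faber_krahn_aux:
  fixes f :: "'a::euclidean_space \<Rightarrow> real"
  assumes fg: "C1c f g" and [measurable]: "A \<in> sets borel" and fA: "\<And>x. f x \<noteq> 0 \<Longrightarrow> x \<in> A"
    and a: "emeasure lborel A \<le> ennreal a" "a > 0" and V: "emeasure lborel (ball (0::'a) h) = ennreal (2 * a)"
    and h: "h \<ge> 0"
  shows "(\<integral>\<^sup>+x. ennreal ((f x)\<^sup>2) \<partial>lborel) \<le> ennreal (2 * h\<^sup>2) * (\<integral>\<^sup>+x. ennreal ((norm (g x))\<^sup>2) \<partial>lborel)"
proof -
  have [measurable]: "f \<in> borel_measurable borel" using C1c_measurable[OF fg] by simp
  have [measurable]: "g \<in> borel_measurable borel" using C1c_measurable[OF fg] by simp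
  have [measurable]: "ball (0::'a) h \<in> sets borel" by simp
  let ?G = "\<integral>\<^sup>+x. ennreal ((norm (g x))\<^sup>2) \<partial>lborel"
  have pt: "ennreal a * ennreal ((f x)\<^sup>2) \<le>
     (\<integral>\<^sup>+z. ennreal ((f (x + z) - f x)\<^sup>2) * indicator (ball 0 h) z \<partial>lborel)" for x
  proof -
    \<comment> \<open>The shifts that keep x inside \<open>A\<close>: a translate of
      \<open>A\<close>, hence of measure at most \<open>a\<close>.\<close>
    define A' where "A' = {z. z + x \<in> A}"
    have [measurable]: "A' \<in> sets borel" unfolding A'_def by measurable
    have "emeasure lborel A' = (\<integral>\<^sup>+z. indicator A (z + x) \<partial>lborel)"
    proof -
      have "(\<integral>\<^sup>+z. indicator A (z + x) \<partial>lborel) = (\<integral>\<^sup>+z. indicator A' z \<partial>lborel)"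
        by (intro nn_integral_cong) (auto simp: A'_def indicator_def)
      then show ?thesis by simp
    qed
    also have "\<dots> = emeasure lborel A" by (subst nn_integral_translate) auto
    finally have eA': "emeasure lborel A' \<le> ennreal a" using a by simp
    define B where "B = ball (0::'a) h - A'"
    have [measurable]: "B \<in> sets borel" unfolding B_def by measurable
    have "ennreal a + ennreal a = emeasure lborel (ball (0::'a) h)" using V a(2) by (simp add: ennreal_plus[symmetric] del: ennreal_plus)
    also have "\<dots> \<le> emeasure lborel (B \<union> A')" by (intro emeasure_mono) (auto simp: B_def)
    also have "\<dots> \<le> emeasure lborel B + emeasure lborel A'" by (intro emeasure_subadditive) auto
    also have "\<dots> \<le> emeasure lborel B + ennreal a" using eA' by (intro add_left_mono)
    finally have aB: "ennreal a \<le> emeasure lborel B" by (simp add: ennreal_add_left_cancel_le add.commute)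
    have "ennreal a * ennreal ((f x)\<^sup>2) \<le> ennreal ((f x)\<^sup>2) * emeasure lborel B"
      using aB by (metis mult.commute mult_left_mono zero_le)
    also have "\<dots> = (\<integral>\<^sup>+z. ennreal ((f x)\<^sup>2) * indicator B z \<partial>lborel)"
      by (subst nn_integral_cmult_indicator) auto
    also have "\<dots> \<le> (\<integral>\<^sup>+z. ennreal ((f (x + z) - f x)\<^sup>2) * indicator (ball 0 h) z \<partial>lborel)"
    proof (intro nn_integral_mono)
      fix z
      have "f (x + z) = 0" if "z \<in> B" using that fA by (auto simp: B_def A'_def add.commute)
      then show "ennreal ((f x)\<^sup>2) * indicator B z \<le> ennreal ((f (x + z) - f x)\<^sup>2) * indicator (ball 0 h) z"
        by (auto simp: indicator_def B_def)
    qed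
    finally show ?thesis .
  qed
  have "ennreal a * (\<integral>\<^sup>+x. ennreal ((f x)\<^sup>2) \<partial>lborel) = (\<integral>\<^sup>+x. ennreal a * ennreal ((f x)\<^sup>2) \<partial>lborel)"
    by (rule nn_integral_cmult[symmetric]) measurable
  also have "\<dots> \<le> (\<integral>\<^sup>+x. \<integral>\<^sup>+z. ennreal ((f (x + z) - f x)\<^sup>2) * indicator (ball 0 h) z \<partial>lborel \<partial>lborel)"
    by (intro nn_integral_mono pt)
  also have "\<dots> = (\<integral>\<^sup>+z. \<integral>\<^sup>+x. ennreal ((f (x + z) - f x)\<^sup>2) * indicator (ball 0 h) z \<partial>lborel \<partial>lborel)"
    by (rule lborel_pair.Fubini') measurable
  also have "\<dots> = (\<integral>\<^sup>+(z::'a). (\<integral>\<^sup>+x. ennreal ((f (x + z) - f x)\<^sup>2) \<partial>lborel) * indicator (ball 0 h) z \<partial>lborel)"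
    by (simp add: nn_integral_multc)
  also have "\<dots> \<le> (\<integral>\<^sup>+(z::'a). (ennreal (h\<^sup>2) * ?G) * indicator (ball 0 h) z \<partial>lborel)"
  proof (intro nn_integral_mono)
    fix z :: 'a
    have "(\<integral>\<^sup>+x. ennreal ((f (x + z) - f x)\<^sup>2) \<partial>lborel) \<le> ennreal (h\<^sup>2) * ?G" if "z \<in> ball 0 h"
    proof -
      have "(norm z)\<^sup>2 \<le> h\<^sup>2" using that by (intro power_mono) auto
      then show ?thesis using C1c_translation_estimate[OF fg, of z]
        by (meson ennreal_leI mult_right_mono order_trans zero_le)
    qed
    then show "(\<integral>\<^sup>+x. ennreal ((f (x + z) - f x)\<^sup>2) \<partial>lborel) * indicator (ball 0 h) z
       \<le> (ennreal (h\<^sup>2) * ?G) * indicator (ball 0 h) z" by (auto simp: indicator_def)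
  qed
  also have "\<dots> = (ennreal (h\<^sup>2) * ?G) * ennreal (2 * a)"
    using V by (subst nn_integral_cmult_indicator) auto
  also have "\<dots> = ennreal a * (ennreal (2 * h\<^sup>2) * ?G)"
    using a(2) by (simp add: ennreal_mult' ennreal_mult'' mult_ac)
  finally show ?thesis using a(2) by (subst (asm) ennreal_mult_le_mult_iff) auto
qed

lemma C1c_integrable_sq:
  fixes f :: "'a::euclidean_space \<Rightarrow> real"
  assumes "C1c f g"
  shows "integrable lborel (\<lambda>x. (f x)\<^sup>2)" "integrable lborel (\<lambda>x. (norm (g x))\<^sup>2)"
proof -
  have "continuous_on UNIV (\<lambda>z::real \<times> 'a. (fst z)\<^sup>2)" "continuous_on UNIV (\<lambda>z::real \<times> 'a. (norm (snd z))\<^sup>2)"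
    by (intro continuous_intros)+
  then show "integrable lborel (\<lambda>x. (f x)\<^sup>2)" "integrable lborel (\<lambda>x. (norm (g x))\<^sup>2)"
    using C1c_integrable[OF assms, of "\<lambda>a b. a\<^sup>2"] C1c_integrable[OF assms, of "\<lambda>a b. (norm b)\<^sup>2"]
    by (simp_all add: case_prod_beta)
qed

lemma faber_krahn:
  "\<exists>K>0. \<forall>(f::'a::euclidean_space \<Rightarrow> real) g A. C1c f g \<longrightarrow> A \<in> sets borel \<longrightarrow> emeasure lborel A < \<infinity> \<longrightarrow>
     (\<forall>x. f x \<noteq> 0 \<longrightarrow> x \<in> A) \<longrightarrow>
     (\<integral>x. (f x)\<^sup>2 \<partial>lborel) \<le> K * measure lborel A powr (2 / DIM('a)) * (\<integral>x. (norm (g x))\<^sup>2 \<partial>lborel)"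
proof (intro exI conjI allI impI)
  define w where "w = unit_ball_vol DIM('a)"
  have w: "w > 0" by (simp add: w_def)
  let ?K = "2 * (2 / w) powr (2 / DIM('a))"
  show "?K > 0" using w by simp
  fix f :: "'a \<Rightarrow> real" and g A
  assume fg: "C1c f g" and A: "A \<in> sets borel" "emeasure lborel A < \<infinity>" "\<forall>x. f x \<noteq> 0 \<longrightarrow> x \<in> A"
  show "(\<integral>x. (f x)\<^sup>2 \<partial>lborel) \<le> ?K * measure lborel A powr (2 / DIM('a)) * (\<integral>x. (norm (g x))\<^sup>2 \<partial>lborel)"
  proof (cases "measure lborel A = 0")
    case True
    then have "emeasure lborel A = 0" using A by (simp add: emeasure_eq_ennreal_measure)
    then have "AE x in lborel. x \<notin> A" using A(1) by (intro AE_not_in null_setsI) auto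
    then have "AE x in lborel. (f x)\<^sup>2 = 0" using A(3) by (auto elim!: eventually_mono)
    then have "(\<integral>x. (f x)\<^sup>2 \<partial>lborel) = 0" by (rule integral_eq_zero_AE)
    then show ?thesis using w by simp
  next
    case False
    define a where "a = measure lborel A"
    have a: "a > 0" using False by (simp add: a_def less_le)
    \<comment> \<open>The radius of a ball with twice the volume of \<open>A\<close>; it produces
      the exponent 2/n in the inequality.\<close>
    define h where "h = (2 * a / w) powr (1 / DIM('a))"
    have h: "h > 0" using a w by (simp add: h_def)
    have hn: "h ^ DIM('a) = 2 * a / w" using h a w
      by (subst powr_realpow[symmetric]) (auto simp: h_def powr_powr)
    have h2: "2 * h\<^sup>2 = ?K * a powr (2 / DIM('a))"
    proof -
      have "h\<^sup>2 = (2 * a / w) powr (2 / DIM('a))" using h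
        by (subst powr_realpow[symmetric]) (auto simp: h_def powr_powr)
      also have "\<dots> = (2 / w * a) powr (2 / DIM('a))" by (simp add: field_simps)
      also have "\<dots> = (2 / w) powr (2 / DIM('a)) * a powr (2 / DIM('a))" by (rule powr_mult)
      finally show ?thesis by simp
    qed
    have "(\<integral>\<^sup>+x. ennreal ((f x)\<^sup>2) \<partial>lborel) \<le> ennreal (2 * h\<^sup>2) * (\<integral>\<^sup>+x. ennreal ((norm (g x))\<^sup>2) \<partial>lborel)"
    proof (rule faber_krahn_aux[OF fg A(1)])
      show "emeasure lborel A \<le> ennreal a" using A by (simp add: a_def emeasure_eq_ennreal_measure)
      show "emeasure lborel (ball (0::'a) h) = ennreal (2 * a)"
        using emeasure_ball[of h "0::'a"] h hn w by (simp add: w_def[symmetric])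
    qed (use A a h in auto)
    then have "ennreal (\<integral>x. (f x)\<^sup>2 \<partial>lborel) \<le> ennreal (2 * h\<^sup>2 * (\<integral>x. (norm (g x))\<^sup>2 \<partial>lborel))"
      by (simp add: nn_integral_eq_integral C1c_integrable_sq[OF fg] ennreal_mult')
    then have "(\<integral>x. (f x)\<^sup>2 \<partial>lborel) \<le> 2 * h\<^sup>2 * (\<integral>x. (norm (g x))\<^sup>2 \<partial>lborel)"
      by (subst (asm) ennreal_le_iff) auto
    then show ?thesis unfolding h2 a_def .
  qed
qed

section \<open>Sobolev inequality by dyadic truncation\<close>

lemma smooth_step_derivative:
  obtains d M where "\<And>t. (smooth_step has_real_derivative d t) (at t)" "continuous_on UNIV d"
    "\<And>t. t < 0 \<or> t > 1 \<Longrightarrow> d t = 0" "M > 0" "\<And>t. \<bar>d t\<bar> \<le> M"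
proof -
  obtain d where d: "\<And>t. (smooth_step has_real_derivative d t) (at t)" "continuous_on UNIV d"
    using S_k_smooth_step[of "Suc 0"] by auto
  have z: "d t = 0" if "t < 0 \<or> t > 1" for t
  proof -
    have "\<exists>c S. open S \<and> t \<in> S \<and> (\<forall>u\<in>S. smooth_step u = c)"
    proof (cases "t < 0")
      case True then show ?thesis
        by (intro exI[of _ 0] exI[of _ "{..<0}"]) (auto simp: smooth_step_props)
    next
      case False then show ?thesis using that
        by (intro exI[of _ 1] exI[of _ "{1<..}"]) (auto simp: smooth_step_props)
    qed
    then obtain c S where S: "open S" "t \<in> S" "\<And>u. u \<in> S \<Longrightarrow> smooth_step u = c" by blast
    have "((\<lambda>_. c) has_real_derivative 0) (at t)" by simp
    then have "(smooth_step has_real_derivative 0) (at t)"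
      by (rule has_field_derivative_transform_within_open[OF _ S(1,2)]) (simp add: S)
    then show ?thesis using d(1) DERIV_unique by blast
  qed
  have "compact (d ` {0..1})" by (intro compact_continuous_image continuous_on_subset[OF d(2)]) auto
  then obtain B where B: "\<And>t. t \<in> {0..1} \<Longrightarrow> \<bar>d t\<bar> \<le> B"
    using compact_imp_bounded bounded_iff by (metis image_eqI real_norm_def)
  have "\<bar>d t\<bar> \<le> max B 1" for t using B[of t] z[of t] by (cases "t \<in> {0..1}") auto
  then show thesis using that[OF d z, of "max B 1"] by auto
qed

text \<open>Faber-Krahn applied to a smooth truncation of \<open>f\<close> that is 0 below height c
  and equal to c above height 2c: its square integral dominates the left side, its support lies in
  the larger level set, and its gradient lives on the band between the heights.\<close>

lemma level_estimate:
  "\<exists>K>0. \<forall>(f::'a::euclidean_space \<Rightarrow> real) g c. C1c f g \<longrightarrow> c > 0 \<longrightarrow>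
     c\<^sup>2 * measure lborel {x. 2 * c \<le> \<bar>f x\<bar>}
      \<le> K * measure lborel {x. c \<le> \<bar>f x\<bar>} powr (2 / DIM('a)) *
         (\<integral>x. (norm (g x))\<^sup>2 * indicator {x. c \<le> \<bar>f x\<bar> \<and> \<bar>f x\<bar> \<le> 2 * c} x \<partial>lborel)"
proof -
  obtain K where K: "K > 0" and FK: "\<And>(f::'a \<Rightarrow> real) g A. C1c f g \<Longrightarrow> A \<in> sets borel \<Longrightarrow> emeasure lborel A < \<infinity> \<Longrightarrow>
     (\<forall>x. f x \<noteq> 0 \<longrightarrow> x \<in> A) \<Longrightarrow>
     (\<integral>x. (f x)\<^sup>2 \<partial>lborel) \<le> K * measure lborel A powr (2 / DIM('a)) * (\<integral>x. (norm (g x))\<^sup>2 \<partial>lborel)"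
    using faber_krahn by blast
  obtain d M where d: "\<And>t. (smooth_step has_real_derivative d t) (at t)" "continuous_on UNIV d"
    "\<And>t. t < 0 \<or> t > 1 \<Longrightarrow> d t = 0" and M: "M > 0" "\<And>t. \<bar>d t\<bar> \<le> M"
    by (rule smooth_step_derivative) blast
  show ?thesis
  proof (intro exI[of _ "K * (4 * M)\<^sup>2"] conjI allI impI)
    show "K * (4 * M)\<^sup>2 > 0" using K M by simp
    fix f :: "'a \<Rightarrow> real" and g and c :: real
    assume fg: "C1c f g" and c: "c > 0"
    have [measurable]: "f \<in> borel_measurable borel" using C1c_measurable[OF fg] by simp
    have [measurable]: "g \<in> borel_measurable borel" using C1c_measurable[OF fg] by simp
    \<comment> \<open>The argument is quadratic in u so that T is even and differentiable at 0. It
      is at most 0 for |u| \<le> c and at least 3 for |u| \<ge> 2c.\<close>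
    define T where "T u = c * smooth_step ((u / c)\<^sup>2 - 1)" for u
    define T' where "T' u = c * (d ((u / c)\<^sup>2 - 1) * (2 * (u / c) * (1 / c)))" for u
    have T: "(T has_real_derivative T' u) (at u)" for u unfolding T_def T'_def
      by (intro DERIV_cmult DERIV_chain2[OF d(1)]) (use c in \<open>auto intro!: derivative_eq_intros\<close>)
    have T'c: "continuous_on UNIV T'" unfolding T'_def
      by (intro continuous_intros continuous_on_compose2[OF d(2)]) (use c in auto)
    have Tfg: "C1c (\<lambda>x. T (f x)) (\<lambda>x. T' (f x) *\<^sub>R g x)"
      by (rule C1c_compose[OF fg T T'c]) (simp add: T_def smooth_step_props)
    let ?A = "{x. c \<le> \<bar>f x\<bar>}" and ?A2 = "{x. 2 * c \<le> \<bar>f x\<bar>}" and ?B = "{x. c \<le> \<bar>f x\<bar> \<and> \<bar>f x\<bar> \<le> 2 * c}"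
    obtain R where R: "\<And>x. norm x > R \<Longrightarrow> f x = 0" using C1c_support[OF fg] by blast
    have "?A \<subseteq> cball 0 R" using R c by (force simp: not_less[symmetric])
    then have finA: "emeasure lborel ?A < \<infinity>"
      using emeasure_bounded_finite[of ?A] bounded_subset[OF bounded_cball] by auto
    then have finA2: "emeasure lborel ?A2 < \<infinity>"
      by (rule le_less_trans[rotated]) (use c in \<open>auto intro!: emeasure_mono\<close>)
    have sq: "c\<^sup>2 \<le> u\<^sup>2 \<longleftrightarrow> c \<le> \<bar>u\<bar>" "(2 * c)\<^sup>2 \<le> u\<^sup>2 \<longleftrightarrow> 2 * c \<le> \<bar>u\<bar>" for u
      using abs_le_square_iff[of c u] abs_le_square_iff[of "2*c" u] c by auto
    have T0: "T u = 0" if "\<not> c \<le> \<bar>u\<bar>" for u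
      unfolding T_def by (subst smooth_step_props(1)) (use that sq(1)[of u] c in \<open>auto simp: power_divide field_simps\<close>)
    have T1: "T u = c" if "2 * c \<le> \<bar>u\<bar>" for u
      unfolding T_def by (subst smooth_step_props(2)) (use that sq(2)[of u] c in \<open>auto simp: power_divide field_simps intro: order_trans[rotated]\<close>)
    \<comment> \<open>On the band the inner derivative 2|u|/c is at most 4; off the band
      \<open>d\<close> vanishes. This is the factor 4M of the constant.\<close>
    have T'b: "\<bar>T' u\<bar> \<le> (4 * M) * indicator {u. c \<le> \<bar>u\<bar> \<and> \<bar>u\<bar> \<le> 2 * c} u" for u
    proof (cases "c \<le> \<bar>u\<bar> \<and> \<bar>u\<bar> \<le> 2 * c")
      case True
      have "\<bar>T' u\<bar> = \<bar>d ((u / c)\<^sup>2 - 1)\<bar> * (2 * (\<bar>u\<bar> / c))" using c by (simp add: T'_def abs_mult field_simps)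
      also have "\<dots> \<le> M * (2 * 2)" by (intro mult_mono M) (use True c M in \<open>auto simp: field_simps\<close>)
      finally show ?thesis using True by simp
    next
      case False
      then have "(u / c)\<^sup>2 - 1 < 0 \<or> (u / c)\<^sup>2 - 1 > 1"
      proof (cases "c \<le> \<bar>u\<bar>")
        case True
        then have "(2 * c)\<^sup>2 \<le> u\<^sup>2" using False sq(2)[of u] by auto
        then have "4 \<le> (u / c)\<^sup>2" using c by (simp add: power_divide field_simps)
        then show ?thesis by simp
      next
        case False
        then have "u\<^sup>2 < c\<^sup>2" using sq(1)[of u] by auto
        then show ?thesis using c by (simp add: power_divide field_simps)
      qed
      then have "T' u = 0" using d(3) by (simp add: T'_def)
      then show ?thesis using M by (simp add: indicator_def)
    qed
    have "c\<^sup>2 * measure lborel ?A2 = (\<integral>x. c\<^sup>2 * indicator ?A2 x \<partial>lborel)" by simp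
    also have "\<dots> \<le> (\<integral>x. (T (f x))\<^sup>2 \<partial>lborel)"
    proof (rule integral_mono)
      show "integrable lborel (\<lambda>x. c\<^sup>2 * indicator ?A2 x)" using finA2
        by (intro integrable_mult_right integrable_real_indicator) auto
    qed (use C1c_integrable_sq[OF Tfg] T1 in \<open>auto simp: indicator_def\<close>)
    also have "\<dots> \<le> K * measure lborel ?A powr (2 / DIM('a)) * (\<integral>x. (norm (T' (f x) *\<^sub>R g x))\<^sup>2 \<partial>lborel)"
      by (rule FK[OF Tfg _ finA]) (use T0 in auto)
    also have "\<dots> \<le> K * measure lborel ?A powr (2 / DIM('a)) * (\<integral>x. (4 * M)\<^sup>2 * ((norm (g x))\<^sup>2 * indicator ?B x) \<partial>lborel)"
    proof (intro mult_left_mono integral_mono)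
      show "integrable lborel (\<lambda>x. (4 * M)\<^sup>2 * ((norm (g x))\<^sup>2 * indicator ?B x))"
        by (intro integrable_mult_right integrable_real_mult_indicator C1c_integrable_sq[OF fg]) auto
      fix x
      have "(\<bar>T' (f x)\<bar>)\<^sup>2 \<le> ((4 * M) * indicator {u. c \<le> \<bar>u\<bar> \<and> \<bar>u\<bar> \<le> 2 * c} (f x))\<^sup>2"
        by (intro power_mono T'b) auto
      also have "\<dots> = (4 * M)\<^sup>2 * indicator ?B x" by (auto simp: indicator_def)
      finally have "(T' (f x))\<^sup>2 * (norm (g x))\<^sup>2 \<le> (4 * M)\<^sup>2 * indicator ?B x * (norm (g x))\<^sup>2"
        by (intro mult_right_mono) auto
      then show "(norm (T' (f x) *\<^sub>R g x))\<^sup>2 \<le> (4 * M)\<^sup>2 * ((norm (g x))\<^sup>2 * indicator ?B x)"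
        by (simp add: power_mult_distrib mult_ac)
    qed (use C1c_integrable_sq[OF Tfg] K in auto)
    finally show "c\<^sup>2 * measure lborel ?A2 \<le> K * (4 * M)\<^sup>2 * measure lborel ?A powr (2 / DIM('a)) *
       (\<integral>x. (norm (g x))\<^sup>2 * indicator ?B x \<partial>lborel)" by (simp add: mult_ac)
  qed
qed

text \<open>The level estimate at heights 2^-i becomes a recursion for suitably weighted level set
  measures. Summing it gives X \<le> const X^(2/n) E for the total X, and since X is finite the
  power can be absorbed. The bound |f| < 1 lets the heights be indexed by natural numbers;
  \<open>sobolev\<close> removes it by scaling.\<close>

lemma sobolev_bounded:
  fixes p :: real
  assumes n: "DIM('a::euclidean_space) \<ge> 3" and p: "p = 2 * DIM('a) / (real DIM('a) - 2)"
  shows "\<exists>C>0. \<forall>(f::'a \<Rightarrow> real) g. C1c f g \<longrightarrow> (\<forall>x. \<bar>f x\<bar> < 1) \<longrightarrow>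
     (\<integral>x. \<bar>f x\<bar> powr p \<partial>lborel) \<le> C * (\<integral>x. (norm (g x))\<^sup>2 \<partial>lborel) powr (p / 2)"
proof -
  define n' where "n' = real DIM('a)"
  have n': "n' \<ge> 3" using n by (simp add: n'_def)
  have p': "p = 2 * n' / (n' - 2)" using p by (simp add: n'_def)
  \<comment> \<open>This identity singles out the critical exponent: it cancels all powers of 2 that
    depend on the level in \<open>step\<close>.\<close>
  have pexp: "2 + 2 * p / n' = p" using n' by (simp add: p' field_simps)
  have p0: "p > 2" using n' by (simp add: p' field_simps)
  obtain K where K: "K > 0" and lev: "\<And>(f::'a \<Rightarrow> real) g c. C1c f g \<Longrightarrow> c > 0 \<Longrightarrow>
     c\<^sup>2 * measure lborel {x. 2 * c \<le> \<bar>f x\<bar>}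
      \<le> K * measure lborel {x. c \<le> \<bar>f x\<bar>} powr (2 / DIM('a)) *
         (\<integral>x. (norm (g x))\<^sup>2 * indicator {x. c \<le> \<bar>f x\<bar> \<and> \<bar>f x\<bar> \<le> 2 * c} x \<partial>lborel)"
    using level_estimate[where 'a='a] by blast
  define K2 where "K2 = K * 2 powr p * 2"
  have K2: "K2 > 0" using K by (simp add: K2_def)
  show ?thesis
  proof (intro exI[of _ "2 powr p * K2 powr (p/2)"] conjI allI impI)
    show "2 powr p * K2 powr (p/2) > 0" using K2 by simp
    fix f :: "'a \<Rightarrow> real" and g
    assume fg: "C1c f g" and f1: "\<forall>x. \<bar>f x\<bar> < 1"
    have [measurable]: "f \<in> borel_measurable borel" using C1c_measurable[OF fg] by simp
    have [measurable]: "g \<in> borel_measurable borel" using C1c_measurable[OF fg] by simp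
    define l where "l i = 2 powr (- real i)" for i :: nat
    have l: "l i > 0" "2 * l (Suc i) = l i" "l 0 = 1" for i by (auto simp: l_def powr_diff powr_minus field_simps)
    define a where "a i = measure lborel {x. l i \<le> \<bar>f x\<bar>}" for i
    \<comment> \<open>Weighted so that 2^p times the sum of \<open>b\<close> dominates the integral
      of |f|^p.\<close>
    define b where "b i = 2 powr (- p * real i) * a i" for i
    define e where "e i = (\<integral>x. (norm (g x))\<^sup>2 * indicator {x. l i \<le> \<bar>f x\<bar> \<and> \<bar>f x\<bar> \<le> 2 * l i} x \<partial>lborel)" for i
    define E where "E = (\<integral>x. (norm (g x))\<^sup>2 \<partial>lborel)"
    have E0: "E \<ge> 0" by (simp add: E_def)
    have e0: "e i \<ge> 0" for i unfolding e_def by (intro integral_nonneg_AE) auto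
    obtain R where R: "\<And>x. norm x > R \<Longrightarrow> f x = 0" using C1c_support[OF fg] by blast
    have sub: "{x. l i \<le> \<bar>f x\<bar>} \<subseteq> cball 0 R" for i using R l(1)[of i] by (force simp: not_less[symmetric])
    have fin: "emeasure lborel {x. l i \<le> \<bar>f x\<bar>} < \<infinity>" for i
      using emeasure_bounded_finite[of "{x. l i \<le> \<bar>f x\<bar>}"] bounded_subset[OF bounded_cball sub] by auto
    have a_le: "a i \<le> measure lborel (cball (0::'a) R)" for i unfolding a_def
      using emeasure_bounded_finite[OF bounded_cball, of 0 R]
      by (intro measure_mono_fmeasurable sub) (auto intro!: fmeasurableI)
    have a0: "a i \<ge> 0" "b i \<ge> 0" for i by (auto simp: a_def b_def)
    have b_sum: "summable b"
    \<comment> \<open>The level sets lie in one ball, so \<open>a\<close> is bounded and the weights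
      are geometric. Finiteness of the sum is what later permits dividing by a power of it.\<close>
    proof (rule summable_comparison_test')
      show "summable (\<lambda>i. measure lborel (cball (0::'a) R) * (2 powr (-p)) ^ i)"
        by (intro summable_mult summable_geometric) (use p0 in \<open>auto simp: powr_minus field_simps\<close>)
      show "norm (b i) \<le> measure lborel (cball (0::'a) R) * (2 powr (-p)) ^ i" for i
        using a_le[of i] a0[of i]
        by (auto simp: b_def powr_realpow[symmetric] powr_powr abs_mult mult.commute[of _ "2 powr _"] intro!: mult_left_mono)
    qed
    have step: "b i \<le> K * 2 powr p * (b (Suc i) powr (2 / n') * e (Suc i))" for i
    proof -
      have "(l (Suc i))\<^sup>2 * a i \<le> K * a (Suc i) powr (2 / n') * e (Suc i)"
        using lev[OF fg l(1)[of "Suc i"]] l(2)[of i] by (simp add: a_def e_def n'_def)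
      moreover have "(l (Suc i))\<^sup>2 = 2 powr (- 2 * real (Suc i))"
        by (simp add: l_def powr_powr powr_realpow[symmetric] mult.commute del: of_nat_Suc)
      ultimately have "2 powr (- 2 * real (Suc i)) * a i \<le> K * a (Suc i) powr (2 / n') * e (Suc i)" by simp
      then have "2 powr (2 * real (Suc i) - p * real i) * (2 powr (- 2 * real (Suc i)) * a i)
         \<le> 2 powr (2 * real (Suc i) - p * real i) * (K * a (Suc i) powr (2 / n') * e (Suc i))"
        by (intro mult_left_mono) auto
      also have "2 powr (2 * real (Suc i) - p * real i) * (2 powr (- 2 * real (Suc i)) * a i) = b i"
        by (simp add: b_def mult.assoc[symmetric] powr_add[symmetric] del: of_nat_Suc)
      also have "a (Suc i) = 2 powr (p * real (Suc i)) * b (Suc i)"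
        by (simp add: b_def mult.assoc[symmetric] powr_add[symmetric] del: of_nat_Suc)
      also have "(2 powr (p * real (Suc i)) * b (Suc i)) powr (2 / n') = 2 powr (2 * p / n' * real (Suc i)) * b (Suc i) powr (2 / n')"
        by (simp add: powr_mult powr_powr mult_ac del: of_nat_Suc)
      also have "2 powr (2 * real (Suc i) - p * real i) * (K * (2 powr (2 * p / n' * real (Suc i)) * b (Suc i) powr (2 / n')) * e (Suc i))
        = (2 powr (2 * real (Suc i) - p * real i) * 2 powr (2 * p / n' * real (Suc i))) * K * (b (Suc i) powr (2 / n') * e (Suc i))"
        by (simp add: mult_ac)
      also have "2 powr (2 * real (Suc i) - p * real i) * 2 powr (2 * p / n' * real (Suc i)) = 2 powr ((2 + 2 * p / n') * real (Suc i) - p * real i)"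
        by (simp add: powr_add[symmetric] algebra_simps)
      also have "(2 + 2 * p / n') * real (Suc i) - p * real i = p" unfolding pexp by (simp add: algebra_simps)
      finally show ?thesis by (simp add: mult_ac)
    qed
    define X where "X = suminf b"
    have bX: "b i \<le> X" for i unfolding X_def
      using sum_le_suminf[OF b_sum, of "{i}"] a0 by auto
    have X0: "X \<ge> 0" using bX[of 0] a0[of 0] by linarith
    have gi: "integrable lborel (\<lambda>x. (norm (g x))\<^sup>2)" by (rule C1c_integrable_sq[OF fg])
    have esum: "(\<Sum>i<N. e (Suc i)) \<le> 2 * E" for N
    proof -
      have "(\<Sum>i<N. e (Suc i)) = (\<integral>x. (\<Sum>i<N. (norm (g x))\<^sup>2 * indicator {x. l (Suc i) \<le> \<bar>f x\<bar> \<and> \<bar>f x\<bar> \<le> 2 * l (Suc i)} x) \<partial>lborel)"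
        unfolding e_def by (intro Bochner_Integration.integral_sum[symmetric] integrable_real_mult_indicator gi) auto
      also have "\<dots> \<le> (\<integral>x. 2 * (norm (g x))\<^sup>2 \<partial>lborel)"
      proof (intro integral_mono Bochner_Integration.integrable_sum integrable_real_mult_indicator gi integrable_mult_right)
        fix x
        let ?S = "{i\<in>{..<N}. l (Suc i) \<le> \<bar>f x\<bar> \<and> \<bar>f x\<bar> \<le> 2 * l (Suc i)}"
        \<comment> \<open>The bands are closed, so neighbouring ones share a height: a point can lie
          in two of them, but not in three. Hence the factor 2.\<close>
        have "card ?S \<le> 2"
        proof (cases "?S = {}")
          case False
          define m where "m = Min ?S"
          have m: "m \<in> ?S" unfolding m_def by (rule Min_in) (use False in auto)
          have mle: "m \<le> i" if "i \<in> ?S" for i unfolding m_def by (rule Min_le[OF _ that]) auto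
          have "?S \<subseteq> {m, Suc m}"
          proof
            fix i assume i: "i \<in> ?S"
            have "i \<le> Suc m"
            proof (rule ccontr)
              assume "\<not> i \<le> Suc m"
              then have "l i < l (Suc m)" by (auto simp: l_def)
              moreover have "\<bar>f x\<bar> \<le> l i" using i l(2)[of i] by simp
              moreover have "l (Suc m) \<le> \<bar>f x\<bar>" using m by simp
              ultimately show False by simp
            qed
            then show "i \<in> {m, Suc m}" using mle[OF i] by auto
          qed
          then have "card ?S \<le> card {m, Suc m}" by (intro card_mono) auto
          then show ?thesis by simp
        next
          case True
          then have "card ?S = 0" by (simp only: card.empty)
          then show ?thesis by linarith
        qed
        have "(\<Sum>i<N. (norm (g x))\<^sup>2 * indicator {x. l (Suc i) \<le> \<bar>f x\<bar> \<and> \<bar>f x\<bar> \<le> 2 * l (Suc i)} x)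
           = (norm (g x))\<^sup>2 * (\<Sum>i<N. indicator {x. l (Suc i) \<le> \<bar>f x\<bar> \<and> \<bar>f x\<bar> \<le> 2 * l (Suc i)} x)"
          by (rule sum_distrib_left[symmetric])
        also have "(\<Sum>i<N. indicator {x. l (Suc i) \<le> \<bar>f x\<bar> \<and> \<bar>f x\<bar> \<le> 2 * l (Suc i)} x) = real (card ?S)"
          by (simp add: indicator_def of_bool_def sum.If_cases Int_def conj_commute)
        also have "(norm (g x))\<^sup>2 * real (card ?S) \<le> (norm (g x))\<^sup>2 * 2"
          using \<open>card ?S \<le> 2\<close> by (intro mult_left_mono) auto
        finally show "(\<Sum>i<N. (norm (g x))\<^sup>2 * indicator {x. l (Suc i) \<le> \<bar>f x\<bar> \<and> \<bar>f x\<bar> \<le> 2 * l (Suc i)} x) \<le> 2 * (norm (g x))\<^sup>2"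
          by simp
      qed auto
      also have "\<dots> = 2 * E" by (simp add: E_def)
      finally show ?thesis .
    qed
    \<comment> \<open>Each factor \<open>b (Suc i) powr (2 / n')\<close> is replaced by the same
      power of the total, and only the band energies are summed.\<close>
    have Xle: "X \<le> K2 * X powr (2 / n') * E" unfolding X_def
    proof (rule suminf_le_const[OF b_sum])
      fix N
      have "(\<Sum>i<N. b i) \<le> (\<Sum>i<N. K * 2 powr p * (X powr (2 / n') * e (Suc i)))"
        by (intro sum_mono order_trans[OF step] mult_left_mono mult_right_mono powr_mono2 bX a0 e0)
           (use K n' in auto)
      also have "\<dots> = K * 2 powr p * X powr (2 / n') * (\<Sum>i<N. e (Suc i))"
        by (simp add: sum_distrib_left sum_distrib_right mult_ac)
      also have "\<dots> \<le> K * 2 powr p * X powr (2 / n') * (2 * E)"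
        using K by (intro mult_left_mono esum) auto
      finally show "(\<Sum>i<N. b i) \<le> K2 * suminf b powr (2 / n') * E" by (simp add: K2_def X_def mult_ac)
    qed
    have XE: "X \<le> (K2 * E) powr (p / 2)"
    proof (cases "X = 0")
      case False
      then have X: "X > 0" using X0 by simp
      have "X powr (1 - 2 / n') = X / X powr (2 / n')" using X by (simp add: powr_diff)
      also have "\<dots> \<le> K2 * E" using Xle X by (simp add: field_simps)
      finally have "(X powr (1 - 2 / n')) powr (p / 2) \<le> (K2 * E) powr (p / 2)"
        using p0 by (intro powr_mono2) auto
      moreover have "(1 - 2 / n') * (p / 2) = 1" using n' by (simp add: p' field_simps)
      ultimately show ?thesis using X by (simp add: powr_powr)
    qed simp
    have "(\<integral>\<^sup>+x. ennreal (\<bar>f x\<bar> powr p) \<partial>lborel)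
       \<le> (\<integral>\<^sup>+x. (\<Sum>i. ennreal (2 powr p * 2 powr (- p * real i)) * indicator {x. l i \<le> \<bar>f x\<bar>} x) \<partial>lborel)"
    proof (intro nn_integral_mono)
      fix x
      show "ennreal (\<bar>f x\<bar> powr p) \<le> (\<Sum>i. ennreal (2 powr p * 2 powr (- p * real i)) * indicator {x. l i \<le> \<bar>f x\<bar>} x)"
      proof (cases "f x = 0")
        case False
        have "\<exists>i. l i \<le> \<bar>f x\<bar>"
        proof -
          have "(\<lambda>i. (1/2::real) ^ i) \<longlonglongrightarrow> 0" by (intro LIMSEQ_power_zero) auto
          then have "eventually (\<lambda>i. (1/2::real) ^ i < \<bar>f x\<bar>) sequentially"
            using False by (intro order_tendstoD) auto
          moreover have "(1/2::real) ^ i = l i" for i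
            by (simp add: l_def powr_minus powr_realpow power_one_over inverse_eq_divide)
          ultimately show ?thesis by (auto simp: eventually_sequentially intro: less_imp_le)
        qed
        \<comment> \<open>The first level reached by |f x|. It is not level 0 since |f x| < 1, so
          the previous level, twice as high, bounds |f x| from above.\<close>
        define i where "i = (LEAST i. l i \<le> \<bar>f x\<bar>)"
        have i: "l i \<le> \<bar>f x\<bar>" unfolding i_def by (rule LeastI_ex) fact
        have "i \<noteq> 0" using i f1 l(3) by (metis not_less)
        then obtain j where j: "i = Suc j" by (cases i) auto
        have "\<not> l j \<le> \<bar>f x\<bar>" using not_less_Least[of j "\<lambda>i. l i \<le> \<bar>f x\<bar>"] j by (simp add: i_def[symmetric])
        then have "\<bar>f x\<bar> powr p \<le> (2 * l i) powr p" using p0 l(2)[of j] j by (intro powr_mono2) auto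
        also have "\<dots> = 2 powr p * 2 powr (- p * real i)" by (simp add: l_def powr_mult powr_powr mult_ac)
        finally have "ennreal (\<bar>f x\<bar> powr p) \<le> ennreal (2 powr p * 2 powr (- p * real i)) * indicator {x. l i \<le> \<bar>f x\<bar>} x"
          using i by (simp add: ennreal_leI)
        also have "\<dots> \<le> (\<Sum>i. ennreal (2 powr p * 2 powr (- p * real i)) * indicator {x. l i \<le> \<bar>f x\<bar>} x)"
        proof -
          have "F i \<le> suminf F" for F :: "nat \<Rightarrow> ennreal" using sum_le_suminf[of F "{i}"] by simp
          then show ?thesis .
        qed
        finally show ?thesis .
      qed simp
    qed
    also have "\<dots> = (\<Sum>i. (\<integral>\<^sup>+x. ennreal (2 powr p * 2 powr (- p * real i)) * indicator {x. l i \<le> \<bar>f x\<bar>} x \<partial>lborel))"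
      by (rule nn_integral_suminf) measurable
    also have "\<dots> = (\<Sum>i. ennreal (2 powr p * b i))"
    proof (intro suminf_cong)
      fix i
      have "(\<integral>\<^sup>+x. ennreal (2 powr p * 2 powr (- p * real i)) * indicator {x. l i \<le> \<bar>f x\<bar>} x \<partial>lborel)
         = ennreal (2 powr p * 2 powr (- p * real i)) * emeasure lborel {x. l i \<le> \<bar>f x\<bar>}"
        by (rule nn_integral_cmult_indicator) measurable
      also have "emeasure lborel {x. l i \<le> \<bar>f x\<bar>} = ennreal (a i)"
        using fin[of i] by (simp add: a_def emeasure_eq_ennreal_measure)
      finally show "(\<integral>\<^sup>+x. ennreal (2 powr p * 2 powr (- p * real i)) * indicator {x. l i \<le> \<bar>f x\<bar>} x \<partial>lborel) = ennreal (2 powr p * b i)"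
        using a0[of i] by (simp add: b_def ennreal_mult'[symmetric] mult_ac)
    qed
    also have "\<dots> = ennreal (\<Sum>i. 2 powr p * b i)"
      by (rule suminf_ennreal2) (use a0 in simp, rule summable_mult[OF b_sum])
    also have "(\<Sum>i. 2 powr p * b i) = 2 powr p * X" unfolding X_def by (rule suminf_mult[OF b_sum])
    finally have "ennreal (\<integral>x. \<bar>f x\<bar> powr p \<partial>lborel) \<le> ennreal (2 powr p * X)"
    proof (subst nn_integral_eq_integral[symmetric])
      have "continuous_on UNIV (\<lambda>z::real \<times> 'a. \<bar>fst z\<bar> powr p)"
        using p0 by (intro continuous_on_powr' continuous_intros) auto
      then show "integrable lborel (\<lambda>x. \<bar>f x\<bar> powr p)"
        using C1c_integrable[OF fg, of "\<lambda>a b. \<bar>a\<bar> powr p"] by (simp add: case_prod_beta)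
    qed auto
    then have "(\<integral>x. \<bar>f x\<bar> powr p \<partial>lborel) \<le> 2 powr p * X" using X0 by simp
    also have "\<dots> \<le> 2 powr p * (K2 * E) powr (p / 2)" by (intro mult_left_mono XE) auto
    also have "(K2 * E) powr (p / 2) = K2 powr (p / 2) * E powr (p / 2)" by (rule powr_mult)
    finally show "(\<integral>x. \<bar>f x\<bar> powr p \<partial>lborel) \<le> 2 powr p * K2 powr (p / 2) * (\<integral>x. (norm (g x))\<^sup>2 \<partial>lborel) powr (p / 2)"
      by (simp add: E_def mult.assoc)
  qed
qed

text \<open>Both sides are homogeneous of degree p, so multiplying \<open>f\<close> by 1/(2M), with
  M a bound for |f|, reduces to the case |f| < 1.\<close>

theorem sobolev:
  fixes p :: real
  assumes n: "DIM('a::euclidean_space) \<ge> 3" and p: "p = 2 * DIM('a) / (real DIM('a) - 2)"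
  shows "\<exists>C>0. \<forall>(f::'a \<Rightarrow> real) g. C1c f g \<longrightarrow>
     (\<integral>x. \<bar>f x\<bar> powr p \<partial>lborel) \<le> C * (\<integral>x. (norm (g x))\<^sup>2 \<partial>lborel) powr (p / 2)"
proof -
  obtain C where C: "C > 0" "\<And>(f::'a \<Rightarrow> real) g. C1c f g \<Longrightarrow> (\<forall>x. \<bar>f x\<bar> < 1) \<Longrightarrow>
     (\<integral>x. \<bar>f x\<bar> powr p \<partial>lborel) \<le> C * (\<integral>x. (norm (g x))\<^sup>2 \<partial>lborel) powr (p / 2)"
    using sobolev_bounded[OF n p] by blast
  show ?thesis
  proof (intro exI[of _ C] conjI allI impI)
    fix f :: "'a \<Rightarrow> real" and g
    assume fg: "C1c f g"
    obtain M where M: "M > 0" "\<And>x. \<bar>f x\<bar> \<le> M" using C1c_bounded[OF fg] by blast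
    define c where "c = 1 / (2 * M)"
    have c: "c > 0" using M by (simp add: c_def)
    have "\<bar>c * f x\<bar> < 1" for x using M(1) M(2)[of x] by (simp add: c_def abs_mult field_simps)
    then have "(\<integral>x. \<bar>c * f x\<bar> powr p \<partial>lborel) \<le> C * (\<integral>x. (norm (c *\<^sub>R g x))\<^sup>2 \<partial>lborel) powr (p / 2)"
      by (intro C(2) C1c_cmult fg) auto
    also have "(\<integral>x. (norm (c *\<^sub>R g x))\<^sup>2 \<partial>lborel) = c\<^sup>2 * (\<integral>x. (norm (g x))\<^sup>2 \<partial>lborel)"
      by (simp add: power_mult_distrib)
    also have "\<dots> powr (p / 2) = c powr p * (\<integral>x. (norm (g x))\<^sup>2 \<partial>lborel) powr (p / 2)"
    proof -
      have "c\<^sup>2 = c powr 2" using c by simp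
      then have "(c\<^sup>2) powr (p / 2) = c powr p" by (simp only: powr_powr) simp
      then show ?thesis by (simp add: powr_mult)
    qed
    also have "(\<integral>x. \<bar>c * f x\<bar> powr p \<partial>lborel) = c powr p * (\<integral>x. \<bar>f x\<bar> powr p \<partial>lborel)"
      using c by (simp add: abs_mult powr_mult)
    finally show "(\<integral>x. \<bar>f x\<bar> powr p \<partial>lborel) \<le> C * (\<integral>x. (norm (g x))\<^sup>2 \<partial>lborel) powr (p / 2)"
      using c by (simp add: mult.left_commute[of C])
  qed (rule C)
qed

section \<open>Hardy inequality\<close>

text \<open>With V = 1/(|x|^2 + e) the field f^2 V x is regular at the origin and its divergence
  integrates to 0. Adding a times this divergence to |g + a f V x|^2 \<ge> 0, with a = (n-2)/2,
  gives the inequality for the regularized weight, and Fatou removes e.\<close>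

lemma hardy:
  fixes f :: "'a::euclidean_space \<Rightarrow> real"
  assumes n: "DIM('a) \<ge> 2" and fg: "C1c f g"
  shows "ennreal (((real DIM('a) - 2) / 2)\<^sup>2) * (\<integral>\<^sup>+x. ennreal ((f x)\<^sup>2 / (norm x)\<^sup>2) \<partial>lborel)
    \<le> ennreal (\<integral>x. (norm (g x))\<^sup>2 \<partial>lborel)"
proof -
  define a where "a = (real DIM('a) - 2) / 2"
  have a: "a \<ge> 0" using n by (simp add: a_def)
  have [measurable]: "f \<in> borel_measurable borel" using C1c_measurable[OF fg] by simp
  have [measurable]: "g \<in> borel_measurable borel" using C1c_measurable[OF fg] by simp
  obtain R where R: "R > 0" "\<And>x. norm x > R \<Longrightarrow> f x = 0" "\<And>x. norm x > R \<Longrightarrow> g x = 0"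
    using C1c_support[OF fg] by blast
  have gi: "integrable lborel (\<lambda>x. (norm (g x))\<^sup>2)" by (rule C1c_integrable_sq[OF fg])
  have main: "a\<^sup>2 * (\<integral>x. (f x)\<^sup>2 / ((norm x)\<^sup>2 + e) \<partial>lborel) \<le> (\<integral>x. (norm (g x))\<^sup>2 \<partial>lborel)"
    and main_int: "integrable lborel (\<lambda>x. (f x)\<^sup>2 / ((norm x)\<^sup>2 + e))" if e: "e > 0" for e :: real
  proof -
    have pos: "(norm x)\<^sup>2 + e > 0" for x :: 'a using e by (simp add: add_nonneg_pos)
    have ne: "(norm x)\<^sup>2 + e \<noteq> 0" for x :: 'a using pos[of x] by simp
    define V where "V x = 1 / ((norm x)\<^sup>2 + e)" for x :: 'a
    have V0: "V x > 0" for x using pos by (simp add: V_def)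
    have Vx: "V x * (norm x)\<^sup>2 \<le> 1" for x using pos[of x] e by (simp add: V_def field_simps)
    have Vc: "continuous_on UNIV V" unfolding V_def by (intro continuous_intros) (use ne in auto)
    have Vd: "(V has_derivative (\<lambda>v. (- 2 * (V x)\<^sup>2) *\<^sub>R x \<bullet> v)) (at x)" for x
    proof -
      have "((\<lambda>x::'a. x \<bullet> x + e) has_derivative (\<lambda>v. 2 * (x \<bullet> v))) (at x)"
        by (auto intro!: derivative_eq_intros simp: inner_commute)
      then have "((\<lambda>x::'a. inverse (x \<bullet> x + e)) has_derivative
          (\<lambda>v. - (inverse (x \<bullet> x + e) * (2 * (x \<bullet> v)) * inverse (x \<bullet> x + e)))) (at x)"
        using ne[of x] by (intro Deriv.has_derivative_inverse) (auto simp: power2_norm_eq_inner)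
      moreover have "(\<lambda>x::'a. inverse (x \<bullet> x + e)) = V"
        by (auto simp: V_def power2_norm_eq_inner inverse_eq_divide)
      moreover have "inverse (x \<bullet> x + e) = V x"
        by (simp add: V_def power2_norm_eq_inner inverse_eq_divide)
      ultimately show ?thesis by (simp add: power2_eq_square mult_ac)
    qed
    \<comment> \<open>The gradient of the component in direction b of the field f^2 V x; its own
      b-entries add up to the divergence.\<close>
    define G where "G b x = ((f x)\<^sup>2) *\<^sub>R (V x *\<^sub>R b + (x \<bullet> b) *\<^sub>R ((- 2 * (V x)\<^sup>2) *\<^sub>R x)) +
        (V x * (x \<bullet> b)) *\<^sub>R ((2 * f x) *\<^sub>R g x)" for b x
    have f2: "C1c (\<lambda>x. (f x)\<^sup>2) (\<lambda>x. (2 * f x) *\<^sub>R g x)"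
      by (rule C1c_compose[OF fg, of "\<lambda>t. t\<^sup>2"]) (auto intro!: derivative_eq_intros continuous_intros)
    have C1G: "C1c (\<lambda>x. (V x * (x \<bullet> b)) * (f x)\<^sup>2) (G b)" for b
    proof -
      have d: "((\<lambda>x. V x * (x \<bullet> b)) has_derivative
          (\<lambda>v. (V x *\<^sub>R b + (x \<bullet> b) *\<^sub>R ((- 2 * (V x)\<^sup>2) *\<^sub>R x)) \<bullet> v)) (at x)" for x
        by (rule has_derivative_eq_rhs[OF has_derivative_mult[OF Vd]], rule has_derivative_inner_left, rule has_derivative_ident)
           (auto simp: inner_add_left inner_commute algebra_simps)
      have c: "continuous_on UNIV (\<lambda>x. V x *\<^sub>R b + (x \<bullet> b) *\<^sub>R ((- 2 * (V x)\<^sup>2) *\<^sub>R x))"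
        by (intro continuous_intros Vc)
      show ?thesis using C1c_mult[OF f2 d c] by (simp add: G_def[abs_def] add.commute)
    qed
    have int: "integrable lborel h" if "continuous_on UNIV h" "\<And>x. norm x > R \<Longrightarrow> h x = 0" for h :: "'a \<Rightarrow> real"
      using integrable_continuous_bounded_support[OF that] .
    note ci = continuous_intros Vc C1c_continuous[OF fg]
    show main_int: "integrable lborel (\<lambda>x. (f x)\<^sup>2 / ((norm x)\<^sup>2 + e))"
    proof -
      have "integrable lborel (\<lambda>x. (f x)\<^sup>2 * V x)" by (intro int ci) (use R in auto)
      then show ?thesis by (simp add: V_def)
    qed
    have i1: "integrable lborel (\<lambda>x. (f x)\<^sup>2 * (DIM('a) * V x - 2 * (V x)\<^sup>2 * (norm x)\<^sup>2))"
      by (intro int ci) (use R in auto)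
    have i2: "integrable lborel (\<lambda>x. 2 * f x * V x * (x \<bullet> g x))" by (intro int ci) (use R in auto)
    have i3: "integrable lborel (\<lambda>x. a\<^sup>2 * ((f x)\<^sup>2 * (V x)\<^sup>2 * (norm x)\<^sup>2))" by (intro int ci) (use R in auto)
    have sumG: "(\<Sum>b\<in>Basis. G b x \<bullet> b) = (f x)\<^sup>2 * (DIM('a) * V x - 2 * (V x)\<^sup>2 * (norm x)\<^sup>2) + 2 * f x * V x * (x \<bullet> g x)" for x
    proof -
      have 1: "(\<Sum>b\<in>Basis. (x \<bullet> b) * (x \<bullet> b)) = (norm x)\<^sup>2"
        by (simp add: power2_norm_eq_inner euclidean_inner[of x x])
      have 2: "(\<Sum>b\<in>Basis. (x \<bullet> b) * (g x \<bullet> b)) = x \<bullet> g x" by (simp add: euclidean_inner[of x "g x"])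
      have "G b x \<bullet> b = (f x)\<^sup>2 * V x - 2 * (f x)\<^sup>2 * (V x)\<^sup>2 * ((x \<bullet> b) * (x \<bullet> b)) + 2 * f x * V x * ((x \<bullet> b) * (g x \<bullet> b))"
        if "b \<in> Basis" for b using that by (simp add: G_def inner_add_left algebra_simps)
      then have "(\<Sum>b\<in>Basis. G b x \<bullet> b) = (\<Sum>b\<in>Basis. (f x)\<^sup>2 * V x - 2 * (f x)\<^sup>2 * (V x)\<^sup>2 * ((x \<bullet> b) * (x \<bullet> b)) + 2 * f x * V x * ((x \<bullet> b) * (g x \<bullet> b)))"
        by simp
      also have "\<dots> = DIM('a) * ((f x)\<^sup>2 * V x) - 2 * (f x)\<^sup>2 * (V x)\<^sup>2 * (norm x)\<^sup>2 + 2 * f x * V x * (x \<bullet> g x)"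
        by (simp only: sum.distrib sum_subtractf sum_distrib_left[symmetric] 1 2) simp
      finally show ?thesis by (simp add: algebra_simps)
    qed
    have Gi: "integrable lborel (\<lambda>x. G b x \<bullet> b)" for b
      by (intro int continuous_intros C1c_continuous(2)[OF C1G]) (use R in \<open>auto simp: G_def\<close>)
    have "0 = (\<Sum>b\<in>Basis. (\<integral>x. G b x \<bullet> b \<partial>lborel))" using C1c_integral_partial[OF C1G] by simp
    also have "\<dots> = (\<integral>x. (\<Sum>b\<in>Basis. G b x \<bullet> b) \<partial>lborel)"
      by (intro Bochner_Integration.integral_sum[symmetric] Gi)
    also have "\<dots> = (\<integral>x. (f x)\<^sup>2 * (DIM('a) * V x - 2 * (V x)\<^sup>2 * (norm x)\<^sup>2) \<partial>lborel) + (\<integral>x. 2 * f x * V x * (x \<bullet> g x) \<partial>lborel)"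
      unfolding sumG by (intro Bochner_Integration.integral_add i1 i2)
    finally have div0: "(\<integral>x. (f x)\<^sup>2 * (DIM('a) * V x - 2 * (V x)\<^sup>2 * (norm x)\<^sup>2) \<partial>lborel) = - (\<integral>x. 2 * f x * V x * (x \<bullet> g x) \<partial>lborel)" by simp
    have "a\<^sup>2 * (\<integral>x. (f x)\<^sup>2 / ((norm x)\<^sup>2 + e) \<partial>lborel) = (\<integral>x. a\<^sup>2 * ((f x)\<^sup>2 / ((norm x)\<^sup>2 + e)) \<partial>lborel)"
      by (rule integral_mult_right_zero[symmetric])
    also have "\<dots> \<le> (\<integral>x. (norm (g x))\<^sup>2 + a * ((f x)\<^sup>2 * (DIM('a) * V x - 2 * (V x)\<^sup>2 * (norm x)\<^sup>2)) + a * (2 * f x * V x * (x \<bullet> g x)) \<partial>lborel)"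
    proof (intro integral_mono integrable_mult_right main_int Bochner_Integration.integrable_add gi i1 i2)
      fix x
      have "0 \<le> (norm (g x + (a * f x * V x) *\<^sub>R x))\<^sup>2" by simp
      also have "\<dots> = (norm (g x))\<^sup>2 + 2 * (a * f x * V x) * (x \<bullet> g x) + (a * f x * V x)\<^sup>2 * (norm x)\<^sup>2"
        using dot_norm[of "g x" "(a * f x * V x) *\<^sub>R x"] by (simp add: power_mult_distrib inner_commute)
      finally have 1: "0 \<le> (norm (g x))\<^sup>2 + a * (2 * f x * V x * (x \<bullet> g x)) + a\<^sup>2 * (f x)\<^sup>2 * (V x)\<^sup>2 * (norm x)\<^sup>2"
        by (simp add: power_mult_distrib mult_ac)
      have n2: "real DIM('a) = 2 * a + 2" unfolding a_def by (simp add: field_simps)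
      \<comment> \<open>This discards the term in which e enters. With n = 2a + 2 the remaining
        coefficients of f^2 V add up to exactly a^2.\<close>
      have 2: "(V x)\<^sup>2 * (norm x)\<^sup>2 \<le> V x" using mult_left_mono[OF Vx[of x], of "V x"] V0[of x]
        by (simp add: power2_eq_square mult.assoc)
      have "(f x)\<^sup>2 * ((2 * a + a\<^sup>2) * ((V x)\<^sup>2 * (norm x)\<^sup>2)) \<le> (f x)\<^sup>2 * ((2 * a + a\<^sup>2) * V x)"
        using a by (intro mult_left_mono 2) auto
      then have "a\<^sup>2 * ((f x)\<^sup>2 * V x) \<le> a * ((f x)\<^sup>2 * (DIM('a) * V x - 2 * (V x)\<^sup>2 * (norm x)\<^sup>2)) - a\<^sup>2 * (f x)\<^sup>2 * (V x)\<^sup>2 * (norm x)\<^sup>2"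
        unfolding n2 by (simp add: algebra_simps power2_eq_square)
      with 1 show "a\<^sup>2 * ((f x)\<^sup>2 / ((norm x)\<^sup>2 + e)) \<le> (norm (g x))\<^sup>2 + a * ((f x)\<^sup>2 * (DIM('a) * V x - 2 * (V x)\<^sup>2 * (norm x)\<^sup>2)) + a * (2 * f x * V x * (x \<bullet> g x))"
        by (simp add: V_def)
    qed
    also have "\<dots> = (\<integral>x. (norm (g x))\<^sup>2 \<partial>lborel)"
    proof -
      have "(\<integral>x. (norm (g x))\<^sup>2 + a * ((f x)\<^sup>2 * (DIM('a) * V x - 2 * (V x)\<^sup>2 * (norm x)\<^sup>2)) + a * (2 * f x * V x * (x \<bullet> g x)) \<partial>lborel)
        = (\<integral>x. (norm (g x))\<^sup>2 \<partial>lborel) + a * (\<integral>x. (f x)\<^sup>2 * (DIM('a) * V x - 2 * (V x)\<^sup>2 * (norm x)\<^sup>2) \<partial>lborel) + a * (\<integral>x. 2 * f x * V x * (x \<bullet> g x) \<partial>lborel)"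
        by (subst Bochner_Integration.integral_add Bochner_Integration.integral_mult_right,
            (intro Bochner_Integration.integrable_add integrable_mult_right gi i1 i2)+)+ (simp only: integral_mult_right_zero)
      then show ?thesis unfolding div0 by simp
    qed
    finally show "a\<^sup>2 * (\<integral>x. (f x)\<^sup>2 / ((norm x)\<^sup>2 + e) \<partial>lborel) \<le> (\<integral>x. (norm (g x))\<^sup>2 \<partial>lborel)" .
  qed
  \<comment> \<open>Regularization parameters decreasing to 0; off the origin the regularized
    weights converge to 1/|x|^2.\<close>
  define t where "t k = inverse (real (Suc k))" for k
  have t: "t k > 0" for k by (simp add: t_def)
  have "AE x in lborel. x \<noteq> (0::'a)" by (rule AE_lborel_singleton)
  then have "AE x in lborel. ennreal (a\<^sup>2) * ennreal ((f x)\<^sup>2 / (norm x)\<^sup>2) =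
      liminf (\<lambda>k. ennreal (a\<^sup>2 * ((f x)\<^sup>2 / ((norm x)\<^sup>2 + t k))))"
  proof eventually_elim
    case (elim x)
    have "t \<longlonglongrightarrow> 0" unfolding t_def by (rule LIMSEQ_inverse_real_of_nat)
    then have "(\<lambda>k. ennreal (a\<^sup>2 * ((f x)\<^sup>2 / ((norm x)\<^sup>2 + t k)))) \<longlonglongrightarrow> ennreal (a\<^sup>2 * ((f x)\<^sup>2 / ((norm x)\<^sup>2 + 0)))"
      using elim by (intro tendsto_intros tendsto_ennrealI) auto
    then have "liminf (\<lambda>k. ennreal (a\<^sup>2 * ((f x)\<^sup>2 / ((norm x)\<^sup>2 + t k)))) = ennreal (a\<^sup>2 * ((f x)\<^sup>2 / ((norm x)\<^sup>2 + 0)))"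
      by (intro lim_imp_Liminf) auto
    moreover have "ennreal (a\<^sup>2) * ennreal ((f x)\<^sup>2 / (norm x)\<^sup>2) = ennreal (a\<^sup>2 * ((f x)\<^sup>2 / (norm x)\<^sup>2))"
      by (rule ennreal_mult[symmetric]) auto
    ultimately show ?case by simp
  qed
  then have "(\<integral>\<^sup>+x. ennreal (a\<^sup>2) * ennreal ((f x)\<^sup>2 / (norm x)\<^sup>2) \<partial>lborel) =
     (\<integral>\<^sup>+x. liminf (\<lambda>k. ennreal (a\<^sup>2 * ((f x)\<^sup>2 / ((norm x)\<^sup>2 + t k)))) \<partial>lborel)"
    by (rule nn_integral_cong_AE)
  also have "\<dots> \<le> liminf (\<lambda>k. (\<integral>\<^sup>+x. ennreal (a\<^sup>2 * ((f x)\<^sup>2 / ((norm x)\<^sup>2 + t k))) \<partial>lborel))"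
    by (rule nn_integral_liminf) measurable
  also have "\<dots> \<le> ennreal (\<integral>x. (norm (g x))\<^sup>2 \<partial>lborel)"
  proof (intro Liminf_le always_eventually allI)
    fix k
    have "(\<integral>\<^sup>+x. ennreal (a\<^sup>2 * ((f x)\<^sup>2 / ((norm x)\<^sup>2 + t k))) \<partial>lborel) = ennreal (\<integral>x. a\<^sup>2 * ((f x)\<^sup>2 / ((norm x)\<^sup>2 + t k)) \<partial>lborel)"
    proof (intro nn_integral_eq_integral integrable_mult_right main_int t AE_I2)
      show "0 \<le> a\<^sup>2 * ((f x)\<^sup>2 / ((norm x)\<^sup>2 + t k))" for x
        using t[of k] by (intro mult_nonneg_nonneg divide_nonneg_nonneg add_nonneg_nonneg) auto
    qed
    then show "(\<integral>\<^sup>+x. ennreal (a\<^sup>2 * ((f x)\<^sup>2 / ((norm x)\<^sup>2 + t k))) \<partial>lborel) \<le> ennreal (\<integral>x. (norm (g x))\<^sup>2 \<partial>lborel)"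
      using main[OF t[of k]] by (simp only: integral_mult_right_zero ennreal_leI)
  qed simp
  finally show ?thesis by (subst (asm) nn_integral_cmult) (auto simp: a_def)
qed

section \<open>Weighted measures and the Hardy-Sobolev inequality\<close>

lemma test_functions_C1c:
  fixes f :: "real^'n::finite \<Rightarrow> real"
  assumes "f \<in> test_functions" shows "C1c f (grad f)"
proof -
  have *: "C_k (Suc 0) f" using assms test_functions_C_k by blast
  have D: "(f has_derivative frechet_derivative f (at x)) (at x)" for x
    using * by (simp add: differentiable_on_def frechet_derivative_works[symmetric])
  have "frechet_derivative f (at x) h = grad f x \<bullet> h" for x h
  proof -
    have lin: "linear (frechet_derivative f (at x))" using has_derivative_linear[OF D] .
    have "frechet_derivative f (at x) h = frechet_derivative f (at x) (\<Sum>i\<in>UNIV. (h $ i) *\<^sub>R axis i 1)"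
      using basis_expansion[of h] by (simp add: scalar_mult_eq_scaleR)
    also have "\<dots> = (\<Sum>i\<in>UNIV. (h $ i) * partial i f x)"
      by (simp add: linear_sum[OF lin] linear_scale[OF lin] partial_def)
    also have "\<dots> = grad f x \<bullet> h" by (simp add: grad_def inner_vec_def mult.commute)
    finally show ?thesis .
  qed
  then have D': "(f has_derivative (\<lambda>h. grad f x \<bullet> h)) (at x)" for x using D[of x] by presburger
  have "continuous_on UNIV (grad f)" unfolding grad_def[abs_def]
    using * by (intro continuous_on_vec_lambda) simp
  moreover obtain K where "compact K" "\<And>x. x \<notin> K \<Longrightarrow> f x = 0"
    using test_functions_support[OF assms] by blast
  moreover then obtain R where "\<And>x. x \<in> K \<Longrightarrow> norm x \<le> R" using compact_imp_bounded bounded_iff by metis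
  ultimately have "\<exists>R. \<forall>x. norm x > R \<longrightarrow> f x = 0" by (metis not_le)
  then show ?thesis unfolding C1c_def using D' \<open>continuous_on UNIV (grad f)\<close> by blast
qed

text \<open>The device for computing \<open>grad\<close>: exhibit any \<open>C1c\<close> gradient of
  the function.\<close>

lemma C1c_grad_unique:
  fixes f :: "real^'n::finite \<Rightarrow> real"
  assumes "f \<in> test_functions" "C1c f g" shows "grad f = g"
proof
  fix x
  have "(\<lambda>h. g x \<bullet> h) = (\<lambda>h. grad f x \<bullet> h)"
    using C1c_derivative[OF assms(2)] C1c_derivative[OF test_functions_C1c[OF assms(1)]] has_derivative_unique by blast
  then have "(grad f x - g x) \<bullet> h = 0" for h by (metis inner_diff_left right_minus_eq)
  then show "grad f x = g x" by (metis inner_eq_zero_iff right_minus_eq)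
qed

text \<open>Absorbing the weight into the measure lets the L^q lemmas, stated over an arbitrary
  measure, serve every s at once, including s = 2 for the Hardy term. At the origin the density is 0
  by the convention for division, on a null set.\<close>

definition hs_measure :: "real \<Rightarrow> (real^'n::finite) measure" where
  "hs_measure s = density lborel (\<lambda>x. ennreal (1 / norm x powr s))"

lemma sets_hs_measure [measurable_cong, simp]: "sets (hs_measure s) = sets borel"
  by (simp add: hs_measure_def)

lemma space_hs_measure [simp]: "space (hs_measure s) = UNIV"
  by (simp add: hs_measure_def)

lemma nn_integral_hs_measure:
  assumes "f \<in> borel_measurable borel" "\<And>x. f x \<ge> 0"
  shows "(\<integral>\<^sup>+x. ennreal (f x) \<partial>hs_measure s) = (\<integral>\<^sup>+x. ennreal (f x / norm x powr s) \<partial>lborel)"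
  unfolding hs_measure_def using assms
  by (subst nn_integral_density) (auto simp: ennreal_mult'[symmetric] mult.commute)

lemma integral_hs_measure:
  fixes f :: "real^'n::finite \<Rightarrow> real"
  assumes "f \<in> borel_measurable borel"
  shows "(\<integral>x. f x \<partial>hs_measure s) = (\<integral>x. f x / norm x powr s \<partial>lborel)"
  unfolding hs_measure_def using assms
  by (subst integral_density) (auto simp: mult.commute divide_inverse)

text \<open>The density is positive off the origin, so all the weighted measures have the Lebesgue
  null sets and a.e. convergence passes freely between different s.\<close>

lemma AE_hs_measure: 
  "(AE x in hs_measure s. P x) \<longleftrightarrow> (AE x in (lborel :: (real^'n::finite) measure). P x)"
proof -
  have nz: "AE x in lborel. x \<noteq> (0::real^'n)" by (rule AE_lborel_singleton)
  have "(AE x in hs_measure s. P x) \<longleftrightarrow> (AE x in lborel. 0 < ennreal (1 / norm x powr s) \<longrightarrow> P x)"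
    unfolding hs_measure_def by (subst AE_density) auto
  also have "\<dots> \<longleftrightarrow> (AE x in lborel. P x)"
  proof
    assume "AE x in lborel. 0 < ennreal (1 / norm x powr s) \<longrightarrow> P x"
    with nz show "AE x in lborel. P x" by eventually_elim auto
  qed (auto elim!: eventually_mono)
  finally show ?thesis .
qed

text \<open>The fourth claim is the interpolation relation: the exponent for s lies between the
  Hardy exponent 2 and the Sobolev exponent, with weights s/2 and 1 - s/2.\<close>

lemma crit_exp_gt2:
  assumes "CARD('n::finite) \<ge> 3" "0 \<le> s" "s \<le> 2"
  shows "crit_exp TYPE('n) s \<ge> 2" "s < 2 \<Longrightarrow> crit_exp TYPE('n) s > 2" "crit_exp TYPE('n) s > 0"
    "crit_exp TYPE('n) s = 2 * (s / 2) + crit_exp TYPE('n) 0 * (1 - s / 2)"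
    "crit_exp TYPE('n) 2 = 2" "s > 0 \<Longrightarrow> crit_exp TYPE('n) s < crit_exp TYPE('n) 0"
proof -
  have n: "real CARD('n) \<ge> 3" using assms by simp
  show "crit_exp TYPE('n) s = 2 * (s / 2) + crit_exp TYPE('n) 0 * (1 - s / 2)" "crit_exp TYPE('n) 2 = 2"
    using n by (simp_all add: crit_exp_def field_simps)
  have "2 * (real CARD('n) - 2) \<le> 2 * (real CARD('n) - s)" using assms by simp
  then show *: "crit_exp TYPE('n) s \<ge> 2" using n by (simp add: crit_exp_def field_simps)
  then show "crit_exp TYPE('n) s > 0" by simp
  show "crit_exp TYPE('n) s > 2" if "s < 2" using n that by (simp add: crit_exp_def field_simps)
  show "crit_exp TYPE('n) s < crit_exp TYPE('n) 0" if "s > 0" using n that by (simp add: crit_exp_def divide_strict_right_mono)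
qed

text \<open>Pointwise the integrand is X^(s/2) Y^(1 - s/2), with X the Hardy and Y the Sobolev
  integrand, hence at most X + Y. This inhomogeneous bound is enough when the Dirichlet integral is
  1; scaling gives the rest.\<close>

theorem hardy_sobolev:
  assumes n: "CARD('n::finite) \<ge> 3" and s: "0 \<le> s" "s \<le> 2"
  shows "\<exists>C>0. \<forall>(f::real^'n \<Rightarrow> real) g. C1c f g \<longrightarrow>
     (\<integral>\<^sup>+x. ennreal (\<bar>f x\<bar> powr crit_exp TYPE('n) s) \<partial>hs_measure s)
       \<le> ennreal (C * (\<integral>x. (norm (g x))\<^sup>2 \<partial>lborel) powr (crit_exp TYPE('n) s / 2))"
proof -
  define p where "p = crit_exp TYPE('n) s"
  define p0 where "p0 = crit_exp TYPE('n) 0"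
  have p: "p > 0" "p = 2 * (s / 2) + p0 * (1 - s / 2)" "p0 > 0" unfolding p_def p0_def
    using crit_exp_gt2(3,4)[OF n s] crit_exp_gt2(3)[OF n, of 0] by auto
  have "p0 = 2 * DIM(real^'n) / (real DIM(real^'n) - 2)" "DIM(real^'n) \<ge> 3" using n
    by (simp_all add: p0_def crit_exp_def)
  then obtain C0 where C0: "C0 > 0" "\<And>(f::real^'n \<Rightarrow> real) g. C1c f g \<Longrightarrow>
     (\<integral>x. \<bar>f x\<bar> powr p0 \<partial>lborel) \<le> C0 * (\<integral>x. (norm (g x))\<^sup>2 \<partial>lborel) powr (p0 / 2)"
    using sobolev[where 'a="real^'n"] by blast
  define a2 where "a2 = ((real CARD('n) - 2) / 2)\<^sup>2"
  have a2: "a2 > 0" using n by (simp add: a2_def)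
  have int0: "integrable lborel (\<lambda>x. \<bar>f x\<bar> powr p0)" if fg: "C1c f g" for f :: "real^'n \<Rightarrow> real" and g
  proof -
    have "continuous_on UNIV (\<lambda>z::real \<times> (real^'n). \<bar>fst z\<bar> powr p0)"
      using p by (intro continuous_on_powr' continuous_intros) auto
    then show ?thesis
      using C1c_integrable[OF fg, of "\<lambda>a b. \<bar>a\<bar> powr p0"] by (simp add: case_prod_beta)
  qed
  have norm1: "(\<integral>\<^sup>+x. ennreal (\<bar>f x\<bar> powr p) \<partial>hs_measure s) \<le> ennreal (1 / a2 + C0)"
    if fg: "C1c f g" and E1: "(\<integral>x. (norm (g x))\<^sup>2 \<partial>lborel) = 1" for f :: "real^'n \<Rightarrow> real" and g
  proof -
    have [measurable]: "f \<in> borel_measurable borel" using C1c_measurable[OF fg] by simp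
    have "ennreal a2 * (\<integral>\<^sup>+x. ennreal ((f x)\<^sup>2 / (norm x)\<^sup>2) \<partial>lborel) \<le> ennreal 1"
      using hardy[OF _ fg] n E1 by (simp add: a2_def)
    then have "ennreal (1 / a2) * (ennreal a2 * (\<integral>\<^sup>+x. ennreal ((f x)\<^sup>2 / (norm x)\<^sup>2) \<partial>lborel)) \<le> ennreal (1 / a2) * ennreal 1"
      by (intro mult_left_mono) auto
    then have H: "(\<integral>\<^sup>+x. ennreal ((f x)\<^sup>2 / (norm x)\<^sup>2) \<partial>lborel) \<le> ennreal (1 / a2)"
      using a2 by (simp add: mult.assoc[symmetric] ennreal_mult'[symmetric])
    have S: "(\<integral>\<^sup>+x. ennreal (\<bar>f x\<bar> powr p0) \<partial>lborel) \<le> ennreal C0"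
      using C0(2)[OF fg] E1 int0[OF fg] by (simp add: nn_integral_eq_integral ennreal_leI)
    have nz: "AE x in lborel. x \<noteq> (0::real^'n)" by (rule AE_lborel_singleton)
    have "(\<integral>\<^sup>+x. ennreal (\<bar>f x\<bar> powr p) \<partial>hs_measure s) = (\<integral>\<^sup>+x. ennreal (\<bar>f x\<bar> powr p / norm x powr s) \<partial>lborel)"
      by (rule nn_integral_hs_measure) auto
    also have "\<dots> \<le> (\<integral>\<^sup>+x. ennreal ((f x)\<^sup>2 / (norm x)\<^sup>2) + ennreal (\<bar>f x\<bar> powr p0) \<partial>lborel)"
    proof (rule nn_integral_mono_AE, use nz in eventually_elim)
      case (elim x)
      define X where "X = (f x)\<^sup>2 / (norm x)\<^sup>2"
      define Y where "Y = \<bar>f x\<bar> powr p0"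
      have XY: "X \<ge> 0" "Y \<ge> 0" by (auto simp: X_def Y_def)
      have "\<bar>f x\<bar> powr p / norm x powr s = X powr (s / 2) * Y powr (1 - s / 2)"
      proof (cases "f x = 0")
        case True
        then show ?thesis using p by (cases "s = 0") (auto simp: X_def Y_def)
      next
        case False
        have "X = (\<bar>f x\<bar> / norm x) powr 2" using elim False by (simp add: X_def power_divide)
        then have "X powr (s / 2) = (\<bar>f x\<bar> / norm x) powr s" by (simp only: powr_powr) simp
        also have "\<dots> = \<bar>f x\<bar> powr (2 * (s / 2)) / norm x powr s" using elim False by (simp add: powr_divide)
        finally have "X powr (s / 2) * Y powr (1 - s / 2) = \<bar>f x\<bar> powr (2 * (s / 2)) * \<bar>f x\<bar> powr (p0 * (1 - s / 2)) / norm x powr s"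
          by (simp add: Y_def powr_powr)
        also have "\<dots> = \<bar>f x\<bar> powr p / norm x powr s" unfolding powr_add[symmetric] p(2)[symmetric] ..
        finally show ?thesis ..
      qed
      also have "\<dots> \<le> max X Y powr (s / 2) * max X Y powr (1 - s / 2)"
        using s XY by (intro mult_mono powr_mono2) auto
      also have "\<dots> \<le> max X Y" using XY by (simp add: powr_add[symmetric])
      also have "\<dots> \<le> X + Y" using XY by simp
      finally show ?case using XY by (simp add: X_def Y_def ennreal_leI flip: ennreal_plus)
    qed
    also have "\<dots> = (\<integral>\<^sup>+x. ennreal ((f x)\<^sup>2 / (norm x)\<^sup>2) \<partial>lborel) + (\<integral>\<^sup>+x. ennreal (\<bar>f x\<bar> powr p0) \<partial>lborel)"
      by (rule nn_integral_add) auto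
    also have "\<dots> \<le> ennreal (1 / a2) + ennreal C0" by (intro add_mono H S)
    finally show ?thesis using a2 C0 by (simp flip: ennreal_plus)
  qed
  show ?thesis unfolding p_def[symmetric]
  proof (intro exI[of _ "1 / a2 + C0"] conjI allI impI)
    show "1 / a2 + C0 > 0" using a2 C0 by (simp add: add_pos_pos)
    fix f :: "real^'n \<Rightarrow> real" and g
    assume fg: "C1c f g"
    have [measurable]: "f \<in> borel_measurable borel" using C1c_measurable[OF fg] by simp
    define E where "E = (\<integral>x. (norm (g x))\<^sup>2 \<partial>lborel)"
    have "E \<ge> 0" by (simp add: E_def)
    show "(\<integral>\<^sup>+x. ennreal (\<bar>f x\<bar> powr p) \<partial>hs_measure s) \<le> ennreal ((1 / a2 + C0) * (\<integral>x. (norm (g x))\<^sup>2 \<partial>lborel) powr (p / 2))"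
    proof (cases "E = 0")
      \<comment> \<open>Normalization is impossible here, but Sobolev forces \<open>f\<close> to
        vanish almost everywhere.\<close>
      case True
      have "(\<integral>x. \<bar>f x\<bar> powr p0 \<partial>lborel) \<le> 0" using C0(2)[OF fg] True p by (simp add: E_def)
      then have "(\<integral>x. \<bar>f x\<bar> powr p0 \<partial>lborel) = 0" by (intro antisym integral_nonneg_AE) auto
      then have "AE x in lborel. \<bar>f x\<bar> powr p0 = 0"
        using int0[OF fg] by (subst (asm) integral_nonneg_eq_0_iff_AE) auto
      then have "AE x in hs_measure s. ennreal (\<bar>f x\<bar> powr p) = 0" unfolding AE_hs_measure
        by eventually_elim (use p in auto)
      then have "(\<integral>\<^sup>+x. ennreal (\<bar>f x\<bar> powr p) \<partial>hs_measure s) = 0" by (subst nn_integral_0_iff_AE) auto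
      then show ?thesis by simp
    next
      case False
      then have E: "E > 0" using \<open>E \<ge> 0\<close> by simp
      define c where "c = 1 / sqrt E"
      have c: "c > 0" using E by (simp add: c_def)
      have "(\<integral>x. (norm (c *\<^sub>R g x))\<^sup>2 \<partial>lborel) = c\<^sup>2 * E" by (simp add: power_mult_distrib E_def)
      also have "\<dots> = 1" using E by (simp add: c_def power_divide)
      finally have "(\<integral>\<^sup>+x. ennreal (\<bar>c * f x\<bar> powr p) \<partial>hs_measure s) \<le> ennreal (1 / a2 + C0)"
        by (intro norm1[OF C1c_cmult[OF fg]])
      also have "(\<integral>\<^sup>+x. ennreal (\<bar>c * f x\<bar> powr p) \<partial>hs_measure s) = (\<integral>\<^sup>+x. ennreal (c powr p) * ennreal (\<bar>f x\<bar> powr p) \<partial>hs_measure s)"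
        using c by (simp add: abs_mult powr_mult ennreal_mult')
      also have "\<dots> = ennreal (c powr p) * (\<integral>\<^sup>+x. ennreal (\<bar>f x\<bar> powr p) \<partial>hs_measure s)"
        by (rule nn_integral_cmult) auto
      finally have "ennreal (E powr (p / 2)) * (ennreal (c powr p) * (\<integral>\<^sup>+x. ennreal (\<bar>f x\<bar> powr p) \<partial>hs_measure s))
          \<le> ennreal (E powr (p / 2)) * ennreal (1 / a2 + C0)" by (intro mult_left_mono) auto
      moreover have "E powr (p / 2) * c powr p = 1"
      proof -
        have "sqrt E = E powr (1 / 2)" using E by (simp add: powr_half_sqrt)
        then have "c powr p = 1 / E powr (p / 2)" using E by (simp add: c_def powr_divide powr_powr)
        then show ?thesis using E by simp
      qed
      moreover from this have "ennreal (E powr (p / 2)) * ennreal (c powr p) = 1"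
        by (subst ennreal_mult[symmetric]) auto
      ultimately have "(\<integral>\<^sup>+x. ennreal (\<bar>f x\<bar> powr p) \<partial>hs_measure s) \<le> ennreal (E powr (p / 2)) * ennreal (1 / a2 + C0)"
        by (simp only: mult.assoc[symmetric] mult_1_left)
      also have "\<dots> = ennreal ((1 / a2 + C0) * E powr (p / 2))"
        using a2 C0 by (subst ennreal_mult'[symmetric]) (auto simp: mult.commute)
      finally show ?thesis by (simp add: E_def)
    qed
  qed
qed

section \<open>Convergence in L^q and the Brezis-Lieb lemma\<close>

text \<open>Whichever of B and d A is larger bounds the sum by a multiple of a single term. The
  argument covers all q > 0, convex or not.\<close>

lemma powr_sum_le:
  fixes A B q :: real
  assumes "q > 0" "d > 0" "A \<ge> 0" "B \<ge> 0"
  shows "(A + B) powr q \<le> (1 + d) powr q * A powr q + (1 + 1 / d) powr q * B powr q"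
proof (cases "B \<le> d * A")
  case True
  then have "(A + B) powr q \<le> ((1 + d) * A) powr q" using assms by (intro powr_mono2) (auto simp: algebra_simps)
  also have "\<dots> = (1 + d) powr q * A powr q" by (rule powr_mult)
  finally show ?thesis by (simp add: add_increasing2)
next
  case False
  then have "A \<le> B / d" using assms by (simp add: field_simps)
  then have "(A + B) powr q \<le> ((1 + 1 / d) * B) powr q" using assms by (intro powr_mono2) (auto simp: algebra_simps)
  also have "\<dots> = (1 + 1 / d) powr q * B powr q" by (rule powr_mult)
  finally show ?thesis by (simp add: add_increasing)
qed

lemma norm_powr_sum_le:
  fixes q :: real
  assumes "q > 0" "e > 0"
  shows "\<exists>C\<ge>0. \<forall>a b::'b::real_normed_vector. norm (a + b) powr q \<le> (1 + e) * norm a powr q + C * norm b powr q"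
proof -
  \<comment> \<open>Solves (1 + d)^q = 1 + e.\<close>
  define d where "d = (1 + e) powr (1 / q) - 1"
  have "1 < (1 + e) powr (1 / q)" using assms by (subst gr_one_powr) auto
  then have d: "d > 0" by (simp add: d_def)
  have dq: "(1 + d) powr q = 1 + e" using assms by (simp add: d_def powr_powr)
  show ?thesis
  proof (intro exI[of _ "(1 + 1 / d) powr q"] conjI allI)
    fix a b :: 'b
    have "norm (a + b) powr q \<le> (norm a + norm b) powr q" using assms by (intro powr_mono2 norm_triangle_ineq) auto
    also have "\<dots> \<le> (1 + e) * norm a powr q + (1 + 1 / d) powr q * norm b powr q"
      using powr_sum_le[OF assms(1) d, of "norm a" "norm b"] dq by simp
    finally show "norm (a + b) powr q \<le> (1 + e) * norm a powr q + (1 + 1 / d) powr q * norm b powr q" .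
  qed simp
qed

lemma norm_powr_sum_le2:
  fixes q :: real
  assumes "q > 0"
  shows "\<exists>C\<ge>0. \<forall>a b::'b::real_normed_vector. norm (a + b) powr q \<le> 2 * norm a powr q + C * norm b powr q"
  using norm_powr_sum_le[OF assms, of 1, where 'b='b] by (simp only: one_add_one zero_less_one)

text \<open>The previous bound is used in both directions, for a + b in terms of a and for a in
  terms of a + b and -b. Near-additivity with an arbitrarily small share of |a|^q drives both norm
  convergence and Brezis-Lieb.\<close>

lemma norm_powr_perturb:
  fixes q :: real
  assumes q: "q > 0" and e: "e > 0"
  shows "\<exists>C\<ge>0. \<forall>a b::'b::real_normed_vector.
     \<bar>norm (a + b) powr q - norm a powr q\<bar> \<le> e * norm a powr q + C * norm b powr q"
proof -
  \<comment> \<open>The second direction produces d (1 + d) A + (1 + d) C B, so d \<le> 1 and 2d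
    \<le> e turn the error into the desired form.\<close>
  define d where "d = min 1 (e / 2)"
  have d: "d > 0" "d \<le> 1" "2 * d \<le> e" using e by (auto simp: d_def)
  obtain C where C: "C \<ge> 0" "\<And>a b::'b. norm (a + b) powr q \<le> (1 + d) * norm a powr q + C * norm b powr q"
    using norm_powr_sum_le[OF q d(1)] by blast
  show ?thesis
  proof (intro exI[of _ "3 * C"] conjI allI)
    fix a b :: 'b
    define A B N where "A = norm a powr q" and "B = norm b powr q" and "N = norm (a + b) powr q"
    have pos: "A \<ge> 0" "B \<ge> 0" "N \<ge> 0" by (auto simp: A_def B_def N_def)
    have 1: "N \<le> (1 + d) * A + C * B" using C(2)[of a b] by (simp add: A_def B_def N_def)
    have 2: "A \<le> (1 + d) * N + C * B" using C(2)[of "a + b" "- b"] by (simp add: A_def B_def N_def)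
    have CB: "C * B \<ge> 0" using C pos by simp
    have dA: "2 * d * A \<le> e * A" "d * A \<ge> 0" using d pos by (auto intro: mult_right_mono)
    have "N - A \<le> e * A + 3 * C * B" using 1 dA CB by (simp add: algebra_simps)
    moreover have "A - N \<le> e * A + 3 * C * B"
    proof -
      have "d * N \<le> d * ((1 + d) * A + C * B)" using 1 d by (intro mult_left_mono) auto
      also have "\<dots> = d * (1 + d) * A + d * (C * B)" by (simp add: algebra_simps)
      also have "\<dots> \<le> 2 * d * A + 1 * (C * B)" using d pos CB by (intro add_mono mult_right_mono) auto
      finally show ?thesis using 2 dA CB by (simp add: algebra_simps)
    qed
    ultimately show "\<bar>norm (a + b) powr q - norm a powr q\<bar> \<le> e * norm a powr q + 3 * C * norm b powr q"
      by (simp add: A_def B_def N_def)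
  qed (use C in simp)
qed

lemma Lq_integrable_limit:
  fixes f g :: "'x \<Rightarrow> 'b::{real_normed_vector, second_countable_topology}"
  assumes q: "q > 0" and [measurable]: "f \<in> borel_measurable M" "g \<in> borel_measurable M"
    and int: "integrable M (\<lambda>x. norm (f x) powr q)" and fin: "(\<integral>\<^sup>+x. ennreal (norm (f x - g x) powr q) \<partial>M) < \<infinity>"
  shows "integrable M (\<lambda>x. norm (g x) powr q)" "integrable M (\<lambda>x. norm (f x - g x) powr q)"
proof -
  show i2: "integrable M (\<lambda>x. norm (f x - g x) powr q)"
    using fin by (intro integrableI_bounded) auto
  obtain C where C: "C \<ge> 0" "\<And>a b::'b. norm (a + b) powr q \<le> 2 * norm a powr q + C * norm b powr q"
    using norm_powr_sum_le2[OF q, where 'b='b] by blast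
  show "integrable M (\<lambda>x. norm (g x) powr q)"
  proof (rule Bochner_Integration.integrable_bound[where f="\<lambda>x. 2 * norm (f x) powr q + C * norm (f x - g x) powr q"])
    show "AE x in M. norm (norm (g x) powr q) \<le> norm (2 * norm (f x) powr q + C * norm (f x - g x) powr q)"
    proof (rule AE_I2)
      fix x
      show "norm (norm (g x) powr q) \<le> norm (2 * norm (f x) powr q + C * norm (f x - g x) powr q)"
        using C(2)[of "f x" "- (f x - g x)"] C(1) by (simp add: norm_minus_commute)
    qed
  qed (auto intro!: integrable_mult_right int i2)
qed

lemma Lq_norm_tendsto:
  fixes f :: "nat \<Rightarrow> 'x \<Rightarrow> 'b::{real_normed_vector, second_countable_topology}"
  assumes q: "q > 0" and [measurable]: "\<And>k. f k \<in> borel_measurable M" "g \<in> borel_measurable M"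
    and int: "\<And>k. integrable M (\<lambda>x. norm (f k x) powr q)"
    and conv: "(\<lambda>k. \<integral>\<^sup>+x. ennreal (norm (f k x - g x) powr q) \<partial>M) \<longlonglongrightarrow> 0"
  shows "integrable M (\<lambda>x. norm (g x) powr q)"
    "(\<lambda>k. \<integral>x. norm (f k x) powr q \<partial>M) \<longlonglongrightarrow> (\<integral>x. norm (g x) powr q \<partial>M)"
proof -
  have "eventually (\<lambda>k. (\<integral>\<^sup>+x. ennreal (norm (f k x - g x) powr q) \<partial>M) < 1) sequentially"
    using conv by (intro order_tendstoD) auto
  then have ev: "eventually (\<lambda>k. (\<integral>\<^sup>+x. ennreal (norm (f k x - g x) powr q) \<partial>M) < \<infinity>) sequentially"
    by eventually_elim (auto intro: less_trans)
  then obtain k0 where "(\<integral>\<^sup>+x. ennreal (norm (f k0 x - g x) powr q) \<partial>M) < \<infinity>"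
    by (auto simp: eventually_sequentially)
  then show gi: "integrable M (\<lambda>x. norm (g x) powr q)" using Lq_integrable_limit(1)[OF q _ _ int] by simp
  define I where "I = (\<integral>x. norm (g x) powr q \<partial>M)"
  have I0: "I \<ge> 0" by (simp add: I_def)
  show "(\<lambda>k. \<integral>x. norm (f k x) powr q \<partial>M) \<longlonglongrightarrow> (\<integral>x. norm (g x) powr q \<partial>M)"
  proof (rule tendstoI)
    fix e :: real assume e: "e > 0"
    define d where "d = e / (2 * (I + 1))"
    have d: "d > 0" "d * I < e / 2"
      using e I0 by (auto simp: d_def field_simps)
    obtain C where C: "C \<ge> 0" "\<And>a b::'b. \<bar>norm (a + b) powr q - norm a powr q\<bar> \<le> d * norm a powr q + C * norm b powr q"
      using norm_powr_perturb[OF q d(1)] by blast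
    have "eventually (\<lambda>k. (\<integral>\<^sup>+x. ennreal (norm (f k x - g x) powr q) \<partial>M) < ennreal (e / (2 * (C + 1)))) sequentially"
      using conv e C(1) by (intro order_tendstoD) auto
    then show "eventually (\<lambda>k. dist (\<integral>x. norm (f k x) powr q \<partial>M) (\<integral>x. norm (g x) powr q \<partial>M) < e) sequentially"
      using ev
    proof eventually_elim
      case (elim k)
      have di: "integrable M (\<lambda>x. norm (f k x - g x) powr q)"
        using Lq_integrable_limit(2)[OF q _ _ int elim(2)] by simp
      have "(\<integral>x. norm (f k x - g x) powr q \<partial>M) < e / (2 * (C + 1))"
        using elim(1) di e C(1) by (simp add: nn_integral_eq_integral ennreal_less_iff)
      then have "C * (\<integral>x. norm (f k x - g x) powr q \<partial>M) \<le> C * (e / (2 * (C + 1)))" using C(1) by (intro mult_left_mono) auto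
      also have "\<dots> \<le> e / 2" using C(1) e by (simp add: field_simps)
      finally have 1: "C * (\<integral>x. norm (f k x - g x) powr q \<partial>M) \<le> e / 2" .
      have "\<bar>(\<integral>x. norm (f k x) powr q \<partial>M) - I\<bar> = \<bar>\<integral>x. norm (f k x) powr q - norm (g x) powr q \<partial>M\<bar>"
        unfolding I_def by (subst Bochner_Integration.integral_diff) (auto intro: int gi)
      also have "\<dots> \<le> (\<integral>x. \<bar>norm (f k x) powr q - norm (g x) powr q\<bar> \<partial>M)" by (rule integral_abs_bound)
      also have "\<dots> \<le> (\<integral>x. d * norm (g x) powr q + C * norm (f k x - g x) powr q \<partial>M)"
      proof (intro integral_mono)
        show "\<bar>norm (f k x) powr q - norm (g x) powr q\<bar> \<le> d * norm (g x) powr q + C * norm (f k x - g x) powr q" for x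
          using C(2)[of "g x" "f k x - g x"] by simp
      qed (auto intro!: integrable_mult_right int gi di)
      also have "\<dots> = d * I + C * (\<integral>x. norm (f k x - g x) powr q \<partial>M)"
        unfolding I_def by (subst Bochner_Integration.integral_add) (auto intro!: integrable_mult_right gi di)
      also have "\<dots> < e" using 1 d(2) by linarith
      finally show ?case by (simp add: dist_real_def I_def)
    qed
  qed
qed

text \<open>Fatou along the a.e. convergent subsequence identifies the L^q limit of the whole
  sequence. It is how one limit function is recognised in all the weighted spaces.\<close>

lemma Lq_Cauchy_Fatou:
  fixes f :: "nat \<Rightarrow> 'x \<Rightarrow> 'b::{real_normed_vector, second_countable_topology}"
  assumes q: "q > 0" and [measurable]: "\<And>k. f k \<in> borel_measurable M" "g \<in> borel_measurable M"
    and ae: "AE x in M. (\<lambda>k. f (r k) x) \<longlonglongrightarrow> g x" and r: "strict_mono r"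
    and cauchy: "\<And>e. e > 0 \<Longrightarrow> \<exists>N. \<forall>k\<ge>N. \<forall>l\<ge>N. (\<integral>\<^sup>+x. ennreal (norm (f k x - f l x) powr q) \<partial>M) \<le> ennreal e"
  shows "(\<lambda>k. \<integral>\<^sup>+x. ennreal (norm (f k x - g x) powr q) \<partial>M) \<longlonglongrightarrow> 0"
proof -
  have bound: "\<exists>N. \<forall>k\<ge>N. (\<integral>\<^sup>+x. ennreal (norm (f k x - g x) powr q) \<partial>M) \<le> ennreal e" if "e > 0" for e
  proof -
    obtain N where N: "\<And>k l. k \<ge> N \<Longrightarrow> l \<ge> N \<Longrightarrow> (\<integral>\<^sup>+x. ennreal (norm (f k x - f l x) powr q) \<partial>M) \<le> ennreal e"
      using cauchy[OF \<open>e > 0\<close>] by blast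
    have "(\<integral>\<^sup>+x. ennreal (norm (f k x - g x) powr q) \<partial>M) \<le> ennreal e" if k: "k \<ge> N" for k
    proof -
      have "(\<integral>\<^sup>+x. ennreal (norm (f k x - g x) powr q) \<partial>M) =
        (\<integral>\<^sup>+x. liminf (\<lambda>l. ennreal (norm (f k x - f (r l) x) powr q)) \<partial>M)"
      proof (rule nn_integral_cong_AE, use ae in eventually_elim)
        case (elim x)
        have "(\<lambda>l. ennreal (norm (f k x - f (r l) x) powr q)) \<longlonglongrightarrow> ennreal (norm (f k x - g x) powr q)"
          using q by (intro tendsto_ennrealI tendsto_powr2 tendsto_intros elim) auto
        then show ?case by (intro lim_imp_Liminf[symmetric]) auto
      qed
      also have "\<dots> \<le> liminf (\<lambda>l. \<integral>\<^sup>+x. ennreal (norm (f k x - f (r l) x) powr q) \<partial>M)"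
        by (rule nn_integral_liminf) measurable
      also have "\<dots> \<le> ennreal e"
      proof (rule Liminf_le)
        show "eventually (\<lambda>l. (\<integral>\<^sup>+x. ennreal (norm (f k x - f (r l) x) powr q) \<partial>M) \<le> ennreal e) sequentially"
          unfolding eventually_sequentially
          by (intro exI[of _ N] allI impI N k) (use seq_suble[OF r] le_trans in blast)
      qed simp
      finally show ?thesis .
    qed
    then show ?thesis by blast
  qed
  show ?thesis
  proof (rule order_tendstoI)
    fix a :: ennreal assume "0 < a"
    then obtain e where e: "e > 0" "ennreal e < a"
      by (metis dense ennreal_cases ennreal_less_zero_iff less_top_ennreal not_less_iff_gr_or_eq order_less_trans)
    obtain N where "\<forall>k\<ge>N. (\<integral>\<^sup>+x. ennreal (norm (f k x - g x) powr q) \<partial>M) \<le> ennreal e" using bound[OF e(1)] by blast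
    then show "eventually (\<lambda>k. (\<integral>\<^sup>+x. ennreal (norm (f k x - g x) powr q) \<partial>M) < a) sequentially"
      using e(2) by (auto simp: eventually_sequentially intro: le_less_trans)
  qed simp
qed

lemma Lq_tendsto_Cauchy:
  fixes f :: "nat \<Rightarrow> 'x \<Rightarrow> 'b::{real_normed_vector, second_countable_topology}"
  assumes q: "q > 0" and [measurable]: "\<And>k. f k \<in> borel_measurable M" "g \<in> borel_measurable M"
    and conv: "(\<lambda>k. \<integral>\<^sup>+x. ennreal (norm (f k x - g x) powr q) \<partial>M) \<longlonglongrightarrow> 0" and e: "e > 0"
  shows "\<exists>N. \<forall>k\<ge>N. \<forall>l\<ge>N. (\<integral>\<^sup>+x. ennreal (norm (f k x - f l x) powr q) \<partial>M) \<le> ennreal e"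
proof -
  obtain C where C: "C \<ge> 0" "\<And>a b::'b. norm (a + b) powr q \<le> 2 * norm a powr q + C * norm b powr q"
    using norm_powr_sum_le2[OF q, where 'b='b] by blast
  define d where "d = e / (2 + C)"
  have d: "d > 0" using e C(1) by (simp add: d_def)
  obtain N where N: "\<And>k. k \<ge> N \<Longrightarrow> (\<integral>\<^sup>+x. ennreal (norm (f k x - g x) powr q) \<partial>M) < ennreal d"
    using order_tendstoD(2)[OF conv, of "ennreal d"] d by (auto simp: eventually_sequentially)
  have "(\<integral>\<^sup>+x. ennreal (norm (f k x - f l x) powr q) \<partial>M) \<le> ennreal e" if kl: "k \<ge> N" "l \<ge> N" for k l
  proof -
    have "(\<integral>\<^sup>+x. ennreal (norm (f k x - f l x) powr q) \<partial>M) \<le>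
      (\<integral>\<^sup>+x. ennreal 2 * ennreal (norm (f k x - g x) powr q) + ennreal C * ennreal (norm (f l x - g x) powr q) \<partial>M)"
    proof (rule nn_integral_mono)
      fix x
      have "norm (f k x - f l x) powr q \<le> 2 * norm (f k x - g x) powr q + C * norm (f l x - g x) powr q"
        using C(2)[of "f k x - g x" "- (f l x - g x)"] by (simp add: norm_minus_commute)
      then show "ennreal (norm (f k x - f l x) powr q) \<le> ennreal 2 * ennreal (norm (f k x - g x) powr q) + ennreal C * ennreal (norm (f l x - g x) powr q)"
        using C(1) by (subst ennreal_mult[symmetric] ennreal_plus[symmetric], simp, simp)+ (rule ennreal_leI)
    qed
    also have "\<dots> = ennreal 2 * (\<integral>\<^sup>+x. ennreal (norm (f k x - g x) powr q) \<partial>M) + ennreal C * (\<integral>\<^sup>+x. ennreal (norm (f l x - g x) powr q) \<partial>M)"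
      by (subst nn_integral_add) (auto simp: nn_integral_cmult)
    also have "\<dots> \<le> ennreal 2 * ennreal d + ennreal C * ennreal d"
      by (intro add_mono mult_left_mono less_imp_le[OF N] kl) auto
    also have "\<dots> = ennreal (2 + C) * ennreal d" using C(1)
      by (subst ennreal_plus) (auto simp: distrib_right)
    also have "\<dots> = ennreal ((2 + C) * d)" using C(1) d by (intro ennreal_mult[symmetric]) auto
    also have "(2 + C) * d = e" using C(1) by (simp add: d_def)
    finally show ?thesis .
  qed
  then show ?thesis by blast
qed

lemma Lq_tendsto_AE_subseq:
  fixes f :: "nat \<Rightarrow> 'x \<Rightarrow> 'b::{real_normed_vector, second_countable_topology}"
  assumes q: "q > 0" and [measurable]: "\<And>k. f k \<in> borel_measurable M" "g \<in> borel_measurable M"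
    and conv: "(\<lambda>k. \<integral>\<^sup>+x. ennreal (norm (f k x - g x) powr q) \<partial>M) \<longlonglongrightarrow> 0"
  shows "\<exists>r. strict_mono r \<and> (AE x in M. (\<lambda>k. f (r k) x) \<longlonglongrightarrow> g x)"
proof -
  have "eventually (\<lambda>k. (\<integral>\<^sup>+x. ennreal (norm (f k x - g x) powr q) \<partial>M) < 1) sequentially"
    using conv by (intro order_tendstoD) auto
  then obtain N where N: "\<And>k. k \<ge> N \<Longrightarrow> (\<integral>\<^sup>+x. ennreal (norm (f k x - g x) powr q) \<partial>M) < \<infinity>"
    unfolding eventually_sequentially by (metis ennreal_one_less_top infinity_ennreal_def order_less_trans)
  \<comment> \<open>Shifted by N, since only from there on are the distances known to be
    finite.\<close>
  define h where "h k x = norm (f (k + N) x - g x) powr q" for k x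
  have hi: "integrable M (h k)" for k unfolding h_def using N[of "k + N"] by (intro integrableI_bounded) auto
  have "(\<lambda>k. ennreal (\<integral>x. h k x \<partial>M)) \<longlonglongrightarrow> ennreal 0"
  proof -
    have "ennreal (\<integral>x. h k x \<partial>M) = (\<integral>\<^sup>+x. ennreal (norm (f (k + N) x - g x) powr q) \<partial>M)" for k
      using hi[of k] by (subst nn_integral_eq_integral[symmetric]) (auto simp: h_def)
    then show ?thesis using LIMSEQ_ignore_initial_segment[OF conv, of N] by simp
  qed
  then have "(\<lambda>k. \<integral>x. h k x \<partial>M) \<longlonglongrightarrow> 0"
    by (subst (asm) tendsto_ennreal_iff) (simp_all add: h_def[abs_def])
  moreover have "norm (h k x) = h k x" for k x by (simp add: h_def)
  ultimately have "(\<lambda>k. \<integral>x. norm (h k x) \<partial>M) \<longlonglongrightarrow> 0" by presburger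
  then obtain r where r: "strict_mono r" "AE x in M. (\<lambda>k. h (r k) x) \<longlonglongrightarrow> 0"
    using tendsto_L1_AE_subseq[of M h] hi by blast
  show ?thesis
  proof (intro exI[of _ "\<lambda>k. r k + N"] conjI)
    show "strict_mono (\<lambda>k. r k + N)" using r(1) by (simp add: strict_mono_def)
    show "AE x in M. (\<lambda>k. f (r k + N) x) \<longlonglongrightarrow> g x" using r(2)
    proof eventually_elim
      case (elim x)
      then have "(\<lambda>k. h (r k) x powr (1 / q)) \<longlonglongrightarrow> 0 powr (1 / q)"
        using q by (intro tendsto_powr2) (auto simp: h_def)
      then have "(\<lambda>k. norm (f (r k + N) x - g x)) \<longlonglongrightarrow> 0" using q by (simp add: h_def powr_powr)
      then show ?case by (simp add: LIM_zero_iff tendsto_norm_zero_iff)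
    qed
  qed
qed

text \<open>The defect D splits into a part dominated by a multiple of |g|^q, which tends to 0 by
  dominated convergence, and at most d |f k - g|^q, whose integral is at most d K uniformly in
  k.\<close>

lemma brezis_lieb:
  fixes f :: "nat \<Rightarrow> 'x \<Rightarrow> real"
  assumes q: "q > 0" and [measurable]: "\<And>k. f k \<in> borel_measurable M" "g \<in> borel_measurable M"
    and int: "\<And>k. integrable M (\<lambda>x. \<bar>f k x\<bar> powr q)" and gi: "integrable M (\<lambda>x. \<bar>g x\<bar> powr q)"
    and bound: "\<And>k. (\<integral>x. \<bar>f k x\<bar> powr q \<partial>M) \<le> B"
    and ae: "AE x in M. (\<lambda>k. f k x) \<longlonglongrightarrow> g x"
  shows "(\<lambda>k. (\<integral>x. \<bar>f k x\<bar> powr q \<partial>M) - (\<integral>x. \<bar>f k x - g x\<bar> powr q \<partial>M)) \<longlonglongrightarrow> (\<integral>x. \<bar>g x\<bar> powr q \<partial>M)"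
proof -
  define I where "I = (\<integral>x. \<bar>g x\<bar> powr q \<partial>M)"
  have I0: "I \<ge> 0" by (simp add: I_def)
  obtain C where C: "C \<ge> 0" "\<And>a b::real. norm (a + b) powr q \<le> 2 * norm a powr q + C * norm b powr q"
    using norm_powr_sum_le2[OF q, where 'b=real] by blast
  have C': "\<bar>f k x - g x\<bar> powr q \<le> 2 * \<bar>f k x\<bar> powr q + C * \<bar>g x\<bar> powr q" for k x
    using C(2)[of "f k x" "- g x"] by simp
  have di: "integrable M (\<lambda>x. \<bar>f k x - g x\<bar> powr q)" for k
    by (rule Bochner_Integration.integrable_bound[where f="\<lambda>x. 2 * \<bar>f k x\<bar> powr q + C * \<bar>g x\<bar> powr q"])
       (use C C' in \<open>auto intro!: integrable_mult_right int gi\<close>)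
  define K where "K = 2 * B + C * I + 1"
  have dK: "(\<integral>x. \<bar>f k x - g x\<bar> powr q \<partial>M) \<le> K" for k
  proof -
    have "(\<integral>x. \<bar>f k x - g x\<bar> powr q \<partial>M) \<le> (\<integral>x. 2 * \<bar>f k x\<bar> powr q + C * \<bar>g x\<bar> powr q \<partial>M)"
      by (intro integral_mono C' di) (auto intro!: integrable_mult_right int gi)
    also have "\<dots> = 2 * (\<integral>x. \<bar>f k x\<bar> powr q \<partial>M) + C * I" unfolding I_def
      by (subst Bochner_Integration.integral_add) (auto intro!: integrable_mult_right int gi)
    also have "\<dots> \<le> K" using bound[of k] by (simp add: K_def)
    finally show ?thesis .
  qed
  have "0 \<le> (\<integral>x. \<bar>f 0 x\<bar> powr q \<partial>M)" "0 \<le> C * I" using C(1) I0 by simp_all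
  then have K0: "K > 0" using bound[of 0] unfolding K_def by linarith
  define D where "D k x = \<bar>f k x\<bar> powr q - \<bar>f k x - g x\<bar> powr q - \<bar>g x\<bar> powr q" for k x
  have Di: "integrable M (D k)" for k unfolding D_def by (intro Bochner_Integration.integrable_diff int di gi)
  have "(\<lambda>k. \<integral>x. D k x \<partial>M) \<longlonglongrightarrow> 0"
  proof (rule tendstoI)
    fix e :: real assume e: "e > 0"
    define d where "d = e / (2 * K)"
    have d: "d > 0" using e K0 by (simp add: d_def)
    obtain L where L: "L \<ge> 0" "\<And>a b::real. \<bar>norm (a + b) powr q - norm a powr q\<bar> \<le> d * norm a powr q + L * norm b powr q"
      using norm_powr_perturb[OF q d(1)] by blast
    \<comment> \<open>The excess of the defect over its small share;
      \<open>norm_powr_perturb\<close> bounds it by (1 + L) |g|^q.\<close>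
    define W where "W k x = max 0 (\<bar>D k x\<bar> - d * \<bar>f k x - g x\<bar> powr q)" for k x
    have [measurable]: "W k \<in> borel_measurable M" for k unfolding W_def[abs_def] D_def[abs_def] by measurable
    have Wb: "W k x \<le> (1 + L) * \<bar>g x\<bar> powr q" for k x
    proof -
      have "\<bar>\<bar>f k x\<bar> powr q - \<bar>f k x - g x\<bar> powr q\<bar> \<le> d * \<bar>f k x - g x\<bar> powr q + L * \<bar>g x\<bar> powr q"
        using L(2)[of "f k x - g x" "g x"] by simp
      moreover have "\<bar>D k x\<bar> \<le> \<bar>\<bar>f k x\<bar> powr q - \<bar>f k x - g x\<bar> powr q\<bar> + \<bar>g x\<bar> powr q"
        unfolding D_def using abs_triangle_ineq4[of "\<bar>f k x\<bar> powr q - \<bar>f k x - g x\<bar> powr q" "\<bar>g x\<bar> powr q"] by simp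
      ultimately show ?thesis using L(1) by (auto simp: W_def algebra_simps)
    qed
    have W0: "W k x \<ge> 0" for k x by (simp add: W_def)
    have Wi: "integrable M (W k)" for k
      by (rule Bochner_Integration.integrable_bound[where f="\<lambda>x. (1 + L) * \<bar>g x\<bar> powr q"])
         (use Wb W0 in \<open>auto intro!: integrable_mult_right gi AE_I2 order_trans[OF _ abs_ge_self]\<close>)
    have "(\<lambda>k. \<integral>x. W k x \<partial>M) \<longlonglongrightarrow> (\<integral>x. 0 \<partial>M)"
    proof (rule integral_dominated_convergence[where w="\<lambda>x. (1 + L) * \<bar>g x\<bar> powr q"])
      show "AE x in M. (\<lambda>k. W k x) \<longlonglongrightarrow> 0" using ae
      proof eventually_elim
        case (elim x)
        have "(\<lambda>k. D k x) \<longlonglongrightarrow> \<bar>g x\<bar> powr q - \<bar>g x - g x\<bar> powr q - \<bar>g x\<bar> powr q" unfolding D_def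
          using q by (intro tendsto_intros tendsto_powr2 elim) auto
        then have "(\<lambda>k. W k x) \<longlonglongrightarrow> max 0 (\<bar>\<bar>g x\<bar> powr q - \<bar>g x - g x\<bar> powr q - \<bar>g x\<bar> powr q\<bar> - d * \<bar>g x - g x\<bar> powr q)"
          unfolding W_def using q by (intro tendsto_max tendsto_diff tendsto_const tendsto_rabs tendsto_mult tendsto_powr2 elim) auto
        then show ?case by simp
      qed
    qed (use Wb W0 in \<open>auto intro!: integrable_mult_right gi\<close>)
    then have "eventually (\<lambda>k. (\<integral>x. W k x \<partial>M) < e / 2) sequentially" using e by (intro order_tendstoD) auto
    then show "eventually (\<lambda>k. dist (\<integral>x. D k x \<partial>M) 0 < e) sequentially"
    proof eventually_elim
      case (elim k)
      have "\<bar>\<integral>x. D k x \<partial>M\<bar> \<le> (\<integral>x. \<bar>D k x\<bar> \<partial>M)" by (rule integral_abs_bound)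
      also have "\<dots> \<le> (\<integral>x. W k x + d * \<bar>f k x - g x\<bar> powr q \<partial>M)"
      proof (intro integral_mono Bochner_Integration.integrable_add integrable_mult_right integrable_abs Wi di Di)
        show "\<bar>D k x\<bar> \<le> W k x + d * \<bar>f k x - g x\<bar> powr q" for x by (simp add: W_def)
      qed
      also have "\<dots> = (\<integral>x. W k x \<partial>M) + d * (\<integral>x. \<bar>f k x - g x\<bar> powr q \<partial>M)"
        by (subst Bochner_Integration.integral_add) (auto intro!: integrable_mult_right Wi di)
      also have "\<dots> \<le> (\<integral>x. W k x \<partial>M) + d * K" using d by (intro add_left_mono mult_left_mono dK) auto
      also have "d * K = e / 2" using K0 by (simp add: d_def)
      finally show ?case using elim by simp
    qed
  qed
  moreover have "(\<integral>x. D k x \<partial>M) = (\<integral>x. \<bar>f k x\<bar> powr q \<partial>M) - (\<integral>x. \<bar>f k x - g x\<bar> powr q \<partial>M) - I" for k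
    unfolding D_def I_def by (simp add: int di gi)
  ultimately have "(\<lambda>k. ((\<integral>x. \<bar>f k x\<bar> powr q \<partial>M) - (\<integral>x. \<bar>f k x - g x\<bar> powr q \<partial>M) - I) + I) \<longlonglongrightarrow> 0 + I"
    by (intro tendsto_add tendsto_const) simp
  then show ?thesis by (simp add: I_def)
qed

text \<open>A rapidly converging subsequence converges almost everywhere. The sets
  \<open>A j\<close> may grow, every point being in all late ones; so the result applies to global
  Cauchy sequences (all \<open>A j\<close> the whole space) and to local ones on balls.\<close>

lemma L2loc_Cauchy_AE_subseq:
  fixes f :: "nat \<Rightarrow> 'x \<Rightarrow> 'b::euclidean_space"
  assumes [measurable]: "\<And>k. f k \<in> borel_measurable M" "\<And>j. A j \<in> sets M"
    and cover: "\<And>x. x \<in> space M \<Longrightarrow> \<exists>j. \<forall>i\<ge>j. x \<in> A (i::nat)"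
    and cauchy: "\<And>j e. e > 0 \<Longrightarrow> \<exists>N. \<forall>k\<ge>N. \<forall>l\<ge>N. (\<integral>\<^sup>+x. ennreal ((norm (f k x - f l x))\<^sup>2) * indicator (A j) x \<partial>M) \<le> ennreal e"
  shows "\<exists>r g. strict_mono r \<and> g \<in> borel_measurable M \<and> (AE x in M. (\<lambda>k. f (r k) x) \<longlonglongrightarrow> g x)"
proof -
  have "\<forall>j. \<exists>N. \<forall>k\<ge>N. \<forall>l\<ge>N. (\<integral>\<^sup>+x. ennreal ((norm (f k x - f l x))\<^sup>2) * indicator (A j) x \<partial>M) \<le> ennreal ((1/4)^j)"
    by (intro allI cauchy) auto
  then obtain N where N: "\<And>j k l. k \<ge> N j \<Longrightarrow> l \<ge> N j \<Longrightarrow>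
     (\<integral>\<^sup>+x. ennreal ((norm (f k x - f l x))\<^sup>2) * indicator (A j) x \<partial>M) \<le> ennreal ((1/4)^j)" by metis
  \<comment> \<open>The partial sums keep r j above N j, and the summand j makes r strictly
    increasing.\<close>
  define r where "r j = (\<Sum>i\<le>j. N i) + j" for j
  have rmono: "strict_mono r" by (rule strict_mono_Suc_iff[THEN iffD2]) (simp add: r_def)
  have rN: "r j \<ge> N j" for j unfolding r_def
    using member_le_sum[of j "{..j}" N] by simp
  \<comment> \<open>Summability of the squared increments alone would not make the increments
    summable. The weight 2^j, affordable against 4^-j, leaves them a geometric bound with ratio
    1/sqrt 2.\<close>
  define d where "d j x = ennreal (2 ^ j * (norm (f (r (Suc j)) x - f (r j) x))\<^sup>2) * indicator (A j) x" for j x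
  have [measurable]: "d j \<in> borel_measurable M" for j unfolding d_def by measurable
  have dj: "(\<integral>\<^sup>+x. d j x \<partial>M) \<le> ennreal ((1/2) ^ j)" for j
  proof -
    have "(\<integral>\<^sup>+x. d j x \<partial>M) = (\<integral>\<^sup>+x. ennreal (2 ^ j) * (ennreal ((norm (f (r (Suc j)) x - f (r j) x))\<^sup>2) * indicator (A j) x) \<partial>M)"
      by (simp add: d_def ennreal_mult' mult.assoc)
    also have "\<dots> = ennreal (2 ^ j) * (\<integral>\<^sup>+x. ennreal ((norm (f (r (Suc j)) x - f (r j) x))\<^sup>2) * indicator (A j) x \<partial>M)"
      by (rule nn_integral_cmult) measurable
    also have "\<dots> \<le> ennreal (2 ^ j) * ennreal ((1/4)^j)"
    proof (intro mult_left_mono N)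
      show "r (Suc j) \<ge> N j" using rN[of j] strict_monoD[OF rmono, of j "Suc j"] by simp
    qed (auto intro: rN)
    also have "\<dots> = ennreal (2 ^ j * (1/4) ^ j)" by (rule ennreal_mult[symmetric]) auto
    also have "(2::real) ^ j * (1/4) ^ j = (1/2) ^ j" by (simp flip: power_mult_distrib)
    finally show ?thesis .
  qed
  have "(\<integral>\<^sup>+x. (\<Sum>j. d j x) \<partial>M) = (\<Sum>j. \<integral>\<^sup>+x. d j x \<partial>M)" by (rule nn_integral_suminf) measurable
  also have "\<dots> \<le> (\<Sum>j. ennreal ((1/2) ^ j))" by (intro suminf_le dj) auto
  also have "\<dots> < \<infinity>" by (subst suminf_ennreal2) (auto intro: summable_geometric)
  finally have "AE x in M. (\<Sum>j. d j x) \<noteq> \<infinity>" by (intro nn_integral_noteq_infinite) auto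
  moreover have "AE x in M. x \<in> space M" by (rule AE_space)
  ultimately have conv: "AE x in M. convergent (\<lambda>k. f (r k) x)"
  proof eventually_elim
    case (elim x)
    obtain S where S: "(\<Sum>j. d j x) = ennreal S" "S \<ge> 0" using elim(1) by (cases "\<Sum>j. d j x") auto
    obtain j0 where j0: "\<And>j. j \<ge> j0 \<Longrightarrow> x \<in> A j" using cover[OF elim(2)] by blast
    have bd: "norm (f (r (Suc j)) x - f (r j) x) \<le> sqrt S * (1 / sqrt 2) ^ j" if "j \<ge> j0" for j
    proof -
      have "d j x \<le> (\<Sum>j. d j x)" using sum_le_suminf[of "\<lambda>j. d j x" "{j}"] by simp
      then have "2 ^ j * (norm (f (r (Suc j)) x - f (r j) x))\<^sup>2 \<le> S"
        using S j0[OF that] by (simp add: d_def)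
      then have "sqrt ((norm (f (r (Suc j)) x - f (r j) x))\<^sup>2) \<le> sqrt (S / 2 ^ j)"
        by (intro real_sqrt_le_mono) (simp add: field_simps)
      then show ?thesis by (simp add: real_sqrt_divide real_sqrt_power power_divide)
    qed
    have "summable (\<lambda>j. f (r (Suc j)) x - f (r j) x)"
    proof (rule summable_comparison_test)
      show "\<exists>N. \<forall>n\<ge>N. norm (f (r (Suc n)) x - f (r n) x) \<le> sqrt S * (1 / sqrt 2) ^ n" using bd by blast
      show "summable (\<lambda>n. sqrt S * (1 / sqrt 2) ^ n)" by (intro summable_mult summable_geometric) auto
    qed
    then have "convergent (\<lambda>n. \<Sum>j<n. f (r (Suc j)) x - f (r j) x)" by (simp add: summable_iff_convergent)
    then have "convergent (\<lambda>n. f (r n) x - f (r 0) x)" by (simp add: sum_lessThan_telescope[of "\<lambda>n. f (r n) x"])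
    then have "convergent (\<lambda>n. (f (r n) x - f (r 0) x) + f (r 0) x)" by (intro convergent_add convergent_const)
    then show ?case by simp
  qed
  define g where "g x = lim (\<lambda>k. f (r k) x)" for x
  have "g \<in> borel_measurable M" unfolding g_def by (rule borel_measurable_lim_metric) measurable
  moreover have "AE x in M. (\<lambda>k. f (r k) x) \<longlonglongrightarrow> g x"
    using conv by eventually_elim (simp add: g_def convergent_LIMSEQ_iff)
  ultimately show ?thesis using rmono by blast
qed

lemma norm_powr_2: "norm (x::'b::real_normed_vector) powr 2 = (norm x)\<^sup>2"
  by (cases "x = 0") auto

lemma Lq_tendsto_diff:
  fixes f f' :: "nat \<Rightarrow> 'x \<Rightarrow> 'b::{real_normed_vector, second_countable_topology}"
  assumes q: "q > 0" and [measurable]: "\<And>k. f k \<in> borel_measurable M" "g \<in> borel_measurable M"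
      "\<And>k. f' k \<in> borel_measurable M" "g' \<in> borel_measurable M"
    and conv: "(\<lambda>k. \<integral>\<^sup>+x. ennreal (norm (f k x - g x) powr q) \<partial>M) \<longlonglongrightarrow> 0"
      "(\<lambda>k. \<integral>\<^sup>+x. ennreal (norm (f' k x - g' x) powr q) \<partial>M) \<longlonglongrightarrow> 0"
  shows "(\<lambda>k. \<integral>\<^sup>+x. ennreal (norm ((f k x - f' k x) - (g x - g' x)) powr q) \<partial>M) \<longlonglongrightarrow> 0"
proof -
  obtain C where C: "C \<ge> 0" "\<And>a b::'b. norm (a + b) powr q \<le> 2 * norm a powr q + C * norm b powr q"
    using norm_powr_sum_le2[OF q, where 'b='b] by blast
  have le: "(\<integral>\<^sup>+x. ennreal (norm ((f k x - f' k x) - (g x - g' x)) powr q) \<partial>M)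
     \<le> ennreal 2 * (\<integral>\<^sup>+x. ennreal (norm (f k x - g x) powr q) \<partial>M) + ennreal C * (\<integral>\<^sup>+x. ennreal (norm (f' k x - g' x) powr q) \<partial>M)" for k
  proof -
    have "(\<integral>\<^sup>+x. ennreal (norm ((f k x - f' k x) - (g x - g' x)) powr q) \<partial>M)
      \<le> (\<integral>\<^sup>+x. ennreal 2 * ennreal (norm (f k x - g x) powr q) + ennreal C * ennreal (norm (f' k x - g' x) powr q) \<partial>M)"
    proof (rule nn_integral_mono)
      fix x
      have "norm ((f k x - f' k x) - (g x - g' x)) powr q \<le> 2 * norm (f k x - g x) powr q + C * norm (f' k x - g' x) powr q"
        using C(2)[of "f k x - g x" "- (f' k x - g' x)"] by (simp add: norm_minus_commute algebra_simps)
      then show "ennreal (norm ((f k x - f' k x) - (g x - g' x)) powr q) \<le> ennreal 2 * ennreal (norm (f k x - g x) powr q) + ennreal C * ennreal (norm (f' k x - g' x) powr q)"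
        using C(1) by (subst ennreal_mult[symmetric] ennreal_plus[symmetric], simp, simp)+ (rule ennreal_leI)
    qed
    also have "\<dots> = ennreal 2 * (\<integral>\<^sup>+x. ennreal (norm (f k x - g x) powr q) \<partial>M) + ennreal C * (\<integral>\<^sup>+x. ennreal (norm (f' k x - g' x) powr q) \<partial>M)"
      by (subst nn_integral_add) (auto simp: nn_integral_cmult)
    finally show ?thesis .
  qed
  have "(\<lambda>k. ennreal 2 * (\<integral>\<^sup>+x. ennreal (norm (f k x - g x) powr q) \<partial>M) + ennreal C * (\<integral>\<^sup>+x. ennreal (norm (f' k x - g' x) powr q) \<partial>M))
     \<longlonglongrightarrow> ennreal 2 * 0 + ennreal C * 0"
    by (intro tendsto_add ennreal_tendsto_cmult conv) auto
  then have "(\<lambda>k. ennreal 2 * (\<integral>\<^sup>+x. ennreal (norm (f k x - g x) powr q) \<partial>M) + ennreal C * (\<integral>\<^sup>+x. ennreal (norm (f' k x - g' x) powr q) \<partial>M)) \<longlonglongrightarrow> 0"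
    by simp
  from tendsto_sandwich[OF _ _ tendsto_const this, of "\<lambda>k. \<integral>\<^sup>+x. ennreal (norm ((f k x - f' k x) - (g x - g' x)) powr q) \<partial>M"]
  show ?thesis using le by simp
qed

section \<open>Dirichlet integrals and the function space\<close>

lemma grad_diff:
  fixes f g :: "real^'n::finite \<Rightarrow> real"
  assumes "f \<in> test_functions" "g \<in> test_functions"
  shows "grad (\<lambda>x. f x - g x) = (\<lambda>x. grad f x - grad g x)"
  by (intro C1c_grad_unique test_functions_diff C1c_diff test_functions_C1c assms)

lemma grad_cmult:
  fixes f :: "real^'n::finite \<Rightarrow> real"
  assumes "f \<in> test_functions"
  shows "grad (\<lambda>x. c * f x) = (\<lambda>x. c *\<^sub>R grad f x)"
  by (intro C1c_grad_unique test_functions_cmult C1c_cmult test_functions_C1c assms)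

lemma test_functions_measurable [measurable_dest]:
  fixes f :: "real^'n::finite \<Rightarrow> real"
  assumes "f \<in> test_functions" shows "f \<in> borel_measurable borel"
  using C1c_measurable[OF test_functions_C1c[OF assms]] by simp

lemma grad_measurable:
  fixes f :: "real^'n::finite \<Rightarrow> real"
  assumes "f \<in> test_functions" shows "grad f \<in> borel_measurable borel"
  using C1c_measurable[OF test_functions_C1c[OF assms]] by simp

text \<open>The power of the weighted norm, without the root. For s = 2 the exponent is 2 as well
  and this is the Hardy integral.\<close>

definition pnorm :: "real \<Rightarrow> (real^'n::finite \<Rightarrow> real) \<Rightarrow> real" where
  "pnorm s u = (\<integral>x. \<bar>u x\<bar> powr crit_exp TYPE('n) s \<partial>hs_measure s)"

definition dirichlet :: "(real^'n::finite \<Rightarrow> real) \<Rightarrow> real" where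
  "dirichlet \<phi> = (\<integral>x. (norm (grad \<phi> x))\<^sup>2 \<partial>lborel)"

text \<open>Meant for test functions, since it uses the classical \<open>grad\<close>; for elements
  of \<open>D12\<close> the numerator is written out with a weak gradient.\<close>

definition energy :: "real \<Rightarrow> (real^'n::finite \<Rightarrow> real) \<Rightarrow> real" where
  "energy \<gamma> \<phi> = dirichlet \<phi> - \<gamma> * pnorm 2 \<phi>"

lemma pnorm_nonneg [simp]: "pnorm s u \<ge> 0"
  by (simp add: pnorm_def)

lemma dirichlet_nonneg [simp]: "dirichlet \<phi> \<ge> 0"
  by (simp add: dirichlet_def)

lemma pnorm_cmult: "pnorm s (\<lambda>x. c * u x) = \<bar>c\<bar> powr crit_exp TYPE('n) s * pnorm s (u :: real^'n::finite \<Rightarrow> real)"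
  by (simp add: pnorm_def abs_mult powr_mult)

lemma dirichlet_cmult: "\<phi> \<in> test_functions \<Longrightarrow> dirichlet (\<lambda>x. c * \<phi> x) = c\<^sup>2 * dirichlet \<phi>"
  by (simp add: dirichlet_def grad_cmult power_mult_distrib)

lemma energy_cmult:
  fixes \<phi> :: "real^'n::finite \<Rightarrow> real"
  assumes "CARD('n) \<ge> 3" "\<phi> \<in> test_functions"
  shows "energy \<gamma> (\<lambda>x. c * \<phi> x) = c\<^sup>2 * energy \<gamma> \<phi>"
proof -
  have "pnorm 2 (\<lambda>x. c * \<phi> x) = c\<^sup>2 * pnorm 2 \<phi>"
    using crit_exp_gt2(5)[OF assms(1), of 0] norm_powr_2[of c] by (simp add: pnorm_cmult)
  then show ?thesis using assms by (simp add: energy_def dirichlet_cmult algebra_simps)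
qed

lemma hardy_sobolev_test:
  assumes n: "CARD('n::finite) \<ge> 3" and s: "0 \<le> s" "s \<le> 2"
  shows "\<exists>C>0. \<forall>\<phi>\<in>(test_functions :: (real^'n \<Rightarrow> real) set).
     (\<integral>\<^sup>+x. ennreal (\<bar>\<phi> x\<bar> powr crit_exp TYPE('n) s) \<partial>hs_measure s) = ennreal (pnorm s \<phi>) \<and>
     integrable (hs_measure s) (\<lambda>x. \<bar>\<phi> x\<bar> powr crit_exp TYPE('n) s) \<and>
     pnorm s \<phi> \<le> C * dirichlet \<phi> powr (crit_exp TYPE('n) s / 2)"
proof -
  let ?p = "crit_exp TYPE('n) s"
  obtain C where C: "C > 0" "\<And>(f::real^'n \<Rightarrow> real) g. C1c f g \<Longrightarrow>
     (\<integral>\<^sup>+x. ennreal (\<bar>f x\<bar> powr ?p) \<partial>hs_measure s) \<le> ennreal (C * (\<integral>x. (norm (g x))\<^sup>2 \<partial>lborel) powr (?p / 2))"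
    using hardy_sobolev[OF n s] by blast
  show ?thesis
  proof (intro exI[of _ C] conjI ballI C(1))
    fix \<phi> :: "real^'n \<Rightarrow> real" assume t: "\<phi> \<in> test_functions"
    note [measurable] = test_functions_measurable[OF t]
    have b: "(\<integral>\<^sup>+x. ennreal (\<bar>\<phi> x\<bar> powr ?p) \<partial>hs_measure s) \<le> ennreal (C * dirichlet \<phi> powr (?p / 2))"
      unfolding dirichlet_def by (rule C(2)[OF test_functions_C1c[OF t]])
    show i: "integrable (hs_measure s) (\<lambda>x. \<bar>\<phi> x\<bar> powr ?p)"
      using le_less_trans[OF b ennreal_less_top] by (intro integrableI_bounded) auto
    show e: "(\<integral>\<^sup>+x. ennreal (\<bar>\<phi> x\<bar> powr ?p) \<partial>hs_measure s) = ennreal (pnorm s \<phi>)"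
      unfolding pnorm_def by (intro nn_integral_eq_integral i) auto
    show "pnorm s \<phi> \<le> C * dirichlet \<phi> powr (?p / 2)"
      using b C(1) unfolding e by (subst (asm) ennreal_le_iff) auto
  qed
qed

lemma dirichlet_nn_integral:
  fixes \<phi> :: "real^'n::finite \<Rightarrow> real"
  assumes "\<phi> \<in> test_functions"
  shows "(\<integral>\<^sup>+x. ennreal (norm (grad \<phi> x) powr 2) \<partial>lborel) = ennreal (dirichlet \<phi>)"
    and "integrable lborel (\<lambda>x. norm (grad \<phi> x) powr 2)"
  using C1c_integrable_sq(2)[OF test_functions_C1c[OF assms]]
  by (simp_all add: norm_powr_2 dirichlet_def nn_integral_eq_integral)

definition dirichlet_Cauchy :: "(nat \<Rightarrow> real^'n::finite \<Rightarrow> real) \<Rightarrow> bool" where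
  "dirichlet_Cauchy \<phi> \<longleftrightarrow> (\<forall>k. \<phi> k \<in> test_functions) \<and>
     (\<forall>e>0. \<exists>N. \<forall>k\<ge>N. \<forall>l\<ge>N. dirichlet (\<lambda>x. \<phi> k x - \<phi> l x) \<le> e)"

lemma dirichlet_Cauchy_hs:
  fixes \<phi> :: "nat \<Rightarrow> real^'n::finite \<Rightarrow> real"
  assumes n: "CARD('n::finite) \<ge> 3" and s: "0 \<le> s" "s \<le> 2" and c: "dirichlet_Cauchy \<phi>" and e: "e > 0"
  shows "\<exists>N. \<forall>k\<ge>N. \<forall>l\<ge>N. (\<integral>\<^sup>+x. ennreal (norm (\<phi> k x - \<phi> l x) powr crit_exp TYPE('n) s) \<partial>hs_measure s) \<le> ennreal e"
proof -
  let ?p = "crit_exp TYPE('n) s"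
  have p: "?p > 0" using crit_exp_gt2(3)[OF n s] .
  obtain C where C: "C > 0" "\<And>\<phi> :: real^'n \<Rightarrow> real. \<phi> \<in> test_functions \<Longrightarrow>
     (\<integral>\<^sup>+x. ennreal (\<bar>\<phi> x\<bar> powr ?p) \<partial>hs_measure s) = ennreal (pnorm s \<phi>)"
     "\<And>\<phi> :: real^'n \<Rightarrow> real. \<phi> \<in> test_functions \<Longrightarrow> pnorm s \<phi> \<le> C * dirichlet \<phi> powr (?p / 2)"
    using hardy_sobolev_test[OF n s] by blast
  define d where "d = (e / C) powr (2 / ?p)"
  have d: "d > 0" "C * d powr (?p / 2) = e" using e C(1) p by (auto simp: d_def powr_powr)
  obtain N where N: "\<And>k l. k \<ge> N \<Longrightarrow> l \<ge> N \<Longrightarrow> dirichlet (\<lambda>x. \<phi> k x - \<phi> l x) \<le> d"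
    using c d(1) unfolding dirichlet_Cauchy_def by blast
  have "(\<integral>\<^sup>+x. ennreal (norm (\<phi> k x - \<phi> l x) powr ?p) \<partial>hs_measure s) \<le> ennreal e" if "k \<ge> N" "l \<ge> N" for k l
  proof -
    have t: "(\<lambda>x. \<phi> k x - \<phi> l x) \<in> test_functions"
      using c by (auto simp: dirichlet_Cauchy_def intro: test_functions_diff)
    have "pnorm s (\<lambda>x. \<phi> k x - \<phi> l x) \<le> C * dirichlet (\<lambda>x. \<phi> k x - \<phi> l x) powr (?p / 2)" by (rule C(3)[OF t])
    also have "\<dots> \<le> C * d powr (?p / 2)" using C(1) p N[OF that] by (intro mult_left_mono powr_mono2) auto
    finally show ?thesis using C(2)[OF t] d(2) by (simp add: ennreal_leI)
  qed
  then show ?thesis by blast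
qed

text \<open>\<open>is_D12_grad\<close> with the approximating sequence exposed, and with
  \<open>powr 2\<close> for the square so that the L^q lemmas apply verbatim.\<close>

definition D12_approx :: "(nat \<Rightarrow> real^'n::finite \<Rightarrow> real) \<Rightarrow> (real^'n \<Rightarrow> real) \<Rightarrow> (real^'n \<Rightarrow> real^'n) \<Rightarrow> bool" where
  "D12_approx \<phi> u G \<longleftrightarrow>
     u \<in> borel_measurable borel \<and> G \<in> borel_measurable borel \<and> (\<forall>k. \<phi> k \<in> test_functions) \<and>
     (\<lambda>k. \<integral>\<^sup>+x. ennreal (norm (grad (\<phi> k) x - G x) powr 2) \<partial>lborel) \<longlonglongrightarrow> 0 \<and>
     (\<lambda>k. \<integral>\<^sup>+x. ennreal (norm (\<phi> k x - u x) powr crit_exp TYPE('n) 0) \<partial>lborel) \<longlonglongrightarrow> 0"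

lemma is_D12_grad_iff: "is_D12_grad u G \<longleftrightarrow> (\<exists>\<phi>. D12_approx \<phi> u G)"
  by (auto simp: is_D12_grad_def D12_approx_def norm_powr_2)

lemma D12_approx_Cauchy:
  assumes "D12_approx \<phi> u G" shows "dirichlet_Cauchy \<phi>"
  unfolding dirichlet_Cauchy_def
proof (intro conjI allI impI)
  show t: "\<phi> k \<in> test_functions" for k using assms by (simp add: D12_approx_def)
  fix e :: real assume e: "e > 0"
  have "\<exists>N. \<forall>k\<ge>N. \<forall>l\<ge>N. (\<integral>\<^sup>+x. ennreal (norm (grad (\<phi> k) x - grad (\<phi> l) x) powr 2) \<partial>lborel) \<le> ennreal e"
    by (rule Lq_tendsto_Cauchy[where g=G]) (use assms e grad_measurable[OF t] in \<open>auto simp: D12_approx_def\<close>)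
  moreover have "(\<integral>\<^sup>+x. ennreal (norm (grad (\<phi> k) x - grad (\<phi> l) x) powr 2) \<partial>lborel) = ennreal (dirichlet (\<lambda>x. \<phi> k x - \<phi> l x))" for k l
    using dirichlet_nn_integral(1)[OF test_functions_diff[OF t[of k] t[of l]]] by (simp add: grad_diff[OF t t])
  ultimately show "\<exists>N. \<forall>k\<ge>N. \<forall>l\<ge>N. dirichlet (\<lambda>x. \<phi> k x - \<phi> l x) \<le> e" using e by (simp add: ennreal_le_iff)
qed

text \<open>The space is defined by convergence in the unweighted critical norm. Dirichlet-Cauchy
  sequences are Cauchy in every weighted norm by Hardy-Sobolev, and an a.e. convergent subsequence
  shows that the limit is the same function.\<close>

lemma D12_approx_Lp:
  fixes \<phi> :: "nat \<Rightarrow> real^'n::finite \<Rightarrow> real"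
  assumes n: "CARD('n::finite) \<ge> 3" and s: "0 \<le> s" "s \<le> 2" and a: "D12_approx \<phi> u G"
  shows "(\<lambda>k. \<integral>\<^sup>+x. ennreal (norm (\<phi> k x - u x) powr crit_exp TYPE('n) s) \<partial>hs_measure s) \<longlonglongrightarrow> 0"
proof -
  have t: "\<phi> k \<in> test_functions" for k using a by (simp add: D12_approx_def)
  note [measurable] = test_functions_measurable[OF t]
  have [measurable]: "u \<in> borel_measurable borel" using a by (simp add: D12_approx_def)
  have "\<exists>r. strict_mono r \<and> (AE x in lborel. (\<lambda>k. \<phi> (r k) x) \<longlonglongrightarrow> u x)"
    by (rule Lq_tendsto_AE_subseq[of "crit_exp TYPE('n) 0"])
       (use a crit_exp_gt2(3)[OF n, of 0] in \<open>auto simp: D12_approx_def\<close>)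
  then obtain r where r: "strict_mono r" "AE x in lborel. (\<lambda>k. \<phi> (r k) x) \<longlonglongrightarrow> u x" by blast
  show ?thesis
    by (rule Lq_Cauchy_Fatou[OF _ _ _ r(2)[folded AE_hs_measure[where s=s]] r(1)])
       (use crit_exp_gt2(3)[OF n s] dirichlet_Cauchy_hs[OF n s D12_approx_Cauchy[OF a]] in auto)
qed

lemma D12_approx_limits:
  fixes \<phi> :: "nat \<Rightarrow> real^'n::finite \<Rightarrow> real"
  assumes n: "CARD('n::finite) \<ge> 3" and a: "D12_approx \<phi> u G"
  shows "\<And>s. 0 \<le> s \<Longrightarrow> s \<le> 2 \<Longrightarrow> integrable (hs_measure s) (\<lambda>x. \<bar>u x\<bar> powr crit_exp TYPE('n) s)"
    "\<And>s. 0 \<le> s \<Longrightarrow> s \<le> 2 \<Longrightarrow> (\<lambda>k. pnorm s (\<phi> k)) \<longlonglongrightarrow> pnorm s u"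
    "integrable lborel (\<lambda>x. (norm (G x))\<^sup>2)"
    "(\<lambda>k. dirichlet (\<phi> k)) \<longlonglongrightarrow> (\<integral>x. (norm (G x))\<^sup>2 \<partial>lborel)"
proof -
  have t: "\<phi> k \<in> test_functions" for k using a by (simp add: D12_approx_def)
  note [measurable] = test_functions_measurable[OF t] grad_measurable[OF t]
  have [measurable]: "u \<in> borel_measurable borel" "G \<in> borel_measurable borel" using a by (auto simp: D12_approx_def)
  show "integrable (hs_measure s) (\<lambda>x. \<bar>u x\<bar> powr crit_exp TYPE('n) s)"
    "(\<lambda>k. pnorm s (\<phi> k)) \<longlonglongrightarrow> pnorm s u" if s: "0 \<le> s" "s \<le> 2" for s
  proof -
    have "integrable (hs_measure s) (\<lambda>x. \<bar>\<phi> k x\<bar> powr crit_exp TYPE('n) s)" for k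
      using hardy_sobolev_test[OF n s] t by blast
    then show "integrable (hs_measure s) (\<lambda>x. \<bar>u x\<bar> powr crit_exp TYPE('n) s)" "(\<lambda>k. pnorm s (\<phi> k)) \<longlonglongrightarrow> pnorm s u"
      using Lq_norm_tendsto[of "crit_exp TYPE('n) s" \<phi> "hs_measure s" u] D12_approx_Lp[OF n s a] crit_exp_gt2(3)[OF n s]
      by (auto simp: pnorm_def)
  qed
  have "(\<lambda>k. \<integral>\<^sup>+x. ennreal (norm (grad (\<phi> k) x - G x) powr 2) \<partial>lborel) \<longlonglongrightarrow> 0"
    using a by (simp add: D12_approx_def)
  then show "integrable lborel (\<lambda>x. (norm (G x))\<^sup>2)" "(\<lambda>k. dirichlet (\<phi> k)) \<longlonglongrightarrow> (\<integral>x. (norm (G x))\<^sup>2 \<partial>lborel)"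
    using Lq_norm_tendsto[of 2 "\<lambda>k. grad (\<phi> k)" lborel G] dirichlet_nn_integral(2)[OF t]
    by (auto simp: norm_powr_2 dirichlet_def)
qed

text \<open>Completeness in the form used later: a pointwise limit along a subsequence already
  forces the whole Dirichlet-Cauchy sequence to approximate u.\<close>

lemma D12_limit:
  fixes \<phi> :: "nat \<Rightarrow> real^'n::finite \<Rightarrow> real"
  assumes n: "CARD('n::finite) \<ge> 3" and c: "dirichlet_Cauchy \<phi>" and u: "u \<in> borel_measurable borel"
    and r: "strict_mono r" and ae: "AE x in lborel. (\<lambda>k. \<phi> (r k) x) \<longlonglongrightarrow> u x"
  shows "\<exists>G. D12_approx \<phi> u G"
proof -
  have t: "\<phi> k \<in> test_functions" for k using c by (simp add: dirichlet_Cauchy_def)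
  note [measurable] = test_functions_measurable[OF t] grad_measurable[OF t] u
  have gC: "\<exists>N. \<forall>k\<ge>N. \<forall>l\<ge>N. (\<integral>\<^sup>+x. ennreal (norm (grad (\<phi> k) x - grad (\<phi> l) x) powr 2) \<partial>lborel) \<le> ennreal e" if "e > 0" for e
  proof -
    have "(\<integral>\<^sup>+x. ennreal (norm (grad (\<phi> k) x - grad (\<phi> l) x) powr 2) \<partial>lborel) = ennreal (dirichlet (\<lambda>x. \<phi> k x - \<phi> l x))" for k l
      using dirichlet_nn_integral(1)[OF test_functions_diff[OF t[of k] t[of l]]] by (simp add: grad_diff[OF t t])
    then show ?thesis using c that by (simp add: dirichlet_Cauchy_def ennreal_le_iff)
  qed
  have "\<exists>r g. strict_mono r \<and> g \<in> borel_measurable lborel \<and> (AE x in lborel. (\<lambda>k. grad (\<phi> (r k)) x) \<longlonglongrightarrow> g x)"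
    by (rule L2loc_Cauchy_AE_subseq[where A="\<lambda>_. UNIV"]) (use gC in \<open>auto simp: norm_powr_2\<close>)
  then obtain r' G where G: "strict_mono r'" "G \<in> borel_measurable borel" "AE x in lborel. (\<lambda>k. grad (\<phi> (r' k)) x) \<longlonglongrightarrow> G x"
    by auto
  note [measurable] = G(2)
  have "(\<lambda>k. \<integral>\<^sup>+x. ennreal (norm (grad (\<phi> k) x - G x) powr 2) \<partial>lborel) \<longlonglongrightarrow> 0"
    by (rule Lq_Cauchy_Fatou[OF _ _ _ G(3) G(1) gC]) auto
  moreover have "(\<lambda>k. \<integral>\<^sup>+x. ennreal (norm (\<phi> k x - u x) powr crit_exp TYPE('n) 0) \<partial>hs_measure 0) \<longlonglongrightarrow> 0"
    by (rule Lq_Cauchy_Fatou[OF _ _ _ ae[folded AE_hs_measure[where s=0]] r])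
       (use crit_exp_gt2(3)[OF n, of 0] dirichlet_Cauchy_hs[OF n _ _ c] in auto)
  moreover have "(\<integral>\<^sup>+x. ennreal (norm (\<phi> k x - u x) powr crit_exp TYPE('n) 0) \<partial>hs_measure 0) =
     (\<integral>\<^sup>+x. ennreal (norm (\<phi> k x - u x) powr crit_exp TYPE('n) 0) \<partial>lborel)" for k
  proof -
    have "AE x in lborel. x \<noteq> (0::real^'n)" by (rule AE_lborel_singleton)
    then show ?thesis by (subst nn_integral_hs_measure) (auto intro!: nn_integral_cong_AE elim!: eventually_mono)
  qed
  ultimately have "D12_approx \<phi> u G" using t u G(2) by (simp add: D12_approx_def)
  then show ?thesis by blast
qed

section \<open>Uniqueness of the weak gradient\<close>

lemma partial_test: 
  fixes \<eta> :: "real^'n::finite \<Rightarrow> real"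
  assumes "\<eta> \<in> test_functions" shows "partial i \<eta> \<in> test_functions"
proof -
  obtain R where R: "\<And>x. norm x > R \<Longrightarrow> grad \<eta> x = 0" using C1c_support[OF test_functions_C1c[OF assms]] by blast
  have "partial i \<eta> x = grad \<eta> x $ i" for x by (simp add: grad_def)
  then have "partial i \<eta> x = 0" if "x \<notin> cball 0 R" for x using R[of x] that by simp
  moreover have "C_k k (partial i \<eta>)" for k using test_functions_C_k[OF assms, of "Suc k"] by simp
  ultimately show ?thesis by (intro test_functionsI[where K="cball 0 R"]) auto
qed

definition laplacian :: "(real^'n::finite \<Rightarrow> real) \<Rightarrow> real^'n \<Rightarrow> real" where
  "laplacian \<eta> x = (\<Sum>i\<in>UNIV. partial i (partial i \<eta>) x)"

text \<open>Sum over i the vanishing integrals of the i-th derivative of \<zeta> times the i-th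
  partial derivative of \<eta>.\<close>

lemma green:
  fixes \<zeta> \<eta> :: "real^'n::finite \<Rightarrow> real"
  assumes z: "\<zeta> \<in> test_functions" and h: "\<eta> \<in> test_functions"
  shows "integrable lborel (\<lambda>x. grad \<zeta> x \<bullet> grad \<eta> x)" "integrable lborel (\<lambda>x. \<zeta> x * laplacian \<eta> x)"
    "(\<integral>x. grad \<zeta> x \<bullet> grad \<eta> x \<partial>lborel) = - (\<integral>x. \<zeta> x * laplacian \<eta> x \<partial>lborel)"
proof -
  note zc = test_functions_C1c[OF z] and hc = test_functions_C1c[OF h]
  obtain R where R: "\<And>x. norm x > R \<Longrightarrow> \<zeta> x = 0" "\<And>x. norm x > R \<Longrightarrow> grad \<zeta> x = 0"
    using C1c_support[OF zc] by blast
  have lc: "continuous_on UNIV (laplacian \<eta>)" unfolding laplacian_def[abs_def]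
    by (intro continuous_on_sum C_k_continuous[of 0] test_functions_C_k partial_test h)
  show i1: "integrable lborel (\<lambda>x. grad \<zeta> x \<bullet> grad \<eta> x)"
    by (rule integrable_continuous_bounded_support[where R=R])
       (auto intro!: continuous_intros C1c_continuous(2)[OF zc] C1c_continuous(2)[OF hc] simp: R)
  show i2: "integrable lborel (\<lambda>x. \<zeta> x * laplacian \<eta> x)"
    by (rule integrable_continuous_bounded_support[where R=R])
       (auto intro!: continuous_intros C1c_continuous(1)[OF zc] lc simp: R)
  define g where "g i x = partial i \<eta> x *\<^sub>R grad \<zeta> x + \<zeta> x *\<^sub>R grad (partial i \<eta>) x" for i x
  have g: "C1c (\<lambda>x. partial i \<eta> x * \<zeta> x) (g i)" for i
    unfolding g_def[abs_def]
    by (rule C1c_mult[OF zc]) (use test_functions_C1c[OF partial_test[OF h]] C1c_derivative C1c_continuous(2) in blast)+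
  have gi: "integrable lborel (\<lambda>x. g i x \<bullet> axis i 1)" for i
    by (rule integrable_continuous_bounded_support[where R=R])
       (intro continuous_intros C1c_continuous(2)[OF g], simp add: g_def R)
  have gax: "g i x \<bullet> axis i 1 = partial i \<zeta> x * partial i \<eta> x + \<zeta> x * partial i (partial i \<eta>) x" for i x
    by (simp add: g_def inner_axis inner_add_left grad_def)
  have "0 = (\<Sum>i\<in>UNIV. (\<integral>x. g i x \<bullet> axis i 1 \<partial>lborel))" using C1c_integral_partial[OF g] by simp
  also have "\<dots> = (\<integral>x. (\<Sum>i\<in>UNIV. g i x \<bullet> axis i 1) \<partial>lborel)"
    by (intro Bochner_Integration.integral_sum[symmetric] gi)
  also have "(\<lambda>x. \<Sum>i\<in>UNIV. g i x \<bullet> axis i 1) = (\<lambda>x. grad \<zeta> x \<bullet> grad \<eta> x + \<zeta> x * laplacian \<eta> x)"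
    unfolding gax by (simp add: laplacian_def inner_vec_def grad_def sum.distrib sum_distrib_left)
  finally show "(\<integral>x. grad \<zeta> x \<bullet> grad \<eta> x \<partial>lborel) = - (\<integral>x. \<zeta> x * laplacian \<eta> x \<partial>lborel)"
    by (simp add: i1 i2)
qed

text \<open>A pointwise stand-in for Hoelder on bounded sets: the constant part is paid by the
  finite volume, the other by the L^q integral.\<close>

lemma le_eps_plus_powr:
  fixes t d q :: real
  assumes "t \<ge> 0" "d > 0" "q \<ge> 1"
  shows "t \<le> d + d powr (1 - q) * t powr q"
proof (cases "t \<le> d")
  case False
  have "t = t powr (1 - q) * t powr q" using False assms by (simp flip: powr_add)
  also have "\<dots> \<le> d powr (1 - q) * t powr q"
    using False assms by (intro mult_right_mono powr_mono2') auto
  finally show ?thesis using assms by simp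
qed (use assms in \<open>auto intro: add_increasing2\<close>)

text \<open>Green moves the derivatives onto \<eta>, whose Laplacian is bounded with bounded
  support; there L^q convergence controls the L^1 norm.\<close>

lemma weak_limit_zero:
  fixes \<zeta> :: "nat \<Rightarrow> real^'n::finite \<Rightarrow> real"
  assumes z: "\<And>k. \<zeta> k \<in> test_functions" and h: "\<eta> \<in> test_functions" and q: "q \<ge> 1"
    and conv: "(\<lambda>k. \<integral>\<^sup>+x. ennreal (norm (\<zeta> k x) powr q) \<partial>lborel) \<longlonglongrightarrow> 0"
  shows "(\<lambda>k. \<integral>x. grad (\<zeta> k) x \<bullet> grad \<eta> x \<partial>lborel) \<longlonglongrightarrow> 0"
proof -
  note [measurable] = test_functions_measurable[OF z] test_functions_measurable[OF h]
  have qi: "integrable lborel (\<lambda>x. \<bar>\<zeta> k x\<bar> powr q)" for k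
  proof -
    have "continuous_on UNIV (\<lambda>z::real \<times> (real^'n). \<bar>fst z\<bar> powr q)"
      using q by (intro continuous_on_powr' continuous_intros) auto
    then show ?thesis
      using C1c_integrable[OF test_functions_C1c[OF z], of "\<lambda>a b. \<bar>a\<bar> powr q"] by (simp add: case_prod_beta)
  qed
  obtain M R where MR: "M > 0" "\<And>x. \<bar>laplacian \<eta> x\<bar> \<le> M" "\<And>x. norm x > R \<Longrightarrow> laplacian \<eta> x = 0"
  proof -
    have t: "partial i (partial i \<eta>) \<in> test_functions" for i by (intro partial_test h)
    have "\<forall>i. \<exists>R. \<forall>x. norm x > R \<longrightarrow> partial i (partial i \<eta>) x = 0"
      using C1c_support[OF test_functions_C1c[OF t]] by blast
    then obtain Rf where Rf: "\<And>i x. norm x > Rf i \<Longrightarrow> partial i (partial i \<eta>) x = 0" by metis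
    have "\<forall>i. \<exists>M. \<forall>x. \<bar>partial i (partial i \<eta>) x\<bar> \<le> M"
      using C1c_bounded[OF test_functions_C1c[OF t]] by blast
    then obtain Mf where Mf: "\<And>i x. \<bar>partial i (partial i \<eta>) x\<bar> \<le> Mf i" by metis
    have "\<bar>laplacian \<eta> x\<bar> \<le> (\<Sum>i\<in>UNIV. Mf i)" for x unfolding laplacian_def
      by (rule order_trans[OF sum_abs sum_mono]) (rule Mf)
    moreover have "laplacian \<eta> x = 0" if "norm x > Max (range Rf)" for x unfolding laplacian_def
    proof (rule sum.neutral, intro ballI Rf)
      fix i show "norm x > Rf i" using that by (meson Max_ge finite finite_imageI le_less_trans rangeI)
    qed
    ultimately show thesis using that[of "max 1 (\<Sum>i\<in>UNIV. Mf i)" "Max (range Rf)"] by (auto simp: le_max_iff_disj)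
  qed
  define b where "b = measure lborel (cball (0::real^'n) R)"
  have b0: "b \<ge> 0" by (simp add: b_def)
  have I: "(\<lambda>k. \<integral>x. \<bar>\<zeta> k x\<bar> powr q \<partial>lborel) \<longlonglongrightarrow> 0"
    using conv qi by (simp add: nn_integral_eq_integral ennreal_tendsto_0_iff)
  have bi: "integrable lborel (indicator (cball (0::real^'n) R) :: _ \<Rightarrow> real)"
    using emeasure_bounded_finite[OF bounded_cball, of "0::real^'n" R] by (intro integrable_real_indicator) auto
  have bound: "\<bar>\<integral>x. grad (\<zeta> k) x \<bullet> grad \<eta> x \<partial>lborel\<bar> \<le> M * (d * b + d powr (1 - q) * (\<integral>x. \<bar>\<zeta> k x\<bar> powr q \<partial>lborel))" if d: "d > 0" for d k
  proof -
    have "\<bar>\<integral>x. grad (\<zeta> k) x \<bullet> grad \<eta> x \<partial>lborel\<bar> = \<bar>\<integral>x. \<zeta> k x * laplacian \<eta> x \<partial>lborel\<bar>" using green(3)[OF z h] by simp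
    also have "\<dots> \<le> (\<integral>x. \<bar>\<zeta> k x * laplacian \<eta> x\<bar> \<partial>lborel)" by (rule integral_abs_bound)
    also have "\<dots> \<le> (\<integral>x. M * (d * indicator (cball 0 R) x + d powr (1 - q) * \<bar>\<zeta> k x\<bar> powr q) \<partial>lborel)"
    proof (intro integral_mono integrable_mult_right Bochner_Integration.integrable_add integrable_abs green(2)[OF z h] qi bi)
      fix x
      show "\<bar>\<zeta> k x * laplacian \<eta> x\<bar> \<le> M * (d * indicator (cball 0 R) x + d powr (1 - q) * \<bar>\<zeta> k x\<bar> powr q)"
      proof (cases "norm x > R")
        case False
        have "\<bar>\<zeta> k x * laplacian \<eta> x\<bar> \<le> M * \<bar>\<zeta> k x\<bar>"
          using mult_right_mono[OF MR(2)[of x], of "\<bar>\<zeta> k x\<bar>"] by (simp add: abs_mult mult.commute)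
        also have "\<dots> \<le> M * (d + d powr (1 - q) * \<bar>\<zeta> k x\<bar> powr q)"
          using MR(1) d q by (intro mult_left_mono le_eps_plus_powr) auto
        finally show ?thesis using False by (simp add: indicator_def)
      qed (use MR d in auto)
    qed
    also have "\<dots> = M * (d * b + d powr (1 - q) * (\<integral>x. \<bar>\<zeta> k x\<bar> powr q \<partial>lborel))"
      by (simp add: b_def qi bi)
    finally show ?thesis .
  qed
  show ?thesis
  proof (rule tendstoI)
    fix e :: real assume e: "e > 0"
    \<comment> \<open>Makes M d b less than e/2; the summand 1 covers b = 0.\<close>
    define d where "d = e / (2 * M * (b + 1))"
    have d: "d > 0" using e MR(1) b0 by (simp add: d_def)
    have "M * d = e / 2 / (b + 1)" using MR(1) by (simp add: d_def)
    then have "M * (d * b) = e / 2 * (b / (b + 1))" by (simp add: mult.assoc[symmetric])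
    also have "\<dots> < e / 2 * 1" using e b0 by (intro mult_strict_left_mono) (auto simp: field_simps)
    finally have Mdb: "M * (d * b) < e / 2" by simp
    have "(\<lambda>k. M * (d powr (1 - q) * (\<integral>x. \<bar>\<zeta> k x\<bar> powr q \<partial>lborel))) \<longlonglongrightarrow> M * (d powr (1 - q) * 0)"
      by (intro tendsto_intros I)
    then have "eventually (\<lambda>k. M * (d powr (1 - q) * (\<integral>x. \<bar>\<zeta> k x\<bar> powr q \<partial>lborel)) < e / 2) sequentially"
      using e by (intro order_tendstoD) auto
    then show "eventually (\<lambda>k. dist (\<integral>x. grad (\<zeta> k) x \<bullet> grad \<eta> x \<partial>lborel) 0 < e) sequentially"
    proof eventually_elim
      case (elim k)
      then show ?case using bound[OF d, of k] Mdb by (simp add: distrib_left)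
    qed
  qed
qed

lemma dirichlet_diff:
  fixes f g :: "real^'n::finite \<Rightarrow> real"
  assumes "f \<in> test_functions" "g \<in> test_functions"
  shows "dirichlet (\<lambda>x. f x - g x) = dirichlet f + dirichlet g - 2 * (\<integral>x. grad f x \<bullet> grad g x \<partial>lborel)"
proof -
  have "dirichlet (\<lambda>x. f x - g x) = (\<integral>x. (norm (grad f x))\<^sup>2 + (norm (grad g x))\<^sup>2 - 2 * (grad f x \<bullet> grad g x) \<partial>lborel)"
    unfolding dirichlet_def grad_diff[OF assms]
    by (intro Bochner_Integration.integral_cong refl) (simp add: power2_norm_eq_inner inner_diff_left inner_diff_right inner_commute)
  also have "\<dots> = dirichlet f + dirichlet g - 2 * (\<integral>x. grad f x \<bullet> grad g x \<partial>lborel)"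
    unfolding dirichlet_def
    by (simp add: green(1)[OF assms] C1c_integrable_sq(2)[OF test_functions_C1c] assms)
  finally show ?thesis .
qed

text \<open>Makes the choice in \<open>D12_grad\<close> harmless. The difference of two
  approximating sequences is Dirichlet-Cauchy and tends to 0 in the critical norm, so it is weakly
  null against each of its own members; expanding the square then forces its Dirichlet integrals to
  0.\<close>

lemma is_D12_grad_unique:
  fixes u :: "real^'n::finite \<Rightarrow> real"
  assumes n: "CARD('n::finite) \<ge> 3" and "is_D12_grad u G" "is_D12_grad u G'"
  shows "AE x in lborel. G x = G' x"
proof -
  obtain \<phi> \<phi>' where a: "D12_approx \<phi> u G" "D12_approx \<phi>' u G'" using assms(2,3) is_D12_grad_iff by blast
  have t: "\<phi> k \<in> test_functions" "\<phi>' k \<in> test_functions" for k using a by (auto simp: D12_approx_def)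
  have m[measurable]: "u \<in> borel_measurable borel" "G \<in> borel_measurable borel" "G' \<in> borel_measurable borel"
    using a by (auto simp: D12_approx_def)
  note [measurable] = test_functions_measurable[OF t(1)] test_functions_measurable[OF t(2)] grad_measurable[OF t(1)] grad_measurable[OF t(2)]
  define \<zeta> where "\<zeta> k x = \<phi> k x - \<phi>' k x" for k x
  have zt: "\<zeta> k \<in> test_functions" for k unfolding \<zeta>_def[abs_def] by (intro test_functions_diff t)
  have gz: "grad (\<zeta> k) = (\<lambda>x. grad (\<phi> k) x - grad (\<phi>' k) x)" for k unfolding \<zeta>_def[abs_def] by (intro grad_diff t)
  define p where "p = crit_exp TYPE('n) 0"
  have p: "p \<ge> 1" "p > 0" using crit_exp_gt2(1)[OF n, of 0] by (auto simp: p_def)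
  have conv0: "(\<lambda>k. \<integral>\<^sup>+x. ennreal (norm (\<zeta> k x) powr p) \<partial>lborel) \<longlonglongrightarrow> 0"
    using Lq_tendsto_diff[of p \<phi> lborel u \<phi>' u] p a by (simp add: \<zeta>_def D12_approx_def p_def)
  have convg: "(\<lambda>k. \<integral>\<^sup>+x. ennreal (norm (grad (\<zeta> k) x - (G x - G' x)) powr 2) \<partial>lborel) \<longlonglongrightarrow> 0"
    using Lq_tendsto_diff[of 2 "\<lambda>k. grad (\<phi> k)" lborel G "\<lambda>k. grad (\<phi>' k)" G'] a by (simp add: gz D12_approx_def)
  have "D12_approx \<zeta> (\<lambda>_. 0) (\<lambda>x. G x - G' x)" using zt conv0 convg by (simp add: D12_approx_def p_def)
  from D12_approx_limits(3,4)[OF n this] D12_approx_Cauchy[OF this]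
  have Hi: "integrable lborel (\<lambda>x. (norm (G x - G' x))\<^sup>2)"
    and lim: "(\<lambda>k. dirichlet (\<zeta> k)) \<longlonglongrightarrow> (\<integral>x. (norm (G x - G' x))\<^sup>2 \<partial>lborel)" and c: "dirichlet_Cauchy \<zeta>" by auto
  define L where "L = (\<integral>x. (norm (G x - G' x))\<^sup>2 \<partial>lborel)"
  have "L \<le> e" if e: "e > 0" for e
  proof -
    obtain N where N: "\<And>k l. k \<ge> N \<Longrightarrow> l \<ge> N \<Longrightarrow> dirichlet (\<lambda>x. \<zeta> k x - \<zeta> l x) \<le> e"
      using c e unfolding dirichlet_Cauchy_def by blast
    \<comment> \<open>The expansion of the Dirichlet integral of \<zeta> k - \<zeta> N with N fixed:
      the cross term dies as k grows, while the Cauchy property keeps the whole below e.\<close>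
    have "(\<lambda>k. dirichlet (\<zeta> k) + dirichlet (\<zeta> N) - 2 * (\<integral>x. grad (\<zeta> k) x \<bullet> grad (\<zeta> N) x \<partial>lborel)) \<longlonglongrightarrow> L + dirichlet (\<zeta> N) - 2 * 0"
      unfolding L_def by (intro tendsto_intros lim weak_limit_zero[OF zt zt p(1) conv0])
    then have "L + dirichlet (\<zeta> N) - 2 * 0 \<le> e"
    proof (rule LIMSEQ_le_const2)
      show "\<exists>M. \<forall>k\<ge>M. dirichlet (\<zeta> k) + dirichlet (\<zeta> N) - 2 * (\<integral>x. grad (\<zeta> k) x \<bullet> grad (\<zeta> N) x \<partial>lborel) \<le> e"
        using N dirichlet_diff[OF zt zt] by (metis order_refl)
    qed
    then show "L \<le> e" using dirichlet_nonneg[of "\<zeta> N"] by linarith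
  qed
  then have "L \<le> 0" by (meson dense not_less)
  then have "L = 0" by (simp add: L_def antisym)
  then have "AE x in lborel. (norm (G x - G' x))\<^sup>2 = 0"
    unfolding L_def using Hi by (subst (asm) integral_nonneg_eq_0_iff_AE) auto
  then show ?thesis by eventually_elim simp
qed

section \<open>Approximation by test functions and convexity of the energy\<close>

lemma D12_approx_test:
  assumes "\<phi> \<in> test_functions" shows "D12_approx (\<lambda>_. \<phi>) \<phi> (grad \<phi>)"
  using assms by (simp add: D12_approx_def test_functions_measurable grad_measurable)

text \<open>Supplies the weak gradient of \<open>U k\<close> - u, so that the defining inequality of
  the infimum can be applied to the remainder in the dichotomy.\<close>

lemma D12_approx_const_diff:
  fixes \<psi> :: "real^'n::finite \<Rightarrow> real"
  assumes a: "D12_approx \<phi> u G" and t: "\<psi> \<in> test_functions"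
  shows "D12_approx (\<lambda>k x. \<psi> x - \<phi> k x) (\<lambda>x. \<psi> x - u x) (\<lambda>x. grad \<psi> x - G x)"
proof -
  have t': "\<phi> k \<in> test_functions" for k using a by (simp add: D12_approx_def)
  have [measurable]: "u \<in> borel_measurable borel" "G \<in> borel_measurable borel"
    using a by (auto simp: D12_approx_def)
  note [measurable] = test_functions_measurable[OF t] grad_measurable[OF t]
  have "(\<psi> x - \<phi> k x) - (\<psi> x - u x) = - (\<phi> k x - u x)" "(grad \<psi> x - grad (\<phi> k) x) - (grad \<psi> x - G x) = - (grad (\<phi> k) x - G x)" for k x
    by auto
  then show ?thesis using a unfolding D12_approx_def
    by (simp only: grad_diff[OF t t'] norm_minus_cancel) (simp add: test_functions_diff t t')
qed

lemma pnorm_2_eq: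
  fixes u :: "real^'n::finite \<Rightarrow> real"
  assumes "CARD('n) \<ge> 3" "u \<in> borel_measurable borel"
  shows "pnorm 2 u = (\<integral>x. (u x)\<^sup>2 / (norm x)\<^sup>2 \<partial>lborel)"
  using assms norm_powr_2[of "u _"] unfolding pnorm_def
  by (subst integral_hs_measure) (auto simp: crit_exp_gt2(5)[OF assms(1), of 0] norm_powr_2)

lemma hardy_test:
  fixes \<phi> :: "real^'n::finite \<Rightarrow> real"
  assumes n: "CARD('n) \<ge> 3" and t: "\<phi> \<in> test_functions"
  shows "(real CARD('n) - 2)\<^sup>2 / 4 * pnorm 2 \<phi> \<le> dirichlet \<phi>"
proof -
  note [measurable] = test_functions_measurable[OF t]
  have "ennreal (pnorm 2 \<phi>) = (\<integral>\<^sup>+x. ennreal (\<bar>\<phi> x\<bar> powr crit_exp TYPE('n) 2) \<partial>hs_measure 2)"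
    using hardy_sobolev_test[OF n, of 2] t by auto
  also have "\<dots> = (\<integral>\<^sup>+x. ennreal ((\<phi> x)\<^sup>2 / (norm x)\<^sup>2) \<partial>lborel)"
    using norm_powr_2[of "\<phi> _"] by (subst nn_integral_hs_measure) (auto simp: crit_exp_gt2(5)[OF n, of 0] norm_powr_2)
  finally have "ennreal (((real CARD('n) - 2) / 2)\<^sup>2) * ennreal (pnorm 2 \<phi>) \<le> ennreal (dirichlet \<phi>)"
    using hardy[OF _ test_functions_C1c[OF t]] n by (simp add: dirichlet_def)
  then have "ennreal (((real CARD('n) - 2) / 2)\<^sup>2 * pnorm 2 \<phi>) \<le> ennreal (dirichlet \<phi>)"
    by (subst ennreal_mult) auto
  then show ?thesis by (subst (asm) ennreal_le_iff) (auto simp: power_divide)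
qed

lemma norm_convex_identity:
  fixes a b :: "'b::real_inner"
  shows "(norm ((1 - t) *\<^sub>R a + t *\<^sub>R b))\<^sup>2 = (1 - t) * (norm a)\<^sup>2 + t * (norm b)\<^sup>2 - t * (1 - t) * (norm (a - b))\<^sup>2"
  unfolding power2_norm_eq_inner
  by (simp only: inner_add_left inner_add_right inner_diff_left inner_diff_right inner_scaleR_left inner_scaleR_right inner_commute[of b a])
     algebra

text \<open>The energy is a quadratic form, so the convexity defect is again an energy, that of the
  difference.\<close>

lemma energy_convex_identity:
  fixes v w :: "real^'n::finite \<Rightarrow> real"
  assumes n: "CARD('n) \<ge> 3" and t: "v \<in> test_functions" "w \<in> test_functions"
  shows "energy \<gamma> (\<lambda>x. (1 - t) * v x + t * w x) = (1 - t) * energy \<gamma> v + t * energy \<gamma> w - t * (1 - t) * energy \<gamma> (\<lambda>x. v x - w x)"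
proof -
  have d: "(\<lambda>x. v x - w x) \<in> test_functions" by (intro test_functions_diff t)
  \<comment> \<open>The sum is written as a difference with factor -t to fit
    \<open>grad_diff\<close>.\<close>
  have c: "(\<lambda>x. (1 - t) * v x - (- t) * w x) \<in> test_functions" by (intro test_functions_diff test_functions_cmult t)
  have gc: "grad (\<lambda>x. (1 - t) * v x - (- t) * w x) = (\<lambda>x. (1 - t) *\<^sub>R grad v x - (- t) *\<^sub>R grad w x)"
    by (subst grad_diff) (simp_all only: test_functions_cmult t grad_cmult)
  have sq: "integrable lborel (\<lambda>x. (norm (grad f x))\<^sup>2)" if "f \<in> test_functions" for f :: "real^'n \<Rightarrow> real"
    using C1c_integrable_sq(2)[OF test_functions_C1c[OF that]] .
  have "dirichlet (\<lambda>x. (1 - t) * v x - (- t) * w x) = (\<integral>x. (1 - t) * (norm (grad v x))\<^sup>2 + t * (norm (grad w x))\<^sup>2 - t * (1 - t) * (norm (grad v x - grad w x))\<^sup>2 \<partial>lborel)"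
    unfolding dirichlet_def gc using norm_convex_identity[of t] by (intro Bochner_Integration.integral_cong refl) simp
  also have "\<dots> = (1 - t) * dirichlet v + t * dirichlet w - t * (1 - t) * dirichlet (\<lambda>x. v x - w x)"
    using sq[OF d] sq[OF t(1)] sq[OF t(2)] by (simp add: dirichlet_def grad_diff[OF t])
  finally have 1: "dirichlet (\<lambda>x. (1 - t) * v x + t * w x) = (1 - t) * dirichlet v + t * dirichlet w - t * (1 - t) * dirichlet (\<lambda>x. v x - w x)" by simp
  have p2: "\<bar>y\<bar> powr crit_exp TYPE('n) 2 = y\<^sup>2" for y :: real using norm_powr_2[of y] by (simp add: crit_exp_gt2(5)[OF n, of 0])
  have hs: "integrable (hs_measure 2) (\<lambda>x. (f x)\<^sup>2)" if "f \<in> test_functions" for f :: "real^'n \<Rightarrow> real"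
    using hardy_sobolev_test[OF n, of 2] that by (auto simp: p2)
  have "pnorm 2 (\<lambda>x. (1 - t) * v x + t * w x) = (\<integral>x. (1 - t) * (v x)\<^sup>2 + t * (w x)\<^sup>2 - t * (1 - t) * (v x - w x)\<^sup>2 \<partial>hs_measure 2)"
    unfolding pnorm_def p2 using norm_convex_identity[of t "v _" "w _"] by (intro Bochner_Integration.integral_cong refl) simp
  also have "\<dots> = (1 - t) * pnorm 2 v + t * pnorm 2 w - t * (1 - t) * pnorm 2 (\<lambda>x. v x - w x)"
    unfolding pnorm_def p2 using hs[OF d] hs[OF t(1)] hs[OF t(2)] by simp
  finally have 2: "pnorm 2 (\<lambda>x. (1 - t) * v x + t * w x) = (1 - t) * pnorm 2 v + t * pnorm 2 w - t * (1 - t) * pnorm 2 (\<lambda>x. v x - w x)" .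
  show ?thesis unfolding energy_def 1 2 by (simp add: algebra_simps)
qed

section \<open>The minimization problem\<close>

text \<open>A locale rather than fixed parameters, because the unweighted cases compare the problem
  with its instance \<gamma> = s = 0, the Sobolev problem. The argument \<open>dim\<close> only
  carries the dimension.\<close>

locale hs_problem =
  fixes dim :: "'n::finite itself" and \<gamma> s :: real
  assumes n: "CARD('n) \<ge> 3" and s: "0 \<le> s" "s < 2" and \<gamma>: "\<gamma> < (real CARD('n) - 2)\<^sup>2 / 4"
begin

abbreviation T where "T \<equiv> (test_functions :: (real^'n \<Rightarrow> real) set)"

lemma s2: "s \<le> 2" using s by simp

lemma p: "crit_exp TYPE('n) s > 2" "crit_exp TYPE('n) s > 0" "crit_exp TYPE('n) s \<ge> 1" "2 / crit_exp TYPE('n) s > 0" "2 / crit_exp TYPE('n) s < 1"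
  using crit_exp_gt2[OF n s(1) s2] s(2) by auto

text \<open>For positive \<gamma>, Hardy bounds the subtracted term by a fraction \<gamma>/h < 1 of
  the Dirichlet integral; otherwise the term only helps.\<close>

lemma coercive: "\<exists>c>0. \<forall>\<phi>\<in>T. c * dirichlet \<phi> \<le> energy \<gamma> \<phi>"
proof (cases "\<gamma> \<le> 0")
  case True
  then have "1 * dirichlet \<phi> \<le> energy \<gamma> \<phi>" for \<phi> :: "real^'n \<Rightarrow> real"
    by (simp add: energy_def mult_nonpos_nonneg)
  then show ?thesis by (intro exI[of _ 1]) auto
next
  case False
  define h where "h = (real CARD('n) - 2)\<^sup>2 / 4"
  have h: "h > 0" "\<gamma> < h" using n \<gamma> by (auto simp: h_def)
  have "(1 - \<gamma> / h) * dirichlet \<phi> \<le> energy \<gamma> \<phi>" if "\<phi> \<in> T" for \<phi>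
  proof -
    have "\<gamma> / h * (h * pnorm 2 \<phi>) \<le> \<gamma> / h * dirichlet \<phi>"
      using hardy_test[OF n that] False h by (intro mult_left_mono) (auto simp: h_def)
    then show ?thesis using h by (simp add: energy_def algebra_simps)
  qed
  then show ?thesis using h by (intro exI[of _ "1 - \<gamma> / h"]) auto
qed

lemma energy_nonneg: "\<phi> \<in> T \<Longrightarrow> energy \<gamma> \<phi> \<ge> 0"
proof -
  assume "\<phi> \<in> T"
  obtain c where "c > 0" "\<forall>\<phi>\<in>T. c * dirichlet \<phi> \<le> energy \<gamma> \<phi>" using coercive by blast
  then have "c * dirichlet \<phi> \<le> energy \<gamma> \<phi>" "0 \<le> c * dirichlet \<phi>" using \<open>\<phi> \<in> T\<close> by auto
  then show ?thesis by (rule order_trans[rotated])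
qed

lemma pnorm_le_energy: "\<exists>c>0. \<forall>\<phi>\<in>T. c * pnorm s \<phi> powr (2 / crit_exp TYPE('n) s) \<le> energy \<gamma> \<phi>"
proof -
  obtain c where c: "c > 0" "\<And>\<phi>. \<phi> \<in> T \<Longrightarrow> c * dirichlet \<phi> \<le> energy \<gamma> \<phi>" using coercive by blast
  obtain C where C: "C > 0" "\<And>\<phi>. \<phi> \<in> T \<Longrightarrow> pnorm s \<phi> \<le> C * dirichlet \<phi> powr (crit_exp TYPE('n) s / 2)"
    using hardy_sobolev_test[OF n s(1) s2] by blast
  define D where "D = C powr (2 / crit_exp TYPE('n) s)"
  have D: "D > 0" using C by (simp add: D_def)
  have "c / D * pnorm s \<phi> powr (2 / crit_exp TYPE('n) s) \<le> energy \<gamma> \<phi>" if t: "\<phi> \<in> T" for \<phi>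
  proof -
    have "pnorm s \<phi> powr (2 / crit_exp TYPE('n) s) \<le> (C * dirichlet \<phi> powr (crit_exp TYPE('n) s / 2)) powr (2 / crit_exp TYPE('n) s)"
      using C(2)[OF t] p by (intro powr_mono2) auto
    also have "\<dots> = D * dirichlet \<phi>" using p by (simp add: powr_mult powr_powr D_def)
    finally have "c / D * pnorm s \<phi> powr (2 / crit_exp TYPE('n) s) \<le> c / D * (D * dirichlet \<phi>)" using c D by (intro mult_left_mono) auto
    then show ?thesis using c(2)[OF t] D by simp
  qed
  then show ?thesis using c D by (intro exI[of _ "c / D"]) auto
qed

lemma energy_limit:
  assumes "D12_approx \<phi> u G"
  shows "(\<lambda>k. energy \<gamma> (\<phi> k)) \<longlonglongrightarrow> (\<integral>x. (norm (G x))\<^sup>2 \<partial>lborel) - \<gamma> * pnorm 2 (u :: real^'n \<Rightarrow> real)"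
  unfolding energy_def using D12_approx_limits[OF n assms] by (intro tendsto_intros) auto

text \<open>Replaces the chosen gradient by whichever weak gradient is at hand, through
  uniqueness.\<close>

lemma quotient_eq:
  assumes a: "D12_approx \<phi> u G"
  shows "HS_quotient \<gamma> s u = ((\<integral>x. (norm (G x))\<^sup>2 \<partial>lborel) - \<gamma> * pnorm 2 u) / pnorm s (u :: real^'n \<Rightarrow> real) powr (2 / crit_exp TYPE('n) s)"
proof -
  have u[measurable]: "u \<in> borel_measurable borel" using a by (simp add: D12_approx_def)
  have G: "is_D12_grad u G" using a is_D12_grad_iff by blast
  then have D: "is_D12_grad u (D12_grad u)" unfolding D12_grad_def by (rule someI[where P="is_D12_grad u"])
  have [measurable]: "G \<in> borel_measurable borel" "D12_grad u \<in> borel_measurable borel"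
    using G D by (auto simp: is_D12_grad_def)
  have "(\<integral>x. (norm (D12_grad u x))\<^sup>2 \<partial>lborel) = (\<integral>x. (norm (G x))\<^sup>2 \<partial>lborel)"
    using is_D12_grad_unique[OF n D G] by (intro integral_cong_AE) (auto elim: eventually_mono)
  moreover have "(\<integral>x. \<bar>u x\<bar> powr crit_exp TYPE('n) s / norm x powr s \<partial>lborel) = pnorm s u"
    unfolding pnorm_def by (rule integral_hs_measure[symmetric]) measurable
  ultimately show ?thesis by (simp add: HS_quotient_def pnorm_2_eq[OF n u])
qed

lemma D12E: "u \<in> D12 \<Longrightarrow> \<exists>\<phi> G. D12_approx \<phi> (u :: real^'n \<Rightarrow> real) G"
  by (auto simp: D12_def is_D12_grad_iff)

lemma D12_nonzeroE: "u \<in> D12_nonzero \<Longrightarrow> \<exists>\<phi> G. D12_approx \<phi> (u :: real^'n \<Rightarrow> real) G"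
  by (simp add: D12_nonzero_def D12E)

lemma pnorm_pos_iff:
  assumes "D12_approx \<phi> u G"
  shows "pnorm s (u :: real^'n \<Rightarrow> real) > 0 \<longleftrightarrow> u \<in> D12_nonzero"
proof -
  have "u \<in> D12" using assms by (auto simp: D12_def is_D12_grad_iff)
  have "pnorm s u = 0 \<longleftrightarrow> (AE x in hs_measure s. \<bar>u x\<bar> powr crit_exp TYPE('n) s = 0)"
    unfolding pnorm_def using D12_approx_limits(1)[OF n assms s(1) s2] by (intro integral_nonneg_eq_0_iff_AE) auto
  also have "\<dots> \<longleftrightarrow> (AE x in lborel. u x = 0)" by (simp add: AE_hs_measure)
  finally show ?thesis using \<open>u \<in> D12\<close> pnorm_nonneg[of s u] by (auto simp: D12_nonzero_def less_le)
qed

lemma quotient_bdd: "\<exists>c>0. \<forall>u\<in>D12_nonzero. c \<le> HS_quotient \<gamma> s (u :: real^'n \<Rightarrow> real)"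
proof -
  obtain c where c: "c > 0" "\<And>\<phi>. \<phi> \<in> T \<Longrightarrow> c * pnorm s \<phi> powr (2 / crit_exp TYPE('n) s) \<le> energy \<gamma> \<phi>" using pnorm_le_energy by blast
  have "c \<le> HS_quotient \<gamma> s u" if u: "u \<in> D12_nonzero" for u :: "real^'n \<Rightarrow> real"
  proof -
    obtain \<phi> G where a: "D12_approx \<phi> u G" using D12_nonzeroE[OF u] by blast
    have pos: "pnorm s u > 0" using pnorm_pos_iff[OF a] u by simp
    have "(\<lambda>k. c * pnorm s (\<phi> k) powr (2 / crit_exp TYPE('n) s)) \<longlonglongrightarrow> c * pnorm s u powr (2 / crit_exp TYPE('n) s)"
      using pos by (intro tendsto_intros D12_approx_limits(2)[OF n a s(1) s2]) auto
    then have "c * pnorm s u powr (2 / crit_exp TYPE('n) s) \<le> (\<integral>x. (norm (G x))\<^sup>2 \<partial>lborel) - \<gamma> * pnorm 2 u"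
      by (rule LIMSEQ_le[OF _ energy_limit[OF a]]) (use c(2) a in \<open>auto simp: D12_approx_def\<close>)
    then show ?thesis using pos by (simp add: quotient_eq[OF a] field_simps)
  qed
  then show ?thesis using c(1) by blast
qed

lemma quotient_bdd_below: "bdd_below (HS_quotient \<gamma> s ` (D12_nonzero :: (real^'n \<Rightarrow> real) set))"
proof -
  obtain c where "\<forall>u\<in>D12_nonzero. c \<le> HS_quotient \<gamma> s (u :: real^'n \<Rightarrow> real)" using quotient_bdd by blast
  then show ?thesis by (intro bdd_belowI2[of _ c]) simp
qed

lemma nonzero_exists: "(D12_nonzero :: (real^'n \<Rightarrow> real) set) \<noteq> {}"
proof -
  have t: "cutoff (0::real^'n) 1 \<in> T" by (rule cutoff_test) simp
  have "pnorm s (cutoff (0::real^'n) 1) \<noteq> 0"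
  proof
    assume "pnorm s (cutoff (0::real^'n) 1) = 0"
    then have "AE x in lborel. cutoff (0::real^'n) 1 x = 0"
      using pnorm_pos_iff[OF D12_approx_test[OF t]] D12_approx_test[OF t]
      by (auto simp: D12_nonzero_def D12_def is_D12_grad_iff)
    then have "AE x in lborel. x \<notin> ball (0::real^'n) 1"
      by eventually_elim (use cutoff_eq_1[of 1 _ "0::real^'n"] in auto)
    then have "emeasure lborel (ball (0::real^'n) 1) = 0"
      by (subst (asm) AE_iff_measurable[of "ball 0 1"]) auto
    then show False using emeasure_ball[of 1 "0::real^'n"] unit_ball_vol_pos[of "real CARD('n)"] by simp
  qed
  then have "pnorm s (cutoff (0::real^'n) 1) > 0" using pnorm_nonneg[of s "cutoff (0::real^'n) 1"] by linarith
  then show ?thesis using pnorm_pos_iff[OF D12_approx_test[OF t]] by auto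
qed

lemma mu_pos: "HS_mu TYPE('n) \<gamma> s > 0"
proof -
  obtain c where c: "c > 0" "\<And>u. u \<in> D12_nonzero \<Longrightarrow> c \<le> HS_quotient \<gamma> s (u :: real^'n \<Rightarrow> real)" using quotient_bdd by blast
  then have "c \<le> HS_mu TYPE('n) \<gamma> s" unfolding HS_mu_def by (intro cINF_greatest nonzero_exists)
  then show ?thesis using c by simp
qed

lemma mu_le: "u \<in> D12_nonzero \<Longrightarrow> HS_mu TYPE('n) \<gamma> s \<le> HS_quotient \<gamma> s (u :: real^'n \<Rightarrow> real)"
  unfolding HS_mu_def by (rule cINF_lower[OF quotient_bdd_below])

text \<open>The infimum in multiplied-out form, which also holds for functions that vanish almost
  everywhere and so can be used without checking.\<close>

lemma mu_D12:
  assumes a: "D12_approx \<phi> u G"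
  shows "HS_mu TYPE('n) \<gamma> s * pnorm s (u :: real^'n \<Rightarrow> real) powr (2 / crit_exp TYPE('n) s) \<le> (\<integral>x. (norm (G x))\<^sup>2 \<partial>lborel) - \<gamma> * pnorm 2 u"
proof (cases "pnorm s u = 0")
  case True
  have "0 \<le> (\<integral>x. (norm (G x))\<^sup>2 \<partial>lborel) - \<gamma> * pnorm 2 u"
    by (rule LIMSEQ_le_const[OF energy_limit[OF a]]) (use energy_nonneg a in \<open>auto simp: D12_approx_def\<close>)
  then show ?thesis using True by simp
next
  case False
  then have pos: "pnorm s u > 0" using pnorm_nonneg[of s u] by (simp add: less_le)
  then have "HS_mu TYPE('n) \<gamma> s \<le> HS_quotient \<gamma> s u" using pnorm_pos_iff[OF a] by (intro mu_le) simp
  then show ?thesis using pos by (simp add: quotient_eq[OF a] field_simps)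
qed

lemma mu_test: "\<phi> \<in> T \<Longrightarrow> HS_mu TYPE('n) \<gamma> s * pnorm s \<phi> powr (2 / crit_exp TYPE('n) s) \<le> energy \<gamma> \<phi>"
  using mu_D12[OF D12_approx_test] by (simp add: energy_def dirichlet_def)

text \<open>Quotients converge along an approximating sequence, so test functions already come
  arbitrarily close to the infimum, and homogeneity normalizes them.\<close>

lemma near_minimizer:
  assumes "e > 0"
  shows "\<exists>\<phi>\<in>T. pnorm s \<phi> = 1 \<and> energy \<gamma> \<phi> < HS_mu TYPE('n) \<gamma> s + e"
proof -
  have "\<exists>u\<in>D12_nonzero. HS_quotient \<gamma> s (u :: real^'n \<Rightarrow> real) < HS_mu TYPE('n) \<gamma> s + e"
    using assms unfolding HS_mu_def
    by (subst cINF_less_iff[OF nonzero_exists quotient_bdd_below, symmetric]) simp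
  then obtain u :: "real^'n \<Rightarrow> real" where u: "u \<in> D12_nonzero" "HS_quotient \<gamma> s u < HS_mu TYPE('n) \<gamma> s + e" by blast
  obtain \<phi> G where a: "D12_approx \<phi> u G" using D12_nonzeroE[OF u(1)] by blast
  have pos: "pnorm s u > 0" using pnorm_pos_iff[OF a] u by simp
  have pl: "(\<lambda>k. pnorm s (\<phi> k)) \<longlonglongrightarrow> pnorm s u" by (rule D12_approx_limits(2)[OF n a s(1) s2])
  have "(\<lambda>k. energy \<gamma> (\<phi> k) / pnorm s (\<phi> k) powr (2 / crit_exp TYPE('n) s)) \<longlonglongrightarrow> HS_quotient \<gamma> s u"
    unfolding quotient_eq[OF a] using pos by (intro tendsto_intros energy_limit[OF a] pl) auto
  then have "eventually (\<lambda>k. energy \<gamma> (\<phi> k) / pnorm s (\<phi> k) powr (2 / crit_exp TYPE('n) s) < HS_mu TYPE('n) \<gamma> s + e) sequentially"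
    using u(2) by (intro order_tendstoD)
  moreover have "eventually (\<lambda>k. pnorm s (\<phi> k) > 0) sequentially" using pl pos by (intro order_tendstoD)
  ultimately have "eventually (\<lambda>k. energy \<gamma> (\<phi> k) / pnorm s (\<phi> k) powr (2 / crit_exp TYPE('n) s) < HS_mu TYPE('n) \<gamma> s + e \<and> pnorm s (\<phi> k) > 0) sequentially"
    by eventually_elim simp
  then obtain k where "\<forall>j\<ge>k. energy \<gamma> (\<phi> j) / pnorm s (\<phi> j) powr (2 / crit_exp TYPE('n) s) < HS_mu TYPE('n) \<gamma> s + e \<and> pnorm s (\<phi> j) > 0"
    unfolding eventually_sequentially ..
  then have k: "energy \<gamma> (\<phi> k) / pnorm s (\<phi> k) powr (2 / crit_exp TYPE('n) s) < HS_mu TYPE('n) \<gamma> s + e" "pnorm s (\<phi> k) > 0" by simp_all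
  have t: "\<phi> k \<in> T" using a by (simp add: D12_approx_def)
  \<comment> \<open>Since \<open>pnorm\<close> scales with c to the power \<open>crit_exp\<close>,
    this makes it 1.\<close>
  define c where "c = pnorm s (\<phi> k) powr (- (1 / crit_exp TYPE('n) s))"
  have c: "c > 0" using k by (simp add: c_def)
  have "c powr crit_exp TYPE('n) s = 1 / pnorm s (\<phi> k)" unfolding c_def powr_powr using p k by (simp add: powr_minus_divide)
  then have "pnorm s (\<lambda>x. c * \<phi> k x) = 1" using c k by (simp add: pnorm_cmult)
  moreover have "c\<^sup>2 = 1 / pnorm s (\<phi> k) powr (2 / crit_exp TYPE('n) s)"
  proof -
    have "c\<^sup>2 = c powr 2" using c by simp
    also have "\<dots> = pnorm s (\<phi> k) powr (- (2 / crit_exp TYPE('n) s))" by (simp only: c_def powr_powr) simp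
    finally show ?thesis by (simp only: powr_minus_divide)
  qed
  then have "energy \<gamma> (\<lambda>x. c * \<phi> k x) < HS_mu TYPE('n) \<gamma> s + e" using k by (simp add: energy_cmult[OF n t])
  ultimately show ?thesis using test_functions_cmult[OF t] by blast
qed

lemma minimizing_sequence:
  "\<exists>\<phi>. (\<forall>k. \<phi> k \<in> T \<and> pnorm s (\<phi> k) = 1) \<and> (\<lambda>k. energy \<gamma> (\<phi> k)) \<longlonglongrightarrow> HS_mu TYPE('n) \<gamma> s"
proof -
  have "\<exists>\<phi>. \<forall>k. \<phi> k \<in> T \<and> pnorm s (\<phi> k) = 1 \<and> energy \<gamma> (\<phi> k) < HS_mu TYPE('n) \<gamma> s + inverse (real (Suc k))"
  proof (rule choice, rule allI)
    fix k
    show "\<exists>\<psi>. \<psi> \<in> T \<and> pnorm s \<psi> = 1 \<and> energy \<gamma> \<psi> < HS_mu TYPE('n) \<gamma> s + inverse (real (Suc k))"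
      using near_minimizer[of "inverse (real (Suc k))"] by auto
  qed
  then obtain \<phi> where "\<forall>k. \<phi> k \<in> T \<and> pnorm s (\<phi> k) = 1 \<and> energy \<gamma> (\<phi> k) < HS_mu TYPE('n) \<gamma> s + inverse (real (Suc k))" ..
  then have \<phi>: "\<And>k. \<phi> k \<in> T" "\<And>k. pnorm s (\<phi> k) = 1" "\<And>k. energy \<gamma> (\<phi> k) < HS_mu TYPE('n) \<gamma> s + inverse (real (Suc k))" by auto
  have lower: "HS_mu TYPE('n) \<gamma> s \<le> energy \<gamma> (\<phi> k)" for k using mu_test[OF \<phi>(1)[of k]] \<phi>(2)[of k] by simp
  have "(\<lambda>k. HS_mu TYPE('n) \<gamma> s + inverse (real (Suc k))) \<longlonglongrightarrow> HS_mu TYPE('n) \<gamma> s + 0" by (intro tendsto_intros LIMSEQ_inverse_real_of_nat)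
  then have ub: "(\<lambda>k. HS_mu TYPE('n) \<gamma> s + inverse (real (Suc k))) \<longlonglongrightarrow> HS_mu TYPE('n) \<gamma> s" by simp
  have "(\<lambda>k. energy \<gamma> (\<phi> k)) \<longlonglongrightarrow> HS_mu TYPE('n) \<gamma> s"
    by (rule tendsto_sandwich[OF _ _ tendsto_const ub]) (use lower less_imp_le[OF \<phi>(3)] in simp_all)
  then show ?thesis using \<phi> by blast
qed

lemma attainedI:
  assumes a: "D12_approx \<phi> u G" and pos: "pnorm s (u :: real^'n \<Rightarrow> real) > 0"
    and le: "(\<integral>x. (norm (G x))\<^sup>2 \<partial>lborel) - \<gamma> * pnorm 2 u \<le> HS_mu TYPE('n) \<gamma> s * pnorm s u powr (2 / crit_exp TYPE('n) s)"
  shows "HS_mu_attained TYPE('n) \<gamma> s"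
proof -
  have u: "u \<in> D12_nonzero" using pnorm_pos_iff[OF a] pos by simp
  have "HS_quotient \<gamma> s u \<le> HS_mu TYPE('n) \<gamma> s" using le pos by (simp add: quotient_eq[OF a] field_simps)
  then show ?thesis using mu_le[OF u] u unfolding HS_mu_attained_def by (intro bexI[of _ u]) auto
qed

lemma attainedE:
  assumes "HS_mu_attained TYPE('n) \<gamma> s"
  obtains \<phi> u G where "D12_approx \<phi> (u :: real^'n \<Rightarrow> real) G" "pnorm s u > 0"
    "(\<integral>x. (norm (G x))\<^sup>2 \<partial>lborel) - \<gamma> * pnorm 2 u = HS_mu TYPE('n) \<gamma> s * pnorm s u powr (2 / crit_exp TYPE('n) s)"
proof -
  obtain u :: "real^'n \<Rightarrow> real" where u: "u \<in> D12_nonzero" "HS_quotient \<gamma> s u = HS_mu TYPE('n) \<gamma> s"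
    using assms by (auto simp: HS_mu_attained_def)
  obtain \<phi> G where a: "D12_approx \<phi> u G" using D12_nonzeroE[OF u(1)] by blast
  have pos: "pnorm s u > 0" using pnorm_pos_iff[OF a] u by simp
  show thesis
    by (rule that[OF a pos]) (use u(2) pos in \<open>simp add: quotient_eq[OF a] field_simps\<close>)
qed

end

section \<open>Rellich compactness through averages over cubes\<close>

text \<open>Half-open cubes of side d indexed by integer vectors: an exact partition, so that a
  point lies in one cube only.\<close>

definition cell :: "real \<Rightarrow> int^'n::finite \<Rightarrow> (real^'n) set" where
  "cell d v = {x. \<forall>i. floor (x $ i / d) = v $ i}"

lemma cell_measurable [measurable]: "cell d v \<in> sets borel"
  unfolding cell_def by measurable

lemma emeasure_cell:
  fixes v :: "int^'n::finite"
  assumes d: "d > 0"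
  shows "emeasure lborel (cell d v) = ennreal (d ^ CARD('n))"
proof -
  define a b :: "real^'n" where "a = (\<chi> i. d * of_int (v $ i))" and "b = (\<chi> i. d * of_int (v $ i) + d)"
  have fl: "floor (t / d) = m \<longleftrightarrow> d * of_int m \<le> t \<and> t < d * of_int m + d" for t and m :: int
    using d by (simp add: floor_eq_iff field_simps)
  have "x \<in> cbox a b" if "x \<in> cell d v" for x
  proof -
    have "floor (x $ i / d) = v $ i" for i using that by (simp add: cell_def)
    then have "a $ i \<le> x $ i \<and> x $ i \<le> b $ i" for i by (simp add: fl a_def b_def less_imp_le)
    then show ?thesis by (simp add: mem_box_cart)
  qed
  moreover have "box a b \<subseteq> cell d v"
    by (auto simp: cell_def fl a_def b_def mem_box_cart less_imp_le)
  ultimately have sub: "box a b \<subseteq> cell d v" "cell d v \<subseteq> cbox a b" by auto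
  have ab: "a \<bullet> i \<le> b \<bullet> i" if "i \<in> Basis" for i
    using that d by (auto simp: a_def b_def Basis_vec_def inner_axis)
  have pr: "(\<Prod>i\<in>Basis. (b - a) \<bullet> i) = d ^ CARD('n)"
  proof -
    have "(b - a) \<bullet> i = d" if "i \<in> Basis" for i
      using that by (auto simp: a_def b_def Basis_vec_def inner_axis)
    then have "(\<Prod>i\<in>Basis. (b - a) \<bullet> i) = (\<Prod>i\<in>(Basis::(real^'n) set). d)" by (intro prod.cong) auto
    then show ?thesis by simp
  qed
  have "ennreal (d ^ CARD('n)) \<le> emeasure lborel (cell d v)"
    using emeasure_mono[OF sub(1), of lborel] emeasure_lborel_box[OF ab] pr by simp
  moreover have "emeasure lborel (cell d v) \<le> ennreal (d ^ CARD('n))"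
    using emeasure_mono[OF sub(2), of lborel] emeasure_lborel_cbox[OF ab] pr by simp
  ultimately show ?thesis by (rule antisym[rotated])
qed

lemma cell_diameter:
  fixes x y :: "real^'n::finite"
  assumes "d > 0" "x \<in> cell d v" "y \<in> cell d v"
  shows "norm (y - x) \<le> real CARD('n) * d"
proof -
  have "\<bar>(y - x) $ i\<bar> \<le> d" for i
  proof -
    have "floor (x $ i / d) = floor (y $ i / d)" using assms(2,3) by (simp add: cell_def)
    then have "\<bar>y $ i / d - x $ i / d\<bar> \<le> 1" by linarith
    then have "\<bar>(y $ i - x $ i) / d\<bar> \<le> 1" by (simp add: diff_divide_distrib)
    then show ?thesis using assms(1) by (simp add: abs_divide field_simps)
  qed
  then have "(\<Sum>i\<in>UNIV. \<bar>(y - x) $ i\<bar>) \<le> (\<Sum>i\<in>(UNIV::'n set). d)" by (intro sum_mono)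
  then show ?thesis using norm_le_l1_cart[of "y - x"] by simp
qed

text \<open>The variance identity: the double integral over Q x Q of squared differences is 2 (|Q|
  times the integral of f^2, minus the square of the integral of f). It turns means over cubes into
  increments of f.\<close>

lemma cell_variance:
  fixes f :: "real^'n::finite \<Rightarrow> real"
  assumes fg: "C1c f g" and d: "d > 0"
  shows "(\<integral>\<^sup>+x. \<integral>\<^sup>+y. ennreal ((f y - f x)\<^sup>2) * (indicator (cell d v) x * indicator (cell d v) y) \<partial>lborel \<partial>lborel) =
    ennreal (2 * (d ^ CARD('n) * (\<integral>x. (f x)\<^sup>2 * indicator (cell d v) x \<partial>lborel) - (\<integral>x. f x * indicator (cell d v) x \<partial>lborel)\<^sup>2))"
proof -
  define V where "V = d ^ CARD('n)"
  define A where "A = (\<integral>x. (f x)\<^sup>2 * indicator (cell d v) x \<partial>lborel)"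
  define m where "m = (\<integral>x. f x * indicator (cell d v) x \<partial>lborel)"
  have [measurable]: "f \<in> borel_measurable borel" using C1c_measurable[OF fg] by simp
  have ii: "integrable lborel (indicator (cell d v) :: _ \<Rightarrow> real)"
    using emeasure_cell[OF d, of v] by (intro integrable_real_indicator) auto
  have iV: "(\<integral>x. indicator (cell d v) x \<partial>lborel) = V"
    using emeasure_cell[OF d, of v] d by (simp add: V_def measure_def)
  have i2: "integrable lborel (\<lambda>x. (f x)\<^sup>2 * indicator (cell d v) x)"
    by (intro integrable_real_mult_indicator C1c_integrable_sq[OF fg]) auto
  have i1: "integrable lborel (\<lambda>x. f x * indicator (cell d v) x)"
    using C1c_integrable[OF fg, of "\<lambda>a b. a"]
    by (intro integrable_real_mult_indicator) (auto simp: case_prod_beta continuous_on_fst)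
  have inner: "(\<integral>\<^sup>+y. ennreal ((f y - f x)\<^sup>2) * (indicator (cell d v) x * indicator (cell d v) y) \<partial>lborel)
      = ennreal ((A - 2 * f x * m + V * (f x)\<^sup>2) * indicator (cell d v) x)" for x
  proof -
    have e: "(f y - f x)\<^sup>2 * indicator (cell d v) y = (f y)\<^sup>2 * indicator (cell d v) y - 2 * f x * (f y * indicator (cell d v) y) + (f x)\<^sup>2 * indicator (cell d v) y" for y
      by (simp add: power2_eq_square algebra_simps)
    have "integrable lborel (\<lambda>y. (f y - f x)\<^sup>2 * indicator (cell d v) y)" unfolding e
      by (intro Bochner_Integration.integrable_add Bochner_Integration.integrable_diff integrable_mult_right i2 i1 ii)
    then have "(\<integral>\<^sup>+y. ennreal ((f y - f x)\<^sup>2 * indicator (cell d v) y) \<partial>lborel) = ennreal (\<integral>y. (f y - f x)\<^sup>2 * indicator (cell d v) y \<partial>lborel)"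
      by (intro nn_integral_eq_integral) auto
    also have "(\<integral>y. (f y - f x)\<^sup>2 * indicator (cell d v) y \<partial>lborel) = A - 2 * f x * m + V * (f x)\<^sup>2" unfolding e
      using i1 i2 ii iV by (simp add: A_def m_def)
    finally have "(\<integral>\<^sup>+y. ennreal ((f y - f x)\<^sup>2 * indicator (cell d v) y) \<partial>lborel) = ennreal (A - 2 * f x * m + V * (f x)\<^sup>2)" .
    then show ?thesis by (auto simp: indicator_def ennreal_mult' of_bool_def if_distrib cong: if_cong)
  qed
  have nonneg: "0 \<le> A - 2 * f x * m + V * (f x)\<^sup>2" for x
  proof -
    have e: "(f y - f x)\<^sup>2 * indicator (cell d v) y = (f y)\<^sup>2 * indicator (cell d v) y - 2 * f x * (f y * indicator (cell d v) y) + (f x)\<^sup>2 * indicator (cell d v) y" for y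
      by (simp add: power2_eq_square algebra_simps)
    have "0 \<le> (\<integral>y. (f y - f x)\<^sup>2 * indicator (cell d v) y \<partial>lborel)" by (intro integral_nonneg_AE) auto
    also have "\<dots> = A - 2 * f x * m + V * (f x)\<^sup>2" unfolding e
      using i1 i2 ii iV by (simp add: A_def m_def)
    finally show ?thesis .
  qed
  have e2: "(A - 2 * f x * m + V * (f x)\<^sup>2) * indicator (cell d v) x = A * indicator (cell d v) x - 2 * m * (f x * indicator (cell d v) x) + V * ((f x)\<^sup>2 * indicator (cell d v) x)" for x
    by (simp add: algebra_simps)
  have "integrable lborel (\<lambda>x. (A - 2 * f x * m + V * (f x)\<^sup>2) * indicator (cell d v) x)" unfolding e2
    by (intro Bochner_Integration.integrable_add Bochner_Integration.integrable_diff integrable_mult_right i2 i1 ii)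
  then have "(\<integral>\<^sup>+x. ennreal ((A - 2 * f x * m + V * (f x)\<^sup>2) * indicator (cell d v) x) \<partial>lborel) =
     ennreal (\<integral>x. (A - 2 * f x * m + V * (f x)\<^sup>2) * indicator (cell d v) x \<partial>lborel)"
    using nonneg by (intro nn_integral_eq_integral) (auto simp: indicator_def)
  also have "(\<integral>x. (A - 2 * f x * m + V * (f x)\<^sup>2) * indicator (cell d v) x \<partial>lborel) = A * V - 2 * m * m + V * A"
    unfolding e2 using i1 i2 ii iV by (simp add: A_def m_def)
  also have "\<dots> = 2 * (V * A - m\<^sup>2)" by (simp add: power2_eq_square algebra_simps)
  finally show ?thesis unfolding inner by (simp add: V_def A_def m_def)
qed

lemma sum_cells_pair_le:
  fixes x y :: "real^'n::finite"
  assumes "finite I" "d > 0"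
  shows "(\<Sum>v\<in>I. indicator (cell d v) x * indicator (cell d v) y :: ennreal) \<le> indicator (cball 0 (real CARD('n) * d)) (y - x)"
proof (cases "\<exists>v\<in>I. x \<in> cell d v \<and> y \<in> cell d v")
  case True
  then obtain v where v: "v \<in> I" "x \<in> cell d v" "y \<in> cell d v" by blast
  have "x \<notin> cell d w" if "w \<noteq> v" for w using that v(2) by (auto simp: cell_def vec_eq_iff) metis
  then have "(\<Sum>w\<in>I. indicator (cell d w) x * indicator (cell d w) y :: ennreal) = (\<Sum>w\<in>I. if w = v then 1 else 0)"
    using v by (intro sum.cong) (auto simp: indicator_def)
  also have "\<dots> = 1" using v assms by simp
  also have "\<dots> = indicator (cball 0 (real CARD('n) * d)) (y - x)" using cell_diameter[OF assms(2) v(2,3)] by simp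
  finally show ?thesis by simp
next
  case False
  then have "(\<Sum>w\<in>I. indicator (cell d w) x * indicator (cell d w) y :: ennreal) = 0"
    by (intro sum.neutral) (auto simp: indicator_def)
  then show ?thesis by simp
qed

text \<open>Summed over the cubes, the variances involve only pairs closer than n d. Substituting y
  = x + z and applying the translation estimate for each z bounds them by d^2 times the Dirichlet
  integral; what is left are finitely many means.\<close>

lemma cells_poincare:
  "\<exists>K>0. \<forall>(f::real^'n::finite \<Rightarrow> real) g d I. C1c f g \<longrightarrow> d > 0 \<longrightarrow> finite I \<longrightarrow>
     (\<Sum>v\<in>I. \<integral>x. (f x)\<^sup>2 * indicator (cell d v) x \<partial>lborel) \<le>
       K * d\<^sup>2 * (\<integral>x. (norm (g x))\<^sup>2 \<partial>lborel) + (\<Sum>v\<in>I. (\<integral>x. f x * indicator (cell d v) x \<partial>lborel)\<^sup>2) / d ^ CARD('n)"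
proof -
  let ?n = "CARD('n)"
  define w where "w = unit_ball_vol (real ?n)"
  have w: "w > 0" by (simp add: w_def)
  \<comment> \<open>With L = n d, the volume w L^n times L^2 equals d^n (K d^2); the factor d^n
    cancels against the volume of a cube.\<close>
  define K where "K = w * real ?n ^ ?n * (real ?n)\<^sup>2"
  have K: "K > 0" using w by (simp add: K_def)
  show ?thesis
  proof (intro exI[of _ K] conjI allI impI K)
    fix f :: "real^'n \<Rightarrow> real" and g and d :: real and I :: "(int^'n) set"
    assume fg: "C1c f g" and d: "d > 0" and I: "finite I"
    have [measurable]: "f \<in> borel_measurable borel" using C1c_measurable[OF fg] by simp
    have gi: "integrable lborel (\<lambda>x. (norm (g x))\<^sup>2)" by (rule C1c_integrable_sq[OF fg])
    define E where "E = (\<integral>x. (norm (g x))\<^sup>2 \<partial>lborel)"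
    have E0: "E \<ge> 0" by (simp add: E_def)
    define L where "L = real ?n * d"
    have L: "L > 0" using d by (simp add: L_def)
    define A where "A v = (\<integral>x. (f x)\<^sup>2 * indicator (cell d v) x \<partial>lborel)" for v
    define m where "m v = (\<integral>x. f x * indicator (cell d v) x \<partial>lborel)" for v
    define V where "V = d ^ ?n"
    have V: "V > 0" using d by (simp add: V_def)
    have [measurable]: "cball (0::real^'n) L \<in> sets borel" by simp
    have F: "(\<integral>\<^sup>+x. \<integral>\<^sup>+y. ennreal ((f y - f x)\<^sup>2) * (indicator (cell d v) x * indicator (cell d v) y) \<partial>lborel \<partial>lborel) = ennreal (2 * (V * A v - (m v)\<^sup>2))" for v
      using cell_variance[OF fg d, of v] by (simp add: A_def m_def V_def)
    have nonneg: "0 \<le> V * A v - (m v)\<^sup>2" for v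
    proof -
      \<comment> \<open>Cauchy-Schwarz on one cube, from the nonnegative integral of the square of m
        - V f.\<close>
      have e: "(m v - V * f x)\<^sup>2 * indicator (cell d v) x = (m v)\<^sup>2 * indicator (cell d v) x - 2 * m v * V * (f x * indicator (cell d v) x) + V\<^sup>2 * ((f x)\<^sup>2 * indicator (cell d v) x)" for x
        by (simp add: power2_eq_square algebra_simps)
      have ii: "integrable lborel (indicator (cell d v) :: _ \<Rightarrow> real)"
        using emeasure_cell[OF d, of v] by (intro integrable_real_indicator) auto
      have iV: "(\<integral>x. indicator (cell d v) x \<partial>lborel) = V"
        using emeasure_cell[OF d, of v] d by (simp add: V_def measure_def)
      have i2: "integrable lborel (\<lambda>x. (f x)\<^sup>2 * indicator (cell d v) x)"
        by (intro integrable_real_mult_indicator C1c_integrable_sq[OF fg]) auto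
      have i1: "integrable lborel (\<lambda>x. f x * indicator (cell d v) x)"
        using C1c_integrable[OF fg, of "\<lambda>a b. a"]
        by (intro integrable_real_mult_indicator) (auto simp: case_prod_beta continuous_on_fst)
      have "0 \<le> (\<integral>x. (m v - V * f x)\<^sup>2 * indicator (cell d v) x \<partial>lborel)" by (intro integral_nonneg_AE) auto
      also have "\<dots> = (m v)\<^sup>2 * V - 2 * m v * V * m v + V\<^sup>2 * A v"
        unfolding e using ii iV i2 i1 by (simp add: A_def m_def)
      also have "\<dots> = V * (V * A v - (m v)\<^sup>2)" by (simp add: power2_eq_square algebra_simps)
      finally show ?thesis using V by (simp add: zero_le_mult_iff)
    qed
    have "ennreal (\<Sum>v\<in>I. 2 * (V * A v - (m v)\<^sup>2)) = (\<Sum>v\<in>I. ennreal (2 * (V * A v - (m v)\<^sup>2)))"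
      using nonneg by (intro sum_ennreal[symmetric]) auto
    also have "\<dots> = (\<Sum>v\<in>I. (\<integral>\<^sup>+x. \<integral>\<^sup>+y. ennreal ((f y - f x)\<^sup>2) * (indicator (cell d v) x * indicator (cell d v) y) \<partial>lborel \<partial>lborel))"
      by (simp add: F)
    also have "\<dots> = (\<integral>\<^sup>+x. (\<Sum>v\<in>I. \<integral>\<^sup>+y. ennreal ((f y - f x)\<^sup>2) * (indicator (cell d v) x * indicator (cell d v) y) \<partial>lborel) \<partial>lborel)"
      by (rule nn_integral_sum[symmetric]) measurable
    also have "\<dots> = (\<integral>\<^sup>+x. \<integral>\<^sup>+y. (\<Sum>v\<in>I. ennreal ((f y - f x)\<^sup>2) * (indicator (cell d v) x * indicator (cell d v) y)) \<partial>lborel \<partial>lborel)"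
      by (intro nn_integral_cong nn_integral_sum[symmetric]) measurable
    also have "\<dots> \<le> (\<integral>\<^sup>+x. \<integral>\<^sup>+y. ennreal ((f y - f x)\<^sup>2) * indicator (cball 0 L) (y - x) \<partial>lborel \<partial>lborel)"
      unfolding sum_distrib_left[symmetric] L_def
      by (intro nn_integral_mono mult_left_mono sum_cells_pair_le I d) auto
    also have "\<dots> = (\<integral>\<^sup>+x. \<integral>\<^sup>+z. ennreal ((f (x + z) - f x)\<^sup>2) * indicator (cball 0 L) z \<partial>lborel \<partial>lborel)"
    proof (rule nn_integral_cong)
      fix x :: "real^'n"
      show "(\<integral>\<^sup>+y. ennreal ((f y - f x)\<^sup>2) * indicator (cball 0 L) (y - x) \<partial>lborel) = (\<integral>\<^sup>+z. ennreal ((f (x + z) - f x)\<^sup>2) * indicator (cball 0 L) z \<partial>lborel)"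
        by (subst nn_integral_translate[symmetric, where t=x]) (auto simp: add.commute)
    qed
    also have "\<dots> = (\<integral>\<^sup>+z. \<integral>\<^sup>+x. ennreal ((f (x + z) - f x)\<^sup>2) * indicator (cball 0 L) z \<partial>lborel \<partial>lborel)"
      by (rule lborel_pair.Fubini') measurable
    also have "\<dots> = (\<integral>\<^sup>+(z::real^'n). (\<integral>\<^sup>+x. ennreal ((f (x + z) - f x)\<^sup>2) \<partial>lborel) * indicator (cball 0 L) z \<partial>lborel)"
      by (simp add: nn_integral_multc)
    also have "\<dots> \<le> (\<integral>\<^sup>+(z::real^'n). ennreal (L\<^sup>2 * E) * indicator (cball 0 L) z \<partial>lborel)"
    proof (intro nn_integral_mono)
      fix z :: "real^'n"
      have "(\<integral>\<^sup>+x. ennreal ((f (x + z) - f x)\<^sup>2) \<partial>lborel) \<le> ennreal (L\<^sup>2 * E)" if "norm z \<le> L"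
      proof -
        have "(norm z)\<^sup>2 \<le> L\<^sup>2" using that by (intro power_mono) auto
        have "(\<integral>\<^sup>+x. ennreal ((f (x + z) - f x)\<^sup>2) \<partial>lborel) \<le> ennreal ((norm z)\<^sup>2) * ennreal E"
          using C1c_translation_estimate[OF fg, of z] gi by (simp add: nn_integral_eq_integral E_def)
        also have "\<dots> = ennreal ((norm z)\<^sup>2 * E)" using E0 by (intro ennreal_mult[symmetric]) auto
        also have "\<dots> \<le> ennreal (L\<^sup>2 * E)" using \<open>(norm z)\<^sup>2 \<le> L\<^sup>2\<close> E0 by (intro ennreal_leI mult_right_mono) auto
        finally show ?thesis .
      qed
      then show "(\<integral>\<^sup>+x. ennreal ((f (x + z) - f x)\<^sup>2) \<partial>lborel) * indicator (cball 0 L) z \<le> ennreal (L\<^sup>2 * E) * indicator (cball 0 L) z"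
        by (auto simp: indicator_def)
    qed
    also have "\<dots> = ennreal (L\<^sup>2 * E) * ennreal (w * L ^ ?n)"
      using emeasure_cball[of L "0::real^'n"] L by (subst nn_integral_cmult_indicator) (auto simp: w_def)
    also have "\<dots> = ennreal (L\<^sup>2 * E * (w * L ^ ?n))" using L w E0 by (intro ennreal_mult[symmetric]) auto
    finally have "(\<Sum>v\<in>I. 2 * (V * A v - (m v)\<^sup>2)) \<le> L\<^sup>2 * E * (w * L ^ ?n)"
      using L w E0 by (subst (asm) ennreal_le_iff) auto
    also have "\<dots> = V * (K * d\<^sup>2 * E)" by (simp add: L_def K_def V_def power_mult_distrib)
    finally have "2 * (V * (\<Sum>v\<in>I. A v) - (\<Sum>v\<in>I. (m v)\<^sup>2)) \<le> V * (K * d\<^sup>2 * E)"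
      by (simp add: sum_subtractf sum_distrib_left[symmetric])
    moreover have "0 \<le> V * (K * d\<^sup>2 * E)" using V K E0 by simp
    moreover have "X \<le> Y + M" if "2 * (X - M) \<le> Y" "0 \<le> Y" for X Y M :: real
    proof -
      have "X - M \<le> Y / 2" using that(1) by simp
      moreover have "Y / 2 \<le> Y" using that(2) by simp
      ultimately have "X - M \<le> Y" by (rule order_trans)
      then show ?thesis by simp
    qed
    ultimately have "V * (\<Sum>v\<in>I. A v) \<le> V * (K * d\<^sup>2 * E) + (\<Sum>v\<in>I. (m v)\<^sup>2)" by blast
    then have "(\<Sum>v\<in>I. A v) \<le> (V * (K * d\<^sup>2 * E) + (\<Sum>v\<in>I. (m v)\<^sup>2)) / V" using V by (simp add: field_simps)
    also have "\<dots> = K * d\<^sup>2 * E + (\<Sum>v\<in>I. (m v)\<^sup>2) / V" using V by (simp add: add_divide_distrib)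
    finally show "(\<Sum>v\<in>I. \<integral>x. (f x)\<^sup>2 * indicator (cell d v) x \<partial>lborel) \<le>
       K * d\<^sup>2 * (\<integral>x. (norm (g x))\<^sup>2 \<partial>lborel) + (\<Sum>v\<in>I. (\<integral>x. f x * indicator (cell d v) x \<partial>lborel)\<^sup>2) / d ^ ?n"
      by (simp add: A_def m_def V_def E_def)
  qed
qed

lemma finite_cells_meeting_ball:
  assumes "d > 0"
  shows "\<exists>I. finite I \<and> (\<forall>x::real^'n::finite. norm x \<le> R \<longrightarrow> (\<exists>v\<in>I. x \<in> cell d v))"
proof -
  define M where "M = nat (ceiling (\<bar>R\<bar> / d)) + 1"
  define I where "I = (\<lambda>f. \<chi> i. f i) ` (Pi\<^sub>E (UNIV :: 'n set) (\<lambda>_. {- int M .. int M}))"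
  have "finite I" unfolding I_def by (intro finite_imageI finite_PiE) auto
  moreover have "\<exists>v\<in>I. x \<in> cell d v" if x: "norm x \<le> R" for x :: "real^'n"
  proof
    show "x \<in> cell d (\<chi> i. floor (x $ i / d))" by (simp add: cell_def)
    have "floor (x $ i / d) \<in> {- int M .. int M}" for i
    proof -
      have "\<bar>x $ i\<bar> \<le> \<bar>R\<bar>" using component_le_norm_cart[of x i] x by linarith
      then have "\<bar>x $ i / d\<bar> \<le> \<bar>R\<bar> / d" using assms by (simp add: abs_divide divide_right_mono)
      moreover have "\<bar>R\<bar> / d \<le> real M - 1" unfolding M_def using real_nat_ceiling_ge[of "\<bar>R\<bar> / d"] by simp
      ultimately have "- real M \<le> x $ i / d" "x $ i / d \<le> real M" by linarith+
      then show ?thesis by (simp add: le_floor_iff floor_le_iff) 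
    qed
    then show "(\<chi> i. floor (x $ i / d)) \<in> I" unfolding I_def by (intro imageI) (auto simp: PiE_def)
  qed
  ultimately show ?thesis by blast
qed

text \<open>Pairs of a dyadic scale and a cube form a countable set, so one subsequence makes all
  the means converge. The Poincare bound then makes the L^2 distance on a ball small: first the
  scale is fixed, then the finitely many means settle.\<close>

lemma rellich_Cauchy:
  fixes \<phi> :: "nat \<Rightarrow> real^'n::finite \<Rightarrow> real"
  assumes n: "CARD('n) \<ge> 3" and t: "\<And>k. \<phi> k \<in> test_functions" and B: "\<And>k. dirichlet (\<phi> k) \<le> B"
  shows "\<exists>r::nat \<Rightarrow> nat. strict_mono r \<and> (\<forall>R. \<forall>e>0. \<exists>N. \<forall>k\<ge>N. \<forall>l\<ge>N.
     (\<integral>x. (\<phi> (r k) x - \<phi> (r l) x)\<^sup>2 * indicator (cball 0 R) x \<partial>lborel) \<le> e)"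
proof -
  define q where "q = crit_exp TYPE('n) 0"
  have q: "q \<ge> 1" using crit_exp_gt2(1)[OF n, of 0] by (simp add: q_def)
  have B0: "B \<ge> 0" using B[of 0] dirichlet_nonneg[of "\<phi> 0"] by linarith
  note [measurable] = test_functions_measurable[OF t]
  obtain C where C: "C > 0" "\<And>\<phi> :: real^'n \<Rightarrow> real. \<phi> \<in> test_functions \<Longrightarrow> pnorm 0 \<phi> \<le> C * dirichlet \<phi> powr (q / 2)"
    using hardy_sobolev_test[OF n, of 0] unfolding q_def by auto
  have pn: "pnorm 0 \<psi> = (\<integral>x. \<bar>\<psi> x\<bar> powr q \<partial>lborel)" if "\<psi> \<in> test_functions" for \<psi> :: "real^'n \<Rightarrow> real"
  proof -
    note [measurable] = test_functions_measurable[OF that]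
    have "AE x in lborel. x \<noteq> (0::real^'n)" by (rule AE_lborel_singleton)
    then show ?thesis unfolding pnorm_def q_def
      by (subst integral_hs_measure) (auto intro!: integral_cong_AE elim!: eventually_mono)
  qed
  have qi: "integrable lborel (\<lambda>x. \<bar>\<psi> x\<bar> powr q)" if "\<psi> \<in> test_functions" for \<psi> :: "real^'n \<Rightarrow> real"
  proof -
    have "continuous_on UNIV (\<lambda>z::real \<times> (real^'n). \<bar>fst z\<bar> powr q)"
      using q by (intro continuous_on_powr' continuous_intros) auto
    then show ?thesis
      using C1c_integrable[OF test_functions_C1c[OF that], of "\<lambda>a b. \<bar>a\<bar> powr q"] by (simp add: case_prod_beta)
  qed
  define \<delta> where "\<delta> j = (1/2::real) ^ j" for j :: nat
  have \<delta>: "\<delta> j > 0" "\<delta> j \<le> 1" for j by (auto simp: \<delta>_def power_le_one)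
  define m where "m k z = (\<integral>x. \<phi> k x * indicator (cell (\<delta> (fst z)) (snd z)) x \<partial>lborel)" for k and z :: "nat \<times> (int^'n)"
  have i1: "integrable lborel (\<lambda>x. \<psi> x * indicator (cell d v) x)" if "\<psi> \<in> test_functions" for \<psi> :: "real^'n \<Rightarrow> real" and d v
    using C1c_integrable[OF test_functions_C1c[OF that], of "\<lambda>a b. a"]
    by (intro integrable_real_mult_indicator) (auto simp: case_prod_beta continuous_on_fst)
  \<comment> \<open>Boundedness of the means uniformly in scale and cube, from t \<le> 1 + t^q and
    the Sobolev bound; the volume of a cube is at most 1.\<close>
  have mb: "norm (m k z) \<le> 1 + C * B powr (q / 2)" for k z
  proof -
    let ?Q = "cell (\<delta> (fst z)) (snd z)"
    have ii: "integrable lborel (indicator ?Q :: _ \<Rightarrow> real)"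
      using emeasure_cell[OF \<delta>(1)[of "fst z"], of "snd z"] by (intro integrable_real_indicator) auto
    have iV: "(\<integral>x. indicator ?Q x \<partial>lborel) = \<delta> (fst z) ^ CARD('n)"
      using emeasure_cell[OF \<delta>(1)[of "fst z"], of "snd z"] \<delta>(1)[of "fst z"] by (simp add: measure_def)
    have "norm (m k z) \<le> (\<integral>x. \<bar>\<phi> k x * indicator ?Q x\<bar> \<partial>lborel)" unfolding m_def real_norm_def by (rule integral_abs_bound)
    also have "\<dots> \<le> (\<integral>x. indicator ?Q x + \<bar>\<phi> k x\<bar> powr q \<partial>lborel)"
    proof (intro integral_mono Bochner_Integration.integrable_add integrable_abs ii qi t i1)
      show "\<bar>\<phi> k x * indicator ?Q x\<bar> \<le> indicator ?Q x + \<bar>\<phi> k x\<bar> powr q" for x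
        using le_eps_plus_powr[of "\<bar>\<phi> k x\<bar>" 1 q] q by (auto simp: indicator_def)
    qed
    also have "\<dots> = \<delta> (fst z) ^ CARD('n) + pnorm 0 (\<phi> k)" using ii qi[OF t] iV by (simp add: pn[OF t])
    also have "\<dots> \<le> 1 + C * dirichlet (\<phi> k) powr (q / 2)"
      using \<delta>[of "fst z"] by (intro add_mono C(2) t power_le_one) auto
    also have "\<dots> \<le> 1 + C * B powr (q / 2)" using C(1) q B by (intro add_left_mono mult_left_mono powr_mono2) auto
    finally show ?thesis .
  qed
  obtain r where r: "strict_mono r" "\<And>z. \<exists>l. (\<lambda>k. m (r k) z) \<longlonglongrightarrow> l"
    using function_convergent_subsequence[of UNIV m "1 + C * B powr (q / 2)", OF countableI_type mb] by auto
  obtain K where K: "K > 0" and P: "\<And>(f::real^'n \<Rightarrow> real) g d I. C1c f g \<Longrightarrow> d > 0 \<Longrightarrow> finite I \<Longrightarrow>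
     (\<Sum>v\<in>I. \<integral>x. (f x)\<^sup>2 * indicator (cell d v) x \<partial>lborel) \<le>
       K * d\<^sup>2 * (\<integral>x. (norm (g x))\<^sup>2 \<partial>lborel) + (\<Sum>v\<in>I. (\<integral>x. f x * indicator (cell d v) x \<partial>lborel)\<^sup>2) / d ^ CARD('n)"
    using cells_poincare by blast
  have dd: "dirichlet (\<lambda>x. \<phi> k x - \<phi> l x) \<le> 4 * B" for k l
  proof -
    have "dirichlet (\<lambda>x. \<phi> k x - \<phi> l x) \<le> (\<integral>x. 2 * (norm (grad (\<phi> k) x))\<^sup>2 + 2 * (norm (grad (\<phi> l) x))\<^sup>2 \<partial>lborel)"
      unfolding dirichlet_def grad_diff[OF t t]
    proof (intro integral_mono Bochner_Integration.integrable_add integrable_mult_right C1c_integrable_sq(2)[OF test_functions_C1c[OF t]])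
      show "integrable lborel (\<lambda>x. (norm (grad (\<phi> k) x - grad (\<phi> l) x))\<^sup>2)"
        using C1c_integrable_sq(2)[OF test_functions_C1c[OF test_functions_diff[OF t[of k] t[of l]]]] by (simp add: grad_diff[OF t t])
      fix x
      have "(norm (a - b))\<^sup>2 \<le> 2 * (norm a)\<^sup>2 + 2 * (norm b)\<^sup>2" for a b :: "real^'n"
      proof -
        have "2 * (norm a)\<^sup>2 + 2 * (norm b)\<^sup>2 = (norm (a - b))\<^sup>2 + (norm (a + b))\<^sup>2"
          unfolding power2_norm_eq_inner
          by (simp add: inner_add_left inner_add_right inner_diff_left inner_diff_right inner_commute)
        then show ?thesis by simp
      qed
      then show "(norm (grad (\<phi> k) x - grad (\<phi> l) x))\<^sup>2 \<le> 2 * (norm (grad (\<phi> k) x))\<^sup>2 + 2 * (norm (grad (\<phi> l) x))\<^sup>2" .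
    qed
    also have "\<dots> = 2 * dirichlet (\<phi> k) + 2 * dirichlet (\<phi> l)"
      by (simp add: dirichlet_def C1c_integrable_sq(2)[OF test_functions_C1c[OF t]])
    finally show ?thesis using B[of k] B[of l] by linarith
  qed
  have "\<exists>N. \<forall>k\<ge>N. \<forall>l\<ge>N. (\<integral>x. (\<phi> (r k) x - \<phi> (r l) x)\<^sup>2 * indicator (cball 0 R) x \<partial>lborel) \<le> e" if e: "e > 0" for R e
  proof -
    \<comment> \<open>The squared side length is 4^-j, and differences of members have Dirichlet
      integral at most 4B.\<close>
    have "(\<lambda>j. K * ((1/4) ^ j) * (4 * B)) \<longlonglongrightarrow> K * 0 * (4 * B)"
      by (intro tendsto_intros LIMSEQ_power_zero) auto
    then have "eventually (\<lambda>j. K * ((1/4) ^ j) * (4 * B) < e / 2) sequentially" using e by (intro order_tendstoD) auto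
    then obtain j where j: "K * ((1/4) ^ j) * (4 * B) < e / 2" by (auto simp: eventually_sequentially)
    have "(\<delta> j)\<^sup>2 = ((1/2) * (1/2)) ^ j" unfolding \<delta>_def power2_eq_square by (rule power_mult_distrib[symmetric])
    then have dj: "(\<delta> j)\<^sup>2 = (1/4) ^ j" by simp
    obtain I where I: "finite I" "\<And>x::real^'n. norm x \<le> R \<Longrightarrow> \<exists>v\<in>I. x \<in> cell (\<delta> j) v"
    proof -
      have "\<exists>I. finite I \<and> (\<forall>x::real^'n. norm x \<le> R \<longrightarrow> (\<exists>v\<in>I. x \<in> cell (\<delta> j) v))"
        by (rule finite_cells_meeting_ball[OF \<delta>(1)])
      then obtain I where I: "finite I" "\<forall>x::real^'n. norm x \<le> R \<longrightarrow> (\<exists>v\<in>I. x \<in> cell (\<delta> j) v)" by (elim exE conjE)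
      show thesis by (rule that[OF I(1)]) (rule I(2)[rule_format])
    qed
    define F where "F k l = (\<Sum>v\<in>I. (m (r k) (j, v) - m (r l) (j, v))\<^sup>2)" for k l
    have "\<exists>N. \<forall>k\<ge>N. \<forall>l\<ge>N. F k l \<le> e / 2 * \<delta> j ^ CARD('n)"
    proof -
      define L where "L v = lim (\<lambda>k. m (r k) (j, v))" for v
      have L: "(\<lambda>k. m (r k) (j, v)) \<longlonglongrightarrow> L v" for v
        unfolding L_def convergent_LIMSEQ_iff[symmetric] convergent_def by (rule r(2))
      define d where "d = e / 2 * \<delta> j ^ CARD('n)"
      have d: "d > 0" using e \<delta>(1)[of j] by (simp add: d_def)
      have "(\<lambda>k. \<Sum>v\<in>I. (m (r k) (j, v) - L v)\<^sup>2) \<longlonglongrightarrow> (\<Sum>v\<in>I. (L v - L v)\<^sup>2)" by (intro tendsto_intros L)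
      then have "eventually (\<lambda>k. (\<Sum>v\<in>I. (m (r k) (j, v) - L v)\<^sup>2) < d / 4) sequentially" using d by (intro order_tendstoD) auto
      then obtain N where N: "\<And>k. k \<ge> N \<Longrightarrow> (\<Sum>v\<in>I. (m (r k) (j, v) - L v)\<^sup>2) < d / 4" by (auto simp: eventually_sequentially)
      have "F k l \<le> d" if kl: "k \<ge> N" "l \<ge> N" for k l
      proof -
        have "F k l \<le> (\<Sum>v\<in>I. 2 * (m (r k) (j, v) - L v)\<^sup>2 + 2 * (m (r l) (j, v) - L v)\<^sup>2)" unfolding F_def
        proof (rule sum_mono)
          fix v
          have "(a - b)\<^sup>2 \<le> 2 * (a - c)\<^sup>2 + 2 * (b - c)\<^sup>2" for a b c :: real
            using zero_le_power2[of "a + b - 2 * c"] by (simp add: power2_eq_square algebra_simps)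
          then show "(m (r k) (j, v) - m (r l) (j, v))\<^sup>2 \<le> 2 * (m (r k) (j, v) - L v)\<^sup>2 + 2 * (m (r l) (j, v) - L v)\<^sup>2" .
        qed
        also have "\<dots> = 2 * (\<Sum>v\<in>I. (m (r k) (j, v) - L v)\<^sup>2) + 2 * (\<Sum>v\<in>I. (m (r l) (j, v) - L v)\<^sup>2)"
          by (simp add: sum.distrib sum_distrib_left)
        finally show ?thesis using N[OF kl(1)] N[OF kl(2)] by linarith
      qed
      then show ?thesis unfolding d_def by blast
    qed
    then obtain N where N: "\<And>k l. k \<ge> N \<Longrightarrow> l \<ge> N \<Longrightarrow> F k l \<le> e / 2 * \<delta> j ^ CARD('n)" by blast
    have "(\<integral>x. (\<phi> (r k) x - \<phi> (r l) x)\<^sup>2 * indicator (cball 0 R) x \<partial>lborel) \<le> e" if kl: "k \<ge> N" "l \<ge> N" for k l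
    proof -
      define f where "f x = \<phi> (r k) x - \<phi> (r l) x" for x
      have ft: "f \<in> test_functions" unfolding f_def[abs_def] by (intro test_functions_diff t)
      have fg: "C1c f (grad f)" by (rule test_functions_C1c[OF ft])
      have fi: "integrable lborel (\<lambda>x. (f x)\<^sup>2)" by (rule C1c_integrable_sq[OF fg])
      have "(\<integral>x. (f x)\<^sup>2 * indicator (cball 0 R) x \<partial>lborel) \<le> (\<integral>x. (\<Sum>v\<in>I. (f x)\<^sup>2 * indicator (cell (\<delta> j) v) x) \<partial>lborel)"
      proof (intro integral_mono Bochner_Integration.integrable_sum integrable_real_mult_indicator fi)
        fix x
        show "(f x)\<^sup>2 * indicator (cball 0 R) x \<le> (\<Sum>v\<in>I. (f x)\<^sup>2 * indicator (cell (\<delta> j) v) x)"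
        proof (cases "norm x \<le> R")
          case True
          then obtain v where v: "v \<in> I" "x \<in> cell (\<delta> j) v" using I(2) by blast
          have "(f x)\<^sup>2 * indicator (cell (\<delta> j) v) x \<le> (\<Sum>v\<in>I. (f x)\<^sup>2 * indicator (cell (\<delta> j) v) x)"
            by (rule member_le_sum[OF v(1) _ I(1)]) auto
          then show ?thesis using v True by simp
        next
          case False then show ?thesis by (simp add: sum_nonneg)
        qed
      qed auto
      also have "\<dots> = (\<Sum>v\<in>I. \<integral>x. (f x)\<^sup>2 * indicator (cell (\<delta> j) v) x \<partial>lborel)"
        by (intro Bochner_Integration.integral_sum integrable_real_mult_indicator fi) auto
      also have "\<dots> \<le> K * (\<delta> j)\<^sup>2 * dirichlet f + (\<Sum>v\<in>I. (\<integral>x. f x * indicator (cell (\<delta> j) v) x \<partial>lborel)\<^sup>2) / \<delta> j ^ CARD('n)"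
        using P[OF fg \<delta>(1) I(1)] by (simp add: dirichlet_def)
      also have "(\<Sum>v\<in>I. (\<integral>x. f x * indicator (cell (\<delta> j) v) x \<partial>lborel)\<^sup>2) = F k l"
        by (simp add: F_def m_def f_def left_diff_distrib i1 t)
      also have "K * (\<delta> j)\<^sup>2 * dirichlet f + F k l / \<delta> j ^ CARD('n) \<le> e / 2 + e / 2"
      proof (intro add_mono)
        have "K * (\<delta> j)\<^sup>2 * dirichlet f \<le> K * (\<delta> j)\<^sup>2 * (4 * B)"
          unfolding f_def[abs_def] using K by (intro mult_left_mono dd) auto
        then show "K * (\<delta> j)\<^sup>2 * dirichlet f \<le> e / 2" using j unfolding dj by linarith
        show "F k l / \<delta> j ^ CARD('n) \<le> e / 2" using N[OF kl] \<delta>(1)[of j] by (simp add: field_simps)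
      qed
      finally show ?thesis by (simp add: f_def)
    qed
    then show ?thesis by blast
  qed
  then show ?thesis using r(1) by blast
qed

theorem rellich:
  fixes \<phi> :: "nat \<Rightarrow> real^'n::finite \<Rightarrow> real"
  assumes n: "CARD('n) \<ge> 3" and t: "\<And>k. \<phi> k \<in> test_functions" and B: "\<And>k. dirichlet (\<phi> k) \<le> B"
  shows "\<exists>(r::nat \<Rightarrow> nat) u. strict_mono r \<and> u \<in> borel_measurable borel \<and> (AE x in lborel. (\<lambda>k. \<phi> (r k) x) \<longlonglongrightarrow> u x) \<and>
     (\<forall>R. (\<lambda>k. \<integral>\<^sup>+x. ennreal ((\<phi> (r k) x - u x)\<^sup>2) * indicator (cball 0 R) x \<partial>lborel) \<longlonglongrightarrow> 0)"
proof -
  note [measurable] = test_functions_measurable[OF t]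
  obtain r :: "nat \<Rightarrow> nat" where r: "strict_mono r" and C: "\<And>R e. e > 0 \<Longrightarrow> \<exists>N. \<forall>k\<ge>N. \<forall>l\<ge>N.
     (\<integral>x. (\<phi> (r k) x - \<phi> (r l) x)\<^sup>2 * indicator (cball 0 R) x \<partial>lborel) \<le> e"
    using rellich_Cauchy[of \<phi> B, OF n t B] by blast
  have nn: "(\<integral>\<^sup>+x. ennreal ((\<phi> k x - \<phi> l x)\<^sup>2) * indicator (cball 0 R) x \<partial>lborel) = ennreal (\<integral>x. (\<phi> k x - \<phi> l x)\<^sup>2 * indicator (cball 0 R) x \<partial>lborel)" for k l R
  proof -
    have "integrable lborel (\<lambda>x. (\<phi> k x - \<phi> l x)\<^sup>2)"
      using C1c_integrable_sq(1)[OF test_functions_C1c[OF test_functions_diff[OF t[of k] t[of l]]]] .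
    then have "integrable lborel (\<lambda>x. (\<phi> k x - \<phi> l x)\<^sup>2 * indicator (cball 0 R) x)"
      by (intro integrable_real_mult_indicator) auto
    then have "(\<integral>\<^sup>+x. ennreal ((\<phi> k x - \<phi> l x)\<^sup>2 * indicator (cball 0 R) x) \<partial>lborel) = ennreal (\<integral>x. (\<phi> k x - \<phi> l x)\<^sup>2 * indicator (cball 0 R) x \<partial>lborel)"
      by (intro nn_integral_eq_integral) auto
    then show ?thesis by (simp add: ennreal_mult' ennreal_indicator)
  qed
  have Cnn: "\<exists>N. \<forall>k\<ge>N. \<forall>l\<ge>N. (\<integral>\<^sup>+x. ennreal ((\<phi> (r k) x - \<phi> (r l) x)\<^sup>2) * indicator (cball 0 R) x \<partial>lborel) \<le> ennreal e"
    if "e > 0" for R e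
    unfolding nn using C[OF that, of R] that by (simp add: ennreal_le_iff)
  have "\<exists>r' u. strict_mono r' \<and> u \<in> borel_measurable lborel \<and> (AE x in lborel. (\<lambda>k. \<phi> (r (r' k)) x) \<longlonglongrightarrow> u x)"
  proof (rule L2loc_Cauchy_AE_subseq[where A="\<lambda>j. cball 0 (real j)" and f="\<lambda>k. \<phi> (r k)"])
    show "\<exists>j. \<forall>i\<ge>j. x \<in> cball 0 (real i)" for x :: "real^'n"
    proof (intro exI[of _ "nat (ceiling (norm x))"] allI impI)
      fix i assume "nat (ceiling (norm x)) \<le> i"
      then have "norm x \<le> real i" using real_nat_ceiling_ge[of "norm x"] by linarith
      then show "x \<in> cball 0 (real i)" by simp
    qed
  qed (use Cnn in auto)
  then obtain r' u where u: "strict_mono r'" "u \<in> borel_measurable borel" "AE x in lborel. (\<lambda>k. \<phi> (r (r' k)) x) \<longlonglongrightarrow> u x" by auto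
  note [measurable] = u(2)
  have L: "(\<lambda>k. \<integral>\<^sup>+x. ennreal ((\<phi> (r k) x - u x)\<^sup>2) * indicator (cball 0 R) x \<partial>lborel) \<longlonglongrightarrow> 0" for R
  proof -
    \<comment> \<open>Restricting the measure to the ball makes the local statement an instance of
      the global \<open>Lq_Cauchy_Fatou\<close>.\<close>
    let ?M = "density lborel (indicator (cball (0::real^'n) R))"
    have ind: "(indicator (cball (0::real^'n) R) :: _ \<Rightarrow> ennreal) \<in> borel_measurable borel"
      by (intro borel_measurable_indicator) simp
    have d: "(\<integral>\<^sup>+x. ennreal (norm (f x) powr 2) \<partial>?M) = (\<integral>\<^sup>+x. ennreal ((f x)\<^sup>2) * indicator (cball 0 R) x \<partial>lborel)"
      if "f \<in> borel_measurable borel" for f :: "real^'n \<Rightarrow> real"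
      using that ind norm_powr_2[of "f _"] by (subst nn_integral_density) (auto simp: mult.commute)
    have "(\<lambda>k. \<integral>\<^sup>+x. ennreal (norm (\<phi> (r k) x - u x) powr 2) \<partial>?M) \<longlonglongrightarrow> 0"
    proof (rule Lq_Cauchy_Fatou[OF _ _ _ _ u(1)])
      show "AE x in ?M. (\<lambda>k. \<phi> (r (r' k)) x) \<longlonglongrightarrow> u x"
        using u(3) ind by (subst AE_density) (auto elim: eventually_mono)
      show "\<exists>N. \<forall>k\<ge>N. \<forall>l\<ge>N. (\<integral>\<^sup>+x. ennreal (norm (\<phi> (r k) x - \<phi> (r l) x) powr 2) \<partial>?M) \<le> ennreal e" if "e > 0" for e
        using Cnn[OF that, of R] by (subst d) auto
    qed auto
    then show ?thesis by (subst (asm) d) auto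
  qed
  show ?thesis
  proof (intro exI conjI allI)
    show "strict_mono (r \<circ> r')" using r u(1) by (rule strict_mono_o)
    show "u \<in> borel_measurable borel" by (rule u(2))
    show "AE x in lborel. (\<lambda>k. \<phi> ((r \<circ> r') k) x) \<longlonglongrightarrow> u x" using u(3) by simp
    show "(\<lambda>k. \<integral>\<^sup>+x. ennreal ((\<phi> ((r \<circ> r') k) x - u x)\<^sup>2) * indicator (cball 0 R) x \<partial>lborel) \<longlonglongrightarrow> 0" for R
      using LIMSEQ_subseq_LIMSEQ[OF L u(1), of R] by (simp add: o_def)
  qed
qed

section \<open>Convex hulls of tails and the dichotomy\<close>

text \<open>The convex hull of \<open>U k\<close> for k \<ge> N, generated by binary combinations so
  that inherited properties follow by rule induction.\<close>

inductive_set conv_tail :: "(nat \<Rightarrow> 'a \<Rightarrow> real) \<Rightarrow> nat \<Rightarrow> ('a \<Rightarrow> real) set" for U N where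
  base: "k \<ge> N \<Longrightarrow> U k \<in> conv_tail U N"
| step: "v \<in> conv_tail U N \<Longrightarrow> w \<in> conv_tail U N \<Longrightarrow> 0 \<le> t \<Longrightarrow> t \<le> 1 \<Longrightarrow>
    (\<lambda>x. (1 - t) * v x + t * w x) \<in> conv_tail U N"

lemma conv_tail_mono: "v \<in> conv_tail U M \<Longrightarrow> N \<le> M \<Longrightarrow> v \<in> conv_tail U N"
  by (induction rule: conv_tail.induct) (auto intro: conv_tail.intros)

lemma conv_tail_test:
  fixes U :: "nat \<Rightarrow> real^'n::finite \<Rightarrow> real"
  assumes "v \<in> conv_tail U N" "\<And>k. U k \<in> test_functions"
  shows "v \<in> test_functions"
  using assms(1)
proof induction
  case (step v w t)
  then show ?case by (intro test_functions_add test_functions_cmult) auto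
qed (rule assms)

text \<open>Intervals are convex: wherever \<open>U\<close> converges, elements of ever later hulls
  converge to the same value.\<close>

lemma conv_tail_pointwise:
  assumes "v \<in> conv_tail U N" "\<And>k. k \<ge> N \<Longrightarrow> \<bar>U k x - c\<bar> \<le> e"
  shows "\<bar>v x - c\<bar> \<le> e"
  using assms(1)
proof induction
  case (step v w t)
  have "\<bar>(1 - t) * v x + t * w x - c\<bar> = \<bar>(1 - t) * (v x - c) + t * (w x - c)\<bar>" by (simp add: algebra_simps)
  also have "\<dots> \<le> \<bar>(1 - t) * (v x - c)\<bar> + \<bar>t * (w x - c)\<bar>" by (rule abs_triangle_ineq)
  also have "\<dots> = (1 - t) * \<bar>v x - c\<bar> + t * \<bar>w x - c\<bar>" using step by (simp add: abs_mult)
  also have "\<dots> \<le> (1 - t) * e + t * e" using step by (intro add_mono mult_left_mono) auto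
  finally show ?case by (simp add: algebra_simps)
qed (rule assms)

text \<open>For 0 < x < 1 and q < 1 one has x < x^q, so a genuine splitting of unit mass is strictly
  too expensive. All of the concentration argument rests on this.\<close>

lemma powr_sum_le_one:
  fixes m q :: real
  assumes m: "0 \<le> m" "m \<le> 1" and q: "0 < q" "q < 1" and le: "m powr q + (1 - m) powr q \<le> 1"
  shows "m = 0 \<or> m = 1"
proof (rule ccontr)
  assume "\<not> ?thesis"
  then have m': "0 < m" "m < 1" using m by auto
  have gt: "x < x powr q" if "0 < x" "x < 1" for x :: real
  proof -
    have "ln x < 0" using that by simp
    then have "1 * ln x < q * ln x" using q by (intro mult_strict_right_mono_neg) auto
    then have "exp (ln x) < exp (q * ln x)" by simp
    then show ?thesis using that by (simp add: powr_def)
  qed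
  show False using gt[of m] gt[of "1 - m"] m' le by linarith
qed

context hs_problem
begin

text \<open>The minimal energies over the convex hulls of the tails converge, and by the parallelogram
  identity near-minimizers form a Cauchy sequence: this replaces weak compactness.\<close>

lemma mazur_sequence:
  assumes t: "\<And>k. U k \<in> T" and B: "\<And>k. energy \<gamma> (U k) \<le> B"
  shows "\<exists>w dn d. (\<forall>N. w N \<in> conv_tail U N) \<and> (\<forall>N. \<forall>v\<in>conv_tail U N. dn N \<le> energy \<gamma> v) \<and>
    dn \<longlonglongrightarrow> d \<and> (\<lambda>N. energy \<gamma> (w N)) \<longlonglongrightarrow> d"
proof -
  define dn where "dn N = (INF v\<in>conv_tail U N. energy \<gamma> v)" for N
  have bdd: "bdd_below (energy \<gamma> ` conv_tail U N)" for N
    by (rule bdd_belowI2[of _ 0], rule energy_nonneg, erule conv_tail_test[OF _ t])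
  have ne: "conv_tail U N \<noteq> {}" for N using conv_tail.base[of N N U] by blast
  have dle: "dn N \<le> energy \<gamma> v" if "v \<in> conv_tail U N" for N v
    unfolding dn_def by (rule cINF_lower[OF bdd that])
  have inc: "incseq dn"
    by (rule incseq_SucI) (unfold dn_def, intro cINF_superset_mono ne bdd, auto intro: conv_tail_mono)
  have "dn N \<le> B" for N using dle[OF conv_tail.base[of N N U]] B[of N] by simp
  then obtain d where d: "dn \<longlonglongrightarrow> d" using incseq_convergent[OF inc, of B] by blast
  have "\<exists>v\<in>conv_tail U N. energy \<gamma> v < dn N + inverse (real (Suc N))" for N
    unfolding dn_def by (subst cINF_less_iff[OF ne bdd, symmetric]) simp
  then obtain w where w: "\<And>N. w N \<in> conv_tail U N" "\<And>N. energy \<gamma> (w N) < dn N + inverse (real (Suc N))" by metis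
  have "(\<lambda>N. dn N + inverse (real (Suc N))) \<longlonglongrightarrow> d + 0" by (intro tendsto_add d LIMSEQ_inverse_real_of_nat)
  then have ub: "(\<lambda>N. dn N + inverse (real (Suc N))) \<longlonglongrightarrow> d" by simp
  have "(\<lambda>N. energy \<gamma> (w N)) \<longlonglongrightarrow> d"
    by (rule tendsto_sandwich[OF _ _ d ub]) (use dle[OF w(1)] less_imp_le[OF w(2)] in simp_all)
  then show ?thesis using w(1) dle d by blast
qed

text \<open>The combination lies in the hull, so its energy is at least \<open>d\<close>; the
  convexity identity converts this into a bound for the energy of the difference.\<close>

lemma conv_tail_inequality:
  assumes t: "\<And>k. U k \<in> T" and d: "\<And>v. v \<in> conv_tail U N \<Longrightarrow> d \<le> energy \<gamma> v"
    and vw: "v \<in> conv_tail U N" "w \<in> conv_tail U N" and r: "0 \<le> r" "r \<le> 1"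
  shows "r * (1 - r) * energy \<gamma> (\<lambda>x. v x - w x) \<le> (1 - r) * energy \<gamma> v + r * energy \<gamma> w - d"
  using d[OF conv_tail.step[OF vw r]] energy_convex_identity[OF n conv_tail_test[OF vw(1) t] conv_tail_test[OF vw(2) t], of \<gamma> r]
  by simp

lemma mazur_Cauchy:
  assumes t: "\<And>k. U k \<in> T" and w: "\<And>N. w N \<in> conv_tail U N"
    and dn: "\<And>N v. v \<in> conv_tail U N \<Longrightarrow> dn N \<le> energy \<gamma> v" "dn \<longlonglongrightarrow> d" "(\<lambda>N. energy \<gamma> (w N)) \<longlonglongrightarrow> d"
  shows "dirichlet_Cauchy w"
  unfolding dirichlet_Cauchy_def
proof (intro conjI allI impI)
  show wt: "w k \<in> T" for k by (rule conv_tail_test[OF w t])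
  obtain c where c: "c > 0" "\<And>\<phi>. \<phi> \<in> T \<Longrightarrow> c * dirichlet \<phi> \<le> energy \<gamma> \<phi>" using coercive by blast
  fix e :: real assume e: "e > 0"
  \<comment> \<open>The midpoint inequality gives a quarter of the energy at most (d + h) - (d - h),
    so the energy is at most 8h = c e.\<close>
  define h where "h = c * e / 8"
  have h: "h > 0" using e c by (simp add: h_def)
  have "eventually (\<lambda>N. dn N > d - h) sequentially" using dn(2) h by (intro order_tendstoD) auto
  moreover have "eventually (\<lambda>N. energy \<gamma> (w N) < d + h) sequentially" using dn(3) h by (intro order_tendstoD) auto
  ultimately have "eventually (\<lambda>N. dn N > d - h \<and> energy \<gamma> (w N) < d + h) sequentially" by eventually_elim simp
  then obtain N where N: "\<And>k. k \<ge> N \<Longrightarrow> dn k > d - h \<and> energy \<gamma> (w k) < d + h" by (auto simp: eventually_sequentially)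
  have "dirichlet (\<lambda>x. w k x - w l x) \<le> e" if kl: "k \<ge> N" "l \<ge> N" for k l
  proof -
    have "1 / 2 * (1 - 1 / 2) * energy \<gamma> (\<lambda>x. w k x - w l x) \<le> (1 - 1 / 2) * energy \<gamma> (w k) + 1 / 2 * energy \<gamma> (w l) - dn N"
      by (rule conv_tail_inequality[OF t dn(1) conv_tail_mono[OF w kl(1)] conv_tail_mono[OF w kl(2)]]) auto
    then have "energy \<gamma> (\<lambda>x. w k x - w l x) \<le> 8 * h" using N[OF kl(1)] N[OF kl(2)] N[of N] by simp
    then have "c * dirichlet (\<lambda>x. w k x - w l x) \<le> c * e"
      using c(2)[OF test_functions_diff[OF wt[of k] wt[of l]]] by (simp add: h_def)
    then show ?thesis using c(1) by simp
  qed
  then show "\<exists>N. \<forall>k\<ge>N. \<forall>l\<ge>N. dirichlet (\<lambda>x. w k x - w l x) \<le> e" by blast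
qed

text \<open>With m the mass kept by u and q = 2 / \<open>crit_exp\<close>, convexity gives mu
  (1-m)^q \<le> mu - d, where d is the energy of u, while d \<ge> mu m^q by definition of mu. Hence
  m^q + (1-m)^q \<le> 1, so all mass is kept and u is a minimizer, or none is and u = 0.\<close>

lemma limit_dichotomy:
  assumes t: "\<And>k. U k \<in> T" and one: "\<And>k. pnorm s (U k) = 1"
    and lim: "(\<lambda>k. energy \<gamma> (U k)) \<longlonglongrightarrow> HS_mu TYPE('n) \<gamma> s"
    and u: "u \<in> borel_measurable borel" and ae: "AE x in lborel. (\<lambda>k. U k x) \<longlonglongrightarrow> u x"
  shows "HS_mu_attained TYPE('n) \<gamma> s \<or> (AE x in lborel. u x = 0)"
proof -
  note [measurable] = test_functions_measurable[OF t] u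
  have "Bseq (\<lambda>k. energy \<gamma> (U k))" using lim by (intro convergent_imp_Bseq convergentI)
  then obtain B where "\<And>k. norm (energy \<gamma> (U k)) \<le> B" unfolding Bseq_def by blast
  then have B: "energy \<gamma> (U k) \<le> B" for k by (metis abs_le_D1 real_norm_def)
  obtain w dn d where w: "\<And>N. w N \<in> conv_tail U N"
    and dn: "\<And>N v. v \<in> conv_tail U N \<Longrightarrow> dn N \<le> energy \<gamma> v" "dn \<longlonglongrightarrow> d" "(\<lambda>N. energy \<gamma> (w N)) \<longlonglongrightarrow> d"
    using mazur_sequence[of U B, OF t B] by blast
  have wt: "w k \<in> T" for k by (rule conv_tail_test[OF w t])
  have "AE x in lborel. (\<lambda>k. w (id k) x) \<longlonglongrightarrow> u x" using ae
  proof eventually_elim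
    case (elim x)
    show ?case
    proof (rule LIMSEQ_I)
      fix e :: real assume e: "e > 0"
      obtain N where N: "\<And>k. k \<ge> N \<Longrightarrow> norm (U k x - u x) < e / 2" using LIMSEQ_D[OF elim, of "e / 2"] e by auto
      have "\<bar>w k x - u x\<bar> \<le> e / 2" if "k \<ge> N" for k
        by (rule conv_tail_pointwise[OF w]) (use N that in \<open>force intro: less_imp_le\<close>)
      then show "\<exists>N. \<forall>k\<ge>N. norm (w (id k) x - u x) < e" using e by (intro exI[of _ N]) force
    qed
  qed
  then obtain G where a: "D12_approx w u G"
    using D12_limit[OF n mazur_Cauchy[OF t w dn] u, of id] by (auto simp: strict_mono_id)
  have Eu: "(\<integral>x. (norm (G x))\<^sup>2 \<partial>lborel) - \<gamma> * pnorm 2 u = d"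
    using energy_limit[OF a] dn(3) LIMSEQ_unique by blast
  define m where "m = pnorm s u"
  \<comment> \<open>Brezis-Lieb: the remainder \<open>U k\<close> - u carries the mass 1 - m in the
    limit.\<close>
  have "(\<lambda>k. pnorm s (U k) - pnorm s (\<lambda>x. U k x - u x)) \<longlonglongrightarrow> m" unfolding pnorm_def m_def
  proof (rule brezis_lieb[where B=1])
    show "integrable (hs_measure s) (\<lambda>x. \<bar>U k x\<bar> powr crit_exp TYPE('n) s)" for k
      using hardy_sobolev_test[OF n s(1) s2] t by blast
    show "(\<integral>x. \<bar>U k x\<bar> powr crit_exp TYPE('n) s \<partial>hs_measure s) \<le> 1" for k using one[of k] by (simp add: pnorm_def)
    show "AE x in hs_measure s. (\<lambda>k. U k x) \<longlonglongrightarrow> u x" using ae by (simp only: AE_hs_measure)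
  qed (use p D12_approx_limits(1)[OF n a s(1) s2] in auto)
  then have "(\<lambda>k. 1 - pnorm s (\<lambda>x. U k x - u x)) \<longlonglongrightarrow> m" by (simp add: one)
  then have "(\<lambda>k. 1 - (1 - pnorm s (\<lambda>x. U k x - u x))) \<longlonglongrightarrow> 1 - m" by (intro tendsto_intros)
  then have pl: "(\<lambda>k. pnorm s (\<lambda>x. U k x - u x)) \<longlonglongrightarrow> 1 - m" by simp
  have m0: "0 \<le> m" by (simp add: m_def)
  have m1: "0 \<le> 1 - m" by (rule LIMSEQ_le_const[OF pl]) auto
  \<comment> \<open>The combination puts weight 1-r on \<open>U k\<close> and r on a hull element
    \<open>w M\<close>; M is sent to infinity first, so that the difference becomes
    \<open>U k\<close> - u.\<close>
  have key: "r * (1 - r) * (HS_mu TYPE('n) \<gamma> s * pnorm s (\<lambda>x. U k x - u x) powr (2 / crit_exp TYPE('n) s)) \<le> (1 - r) * energy \<gamma> (U k) + r * d - dn k"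
    if r: "0 \<le> r" "r \<le> 1" for r k
  proof -
    have a': "D12_approx (\<lambda>M x. U k x - w M x) (\<lambda>x. U k x - u x) (\<lambda>x. grad (U k) x - G x)"
      by (rule D12_approx_const_diff[OF a t])
    define L where "L = (\<integral>x. (norm (grad (U k) x - G x))\<^sup>2 \<partial>lborel) - \<gamma> * pnorm 2 (\<lambda>x. U k x - u x)"
    have "(\<lambda>M. r * (1 - r) * energy \<gamma> (\<lambda>x. U k x - w M x)) \<longlonglongrightarrow> r * (1 - r) * L"
      unfolding L_def by (intro tendsto_intros energy_limit[OF a'])
    moreover have "(\<lambda>M. (1 - r) * energy \<gamma> (U k) + r * energy \<gamma> (w M) - dn k) \<longlonglongrightarrow> (1 - r) * energy \<gamma> (U k) + r * d - dn k"
      by (intro tendsto_intros dn(3))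
    ultimately have "r * (1 - r) * L \<le> (1 - r) * energy \<gamma> (U k) + r * d - dn k"
    proof (rule LIMSEQ_le)
      have "r * (1 - r) * energy \<gamma> (\<lambda>x. U k x - w M x) \<le> (1 - r) * energy \<gamma> (U k) + r * energy \<gamma> (w M) - dn k" if "k \<le> M" for M
        by (rule conv_tail_inequality[OF t dn(1) conv_tail.base[OF order_refl] conv_tail_mono[OF w that] r])
      then show "\<exists>N. \<forall>M\<ge>N. r * (1 - r) * energy \<gamma> (\<lambda>x. U k x - w M x) \<le> (1 - r) * energy \<gamma> (U k) + r * energy \<gamma> (w M) - dn k" by blast
    qed
    moreover have "r * (1 - r) * (HS_mu TYPE('n) \<gamma> s * pnorm s (\<lambda>x. U k x - u x) powr (2 / crit_exp TYPE('n) s)) \<le> r * (1 - r) * L"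
      unfolding L_def using r by (intro mult_left_mono mu_D12[OF a']) auto
    ultimately show ?thesis by linarith
  qed
  have key2: "r * (1 - r) * (HS_mu TYPE('n) \<gamma> s * (1 - m) powr (2 / crit_exp TYPE('n) s)) \<le> (1 - r) * (HS_mu TYPE('n) \<gamma> s - d)" if r: "0 \<le> r" "r \<le> 1" for r
  proof -
    have q: "2 / crit_exp TYPE('n) s \<noteq> 0" "2 / crit_exp TYPE('n) s > 0" using p by auto
    have pw: "(\<lambda>k. pnorm s (\<lambda>x. U k x - u x) powr (2 / crit_exp TYPE('n) s)) \<longlonglongrightarrow> (1 - m) powr (2 / crit_exp TYPE('n) s)"
      by (rule tendsto_powr2[OF pl tendsto_const]) (use q in auto)
    have "(\<lambda>k. r * (1 - r) * (HS_mu TYPE('n) \<gamma> s * pnorm s (\<lambda>x. U k x - u x) powr (2 / crit_exp TYPE('n) s))) \<longlonglongrightarrow> r * (1 - r) * (HS_mu TYPE('n) \<gamma> s * (1 - m) powr (2 / crit_exp TYPE('n) s))"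
      by (intro tendsto_mult tendsto_const pw)
    moreover have "(\<lambda>k. (1 - r) * energy \<gamma> (U k) + r * d - dn k) \<longlonglongrightarrow> (1 - r) * HS_mu TYPE('n) \<gamma> s + r * d - d"
      by (intro tendsto_intros lim dn(2))
    ultimately have "r * (1 - r) * (HS_mu TYPE('n) \<gamma> s * (1 - m) powr (2 / crit_exp TYPE('n) s)) \<le> (1 - r) * HS_mu TYPE('n) \<gamma> s + r * d - d"
      by (rule LIMSEQ_le) (use key[OF r] in auto)
    then show ?thesis by (simp add: algebra_simps)
  qed
  \<comment> \<open>Dividing by 1-r before letting r tend to 1 preserves the first-order information
    that r = 1 itself would lose.\<close>
  have "r * (HS_mu TYPE('n) \<gamma> s * (1 - m) powr (2 / crit_exp TYPE('n) s)) \<le> HS_mu TYPE('n) \<gamma> s - d" if r: "0 \<le> r" "r < 1" for r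
  proof -
    have "(1 - r) * (r * (HS_mu TYPE('n) \<gamma> s * (1 - m) powr (2 / crit_exp TYPE('n) s))) \<le> (1 - r) * (HS_mu TYPE('n) \<gamma> s - d)" using key2[of r] r by (simp add: mult_ac)
    then show ?thesis using r by simp
  qed
  then have "HS_mu TYPE('n) \<gamma> s * (1 - m) powr (2 / crit_exp TYPE('n) s) \<le> HS_mu TYPE('n) \<gamma> s - d"
    by (rule field_le_mult_one_interval) (rule less_imp_le)
  moreover have d: "HS_mu TYPE('n) \<gamma> s * m powr (2 / crit_exp TYPE('n) s) \<le> d" using mu_D12[OF a] Eu by (simp add: m_def)
  ultimately have "HS_mu TYPE('n) \<gamma> s * (m powr (2 / crit_exp TYPE('n) s) + (1 - m) powr (2 / crit_exp TYPE('n) s)) \<le> HS_mu TYPE('n) \<gamma> s * 1" and dmu: "d \<le> HS_mu TYPE('n) \<gamma> s - HS_mu TYPE('n) \<gamma> s * (1 - m) powr (2 / crit_exp TYPE('n) s)"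
    by (auto simp: algebra_simps)
  then have "m powr (2 / crit_exp TYPE('n) s) + (1 - m) powr (2 / crit_exp TYPE('n) s) \<le> 1" using mu_pos by (simp only: mult_le_cancel_left_pos)
  then have "m = 0 \<or> m = 1" using m0 m1 p by (intro powr_sum_le_one) auto
  then show ?thesis
  proof
    assume "m = 1"
    then have "HS_mu_attained TYPE('n) \<gamma> s"
      by (intro attainedI[OF a]) (use Eu dmu in \<open>auto simp: m_def\<close>)
    then show ?thesis ..
  next
    assume "m = 0"
    then have "\<not> pnorm s u > 0" by (simp add: m_def)
    then have "u \<notin> D12_nonzero" using pnorm_pos_iff[OF a] by simp
    then have "AE x in lborel. u x = 0" using a by (auto simp: D12_nonzero_def D12_def is_D12_grad_iff)
    then show ?thesis ..
  qed
qed

text \<open>The bad alternative: a normalized minimizing sequence whose local L^2 mass disappears on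
  every ball, although its critical mass need not.\<close>

definition vanishing :: "(nat \<Rightarrow> real^'n \<Rightarrow> real) \<Rightarrow> bool" where
  "vanishing U \<longleftrightarrow> (\<forall>k. U k \<in> T \<and> pnorm s (U k) = 1) \<and> (\<lambda>k. energy \<gamma> (U k)) \<longlonglongrightarrow> HS_mu TYPE('n) \<gamma> s \<and>
     (\<forall>R. (\<lambda>k. \<integral>x. (U k x)\<^sup>2 * indicator (cball 0 R) x \<partial>lborel) \<longlonglongrightarrow> 0)"

lemma attained_or_vanishing:
  assumes t: "\<And>k. U k \<in> T" and one: "\<And>k. pnorm s (U k) = 1"
    and lim: "(\<lambda>k. energy \<gamma> (U k)) \<longlonglongrightarrow> HS_mu TYPE('n) \<gamma> s"
  shows "HS_mu_attained TYPE('n) \<gamma> s \<or> (\<exists>r::nat \<Rightarrow> nat. strict_mono r \<and> vanishing (\<lambda>k. U (r k)))"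
proof -
  obtain c where c: "c > 0" "\<And>\<phi>. \<phi> \<in> T \<Longrightarrow> c * dirichlet \<phi> \<le> energy \<gamma> \<phi>" using coercive by blast
  have "Bseq (\<lambda>k. energy \<gamma> (U k))" using lim by (intro convergent_imp_Bseq convergentI)
  then obtain B where B: "\<And>k. norm (energy \<gamma> (U k)) \<le> B" unfolding Bseq_def by blast
  have "dirichlet (U k) \<le> B / c" for k
  proof -
    have "c * dirichlet (U k) \<le> B" using c(2)[OF t[of k]] B[of k] by simp
    then show ?thesis using c(1) by (simp add: field_simps)
  qed
  then obtain r u where r: "strict_mono (r::nat \<Rightarrow> nat)" "u \<in> borel_measurable borel"
    "AE x in lborel. (\<lambda>k. U (r k) x) \<longlonglongrightarrow> u x"
    "\<And>R. (\<lambda>k. \<integral>\<^sup>+x. ennreal ((U (r k) x - u x)\<^sup>2) * indicator (cball 0 R) x \<partial>lborel) \<longlonglongrightarrow> 0"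
    using rellich[OF n, of U "B / c"] t by blast
  have lim': "(\<lambda>k. energy \<gamma> (U (r k))) \<longlonglongrightarrow> HS_mu TYPE('n) \<gamma> s" using LIMSEQ_subseq_LIMSEQ[OF lim r(1)] by (simp add: o_def)
  have "HS_mu_attained TYPE('n) \<gamma> s \<or> (AE x in lborel. u x = 0)"
    by (rule limit_dichotomy[OF t one lim' r(2,3)])
  then show ?thesis
  proof
    assume u0: "AE x in lborel. u x = 0"
    have "(\<lambda>k. \<integral>x. (U (r k) x)\<^sup>2 * indicator (cball 0 R) x \<partial>lborel) \<longlonglongrightarrow> 0" for R
    proof -
      have "integrable lborel (\<lambda>x. (U (r k) x)\<^sup>2 * indicator (cball 0 R) x)" for k
        by (intro integrable_real_mult_indicator C1c_integrable_sq(1)[OF test_functions_C1c[OF t]]) auto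
      then have "ennreal (\<integral>x. (U (r k) x)\<^sup>2 * indicator (cball 0 R) x \<partial>lborel) = (\<integral>\<^sup>+x. ennreal ((U (r k) x)\<^sup>2 * indicator (cball 0 R) x) \<partial>lborel)" for k
        by (intro nn_integral_eq_integral[symmetric]) auto
      also have "(\<integral>\<^sup>+x. ennreal ((U (r k) x)\<^sup>2 * indicator (cball 0 R) x) \<partial>lborel) = (\<integral>\<^sup>+x. ennreal ((U (r k) x - u x)\<^sup>2) * indicator (cball 0 R) x \<partial>lborel)" for k
        by (intro nn_integral_cong_AE eventually_mono[OF u0]) (auto simp: indicator_def)
      finally have e: "ennreal (\<integral>x. (U (r k) x)\<^sup>2 * indicator (cball 0 R) x \<partial>lborel) = (\<integral>\<^sup>+x. ennreal ((U (r k) x - u x)\<^sup>2) * indicator (cball 0 R) x \<partial>lborel)" for k .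
      have "(\<lambda>k. ennreal (\<integral>x. (U (r k) x)\<^sup>2 * indicator (cball 0 R) x \<partial>lborel)) \<longlonglongrightarrow> 0" unfolding e by (rule r(4))
      then show ?thesis by (subst (asm) ennreal_tendsto_0_iff) (auto intro!: integral_nonneg_AE)
    qed
    then have "vanishing (\<lambda>k. U (r k))" using t one lim' by (simp add: vanishing_def)
    then show ?thesis using r(1) by blast
  qed blast
qed

end

section \<open>Localization\<close>

text \<open>With \<open>cutoff_cos\<close> a quadratic partition of unity. Sine and cosine of a
  smooth angle are both smooth, which the square root of 1 minus a squared cutoff might fail to
  be.\<close>

definition cutoff_sin :: "real^'n::finite \<Rightarrow> real \<Rightarrow> real^'n \<Rightarrow> real" where
  "cutoff_sin y r x = sin (pi / 2 * cutoff y r x)"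

definition cutoff_cos :: "real^'n::finite \<Rightarrow> real \<Rightarrow> real^'n \<Rightarrow> real" where
  "cutoff_cos y r x = cos (pi / 2 * cutoff y r x)"

lemma cutoff_sin_cos_squared: "(cutoff_sin y r x)\<^sup>2 + (cutoff_cos y r x)\<^sup>2 = 1"
  by (simp add: cutoff_sin_def cutoff_cos_def)

lemma cutoff_sin_cos_test:
  fixes \<phi> :: "real^'n::finite \<Rightarrow> real"
  assumes "\<phi> \<in> test_functions"
  shows "(\<lambda>x. cutoff_sin y r x * \<phi> x) \<in> test_functions" "(\<lambda>x. cutoff_cos y r x * \<phi> x) \<in> test_functions"
  unfolding cutoff_sin_def cutoff_cos_def
  by (intro smooth_mult_test_functions[OF _ assms] C_k_compose[OF S_k_sin_cos(1)] C_k_mult[OF C_k_const C_k_cutoff],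
      intro smooth_mult_test_functions[OF _ assms] C_k_compose[OF S_k_sin_cos(2)] C_k_mult[OF C_k_const C_k_cutoff])

lemma cutoff_sin_eq_1: "r > 0 \<Longrightarrow> norm (x - y) \<le> r \<Longrightarrow> cutoff_sin y r x = 1"
  by (simp add: cutoff_sin_def cutoff_eq_1)

lemma cutoff_sin_eq_0: "r > 0 \<Longrightarrow> norm (x - y) \<ge> 2 * r \<Longrightarrow> cutoff_sin y r x = 0"
  by (simp add: cutoff_sin_def cutoff_eq_0)

lemma cutoff_cos_eq_1: "r > 0 \<Longrightarrow> norm (x - y) \<ge> 2 * r \<Longrightarrow> cutoff_cos y r x = 1"
  by (simp add: cutoff_cos_def cutoff_eq_0)

text \<open>The localization identity: the mixed terms of the two gradients cancel, and what remains
  beyond the Dirichlet integral is \<phi>^2 |grad \<theta>|^2, bounded by local L^2 mass.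
  \<open>M\<close> and \<open>R\<close> depend on the cutoff but not on \<phi>.\<close>

lemma dirichlet_split:
  fixes y :: "real^'n::finite"
  assumes r: "r > 0"
  shows "\<exists>M R. M \<ge> 0 \<and> (\<forall>\<phi>\<in>test_functions.
     dirichlet (\<lambda>x. cutoff_sin y r x * \<phi> x) + dirichlet (\<lambda>x. cutoff_cos y r x * \<phi> x)
       \<le> dirichlet \<phi> + M * (\<integral>x. (\<phi> x)\<^sup>2 * indicator (cball 0 R) x \<partial>lborel))"
proof -
  define \<theta> where "\<theta> x = pi / 2 * cutoff y r x" for x
  define k where "k x = (pi / 2) *\<^sub>R grad (cutoff y r) x" for x
  have th: "C1c \<theta> k" unfolding \<theta>_def k_def by (intro C1c_cmult test_functions_C1c cutoff_test r)
  obtain M where M: "M > 0" "\<And>x. norm (k x) \<le> M" using C1c_bounded[OF th] by blast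
  obtain R where R: "\<And>x. norm x > R \<Longrightarrow> k x = 0" using C1c_support[OF th] by blast
  have d: "(\<theta> has_derivative (\<lambda>h. k x \<bullet> h)) (at x)" for x by (rule C1c_derivative[OF th])
  have ds: "((\<lambda>x. sin (\<theta> x)) has_derivative (\<lambda>h. (cos (\<theta> x) *\<^sub>R k x) \<bullet> h)) (at x)" for x
    using has_derivative_compose[OF d DERIV_sin[unfolded has_field_derivative_def]] by simp
  have dc: "((\<lambda>x. cos (\<theta> x)) has_derivative (\<lambda>h. (- sin (\<theta> x) *\<^sub>R k x) \<bullet> h)) (at x)" for x
    using has_derivative_compose[OF d DERIV_cos[unfolded has_field_derivative_def]] by simp
  have cs: "continuous_on UNIV (\<lambda>x. cos (\<theta> x) *\<^sub>R k x)" "continuous_on UNIV (\<lambda>x. - sin (\<theta> x) *\<^sub>R k x)"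
    by (intro continuous_intros C1c_continuous[OF th])+
  have "dirichlet (\<lambda>x. cutoff_sin y r x * \<phi> x) + dirichlet (\<lambda>x. cutoff_cos y r x * \<phi> x)
       \<le> dirichlet \<phi> + M\<^sup>2 * (\<integral>x. (\<phi> x)\<^sup>2 * indicator (cball 0 R) x \<partial>lborel)" if t: "\<phi> \<in> test_functions" for \<phi> :: "real^'n \<Rightarrow> real"
  proof -
    note c = test_functions_C1c[OF t]
    have gs: "grad (\<lambda>x. cutoff_sin y r x * \<phi> x) = (\<lambda>x. sin (\<theta> x) *\<^sub>R grad \<phi> x + \<phi> x *\<^sub>R (cos (\<theta> x) *\<^sub>R k x))"
      using C1c_grad_unique[OF cutoff_sin_cos_test(1)[OF t], of y r] C1c_mult[OF c ds cs(1)]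
      by (simp add: cutoff_sin_def \<theta>_def)
    have gc: "grad (\<lambda>x. cutoff_cos y r x * \<phi> x) = (\<lambda>x. cos (\<theta> x) *\<^sub>R grad \<phi> x + \<phi> x *\<^sub>R (- sin (\<theta> x) *\<^sub>R k x))"
      using C1c_grad_unique[OF cutoff_sin_cos_test(2)[OF t], of y r] C1c_mult[OF c dc cs(2)]
      by (simp add: cutoff_cos_def \<theta>_def)
    have sq: "integrable lborel (\<lambda>x. (norm (grad f x))\<^sup>2)" if "f \<in> test_functions" for f :: "real^'n \<Rightarrow> real"
      using C1c_integrable_sq(2)[OF test_functions_C1c[OF that]] .
    have i2: "integrable lborel (\<lambda>x. (\<phi> x)\<^sup>2 * indicator (cball 0 R) x)"
      by (intro integrable_real_mult_indicator C1c_integrable_sq(1)[OF c]) auto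
    have "dirichlet (\<lambda>x. cutoff_sin y r x * \<phi> x) + dirichlet (\<lambda>x. cutoff_cos y r x * \<phi> x) =
      (\<integral>x. (norm (grad (\<lambda>x. cutoff_sin y r x * \<phi> x) x))\<^sup>2 + (norm (grad (\<lambda>x. cutoff_cos y r x * \<phi> x) x))\<^sup>2 \<partial>lborel)"
      unfolding dirichlet_def by (intro Bochner_Integration.integral_add[symmetric] sq cutoff_sin_cos_test t)
    also have "\<dots> \<le> (\<integral>x. (norm (grad \<phi> x))\<^sup>2 + M\<^sup>2 * ((\<phi> x)\<^sup>2 * indicator (cball 0 R) x) \<partial>lborel)"
    proof (intro integral_mono Bochner_Integration.integrable_add integrable_mult_right sq cutoff_sin_cos_test t i2)
      fix x
      \<comment> \<open>Here a and b are the sine and cosine of \<theta>, v is the gradient of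
        \<phi>, w that of \<theta> and f the value of \<phi>.\<close>
      have id: "(norm (a *\<^sub>R v + f *\<^sub>R (b *\<^sub>R w)))\<^sup>2 + (norm (b *\<^sub>R v + f *\<^sub>R (- a *\<^sub>R w)))\<^sup>2 = (norm v)\<^sup>2 + f\<^sup>2 * (norm w)\<^sup>2"
        if ab: "a\<^sup>2 + b\<^sup>2 = 1" for a b f :: real and v w :: "real^'n"
      proof -
        have "(norm (a *\<^sub>R v + f *\<^sub>R (b *\<^sub>R w)))\<^sup>2 + (norm (b *\<^sub>R v + f *\<^sub>R (- a *\<^sub>R w)))\<^sup>2 = (a\<^sup>2 + b\<^sup>2) * (v \<bullet> v) + (a\<^sup>2 + b\<^sup>2) * (f\<^sup>2 * (w \<bullet> w))"
          unfolding power2_norm_eq_inner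
          by (simp add: inner_add_left inner_add_right inner_diff_left inner_diff_right inner_commute power2_eq_square algebra_simps)
        then show ?thesis by (simp add: ab power2_norm_eq_inner)
      qed
      have "(norm (grad (\<lambda>x. cutoff_sin y r x * \<phi> x) x))\<^sup>2 + (norm (grad (\<lambda>x. cutoff_cos y r x * \<phi> x) x))\<^sup>2 = (norm (grad \<phi> x))\<^sup>2 + (\<phi> x)\<^sup>2 * (norm (k x))\<^sup>2"
        unfolding gs gc by (rule id) simp
      moreover have "(norm (k x))\<^sup>2 \<le> M\<^sup>2 * indicator (cball 0 R) x"
        using power_mono[OF M(2)[of x] norm_ge_zero, of 2] R[of x] by (auto simp: indicator_def)
      then have "(\<phi> x)\<^sup>2 * (norm (k x))\<^sup>2 \<le> (\<phi> x)\<^sup>2 * (M\<^sup>2 * indicator (cball 0 R) x)" by (intro mult_left_mono) auto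
      ultimately show "(norm (grad (\<lambda>x. cutoff_sin y r x * \<phi> x) x))\<^sup>2 + (norm (grad (\<lambda>x. cutoff_cos y r x * \<phi> x) x))\<^sup>2 \<le> (norm (grad \<phi> x))\<^sup>2 + M\<^sup>2 * ((\<phi> x)\<^sup>2 * indicator (cball 0 R) x)"
        by (simp add: mult_ac)
    qed
    also have "\<dots> = dirichlet \<phi> + M\<^sup>2 * (\<integral>x. (\<phi> x)\<^sup>2 * indicator (cball 0 R) x \<partial>lborel)"
      unfolding dirichlet_def using sq[OF t] i2 by simp
    finally show ?thesis .
  qed
  then show ?thesis by (intro exI[of _ "M\<^sup>2"] exI[of _ R]) auto
qed

lemma pnorm_2_split:
  fixes \<phi> :: "real^'n::finite \<Rightarrow> real"
  assumes n: "CARD('n) \<ge> 3" and t: "\<phi> \<in> test_functions"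
  shows "pnorm 2 (\<lambda>x. cutoff_sin y r x * \<phi> x) + pnorm 2 (\<lambda>x. cutoff_cos y r x * \<phi> x) = pnorm 2 \<phi>"
proof -
  have p2: "\<bar>z\<bar> powr crit_exp TYPE('n) 2 = z\<^sup>2" for z :: real using norm_powr_2[of z] by (simp add: crit_exp_gt2(5)[OF n, of 0])
  have hs: "integrable (hs_measure 2) (\<lambda>x. (f x)\<^sup>2)" if "f \<in> test_functions" for f :: "real^'n \<Rightarrow> real"
    using hardy_sobolev_test[OF n, of 2] that by (auto simp: p2)
  have "pnorm 2 (\<lambda>x. cutoff_sin y r x * \<phi> x) + pnorm 2 (\<lambda>x. cutoff_cos y r x * \<phi> x) = (\<integral>x. (cutoff_sin y r x * \<phi> x)\<^sup>2 + (cutoff_cos y r x * \<phi> x)\<^sup>2 \<partial>hs_measure 2)"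
    unfolding pnorm_def p2 by (intro Bochner_Integration.integral_add[symmetric] hs cutoff_sin_cos_test t)
  also have "\<dots> = pnorm 2 \<phi>" unfolding pnorm_def p2
    by (intro Bochner_Integration.integral_cong refl)
       (simp only: power_mult_distrib distrib_right[symmetric] cutoff_sin_cos_squared mult_1_left)
  finally show ?thesis .
qed

lemma energy_split:
  fixes y :: "real^'n::finite"
  assumes n: "CARD('n) \<ge> 3" and r: "r > 0"
  shows "\<exists>M R. M \<ge> 0 \<and> (\<forall>\<phi>\<in>test_functions.
     energy \<gamma> (\<lambda>x. cutoff_sin y r x * \<phi> x) + energy \<gamma> (\<lambda>x. cutoff_cos y r x * \<phi> x)
       \<le> energy \<gamma> \<phi> + M * (\<integral>x. (\<phi> x)\<^sup>2 * indicator (cball 0 R) x \<partial>lborel))"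
proof -
  obtain M R where M: "M \<ge> 0" "\<And>\<phi> :: real^'n \<Rightarrow> real. \<phi> \<in> test_functions \<Longrightarrow>
     dirichlet (\<lambda>x. cutoff_sin y r x * \<phi> x) + dirichlet (\<lambda>x. cutoff_cos y r x * \<phi> x)
       \<le> dirichlet \<phi> + M * (\<integral>x. (\<phi> x)\<^sup>2 * indicator (cball 0 R) x \<partial>lborel)"
    using dirichlet_split[OF r] by blast
  show ?thesis
  proof (rule exI[of _ M], rule exI[of _ R], intro conjI ballI M(1))
    fix \<phi> :: "real^'n \<Rightarrow> real" assume t: "\<phi> \<in> test_functions"
    have "\<gamma> * pnorm 2 (\<lambda>x. cutoff_sin y r x * \<phi> x) + \<gamma> * pnorm 2 (\<lambda>x. cutoff_cos y r x * \<phi> x) = \<gamma> * pnorm 2 \<phi>"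
      using pnorm_2_split[OF n t, of y r] by (simp add: distrib_left[symmetric])
    then show "energy \<gamma> (\<lambda>x. cutoff_sin y r x * \<phi> x) + energy \<gamma> (\<lambda>x. cutoff_cos y r x * \<phi> x)
       \<le> energy \<gamma> \<phi> + M * (\<integral>x. (\<phi> x)\<^sup>2 * indicator (cball 0 R) x \<partial>lborel)"
      unfolding energy_def using M(2)[OF t] by linarith
  qed
qed

section \<open>Minkowski inequality\<close>

text \<open>Convexity of the power at the points a/l and b/(1-l), with weights l and 1-l. A free
  weight l is kept so that Minkowski can optimize it after integration.\<close>

lemma powr_add_convex_bound:
  fixes q l a b :: real
  assumes q: "q \<ge> 1" and l: "0 < l" "l < 1" and ab: "a \<ge> 0" "b \<ge> 0"
  shows "(a + b) powr q \<le> l powr (1 - q) * a powr q + (1 - l) powr (1 - q) * b powr q"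
proof -
  have ge1: "1 \<le> x powr (1 - q)" if "0 < x" "x < 1" for x :: real
  proof -
    have "x powr (q - 1) \<le> 1" using that q by (intro powr_le1) auto
    then have "1 \<le> 1 / x powr (q - 1)" using that by simp
    also have "\<dots> = x powr (1 - q)" using powr_minus_divide[of x "q - 1"] by simp
    finally show ?thesis .
  qed
  consider "a = 0" | "b = 0" | "a > 0" "b > 0" using ab by linarith
  then show ?thesis
  proof cases
    case 1
    have "1 * b powr q \<le> (1 - l) powr (1 - q) * b powr q" using ge1[of "1 - l"] l by (intro mult_right_mono) auto
    then show ?thesis using 1 q by simp
  next
    case 2
    have "1 * a powr q \<le> l powr (1 - q) * a powr q" using ge1[of l] l by (intro mult_right_mono) auto
    then show ?thesis using 2 q by simp
  next
    case 3
    have "(l * (a / l) + (1 - l) * (b / (1 - l))) powr q \<le> l * (a / l) powr q + (1 - l) * (b / (1 - l)) powr q"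
      using convex_onD[OF powr_convex[OF q], of "1 - l" "a / l" "b / (1 - l)"] 3 l by (simp add: add.commute)
    moreover have "x * (c / x) powr q = x powr (1 - q) * c powr q" if "x > 0" "c > 0" for x c :: real
      using that by (simp add: powr_divide powr_diff)
    ultimately show ?thesis using 3 l by simp
  qed
qed

lemma minkowski_two:
  fixes f g :: "'x \<Rightarrow> real"
  assumes q: "q \<ge> 1" and nn: "\<And>x. f x \<ge> 0" "\<And>x. g x \<ge> 0"
    and fi: "integrable M (\<lambda>x. f x powr q)" and gi: "integrable M (\<lambda>x. g x powr q)"
    and si: "integrable M (\<lambda>x. (f x + g x) powr q)"
  shows "(\<integral>x. (f x + g x) powr q \<partial>M) powr (1 / q) \<le> (\<integral>x. f x powr q \<partial>M) powr (1 / q) + (\<integral>x. g x powr q \<partial>M) powr (1 / q)"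
proof (rule field_le_epsilon)
  fix e :: real assume e: "e > 0"
  define a b where "a = (\<integral>x. f x powr q \<partial>M)" and "b = (\<integral>x. g x powr q \<partial>M)"
  \<comment> \<open>The two norms, enlarged by e/2 so that they are positive and l below lies
    strictly between 0 and 1.\<close>
  define A B where "A = a powr (1 / q) + e / 2" and "B = b powr (1 / q) + e / 2"
  have ab: "a \<ge> 0" "b \<ge> 0" by (auto simp: a_def b_def)
  have AB: "A > 0" "B > 0" using e by (auto simp: A_def B_def add_nonneg_pos)
  have le: "c \<le> (c powr (1 / q) + e / 2) powr q" if "c \<ge> 0" for c
  proof -
    have "c = (c powr (1 / q)) powr q" using q that by (simp add: powr_powr)
    also have "\<dots> \<le> (c powr (1 / q) + e / 2) powr q" using q e by (intro powr_mono2) auto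
    finally show ?thesis .
  qed
  \<comment> \<open>The optimal weight: both terms then combine to (A + B)^q.\<close>
  define l where "l = A / (A + B)"
  have l: "0 < l" "l < 1" "1 - l = B / (A + B)" using AB by (auto simp: l_def field_simps)
  have "(\<integral>x. (f x + g x) powr q \<partial>M) \<le> (\<integral>x. l powr (1 - q) * f x powr q + (1 - l) powr (1 - q) * g x powr q \<partial>M)"
    by (intro integral_mono powr_add_convex_bound q l nn Bochner_Integration.integrable_add integrable_mult_right fi gi si)
  also have "\<dots> = l powr (1 - q) * a + (1 - l) powr (1 - q) * b"
    using fi gi by (simp add: a_def b_def)
  also have "\<dots> \<le> l powr (1 - q) * A powr q + (1 - l) powr (1 - q) * B powr q"
    using le[OF ab(1)] le[OF ab(2)] by (intro add_mono mult_left_mono) (auto simp: A_def B_def)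
  also have "\<dots> = (A + B) powr q"
  proof -
    have 1: "(c / S) powr (1 - q) * c powr q = S powr (q - 1) * c" if "c > 0" "S > 0" for c S :: real
    proof -
      have "(c / S) powr (1 - q) * c powr q = (c powr (1 - q) * c powr q) / S powr (1 - q)"
        using that by (simp add: powr_divide)
      also have "c powr (1 - q) * c powr q = c" using that by (simp add: powr_add[symmetric])
      also have "c / S powr (1 - q) = S powr (q - 1) * c"
        using that powr_minus_divide[of S "1 - q"] by simp
      finally show ?thesis .
    qed
    have "l powr (1 - q) * A powr q + (1 - l) powr (1 - q) * B powr q = (A + B) powr (q - 1) * (A + B)"
      unfolding l(3) unfolding l_def using 1[of A "A + B"] 1[of B "A + B"] AB by (simp add: distrib_left)
    also have "\<dots> = (A + B) powr (q - 1) * (A + B) powr 1" using AB by simp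
    also have "\<dots> = (A + B) powr q" by (simp only: powr_add[symmetric]) simp
    finally show ?thesis .
  qed
  finally have "(\<integral>x. (f x + g x) powr q \<partial>M) powr (1 / q) \<le> ((A + B) powr q) powr (1 / q)"
    using q by (intro powr_mono2) auto
  also have "\<dots> = A + B" using AB q by (simp add: powr_powr)
  finally show "(\<integral>x. (f x + g x) powr q \<partial>M) powr (1 / q) \<le> (\<integral>x. f x powr q \<partial>M) powr (1 / q) + (\<integral>x. g x powr q \<partial>M) powr (1 / q) + e"
    by (simp add: A_def B_def a_def b_def)
qed

section \<open>Local mass and dilations\<close>

definition mass :: "real \<Rightarrow> (real^'n::finite \<Rightarrow> real) \<Rightarrow> (real^'n) set \<Rightarrow> real" where
  "mass s u A = (\<integral>x. \<bar>u x\<bar> powr crit_exp TYPE('n) s * indicator A x \<partial>hs_measure s)"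

text \<open>The amplitude exponent (n-2)/2 is the one that keeps the Dirichlet integral and the
  critical norms fixed. A shift \<open>b\<close> is compatible only with the unweighted terms, hence
  the conditions \<open>b = 0 \<or> s = 0\<close> and \<open>b = 0 \<or> \<gamma> = 0\<close>
  below.\<close>

definition rescale :: "real \<Rightarrow> real^'n::finite \<Rightarrow> (real^'n \<Rightarrow> real) \<Rightarrow> real^'n \<Rightarrow> real" where
  "rescale l b \<phi> x = l powr ((real CARD('n) - 2) / 2) * \<phi> (l *\<^sub>R x + b)"

lemma rescale_test: "\<phi> \<in> test_functions \<Longrightarrow> l > 0 \<Longrightarrow> rescale l b \<phi> \<in> test_functions"
  unfolding rescale_def[abs_def] by (intro test_functions_cmult test_functions_affine) auto

lemma integral_hs_affine:
  fixes F :: "real^'n::finite \<Rightarrow> real" and b :: "real^'n"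
  assumes [measurable]: "F \<in> borel_measurable borel" and l: "l > 0" and bs: "b = 0 \<or> s = 0"
  shows "(\<integral>x. F (l *\<^sub>R x + b) \<partial>hs_measure s) = l powr (s - real CARD('n)) * (\<integral>x. F x \<partial>hs_measure s)"
proof -
  define h where "h x = F x / norm x powr s" for x
  have [measurable]: "h \<in> borel_measurable borel" unfolding h_def by measurable
  have n1: "AE x in lborel. x \<noteq> (0::real^'n)" by (rule AE_lborel_singleton)
  \<comment> \<open>Excludes the point mapped to 0. For s = 0 the convention 0 powr 0 = 0 would
    otherwise spoil the identity both there and at x = 0.\<close>
  have n2: "AE x in lborel. x \<noteq> - (1 / l) *\<^sub>R b" by (rule AE_lborel_singleton)
  have "(\<integral>x. F (l *\<^sub>R x + b) \<partial>hs_measure s) = (\<integral>x. F (l *\<^sub>R x + b) / norm x powr s \<partial>lborel)"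
    by (rule integral_hs_measure) measurable
  also have "\<dots> = (\<integral>x. l powr s * h (b + l *\<^sub>R x) \<partial>lborel)"
  proof (rule integral_cong_AE)
    show "AE x in lborel. F (l *\<^sub>R x + b) / norm x powr s = l powr s * h (b + l *\<^sub>R x)"
      using n1 n2
    proof eventually_elim
      case (elim x)
      have "l *\<^sub>R x + b \<noteq> 0"
      proof
        assume "l *\<^sub>R x + b = 0"
        then have "l *\<^sub>R x = - b" by (simp add: eq_neg_iff_add_eq_0)
        then have "(1 / l) *\<^sub>R (l *\<^sub>R x) = (1 / l) *\<^sub>R (- b)" by simp
        then show False using elim l by simp
      qed
      then show ?case using bs elim l
        by (auto simp: h_def add.commute powr_mult)
    qed
  qed measurable
  also have "\<dots> = l powr s * (\<integral>x. h (b + l *\<^sub>R x) \<partial>lborel)" by simp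
  also have "(\<integral>x. h (b + l *\<^sub>R x) \<partial>lborel) = (\<integral>x. h x \<partial>lborel) / l ^ CARD('n)"
    using integral_affine[of h l b] l by (simp add: field_simps)
  also have "(\<integral>x. h x \<partial>lborel) = (\<integral>x. F x \<partial>hs_measure s)"
    unfolding h_def by (rule integral_hs_measure[symmetric]) measurable
  also have "l powr s * ((\<integral>x. F x \<partial>hs_measure s) / l ^ CARD('n)) = l powr (s - real CARD('n)) * (\<integral>x. F x \<partial>hs_measure s)"
    using l by (simp add: powr_diff powr_realpow)
  finally show ?thesis .
qed

lemma mass_rescale:
  fixes \<phi> :: "real^'n::finite \<Rightarrow> real"
  assumes n: "CARD('n) \<ge> 3" and t: "\<phi> \<in> test_functions" and l: "l > 0" and bs: "b = 0 \<or> s = 0" and [measurable]: "A \<in> sets borel"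
  shows "mass s (rescale l b \<phi>) {x. l *\<^sub>R x + b \<in> A} = mass s \<phi> A"
proof -
  let ?p = "crit_exp TYPE('n) s"
  note [measurable] = test_functions_measurable[OF t]
  \<comment> \<open>The amplitude raised to the critical exponent gives l^(n - s), which cancels the
    factor l^(s - n) of the change of variables.\<close>
  have e: "(real CARD('n) - 2) / 2 * ?p = real CARD('n) - s" using n by (simp add: crit_exp_def field_simps)
  have pw: "(l powr ((real CARD('n) - 2) / 2)) powr ?p = l powr (real CARD('n) - s)"
    unfolding powr_powr e ..
  have "\<bar>rescale l b \<phi> x\<bar> powr ?p * indicator {x. l *\<^sub>R x + b \<in> A} x =
     l powr (real CARD('n) - s) * (\<bar>\<phi> (l *\<^sub>R x + b)\<bar> powr ?p * indicator A (l *\<^sub>R x + b))" for x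
    by (simp add: rescale_def abs_mult powr_mult pw indicator_def)
  then have "mass s (rescale l b \<phi>) {x. l *\<^sub>R x + b \<in> A} =
     l powr (real CARD('n) - s) * (\<integral>x. \<bar>\<phi> (l *\<^sub>R x + b)\<bar> powr ?p * indicator A (l *\<^sub>R x + b) \<partial>hs_measure s)"
    unfolding mass_def by simp
  also have "(\<integral>x. \<bar>\<phi> (l *\<^sub>R x + b)\<bar> powr ?p * indicator A (l *\<^sub>R x + b) \<partial>hs_measure s) = l powr (s - real CARD('n)) * mass s \<phi> A"
    unfolding mass_def by (rule integral_hs_affine[OF _ l bs, of "\<lambda>x. \<bar>\<phi> x\<bar> powr ?p * indicator A x"]) measurable
  also have "l powr (real CARD('n) - s) * (l powr (s - real CARD('n)) * mass s \<phi> A) = mass s \<phi> A"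
    using l by (simp add: mult.assoc[symmetric] powr_add[symmetric])
  finally show ?thesis .
qed

lemma mass_UNIV: "mass s u UNIV = pnorm s u"
  by (simp add: mass_def pnorm_def)

lemma mass_rescale_cball:
  fixes \<phi> :: "real^'n::finite \<Rightarrow> real"
  assumes "CARD('n) \<ge> 3" "\<phi> \<in> test_functions" "l > 0" "b = 0 \<or> s = 0"
  shows "mass s (rescale l b \<phi>) (cball z r) = mass s \<phi> (cball (l *\<^sub>R z + b) (l * r))"
proof -
  have "{x. l *\<^sub>R x + b \<in> cball (l *\<^sub>R z + b) (l * r)} = cball z r"
    using assms(3) by (auto simp: dist_norm scaleR_diff_right[symmetric])
  then show ?thesis using mass_rescale[OF assms, of "cball (l *\<^sub>R z + b) (l * r)"] by simp
qed

lemma pnorm_rescale: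
  fixes \<phi> :: "real^'n::finite \<Rightarrow> real"
  assumes "CARD('n) \<ge> 3" "\<phi> \<in> test_functions" "l > 0" "b = 0 \<or> s = 0"
  shows "pnorm s (rescale l b \<phi>) = pnorm s \<phi>"
  using mass_rescale[OF assms, of UNIV] by (simp add: mass_UNIV)

lemma dirichlet_rescale:
  fixes \<phi> :: "real^'n::finite \<Rightarrow> real"
  assumes t: "\<phi> \<in> test_functions" and l: "l > 0"
  shows "dirichlet (rescale l b \<phi>) = dirichlet \<phi>"
proof -
  define c where "c = l powr ((real CARD('n) - 2) / 2)"
  note fc = test_functions_C1c[OF t]
  note [measurable] = grad_measurable[OF t]
  have "C1c (rescale l b \<phi>) (\<lambda>x. (c * l) *\<^sub>R grad \<phi> (l *\<^sub>R x + b))"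
  proof -
    have "((\<lambda>x. c * \<phi> (l *\<^sub>R x + b)) has_derivative (\<lambda>h. ((c * l) *\<^sub>R grad \<phi> (l *\<^sub>R x + b)) \<bullet> h)) (at x)" for x
    proof -
      have "((\<lambda>x. \<phi> (l *\<^sub>R x + b)) has_derivative (\<lambda>h. grad \<phi> (l *\<^sub>R x + b) \<bullet> (l *\<^sub>R h))) (at x)"
        by (rule has_derivative_compose[where g=\<phi>, OF _ C1c_derivative[OF fc]]) (auto intro!: derivative_eq_intros)
      then have "((\<lambda>x. c * \<phi> (l *\<^sub>R x + b)) has_derivative (\<lambda>h. c * (grad \<phi> (l *\<^sub>R x + b) \<bullet> (l *\<^sub>R h)))) (at x)"
        by (rule has_derivative_mult_right)
      then show ?thesis by (simp add: mult.assoc)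
    qed
    moreover have "continuous_on UNIV (\<lambda>x. (c * l) *\<^sub>R grad \<phi> (l *\<^sub>R x + b))"
      by (intro continuous_intros continuous_on_compose2[OF C1c_continuous(2)[OF fc]]) auto
    moreover have "\<exists>R. \<forall>x. R < norm x \<longrightarrow> c * \<phi> (l *\<^sub>R x + b) = 0"
      using C1c_support[OF test_functions_C1c[OF rescale_test[OF t l, of b]]] by (simp add: rescale_def c_def) blast
    ultimately show ?thesis unfolding C1c_def rescale_def c_def by blast
  qed
  then have g: "grad (rescale l b \<phi>) = (\<lambda>x. (c * l) *\<^sub>R grad \<phi> (l *\<^sub>R x + b))"
    by (rule C1c_grad_unique[OF rescale_test[OF t l]])
  have "c * c = l powr (real CARD('n) - 2)" by (simp add: c_def powr_add[symmetric])
  then have cl: "(c * l)\<^sup>2 = l ^ CARD('n)" using l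
    by (simp add: power_mult_distrib power2_eq_square[of c] powr_diff powr_realpow)
  have "dirichlet (rescale l b \<phi>) = (\<integral>x. (c * l)\<^sup>2 * (norm (grad \<phi> (l *\<^sub>R x + b)))\<^sup>2 \<partial>lborel)"
    unfolding dirichlet_def g by (simp add: power_mult_distrib)
  also have "\<dots> = l ^ CARD('n) * (\<integral>x. (norm (grad \<phi> (b + l *\<^sub>R x)))\<^sup>2 \<partial>lborel)"
    unfolding cl by (simp add: add.commute)
  also have "\<dots> = dirichlet \<phi>"
    using integral_affine[of "\<lambda>x. (norm (grad \<phi> x))\<^sup>2" l b] l by (simp add: dirichlet_def)
  finally show ?thesis .
qed

lemma energy_rescale:
  fixes \<phi> :: "real^'n::finite \<Rightarrow> real"
  assumes "CARD('n) \<ge> 3" "\<phi> \<in> test_functions" "l > 0" "b = 0 \<or> \<gamma> = 0"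
  shows "energy \<gamma> (rescale l b \<phi>) = energy \<gamma> \<phi>"
  using assms pnorm_rescale[OF assms(1-3), of b 2] by (auto simp: energy_def dirichlet_rescale)

lemma powr_interpolate:
  fixes a b q e :: real
  assumes "a < b" "b < q" "e > 0"
  shows "\<exists>C\<ge>0. \<forall>t\<ge>0. t powr b \<le> e * t powr q + C * t powr a"
proof -
  \<comment> \<open>The crossover point: above K the power b is at most e times the power q, below K
    it is controlled by the power a.\<close>
  define K where "K = e powr (1 / (b - q))"
  have K: "K > 0" using assms by (simp add: K_def)
  have Kq: "K powr (b - q) = e" using assms by (simp add: K_def powr_powr)
  have "t powr b \<le> e * t powr q + K powr (b - a) * t powr a" if "t \<ge> 0" for t
  proof (cases "t \<le> K")
    case True
    have "t powr b = t powr (b - a) * t powr a" by (simp add: powr_add[symmetric])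
    also have "\<dots> \<le> K powr (b - a) * t powr a" using assms that True by (intro mult_right_mono powr_mono2) auto
    finally show ?thesis using assms by (simp add: add_increasing)
  next
    case False
    have "t powr b = t powr (b - q) * t powr q" by (simp add: powr_add[symmetric])
    also have "\<dots> \<le> K powr (b - q) * t powr q" using assms K False by (intro mult_right_mono powr_mono2') auto
    finally show ?thesis unfolding Kq by (simp add: add_increasing2)
  qed
  then show ?thesis by (intro exI[of _ "K powr (b - a)"]) auto
qed

text \<open>A discrete intermediate value argument from monotonicity alone, at the price of a factor
  4 between the two radii. The normalizations below therefore use radii 1/2 and 2 around scale
  1.\<close>

lemma doubling_threshold:
  assumes "(a::real) > 0" "P a" "\<not> P R" and R: "R > 0" and mono: "\<And>x y. 0 < x \<Longrightarrow> x \<le> y \<Longrightarrow> P y \<Longrightarrow> P x"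
  shows "\<exists>l>0. P (l / 2) \<and> \<not> P (2 * l)"
proof -
  obtain j0 :: nat where "R / a < 2 ^ j0" using real_arch_pow[of 2 "R / a"] by auto
  then have "R \<le> a * 2 ^ j0" using assms(1) by (simp add: field_simps)
  then have ex: "\<not> P (a * 2 ^ j0)" using mono[of R "a * 2 ^ j0"] R assms(3) by blast
  define j where "j = (LEAST j. \<not> P (a * 2 ^ j))"
  have j: "\<not> P (a * 2 ^ j)" unfolding j_def by (rule LeastI[of "\<lambda>j. \<not> P (a * 2 ^ j)", OF ex])
  have "j \<noteq> 0" using j assms(2) by (intro notI) simp
  then obtain i where i: "j = Suc i" by (cases j) auto
  have Pi: "P (a * 2 ^ i)" using not_less_Least[of i "\<lambda>j. \<not> P (a * 2 ^ j)"] i by (simp add: j_def[symmetric])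
  show ?thesis
  \<comment> \<open>With i the last good doubling, l/2 is the good radius and 2l lies one doubling
    beyond the first bad one.\<close>
  proof (intro exI[of _ "2 * (a * 2 ^ i)"] conjI)
    show "\<not> P (2 * (2 * (a * 2 ^ i)))"
    proof
      assume "P (2 * (2 * (a * 2 ^ i)))"
      then have "P (a * 2 ^ j)" by (rule mono[rotated 2]) (use assms(1) in \<open>auto simp: i\<close>)
      then show False using j by simp
    qed
  qed (use Pi assms(1) in auto)
qed

section \<open>Excluding vanishing sequences\<close>

context hs_problem
begin

lemma mass_integrable:
  assumes "\<phi> \<in> T" "A \<in> sets borel"
  shows "integrable (hs_measure s) (\<lambda>x. \<bar>\<phi> x\<bar> powr crit_exp TYPE('n) s * indicator A x)"
proof -
  have "integrable (hs_measure s) (\<lambda>x. \<bar>\<phi> x\<bar> powr crit_exp TYPE('n) s)" using hardy_sobolev_test[OF n s(1) s2] assms(1) by blast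
  then show ?thesis using assms(2) by (intro integrable_real_mult_indicator) auto
qed

lemma mass_nonneg: "mass s u A \<ge> 0"
  unfolding mass_def by (intro integral_nonneg_AE) auto

lemma mass_mono: "\<phi> \<in> T \<Longrightarrow> A \<in> sets borel \<Longrightarrow> B \<in> sets borel \<Longrightarrow> A \<subseteq> B \<Longrightarrow> mass s \<phi> A \<le> mass s \<phi> B"
  unfolding mass_def by (intro integral_mono mass_integrable) (auto simp: indicator_def)

lemma mass_Un_le:
  assumes "\<phi> \<in> T" "A \<in> sets borel" "B \<in> sets borel"
  shows "mass s \<phi> (A \<union> B) \<le> mass s \<phi> A + mass s \<phi> B"
proof -
  have "mass s \<phi> (A \<union> B) \<le> (\<integral>x. \<bar>\<phi> x\<bar> powr crit_exp TYPE('n) s * indicator A x + \<bar>\<phi> x\<bar> powr crit_exp TYPE('n) s * indicator B x \<partial>hs_measure s)"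
    unfolding mass_def using assms
    by (intro integral_mono Bochner_Integration.integrable_add mass_integrable) (auto simp: indicator_def)
  also have "\<dots> = mass s \<phi> A + mass s \<phi> B" unfolding mass_def
    by (intro Bochner_Integration.integral_add mass_integrable assms)
  finally show ?thesis .
qed

lemma mass_UN_le:
  assumes "\<phi> \<in> T" "finite Y" "\<And>y. A y \<in> sets borel"
  shows "mass s \<phi> (\<Union>y\<in>Y. A y) \<le> (\<Sum>y\<in>Y. mass s \<phi> (A y))"
  using assms(2)
proof induction
  case empty then show ?case by (simp add: mass_def)
next
  case (insert y Y)
  have "mass s \<phi> (A y \<union> (\<Union>y\<in>Y. A y)) \<le> mass s \<phi> (A y) + mass s \<phi> (\<Union>y\<in>Y. A y)"
    using insert(1) by (intro mass_Un_le assms sets.finite_UN) auto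
  then show ?case using insert by simp
qed

lemma mass_compl:
  assumes "\<phi> \<in> T" "A \<in> sets borel"
  shows "mass s \<phi> A + mass s \<phi> (- A) = pnorm s \<phi>"
proof -
  have A: "- A \<in> sets borel" using assms(2) by (metis borel_comp)
  have "mass s \<phi> A + mass s \<phi> (- A) = (\<integral>x. \<bar>\<phi> x\<bar> powr crit_exp TYPE('n) s * indicator A x + \<bar>\<phi> x\<bar> powr crit_exp TYPE('n) s * indicator (- A) x \<partial>hs_measure s)"
    unfolding mass_def by (intro Bochner_Integration.integral_add[symmetric] mass_integrable assms A)
  also have "\<dots> = pnorm s \<phi>" unfolding pnorm_def
    by (intro Bochner_Integration.integral_cong refl) (auto simp: indicator_def)
  finally show ?thesis .
qed

text \<open>The sine is 1 on the inner ball, the cosine outside the doubled one; only the shell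
  between them is shared.\<close>

lemma mass_le_pnorm_cutoff:
  assumes t: "\<phi> \<in> T" and r: "r > 0"
  shows "mass s \<phi> (cball y r) \<le> pnorm s (\<lambda>x. cutoff_sin y r x * \<phi> x)"
    "mass s \<phi> (- cball y (2 * r)) \<le> pnorm s (\<lambda>x. cutoff_cos y r x * \<phi> x)"
proof -
  have i: "integrable (hs_measure s) (\<lambda>x. \<bar>f x\<bar> powr crit_exp TYPE('n) s)" if "f \<in> T" for f
    using hardy_sobolev_test[OF n s(1) s2] that by blast
  show "mass s \<phi> (cball y r) \<le> pnorm s (\<lambda>x. cutoff_sin y r x * \<phi> x)" unfolding mass_def pnorm_def
    by (intro integral_mono mass_integrable t i cutoff_sin_cos_test)
       (auto simp: indicator_def cutoff_sin_eq_1[OF r] dist_norm norm_minus_commute)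
  show "mass s \<phi> (- cball y (2 * r)) \<le> pnorm s (\<lambda>x. cutoff_cos y r x * \<phi> x)" unfolding mass_def pnorm_def
    by (intro integral_mono mass_integrable t i cutoff_sin_cos_test)
       (auto simp: indicator_def cutoff_cos_eq_1[OF r] dist_norm norm_minus_commute not_le intro: borel_comp)
qed

lemma vanishing_test: "vanishing U \<Longrightarrow> U k \<in> T" "vanishing U \<Longrightarrow> pnorm s (U k) = 1"
  by (auto simp: vanishing_def)

text \<open>The localization error is a multiple of local L^2 mass, which tends to 0 along a
  vanishing sequence.\<close>

lemma vanishing_energy_split:
  assumes v: "vanishing U" and r: "r > 0" and e: "e > 0"
  shows "eventually (\<lambda>k. energy \<gamma> (\<lambda>x. cutoff_sin y r x * U k x) + energy \<gamma> (\<lambda>x. cutoff_cos y r x * U k x) < HS_mu TYPE('n) \<gamma> s + e) sequentially"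
proof -
  obtain M R where M: "M \<ge> 0" "\<forall>\<phi>\<in>T. energy \<gamma> (\<lambda>x. cutoff_sin y r x * \<phi> x) + energy \<gamma> (\<lambda>x. cutoff_cos y r x * \<phi> x)
       \<le> energy \<gamma> \<phi> + M * (\<integral>x. (\<phi> x)\<^sup>2 * indicator (cball 0 R) x \<partial>lborel)"
    using energy_split[OF n r] by blast
  have lims: "(\<lambda>k. energy \<gamma> (U k)) \<longlonglongrightarrow> HS_mu TYPE('n) \<gamma> s" "(\<lambda>k. \<integral>x. (U k x)\<^sup>2 * indicator (cball 0 R) x \<partial>lborel) \<longlonglongrightarrow> 0"
    using v by (auto simp: vanishing_def)
  have "(\<lambda>k. energy \<gamma> (U k) + M * (\<integral>x. (U k x)\<^sup>2 * indicator (cball 0 R) x \<partial>lborel)) \<longlonglongrightarrow> HS_mu TYPE('n) \<gamma> s + M * 0"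
    by (intro tendsto_add tendsto_mult tendsto_const lims)
  then have "eventually (\<lambda>k. energy \<gamma> (U k) + M * (\<integral>x. (U k x)\<^sup>2 * indicator (cball 0 R) x \<partial>lborel) < HS_mu TYPE('n) \<gamma> s + e) sequentially"
    using e by (intro order_tendstoD(2)) auto
  then show ?thesis
  proof eventually_elim
    case (elim k)
    then show ?case using M(2) vanishing_test(1)[OF v, of k] by (meson le_less_trans)
  qed
qed

text \<open>Each localized piece costs at least mu times the q-th power of its mass, with q = 2 /
  \<open>crit_exp\<close>, and together they cost no more than mu in the limit. Mass inside a ball
  and mass outside the doubled ball thus cannot both stay away from 0.\<close>

lemma vanishing_mass_split:
  assumes v: "vanishing U" and r: "r > 0" and e: "e > 0"
  shows "eventually (\<lambda>k. mass s (U k) (cball y r) powr (2 / crit_exp TYPE('n) s) + mass s (U k) (- cball y (2 * r)) powr (2 / crit_exp TYPE('n) s) < 1 + e) sequentially"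
proof -
  have "HS_mu TYPE('n) \<gamma> s * e > 0" using mu_pos e by simp
  from vanishing_energy_split[OF v r this, of y] show ?thesis
  proof eventually_elim
    case (elim k)
    note t = vanishing_test(1)[OF v, of k]
    have "HS_mu TYPE('n) \<gamma> s * (mass s (U k) (cball y r) powr (2 / crit_exp TYPE('n) s) + mass s (U k) (- cball y (2 * r)) powr (2 / crit_exp TYPE('n) s))
       \<le> HS_mu TYPE('n) \<gamma> s * (pnorm s (\<lambda>x. cutoff_sin y r x * U k x) powr (2 / crit_exp TYPE('n) s) + pnorm s (\<lambda>x. cutoff_cos y r x * U k x) powr (2 / crit_exp TYPE('n) s))"
      using mu_pos p by (intro mult_left_mono add_mono powr_mono2 mass_le_pnorm_cutoff t r mass_nonneg) auto
    also have "\<dots> \<le> energy \<gamma> (\<lambda>x. cutoff_sin y r x * U k x) + energy \<gamma> (\<lambda>x. cutoff_cos y r x * U k x)"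
      unfolding distrib_left by (intro add_mono mu_test cutoff_sin_cos_test t)
    also have "\<dots> < HS_mu TYPE('n) \<gamma> s * (1 + e)" using elim by (simp add: distrib_left)
    finally show ?case using mu_pos by (simp only: mult_less_cancel_left_pos)
  qed
qed

text \<open>Without mass in the annulus, half of it sits within the unit ball and half outside
  radius 2. Splitting at radius 1 then costs 2 (1/2)^q, which exceeds 1.\<close>

lemma no_vanishing_annulus:
  assumes v: "vanishing U" and half: "\<And>k. mass s (U k) (cball 0 (1/2)) \<le> 1/2" "\<And>k. mass s (U k) (cball 0 2) \<ge> 1/2"
    and ann: "(\<lambda>k. mass s (U k) (cball 0 2 - cball 0 (1/2))) \<longlonglongrightarrow> 0"
  shows False
proof -
  define q where "q = 2 / crit_exp TYPE('n) s"
  have q: "0 < q" "q < 1" using p by (auto simp: q_def)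
  define L where "L = 2 * (1/2::real) powr q"
  have "(1/2::real) powr 1 < (1/2) powr q" using q by (intro powr_less_mono') auto
  then have L: "L > 1" by (simp add: L_def)
  define a where "a k = mass s (U k) (cball 0 2 - cball 0 (1/2))" for k
  \<comment> \<open>The maximum with 0 keeps the base of the power nonnegative for the finitely many
    k with large annulus mass.\<close>
  have "(\<lambda>k. max 0 (1/2 - a k)) \<longlonglongrightarrow> max 0 (1/2 - 0)" unfolding a_def by (intro tendsto_max tendsto_diff tendsto_const ann)
  then have "(\<lambda>k. max 0 (1/2 - a k)) \<longlonglongrightarrow> 1/2" by simp
  then have "(\<lambda>k. max 0 (1/2 - a k) powr q) \<longlonglongrightarrow> (1/2) powr q" by (rule tendsto_powr) auto
  then have "(\<lambda>k. 2 * max 0 (1/2 - a k) powr q) \<longlonglongrightarrow> L" unfolding L_def by (rule tendsto_mult_left)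
  then have "eventually (\<lambda>k. 2 * max 0 (1/2 - a k) powr q > (1 + L) / 2) sequentially" using L by (intro order_tendstoD(1)) auto
  moreover have "eventually (\<lambda>k. mass s (U k) (cball 0 1) powr q + mass s (U k) (- cball 0 (2 * 1)) powr q < 1 + (L - 1) / 2) sequentially"
    unfolding q_def by (rule vanishing_mass_split[OF v]) (use L in auto)
  ultimately have "eventually (\<lambda>k. False) sequentially"
  proof eventually_elim
    case (elim k)
    note t = vanishing_test(1)[OF v, of k] and one = vanishing_test(2)[OF v, of k]
    have "mass s (U k) (cball 0 2) \<le> mass s (U k) (cball 0 1 \<union> (cball 0 2 - cball 0 (1/2)))"
      by (rule mass_mono[OF t]) auto
    also have "\<dots> \<le> mass s (U k) (cball 0 1) + a k" unfolding a_def by (rule mass_Un_le[OF t]) auto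
    finally have 1: "1/2 - a k \<le> mass s (U k) (cball 0 1)" using half(2)[of k] by simp
    have "mass s (U k) (cball 0 2) \<le> mass s (U k) (cball 0 (1/2) \<union> (cball 0 2 - cball 0 (1/2)))"
      by (rule mass_mono[OF t]) auto
    also have "\<dots> \<le> mass s (U k) (cball 0 (1/2)) + a k" unfolding a_def by (rule mass_Un_le[OF t]) auto
    finally have 2: "1/2 - a k \<le> mass s (U k) (- cball 0 2)" using half(1)[of k] mass_compl[OF t, of "cball 0 2"] one by simp
    have "2 * max 0 (1/2 - a k) powr q \<le> mass s (U k) (cball 0 1) powr q + mass s (U k) (- cball 0 2) powr q"
    proof -
      have "max 0 (1/2 - a k) powr q \<le> mass s (U k) (cball 0 1) powr q"
        by (rule powr_mono2) (use 1 q mass_nonneg in auto)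
      moreover have "max 0 (1/2 - a k) powr q \<le> mass s (U k) (- cball 0 2) powr q"
        by (rule powr_mono2) (use 2 q mass_nonneg in auto)
      ultimately show ?thesis by simp
    qed
    then show ?case using elim by (simp add: field_simps)
  qed
  then show False by simp
qed

lemma mass_large_ball:
  assumes t: "\<phi> \<in> T"
  shows "\<exists>R>0. mass s \<phi> (cball 0 R) = pnorm s \<phi>"
proof -
  obtain R where R: "R > 0" "\<forall>x. norm x > R \<longrightarrow> \<phi> x = 0" using C1c_support[OF test_functions_C1c[OF t]] by blast
  have eq: "\<bar>\<phi> x\<bar> powr crit_exp TYPE('n) s * indicator (cball 0 R) x = \<bar>\<phi> x\<bar> powr crit_exp TYPE('n) s" for x
    using R(2) by (cases "norm x > R") (auto simp: indicator_def)
  have "mass s \<phi> (cball 0 R) = pnorm s \<phi>" unfolding mass_def pnorm_def eq ..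
  then show ?thesis using R(1) by blast
qed

text \<open>Dominated convergence as the radius shrinks: the indicators tend to 0 off the origin,
  and the origin is a null set.\<close>

lemma mass_small_ball:
  assumes t: "\<phi> \<in> T" and e: "e > 0"
  shows "\<exists>r>0. mass s \<phi> (cball 0 r) \<le> e"
proof -
  note [measurable] = test_functions_measurable[OF t]
  define r where "r k = inverse (real (Suc k))" for k
  have r0: "r \<longlonglongrightarrow> 0" unfolding r_def by (rule LIMSEQ_inverse_real_of_nat)
  have "(\<lambda>k. mass s \<phi> (cball 0 (r k))) \<longlonglongrightarrow> (\<integral>x. 0 \<partial>(hs_measure s :: (real^'n) measure))"
    unfolding mass_def
  proof (rule integral_dominated_convergence[where w="\<lambda>x. \<bar>\<phi> x\<bar> powr crit_exp TYPE('n) s"])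
    show "AE x in hs_measure s. (\<lambda>k. \<bar>\<phi> x\<bar> powr crit_exp TYPE('n) s * indicator (cball 0 (r k)) x) \<longlonglongrightarrow> 0"
      unfolding AE_hs_measure using AE_lborel_singleton[of "0::real^'n"]
    proof eventually_elim
      case (elim x)
      have "eventually (\<lambda>k. r k < norm x) sequentially" using r0 elim by (intro order_tendstoD(2)) auto
      then have "eventually (\<lambda>k. \<bar>\<phi> x\<bar> powr crit_exp TYPE('n) s * indicator (cball 0 (r k)) x = 0) sequentially"
        by eventually_elim (simp add: indicator_def)
      then show ?case by (rule tendsto_eventually)
    qed
    show "integrable (hs_measure s) (\<lambda>x. \<bar>\<phi> x\<bar> powr crit_exp TYPE('n) s)" using hardy_sobolev_test[OF n s(1) s2] t by blast
    show "(\<lambda>x. \<bar>\<phi> x\<bar> powr crit_exp TYPE('n) s * indicator (cball 0 (r k)) x) \<in> borel_measurable (hs_measure s)" for k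
      by (rule borel_measurable_integrable[OF mass_integrable[OF t]]) simp
  qed (auto simp: indicator_def)
  then have "eventually (\<lambda>k. mass s \<phi> (cball 0 (r k)) < e) sequentially" using e by (intro order_tendstoD(2)) auto
  then obtain k where "mass s \<phi> (cball 0 (r k)) < e" by (auto simp: eventually_sequentially)
  then show ?thesis by (intro exI[of _ "r k"]) (auto simp: r_def)
qed

text \<open>Fixes the free scale: half of the mass is reached at a radius between 1/2 and 2, so
  neither concentration at the origin nor escape to infinity goes unnoticed.\<close>

lemma normalized_dilation:
  assumes t: "\<phi> \<in> T" and one: "pnorm s \<phi> = 1"
  shows "\<exists>\<psi>\<in>T. pnorm s \<psi> = 1 \<and> energy \<gamma> \<psi> = energy \<gamma> \<phi> \<and> mass s \<psi> (cball 0 (1/2)) \<le> 1/2 \<and> mass s \<psi> (cball 0 2) \<ge> 1/2"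
proof -
  obtain R where R: "R > 0" "mass s \<phi> (cball 0 R) = 1" using mass_large_ball[OF t] one by auto
  obtain a where a: "a > 0" "mass s \<phi> (cball 0 a) \<le> 1/2" using mass_small_ball[OF t, of "1/2"] by auto
  have "\<exists>l>0. mass s \<phi> (cball 0 (l / 2)) \<le> 1/2 \<and> \<not> mass s \<phi> (cball 0 (2 * l)) \<le> 1/2"
  proof (rule doubling_threshold[OF a(1), where P="\<lambda>r. mass s \<phi> (cball 0 r) \<le> 1/2" and R=R])
    show "mass s \<phi> (cball 0 x) \<le> 1/2" if "x \<le> y" "mass s \<phi> (cball 0 y) \<le> 1/2" for x y
      using mass_mono[OF t _ _ subset_cball[OF that(1), of 0]] that(2) by simp
  qed (use a R in auto)
  then obtain l where l: "l > 0" "mass s \<phi> (cball 0 (l / 2)) \<le> 1/2" "mass s \<phi> (cball 0 (2 * l)) \<ge> 1/2" by auto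
  show ?thesis
  proof (intro bexI[of _ "rescale l 0 \<phi>"] conjI)
    show "pnorm s (rescale l 0 \<phi>) = 1" using pnorm_rescale[OF n t l(1), of 0] one by simp
    show "energy \<gamma> (rescale l 0 \<phi>) = energy \<gamma> \<phi>" by (rule energy_rescale[OF n t l(1)]) simp
    show "mass s (rescale l 0 \<phi>) (cball 0 (1/2)) \<le> 1/2" "mass s (rescale l 0 \<phi>) (cball 0 2) \<ge> 1/2"
      using mass_rescale_cball[OF n t l(1), of 0 s 0] l by (auto simp: mult.commute)
  qed (rule rescale_test[OF t l(1)])
qed

text \<open>Reduces attainment to one decay statement about vanishing sequences. It is proved for s
  > 0 by interpolation and for s = 0 < \<gamma> by comparison with the Sobolev constant.\<close>

lemma attained_if_annulus:
  assumes ann: "\<And>U. vanishing U \<Longrightarrow> (\<lambda>k. mass s (U k) (cball 0 2 - cball 0 (1/2))) \<longlonglongrightarrow> 0"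
  shows "HS_mu_attained TYPE('n) \<gamma> s"
proof -
  obtain \<phi> where \<phi>: "\<forall>k. \<phi> k \<in> T \<and> pnorm s (\<phi> k) = 1" "(\<lambda>k. energy \<gamma> (\<phi> k)) \<longlonglongrightarrow> HS_mu TYPE('n) \<gamma> s"
    using minimizing_sequence by blast
  have "\<exists>U. \<forall>k. U k \<in> T \<and> pnorm s (U k) = 1 \<and> energy \<gamma> (U k) = energy \<gamma> (\<phi> k) \<and> mass s (U k) (cball 0 (1/2)) \<le> 1/2 \<and> mass s (U k) (cball 0 2) \<ge> 1/2"
  proof (rule choice, rule allI)
    fix k
    show "\<exists>\<psi>. \<psi> \<in> T \<and> pnorm s \<psi> = 1 \<and> energy \<gamma> \<psi> = energy \<gamma> (\<phi> k) \<and> mass s \<psi> (cball 0 (1/2)) \<le> 1/2 \<and> mass s \<psi> (cball 0 2) \<ge> 1/2"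
      using normalized_dilation[of "\<phi> k"] \<phi>(1) by auto
  qed
  then obtain U where U: "\<forall>k. U k \<in> T \<and> pnorm s (U k) = 1 \<and> energy \<gamma> (U k) = energy \<gamma> (\<phi> k) \<and> mass s (U k) (cball 0 (1/2)) \<le> 1/2 \<and> mass s (U k) (cball 0 2) \<ge> 1/2" ..
  then have "(\<lambda>k. energy \<gamma> (U k)) \<longlonglongrightarrow> HS_mu TYPE('n) \<gamma> s" using \<phi>(2) by simp
  then have "HS_mu_attained TYPE('n) \<gamma> s \<or> (\<exists>r::nat \<Rightarrow> nat. strict_mono r \<and> vanishing (\<lambda>k. U (r k)))"
    using U by (intro attained_or_vanishing) auto
  moreover have False if "vanishing (\<lambda>k. U (r k))" for r :: "nat \<Rightarrow> nat"
    by (rule no_vanishing_annulus[OF that _ _ ann[OF that]]) (use U in auto)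
  ultimately show ?thesis by blast
qed

lemma vanishing_dirichlet_bounded: 
  assumes v: "vanishing U" shows "\<exists>B. \<forall>k. dirichlet (U k) \<le> B"
proof -
  obtain c where c: "c > 0" "\<forall>\<phi>\<in>T. c * dirichlet \<phi> \<le> energy \<gamma> \<phi>" using coercive by blast
  have "(\<lambda>k. energy \<gamma> (U k)) \<longlonglongrightarrow> HS_mu TYPE('n) \<gamma> s" using v by (simp add: vanishing_def)
  then have "Bseq (\<lambda>k. energy \<gamma> (U k))" by (intro convergent_imp_Bseq convergentI)
  then obtain B where B: "\<forall>k. norm (energy \<gamma> (U k)) \<le> B" unfolding Bseq_def by blast
  have "dirichlet (U k) \<le> B / c" for k
  proof -
    have "c * dirichlet (U k) \<le> energy \<gamma> (U k)" using c(2) vanishing_test(1)[OF v, of k] by blast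
    also have "\<dots> \<le> B" using B by (metis abs_le_D1 real_norm_def)
    finally show ?thesis using c(1) by (simp add: field_simps)
  qed
  then show ?thesis by blast
qed

lemma mass_eq_lborel:
  assumes t: "\<phi> \<in> T" and A [measurable]: "A \<in> sets borel"
  shows "mass s \<phi> A = (\<integral>x. \<bar>\<phi> x\<bar> powr crit_exp TYPE('n) s * indicator A x / norm x powr s \<partial>lborel)"
    and "integrable lborel (\<lambda>x. \<bar>\<phi> x\<bar> powr crit_exp TYPE('n) s * indicator A x / norm x powr s)"
proof -
  note [measurable] = test_functions_measurable[OF t]
  define f where "f x = \<bar>\<phi> x\<bar> powr crit_exp TYPE('n) s * indicator A x" for x
  have [measurable]: "f \<in> borel_measurable borel" unfolding f_def by measurable
  have "integrable (hs_measure s) f" unfolding f_def by (rule mass_integrable[OF t A])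
  then have "integrable lborel (\<lambda>x. f x / norm x powr s)"
    unfolding hs_measure_def by (subst (asm) integrable_density) (auto simp: divide_inverse mult.commute)
  then show "integrable lborel (\<lambda>x. \<bar>\<phi> x\<bar> powr crit_exp TYPE('n) s * indicator A x / norm x powr s)" by (simp only: f_def)
  have "(\<integral>x. f x \<partial>hs_measure s) = (\<integral>x. f x / norm x powr s \<partial>lborel)" by (rule integral_hs_measure) measurable
  then show "mass s \<phi> A = (\<integral>x. \<bar>\<phi> x\<bar> powr crit_exp TYPE('n) s * indicator A x / norm x powr s \<partial>lborel)"
    by (simp only: mass_def f_def)
qed

text \<open>Minkowski for the squares in L^(p/2), p = \<open>crit_exp\<close>: the squares of the
  two pieces add up to \<phi>^2 exactly. Unlike \<open>mass_le_pnorm_cutoff\<close> it loses nothing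
  in the shell.\<close>

lemma pnorm_cutoff_sum:
  assumes t: "\<phi> \<in> T"
  shows "pnorm s \<phi> powr (2 / crit_exp TYPE('n) s) \<le> pnorm s (\<lambda>x. cutoff_sin y r x * \<phi> x) powr (2 / crit_exp TYPE('n) s) + pnorm s (\<lambda>x. cutoff_cos y r x * \<phi> x) powr (2 / crit_exp TYPE('n) s)"
proof -
  have i: "integrable (hs_measure s) (\<lambda>x. \<bar>f x\<bar> powr crit_exp TYPE('n) s)" if "f \<in> T" for f
    using hardy_sobolev_test[OF n s(1) s2] that by blast
  have sq: "(z\<^sup>2) powr (crit_exp TYPE('n) s / 2) = \<bar>z\<bar> powr crit_exp TYPE('n) s" for z :: real
  proof -
    have "z\<^sup>2 = \<bar>z\<bar> powr 2" using norm_powr_2[of z] by simp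
    then have "(z\<^sup>2) powr (crit_exp TYPE('n) s / 2) = \<bar>z\<bar> powr (2 * (crit_exp TYPE('n) s / 2))" by (simp only: powr_powr)
    then show ?thesis by simp
  qed
  have sum: "(cutoff_sin y r x * \<phi> x)\<^sup>2 + (cutoff_cos y r x * \<phi> x)\<^sup>2 = (\<phi> x)\<^sup>2" for x
    by (simp only: power_mult_distrib distrib_right[symmetric] cutoff_sin_cos_squared mult_1_left)
  have h: "1 / (crit_exp TYPE('n) s / 2) = 2 / crit_exp TYPE('n) s" by simp
  have I1: "integrable (hs_measure s) (\<lambda>x. ((cutoff_sin y r x * \<phi> x)\<^sup>2) powr (crit_exp TYPE('n) s / 2))"
    unfolding sq by (rule i[OF cutoff_sin_cos_test(1)[OF t]])
  have I2: "integrable (hs_measure s) (\<lambda>x. ((cutoff_cos y r x * \<phi> x)\<^sup>2) powr (crit_exp TYPE('n) s / 2))"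
    unfolding sq by (rule i[OF cutoff_sin_cos_test(2)[OF t]])
  have I3: "integrable (hs_measure s) (\<lambda>x. ((cutoff_sin y r x * \<phi> x)\<^sup>2 + (cutoff_cos y r x * \<phi> x)\<^sup>2) powr (crit_exp TYPE('n) s / 2))"
    unfolding sum sq by (rule i[OF t])
  have "(\<integral>x. ((cutoff_sin y r x * \<phi> x)\<^sup>2 + (cutoff_cos y r x * \<phi> x)\<^sup>2) powr (crit_exp TYPE('n) s / 2) \<partial>hs_measure s) powr (1 / (crit_exp TYPE('n) s / 2))
     \<le> (\<integral>x. ((cutoff_sin y r x * \<phi> x)\<^sup>2) powr (crit_exp TYPE('n) s / 2) \<partial>hs_measure s) powr (1 / (crit_exp TYPE('n) s / 2)) + (\<integral>x. ((cutoff_cos y r x * \<phi> x)\<^sup>2) powr (crit_exp TYPE('n) s / 2) \<partial>hs_measure s) powr (1 / (crit_exp TYPE('n) s / 2))"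
  proof (rule minkowski_two)
    show "1 \<le> crit_exp TYPE('n) s / 2" using p(1) by simp
  qed (rule I1 I2 I3 zero_le_power2)+
  then show ?thesis unfolding sum sq h pnorm_def .
qed

end

context hs_problem
begin

text \<open>The contradiction when translations are free too. If no ball of radius 1/2 has more than
  \<eta>, nearly all mass lies outside it, and the splitting inequality pushes the mass of the
  concentric ball of radius 1/4 down to about \<eta>^a with a > 1. Finitely many such balls cover
  the ball of radius 2 and cannot collect \<eta>.\<close>

lemma no_vanishing_spread:
  "\<exists>\<eta>>0. \<eta> < 1 \<and> (\<forall>U. vanishing U \<longrightarrow> (\<forall>k y. mass s (U k) (cball y (1/2)) \<le> \<eta>) \<longrightarrow> (\<forall>k. mass s (U k) (cball 0 2) \<ge> \<eta>) \<longrightarrow> False)"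
proof -
  have "compact (cball (0::real^'n) 2)" by simp
  then obtain Y where Y: "finite Y" "Y \<subseteq> cball (0::real^'n) 2" "cball 0 2 \<subseteq> (\<Union>y\<in>Y. ball y (1/4))"
    by (rule compactE_image[of "cball (0::real^'n) 2" "cball 0 2" "\<lambda>y. ball y (1/4)"]) auto
  \<comment> \<open>At least the number of covering balls; the extra 1 keeps it positive.\<close>
  define m where "m = real (card Y) + 1"
  have m: "m \<ge> 1" by (simp add: m_def)
  define a where "a = crit_exp TYPE('n) s / 2"
  have a: "a > 1" using p by (simp add: a_def)
  \<comment> \<open>Solves m \<eta>^a = \<eta>/2, leaving a factor 2 of slack for the error
    e.\<close>
  define \<eta> where "\<eta> = (1 / (2 * m)) powr (1 / (a - 1))"
  have e0: "\<eta> > 0" using m by (simp add: \<eta>_def)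
  have e1: "\<eta> powr (a - 1) = 1 / (2 * m)" using a m by (simp add: \<eta>_def powr_powr)
  have "\<eta> < 1"
  proof (rule ccontr)
    assume "\<not> \<eta> < 1"
    then have "1 \<le> \<eta> powr (a - 1)" using a by (intro ge_one_powr_ge_zero) auto
    then show False using e1 m by (simp add: field_simps)
  qed
  have prod: "m * \<eta> powr a = \<eta> / 2"
  proof -
    have "\<eta> powr a = \<eta> powr (a - 1) * \<eta>" using e0 by (simp add: powr_diff)
    then show ?thesis using e1 m by simp
  qed
  have False if v: "vanishing U" and sm: "\<forall>k y. mass s (U k) (cball y (1/2)) \<le> \<eta>" and big: "\<forall>k. mass s (U k) (cball 0 2) \<ge> \<eta>" for U
  proof -
    \<comment> \<open>Chosen so that (\<eta> + e)^a = sqrt 2 times \<eta>^a, which still fits into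
      that slack.\<close>
    define e where "e = \<eta> * (2 powr (1 / (2 * a)) - 1)"
    have "1 < (2::real) powr (1 / (2 * a))" using a by (subst gr_one_powr) auto
    then have e_pos: "e > 0" using e0 by (simp add: e_def)
    have "\<eta> + e = \<eta> * 2 powr (1 / (2 * a))" by (simp add: e_def algebra_simps)
    then have "(\<eta> + e) powr a = \<eta> powr a * 2 powr (1 / 2)" using a by (simp add: powr_mult powr_powr)
    then have "m * (\<eta> + e) powr a = (m * \<eta> powr a) * 2 powr (1 / 2)" by simp
    also have "\<dots> < (m * \<eta> powr a) * 2 powr 1"
      unfolding prod using e0 by (intro mult_strict_left_mono powr_less_mono) auto
    finally have l: "m * (\<eta> + e) powr a < (m * \<eta> powr a) * 2 powr 1" .
    have two: "(2::real) powr 1 = 2" by simp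
    from l have "m * (\<eta> + e) powr a < \<eta> / 2 * 2" unfolding prod two .
    then have e: "m * (\<eta> + e) powr a < \<eta>" by simp
    have ev: "eventually (\<lambda>k. mass s (U k) (cball y (1/4)) \<le> (\<eta> + e) powr a) sequentially" for y
    proof -
      have q: "(1/4::real) > 0" by simp
      show ?thesis using vanishing_mass_split[OF v q e_pos, of y]
      proof (rule eventually_mono)
        fix k
        assume h: "mass s (U k) (cball y (1/4)) powr (2 / crit_exp TYPE('n) s) + mass s (U k) (- cball y (2 * (1/4))) powr (2 / crit_exp TYPE('n) s) < 1 + e"
        define c where "c = mass s (U k) (cball y (1/4))"
        define d where "d = mass s (U k) (- cball y (1/2))"
        define q where "q = 2 / crit_exp TYPE('n) s"
        have h': "c powr q + d powr q < 1 + e" using h by (simp add: c_def d_def q_def)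
        have q: "0 < q" "q \<le> 1" "q * a = 1" using p by (auto simp: q_def a_def)
        have c0: "0 \<le> c" unfolding c_def by (rule mass_nonneg)
        have d0: "0 \<le> d" unfolding d_def by (rule mass_nonneg)
        have "d = 1 - mass s (U k) (cball y (1/2))"
          using mass_compl[OF vanishing_test(1)[OF v, of k], of "cball y (1/2)"] vanishing_test(2)[OF v, of k] by (simp add: d_def)
        moreover have "mass s (U k) (cball y (1/2)) \<ge> 0" by (rule mass_nonneg)
        ultimately have d: "1 - \<eta> \<le> d" "d \<le> 1" using sm by auto
        \<comment> \<open>As d \<le> 1 and q \<le> 1; thus d^q is at least 1 - \<eta>, and only
          \<eta> + e remains for the small ball.\<close>
        have "d \<le> d powr q" using powr_mono'[OF q(2) d0 d(2)] d0 by simp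
        then have "c powr q \<le> \<eta> + e" using h' d(1) by linarith
        then have "(c powr q) powr a \<le> (\<eta> + e) powr a" using a by (intro powr_mono2) auto
        then show "mass s (U k) (cball y (1/4)) \<le> (\<eta> + e) powr a" using q(3) c0 by (simp add: powr_powr c_def)
      qed
    qed
    have "eventually (\<lambda>k. \<forall>y\<in>Y. mass s (U k) (cball y (1/4)) \<le> (\<eta> + e) powr a) sequentially"
      by (rule eventually_ball_finite[OF Y(1)]) (use ev in blast)
    from eventually_happens[OF this] obtain k where k: "\<forall>y\<in>Y. mass s (U k) (cball y (1/4)) \<le> (\<eta> + e) powr a" by auto
    note t = vanishing_test(1)[OF v, of k]
    have sub: "cball 0 2 \<subseteq> (\<Union>y\<in>Y. cball y (1/4))" 
    proof
      fix x :: "real^'n" assume "x \<in> cball 0 2"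
      then obtain y where y: "y \<in> Y" "x \<in> ball y (1/4)" using Y(3) by blast
      then have "x \<in> cball y (1/4)" by simp
      then show "x \<in> (\<Union>y\<in>Y. cball y (1/4))" using y(1) by blast
    qed
    have "\<eta> \<le> mass s (U k) (cball 0 2)" using big by simp
    also have "\<dots> \<le> mass s (U k) (\<Union>y\<in>Y. cball y (1/4))" by (rule mass_mono[OF t _ _ sub]) (use Y(1) in auto)
    also have "\<dots> \<le> (\<Sum>y\<in>Y. mass s (U k) (cball y (1/4)))" by (rule mass_UN_le[OF t Y(1)]) simp
    also have "\<dots> \<le> (\<Sum>y\<in>Y. (\<eta> + e) powr a)" using k by (intro sum_mono) simp
    also have "\<dots> \<le> m * (\<eta> + e) powr a" by (simp add: m_def mult_right_mono)
    finally show False using e by linarith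
  qed
  then show ?thesis using e0 \<open>\<eta> < 1\<close> by blast
qed

end

section \<open>The weighted case\<close>

context hs_problem
begin

text \<open>For s > 0 the exponent lies strictly between 2 and the Sobolev exponent, and the weight
  is at most 2^s on the annulus. Interpolation between vanishing local L^2 mass and the bounded
  Sobolev integral gives the decay.\<close>

lemma annulus_subcritical:
  assumes s0: "s > 0" and v: "vanishing U"
  shows "(\<lambda>k. mass s (U k) (cball 0 2 - cball 0 (1/2))) \<longlonglongrightarrow> 0"
proof -
  define q where "q = crit_exp TYPE('n) 0"
  have pq: "2 < crit_exp TYPE('n) s" "crit_exp TYPE('n) s < q" using p(1) crit_exp_gt2(6)[OF n s(1) s2 s0] by (auto simp: q_def)
  note t = vanishing_test(1)[OF v]
  note [measurable] = test_functions_measurable[OF t]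
  obtain C0 where C0: "C0 > 0" "\<forall>\<phi>\<in>T. pnorm 0 \<phi> \<le> C0 * dirichlet \<phi> powr (q / 2)"
    using hardy_sobolev_test[OF n, of 0] unfolding q_def by auto
  obtain B0 where B0: "\<forall>k. dirichlet (U k) \<le> B0" using vanishing_dirichlet_bounded[OF v] by blast
  \<comment> \<open>The extra 1 makes the bound positive, so that it may be divided by.\<close>
  define B where "B = C0 * B0 powr (q / 2) + 1"
  have B: "pnorm 0 (U k) \<le> B" for k
  proof -
    have "pnorm 0 (U k) \<le> C0 * dirichlet (U k) powr (q / 2)" using C0(2) t by blast
    also have "\<dots> \<le> C0 * B0 powr (q / 2)" using C0(1) pq B0 by (intro mult_left_mono powr_mono2) auto
    finally show ?thesis by (simp add: B_def)
  qed
  have Bpos: "B > 0" using C0(1) by (simp add: B_def add_nonneg_pos)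
  have i2: "integrable lborel (\<lambda>x. (U k x)\<^sup>2 * indicator (cball 0 2) x)" for k
    by (intro integrable_real_mult_indicator C1c_integrable_sq(1)[OF test_functions_C1c[OF t]]) auto
  have nz: "AE x in lborel. x \<noteq> (0::real^'n)" by (rule AE_lborel_singleton)
  have h0: "(\<integral>x. \<bar>U k x\<bar> powr q / norm x powr 0 \<partial>lborel) = pnorm 0 (U k)" for k
    unfolding pnorm_def q_def by (rule integral_hs_measure[symmetric]) measurable
  have iq: "integrable lborel (\<lambda>x. \<bar>U k x\<bar> powr q / norm x powr 0)" for k
  proof -
    have "integrable (hs_measure 0) (\<lambda>x. \<bar>U k x\<bar> powr q)" using hardy_sobolev_test[OF n, of 0] t[of k] unfolding q_def by auto
    then show ?thesis unfolding hs_measure_def by (subst (asm) integrable_density) (auto simp: divide_inverse mult.commute)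
  qed
  show ?thesis
  proof (rule tendstoI)
    fix e :: real assume e: "e > 0"
    \<comment> \<open>The Sobolev part then contributes exactly e/2, whatever the interpolation
      constant C turns out to be.\<close>
    define d where "d = e / (2 * 2 powr s * B)"
    have d: "d > 0" using e Bpos by (simp add: d_def)
    obtain C where C: "C \<ge> 0" "\<forall>t\<ge>0. t powr crit_exp TYPE('n) s \<le> d * t powr q + C * t powr 2"
      using powr_interpolate[OF pq d] by (elim exE conjE) (rule that)
    have bound: "mass s (U k) (cball 0 2 - cball 0 (1/2)) \<le> 2 powr s * (d * B + C * (\<integral>x. (U k x)\<^sup>2 * indicator (cball 0 2) x \<partial>lborel))" for k
    proof -
      let ?A = "cball (0::real^'n) 2 - cball 0 (1/2)"
      have "mass s (U k) ?A = (\<integral>x. \<bar>U k x\<bar> powr crit_exp TYPE('n) s * indicator ?A x / norm x powr s \<partial>lborel)"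
        by (rule mass_eq_lborel(1)[OF t]) simp
      also have "\<dots> \<le> (\<integral>x. 2 powr s * (d * (\<bar>U k x\<bar> powr q / norm x powr 0) + C * ((U k x)\<^sup>2 * indicator (cball 0 2) x)) \<partial>lborel)"
      proof (rule integral_mono_AE)
        show "integrable lborel (\<lambda>x. \<bar>U k x\<bar> powr crit_exp TYPE('n) s * indicator ?A x / norm x powr s)"
          by (rule mass_eq_lborel(2)[OF t]) simp
        show "integrable lborel (\<lambda>x. 2 powr s * (d * (\<bar>U k x\<bar> powr q / norm x powr 0) + C * ((U k x)\<^sup>2 * indicator (cball 0 2) x)))"
          by (intro integrable_mult_right Bochner_Integration.integrable_add iq i2)
        show "AE x in lborel. \<bar>U k x\<bar> powr crit_exp TYPE('n) s * indicator ?A x / norm x powr s \<le> 2 powr s * (d * (\<bar>U k x\<bar> powr q / norm x powr 0) + C * ((U k x)\<^sup>2 * indicator (cball 0 2) x))"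
          using nz
        proof eventually_elim
          case (elim x)
          show ?case
          proof (cases "x \<in> ?A")
            case True
            have "(1/2) powr s \<le> norm x powr s" using True s by (intro powr_mono2) auto
            then have "1 / norm x powr s \<le> 1 / (1/2) powr s" by (intro divide_left_mono) (use elim in auto)
            also have "\<dots> = 2 powr s" by (simp add: powr_divide)
            finally have X: "1 / norm x powr s \<le> 2 powr s" .
            have Y: "\<bar>U k x\<bar> powr crit_exp TYPE('n) s \<le> d * \<bar>U k x\<bar> powr q + C * \<bar>U k x\<bar> powr 2" by (rule C(2)[rule_format, OF abs_ge_zero])
            have Z: "(1 / norm x powr s) * \<bar>U k x\<bar> powr crit_exp TYPE('n) s \<le> 2 powr s * (d * \<bar>U k x\<bar> powr q + C * \<bar>U k x\<bar> powr 2)"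
              by (rule mult_mono[OF X Y]) simp_all
            have i1: "indicator ?A x = (1::real)" "indicator (cball 0 2) x = (1::real)" using True by (simp_all add: indicator_def)
            have n0: "norm x powr 0 = 1" using elim by simp
            have u2: "(U k x)\<^sup>2 = \<bar>U k x\<bar> powr 2" using norm_powr_2[of "U k x"] by simp
            show ?thesis unfolding i1 n0 u2 using Z by (simp only: mult_1_right mult_1_left div_by_1 times_divide_eq_left)
          next
            case False
            have i0: "indicator ?A x = (0::real)" using False by (simp add: indicator_def)
            have "0 \<le> 2 powr s * (d * (\<bar>U k x\<bar> powr q / norm x powr 0) + C * ((U k x)\<^sup>2 * indicator (cball 0 2) x))"
              by (intro mult_nonneg_nonneg add_nonneg_nonneg) (use d C(1) in simp_all)
            then show ?thesis unfolding i0 by (simp only: mult_zero_right div_0)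
          qed
        qed
      qed
      also have "\<dots> = 2 powr s * (d * pnorm 0 (U k) + C * (\<integral>x. (U k x)\<^sup>2 * indicator (cball 0 2) x \<partial>lborel))"
        unfolding h0[symmetric]
        by (simp only: integral_mult_right_zero Bochner_Integration.integral_add[OF integrable_mult_right[OF iq[of k], of d] integrable_mult_right[OF i2[of k], of C]])
      also have "\<dots> \<le> 2 powr s * (d * B + C * (\<integral>x. (U k x)\<^sup>2 * indicator (cball 0 2) x \<partial>lborel))"
        using d by (intro mult_left_mono add_right_mono B) auto
      finally show ?thesis .
    qed
    have l0: "(\<lambda>k. \<integral>x. (U k x)\<^sup>2 * indicator (cball 0 2) x \<partial>lborel) \<longlonglongrightarrow> 0" using v by (simp add: vanishing_def)
    have "(\<lambda>k. 2 powr s * (d * B + C * (\<integral>x. (U k x)\<^sup>2 * indicator (cball 0 2) x \<partial>lborel))) \<longlonglongrightarrow> 2 powr s * (d * B + C * 0)"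
      by (intro tendsto_mult tendsto_add tendsto_const l0)
    moreover have "2 powr s * (d * B + C * 0) < e"
    proof -
      have "2 powr s * (d * B) = e / 2" using Bpos by (simp add: d_def field_simps)
      then show ?thesis using e by simp
    qed
    ultimately have "eventually (\<lambda>k. 2 powr s * (d * B + C * (\<integral>x. (U k x)\<^sup>2 * indicator (cball 0 2) x \<partial>lborel)) < e) sequentially"
      by (rule order_tendstoD(2))
    then show "eventually (\<lambda>k. dist (mass s (U k) (cball 0 2 - cball 0 (1/2))) 0 < e) sequentially"
    proof eventually_elim
      case (elim k)
      then show ?case using bound[of k] mass_nonneg[of "U k" "cball 0 2 - cball 0 (1/2)"] by (simp add: dist_real_def)
    qed
  qed
qed

end

section \<open>The unweighted case: comparison with the Sobolev constant\<close>

text \<open>Far from the origin the Hardy term is an L^2 term. It makes the term negligible both for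
  localized vanishing sequences and for test functions translated to infinity.\<close>

lemma pnorm_2_le_away:
  fixes \<psi> :: "real^'n::finite \<Rightarrow> real"
  assumes n: "CARD('n) \<ge> 3" and t: "\<psi> \<in> test_functions" and \<rho>: "\<rho> > 0"
    and supp: "\<And>x. \<psi> x \<noteq> 0 \<Longrightarrow> norm x \<ge> \<rho>"
  shows "pnorm 2 \<psi> \<le> (1 / \<rho>\<^sup>2) * (\<integral>x. (\<psi> x)\<^sup>2 \<partial>lborel)"
proof -
  note [measurable] = test_functions_measurable[OF t]
  have i: "integrable lborel (\<lambda>x. (\<psi> x)\<^sup>2)" by (rule C1c_integrable_sq(1)[OF test_functions_C1c[OF t]])
  have pt: "(\<psi> x)\<^sup>2 / (norm x)\<^sup>2 \<le> (1 / \<rho>\<^sup>2) * (\<psi> x)\<^sup>2" for x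
  proof (cases "\<psi> x = 0")
    case False
    then have "\<rho>\<^sup>2 \<le> (norm x)\<^sup>2" using supp[of x] \<rho> by (intro power_mono) auto
    moreover have "norm x > 0" using supp[OF False] \<rho> by linarith
    ultimately have "(\<psi> x)\<^sup>2 / (norm x)\<^sup>2 \<le> (\<psi> x)\<^sup>2 / \<rho>\<^sup>2" using \<rho> by (intro divide_left_mono mult_pos_pos zero_less_power) auto
    then show ?thesis by simp
  qed simp
  have "pnorm 2 \<psi> = (\<integral>x. (\<psi> x)\<^sup>2 / (norm x)\<^sup>2 \<partial>lborel)" by (rule pnorm_2_eq[OF n]) measurable
  also have "\<dots> \<le> (\<integral>x. (1 / \<rho>\<^sup>2) * (\<psi> x)\<^sup>2 \<partial>lborel)"
  proof (rule integral_mono)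
    show "integrable lborel (\<lambda>x. (\<psi> x)\<^sup>2 / (norm x)\<^sup>2)"
      by (rule Bochner_Integration.integrable_bound[OF integrable_mult_right[OF i, of "1 / \<rho>\<^sup>2"]])
         (use pt in \<open>auto intro!: AE_I2\<close>)
  qed (use pt i in auto)
  also have "\<dots> = (1 / \<rho>\<^sup>2) * (\<integral>x. (\<psi> x)\<^sup>2 \<partial>lborel)" by (rule integral_mult_right_zero)
  finally show ?thesis .
qed

context hs_problem
begin

lemma hardy_constant_pos: "0 < (real CARD('n) - 2)\<^sup>2 / 4"
proof -
  have "real CARD('n) - 2 > 0" using n by simp
  then show ?thesis by simp
qed

text \<open>A nonzero function feels the Hardy potential; this is the source of strictness in the
  comparisons with the Sobolev constant.\<close>

lemma pnorm_2_pos: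
  assumes a: "D12_approx \<phi> u G" and pos: "pnorm s (u :: real^'n \<Rightarrow> real) > 0"
  shows "pnorm 2 u > 0"
proof (rule ccontr)
  assume "\<not> pnorm 2 u > 0"
  then have z: "pnorm 2 u = 0" using pnorm_nonneg[of 2 u] by linarith
  have i: "integrable (hs_measure 2) (\<lambda>x. \<bar>u x\<bar> powr crit_exp TYPE('n) 2)" by (rule D12_approx_limits(1)[OF n a]) simp_all
  have "AE x in hs_measure 2. \<bar>u x\<bar> powr crit_exp TYPE('n) 2 = 0"
    by (rule iffD1[OF integral_nonneg_eq_0_iff_AE[OF i]]) (use z in \<open>simp_all add: pnorm_def\<close>)
  then have "AE x in hs_measure 2. u x = 0" by eventually_elim simp
  then have ae: "AE x in lborel. u x = 0" by (simp only: AE_hs_measure)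
  have "u \<notin> D12_nonzero" using ae by (simp add: D12_nonzero_def)
  then show False using pnorm_pos_iff[OF a] pos by simp
qed

text \<open>Near \<open>y\<close> the Hardy term is negligible, so that piece pays the Sobolev
  constant S instead of the smaller mu. With A and B the squared norms of the two pieces, S A + mu B
  \<le> mu + o(1) and A + B \<ge> 1, hence (S - mu) A tends to 0.\<close>

lemma local_mass_vanishes:
  assumes s0: "s = 0" and g: "\<gamma> > 0" and S: "HS_mu TYPE('n) 0 0 > HS_mu TYPE('n) \<gamma> s" and v: "vanishing U"
    and r: "r > 0" "2 * r < norm y"
  shows "(\<lambda>k. mass s (U k) (cball y r)) \<longlonglongrightarrow> 0"
proof -
  interpret z: hs_problem dim 0 0 by unfold_locales (rule n hardy_constant_pos order_refl zero_less_numeral)+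
  note t = vanishing_test(1)[OF v] and one = vanishing_test(2)[OF v]
  \<comment> \<open>The distance from the origin to the support of the localized piece;
    \<open>R\<close> below is the radius of a ball containing that support.\<close>
  define \<rho> where "\<rho> = norm y - 2 * r"
  have \<rho>: "\<rho> > 0" using r by (simp add: \<rho>_def)
  define R where "R = norm y + 2 * r"
  define b where "b k = \<gamma> / \<rho>\<^sup>2 * (\<integral>x. (U k x)\<^sup>2 * indicator (cball 0 R) x \<partial>lborel)" for k
  have b0: "b \<longlonglongrightarrow> \<gamma> / \<rho>\<^sup>2 * 0" unfolding b_def
    by (intro tendsto_mult tendsto_const) (use v in \<open>simp add: vanishing_def\<close>)
  have bp: "\<gamma> * pnorm 2 (\<lambda>x. cutoff_sin y r x * U k x) \<le> b k" for k
  proof -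
    have tt: "(\<lambda>x. cutoff_sin y r x * U k x) \<in> T" by (rule cutoff_sin_cos_test(1)[OF t])
    have supp: "norm x \<ge> \<rho> \<and> norm x \<le> R" if "cutoff_sin y r x * U k x \<noteq> 0" for x
    proof -
      have "norm (x - y) < 2 * r" using that cutoff_sin_eq_0[OF r(1), of x y] by (metis mult_zero_left not_less)
      then show ?thesis using norm_triangle_ineq2[of y x] norm_triangle_ineq2[of x y] by (simp add: \<rho>_def R_def norm_minus_commute)
    qed
    have "pnorm 2 (\<lambda>x. cutoff_sin y r x * U k x) \<le> (1 / \<rho>\<^sup>2) * (\<integral>x. (cutoff_sin y r x * U k x)\<^sup>2 \<partial>lborel)"
      by (rule pnorm_2_le_away[OF n tt \<rho>]) (use supp in blast)
    also have "\<dots> \<le> (1 / \<rho>\<^sup>2) * (\<integral>x. (U k x)\<^sup>2 * indicator (cball 0 R) x \<partial>lborel)"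
    proof (intro mult_left_mono integral_mono)
      show "integrable lborel (\<lambda>x. (cutoff_sin y r x * U k x)\<^sup>2)" by (rule C1c_integrable_sq(1)[OF test_functions_C1c[OF tt]])
      show "integrable lborel (\<lambda>x. (U k x)\<^sup>2 * indicator (cball 0 R) x)"
        by (intro integrable_real_mult_indicator C1c_integrable_sq(1)[OF test_functions_C1c[OF t]]) auto
      fix x
      show "(cutoff_sin y r x * U k x)\<^sup>2 \<le> (U k x)\<^sup>2 * indicator (cball 0 R) x"
      proof (cases "cutoff_sin y r x * U k x = 0")
        case True
        then have "(cutoff_sin y r x * U k x)\<^sup>2 = 0" by simp
        moreover have "0 \<le> (U k x)\<^sup>2 * indicator (cball 0 R) x" by simp
        ultimately show ?thesis by (rule ord_eq_le_trans)
      next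
        case False
        have "(cutoff_sin y r x)\<^sup>2 \<le> 1" using cutoff_sin_cos_squared[of y r x] zero_le_power2[of "cutoff_cos y r x"] by linarith
        then have "(cutoff_sin y r x)\<^sup>2 * (U k x)\<^sup>2 \<le> 1 * (U k x)\<^sup>2" by (intro mult_right_mono) auto
        then show ?thesis using supp[OF False] by (simp add: power_mult_distrib)
      qed
    qed simp
    finally have "\<gamma> * pnorm 2 (\<lambda>x. cutoff_sin y r x * U k x) \<le> \<gamma> * ((1 / \<rho>\<^sup>2) * (\<integral>x. (U k x)\<^sup>2 * indicator (cball 0 R) x \<partial>lborel))"
      using g by (intro mult_left_mono) auto
    then show ?thesis by (simp add: b_def)
  qed
  define D where "D = HS_mu TYPE('n) 0 0 - HS_mu TYPE('n) \<gamma> s"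
  have D: "D > 0" using S by (simp add: D_def)
  have key: "D * mass s (U k) (cball y r) powr (2 / crit_exp TYPE('n) s) \<le> energy \<gamma> (\<lambda>x. cutoff_sin y r x * U k x) + energy \<gamma> (\<lambda>x. cutoff_cos y r x * U k x) + b k - HS_mu TYPE('n) \<gamma> s" for k
  proof -
    define A where "A = pnorm s (\<lambda>x. cutoff_sin y r x * U k x) powr (2 / crit_exp TYPE('n) s)"
    define B where "B = pnorm s (\<lambda>x. cutoff_cos y r x * U k x) powr (2 / crit_exp TYPE('n) s)"
    have "1 \<le> A + B" using pnorm_cutoff_sum[OF t[of k], of y r] one[of k] by (simp add: A_def B_def)
    then have AB: "HS_mu TYPE('n) \<gamma> s * 1 \<le> HS_mu TYPE('n) \<gamma> s * (A + B)" using mu_pos by (intro mult_left_mono) auto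
    have e1: "HS_mu TYPE('n) 0 0 * A \<le> energy 0 (\<lambda>x. cutoff_sin y r x * U k x)"
      unfolding A_def s0 by (rule z.mu_test[OF cutoff_sin_cos_test(1)[OF t]])
    have e2: "HS_mu TYPE('n) \<gamma> s * B \<le> energy \<gamma> (\<lambda>x. cutoff_cos y r x * U k x)"
      unfolding B_def by (rule mu_test[OF cutoff_sin_cos_test(2)[OF t]])
    have e3: "energy 0 (\<lambda>x. cutoff_sin y r x * U k x) = energy \<gamma> (\<lambda>x. cutoff_sin y r x * U k x) + \<gamma> * pnorm 2 (\<lambda>x. cutoff_sin y r x * U k x)"
      by (simp add: energy_def)
    have "D * mass s (U k) (cball y r) powr (2 / crit_exp TYPE('n) s) \<le> D * A" unfolding A_def
      using D p mass_nonneg[of "U k" "cball y r"] by (intro mult_left_mono powr_mono2 mass_le_pnorm_cutoff t r) auto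
    also have "\<dots> = HS_mu TYPE('n) 0 0 * A + HS_mu TYPE('n) \<gamma> s * B - HS_mu TYPE('n) \<gamma> s * (A + B)" by (simp add: D_def algebra_simps)
    finally show ?thesis using AB e1 e2 e3 bp[of k] by simp
  qed
  have "(\<lambda>k. mass s (U k) (cball y r) powr (2 / crit_exp TYPE('n) s)) \<longlonglongrightarrow> 0"
  proof (rule tendstoI)
    fix e :: real assume e: "e > 0"
    define d where "d = D * e / 2"
    have d: "d > 0" using D e by (simp add: d_def)
    have "eventually (\<lambda>k. b k < d) sequentially" using b0 d by (intro order_tendstoD(2)) auto
    with vanishing_energy_split[OF v r(1) d, of y]
    show "eventually (\<lambda>k. dist (mass s (U k) (cball y r) powr (2 / crit_exp TYPE('n) s)) 0 < e) sequentially"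
    proof eventually_elim
      case (elim k)
      have "D * mass s (U k) (cball y r) powr (2 / crit_exp TYPE('n) s) < D * e" using key[of k] elim by (simp add: d_def)
      then show ?case using D by (simp add: dist_real_def)
    qed
  qed
  then have "(\<lambda>k. (mass s (U k) (cball y r) powr (2 / crit_exp TYPE('n) s)) powr (crit_exp TYPE('n) s / 2)) \<longlonglongrightarrow> 0 powr (crit_exp TYPE('n) s / 2)"
    using p by (intro tendsto_powr2) auto
  moreover have "(mass s (U k) (cball y r) powr (2 / crit_exp TYPE('n) s)) powr (crit_exp TYPE('n) s / 2) = mass s (U k) (cball y r)" for k
    using p mass_nonneg[of "U k" "cball y r"] by (simp add: powr_powr)
  ultimately show ?thesis by simp
qed

text \<open>Cover the annulus by balls of radius 1/8 centred in it; their doubles stay clear of the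
  origin, as 1/4 < 1/2, so each carries vanishing mass.\<close>

lemma annulus_hardy:
  assumes s0: "s = 0" and g: "\<gamma> > 0" and S: "HS_mu TYPE('n) 0 0 > HS_mu TYPE('n) \<gamma> s" and v: "vanishing U"
  shows "(\<lambda>k. mass s (U k) (cball 0 2 - cball 0 (1/2))) \<longlonglongrightarrow> 0"
proof -
  let ?A = "cball (0::real^'n) 2 - ball 0 (1/2)"
  have "compact ?A" by (intro compact_diff) auto
  then obtain Y where Y: "Y \<subseteq> ?A" "finite Y" "?A \<subseteq> (\<Union>y\<in>Y. ball y (1/8))"
    by (rule compactE_image[of ?A ?A "\<lambda>y. ball y (1/8)"]) auto
  note t = vanishing_test(1)[OF v]
  have "(\<lambda>k. \<Sum>y\<in>Y. mass s (U k) (cball y (1/8))) \<longlonglongrightarrow> (\<Sum>y\<in>Y. 0)"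
  proof (intro tendsto_sum local_mass_vanishes[OF s0 g S v])
    fix y assume "y \<in> Y"
    then have "norm y \<ge> 1/2" using Y(1) by (auto simp: not_less)
    then show "2 * (1/8) < norm y" by simp
  qed auto
  then have ub: "(\<lambda>k. \<Sum>y\<in>Y. mass s (U k) (cball y (1/8))) \<longlonglongrightarrow> 0" by simp
  have sub: "cball 0 2 - cball 0 (1/2) \<subseteq> (\<Union>y\<in>Y. cball y (1/8))"
  proof
    fix x :: "real^'n" assume "x \<in> cball 0 2 - cball 0 (1/2)"
    then have "x \<in> ?A" by auto
    then obtain y where y: "y \<in> Y" "x \<in> ball y (1/8)" using Y(3) by blast
    then have "x \<in> cball y (1/8)" by simp
    then show "x \<in> (\<Union>y\<in>Y. cball y (1/8))" using y(1) by blast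
  qed
  have le: "mass s (U k) (cball 0 2 - cball 0 (1/2)) \<le> (\<Sum>y\<in>Y. mass s (U k) (cball y (1/8)))" for k
  proof -
    have "mass s (U k) (cball 0 2 - cball 0 (1/2)) \<le> mass s (U k) (\<Union>y\<in>Y. cball y (1/8))"
      by (rule mass_mono[OF t _ _ sub]) (use Y(2) in auto)
    also have "\<dots> \<le> (\<Sum>y\<in>Y. mass s (U k) (cball y (1/8)))" by (rule mass_UN_le[OF t Y(2)]) simp
    finally show ?thesis .
  qed
  show ?thesis
    by (rule tendsto_sandwich[OF always_eventually always_eventually tendsto_const ub]) (intro allI mass_nonneg le)+
qed

text \<open>Normalizes the concentration function, the largest mass of a ball of given radius: both
  the scale and the centre are chosen, which requires that neither weight nor potential marks the
  origin.\<close>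

lemma normalized_affine:
  assumes s0: "s = 0" and g: "\<gamma> = 0" and t: "\<phi> \<in> T" and one: "pnorm s \<phi> = 1" and \<eta>: "0 < \<eta>" "\<eta> < 1"
  shows "\<exists>\<psi>. \<psi> \<in> T \<and> pnorm s \<psi> = 1 \<and> energy \<gamma> \<psi> = energy \<gamma> \<phi> \<and>
    (\<forall>y. mass s \<psi> (cball y (1/2)) \<le> \<eta>) \<and> mass s \<psi> (cball 0 2) \<ge> \<eta>"
proof -
  note [measurable] = test_functions_measurable[OF t]
  obtain R where R: "R > 0" "mass s \<phi> (cball 0 R) = 1" using mass_large_ball[OF t] one by auto
  obtain M where M: "M > 0" "\<forall>x. \<bar>\<phi> x\<bar> \<le> M \<and> norm (grad \<phi> x) \<le> M" using C1c_bounded[OF test_functions_C1c[OF t]] by blast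
  define K where "K = M powr crit_exp TYPE('n) s * unit_ball_vol CARD('n)"
  have K: "K > 0" using M(1) by (simp add: K_def)
  \<comment> \<open>A starting radius at which all balls are light, uniformly in the centre: \<phi>
    is bounded, and a \<le> 1 reduces a^n to a.\<close>
  define a where "a = min 1 (\<eta> / K)"
  have "a \<le> \<eta> / K" by (simp add: a_def)
  then have "K * a \<le> \<eta>" using K by (simp add: pos_le_divide_eq mult.commute)
  then have a: "a > 0" "a \<le> 1" "K * a \<le> \<eta>" using K \<eta> by (simp_all add: a_def)
  have small: "mass s \<phi> (cball y a) \<le> \<eta>" for y
  proof -
    have i: "integrable lborel (\<lambda>x. M powr crit_exp TYPE('n) s * indicator (cball y a) x)"
      using emeasure_bounded_finite[OF bounded_cball, of y a] by (intro integrable_mult_right integrable_real_indicator) auto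
    have nz: "AE x in lborel. x \<noteq> (0::real^'n)" by (rule AE_lborel_singleton)
    have "mass s \<phi> (cball y a) = (\<integral>x. \<bar>\<phi> x\<bar> powr crit_exp TYPE('n) s * indicator (cball y a) x / norm x powr s \<partial>lborel)"
      by (rule mass_eq_lborel(1)[OF t]) simp
    also have "\<dots> \<le> (\<integral>x. M powr crit_exp TYPE('n) s * indicator (cball y a) x \<partial>lborel)"
    proof (rule integral_mono_AE)
      have le: "\<bar>\<phi> x\<bar> powr crit_exp TYPE('n) s * indicator (cball y a) x / norm x powr s \<le> M powr crit_exp TYPE('n) s * indicator (cball y a) x" for x
      proof -
        have "\<bar>\<phi> x\<bar> powr crit_exp TYPE('n) s \<le> M powr crit_exp TYPE('n) s" using M(2) p by (intro powr_mono2) auto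
        then show ?thesis by (cases "x = 0") (auto simp: s0 indicator_def)
      qed
      show "AE x in lborel. \<bar>\<phi> x\<bar> powr crit_exp TYPE('n) s * indicator (cball y a) x / norm x powr s \<le> M powr crit_exp TYPE('n) s * indicator (cball y a) x"
        using le by simp
      show "integrable lborel (\<lambda>x. \<bar>\<phi> x\<bar> powr crit_exp TYPE('n) s * indicator (cball y a) x / norm x powr s)"
        by (rule mass_eq_lborel(2)[OF t]) simp
    qed (rule i)
    also have "\<dots> = K * a ^ CARD('n)" using content_cball[of a y] a by (simp add: K_def)
    also have "\<dots> \<le> K * a"
    proof (rule mult_left_mono)
      have "a ^ CARD('n) \<le> a ^ 1" by (rule power_decreasing) (use a n in auto)
      then show "a ^ CARD('n) \<le> a" by simp
    qed (use K in simp)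
    finally show ?thesis using a(3) by linarith
  qed
  have "\<exists>l>0. (\<forall>y. mass s \<phi> (cball y (l / 2)) \<le> \<eta>) \<and> \<not> (\<forall>y. mass s \<phi> (cball y (2 * l)) \<le> \<eta>)"
  proof (rule doubling_threshold[OF a(1), where P="\<lambda>r. \<forall>y. mass s \<phi> (cball y r) \<le> \<eta>" and R=R])
    show "\<not> (\<forall>y. mass s \<phi> (cball y R) \<le> \<eta>)" using R(2) \<eta> by (intro notI) (drule spec[of _ 0], simp)
    show "\<forall>y. mass s \<phi> (cball y u) \<le> \<eta>" if "u \<le> w" "\<forall>y. mass s \<phi> (cball y w) \<le> \<eta>" for u w
    proof
      fix y
      have "mass s \<phi> (cball y u) \<le> mass s \<phi> (cball y w)" by (rule mass_mono[OF t _ _ subset_cball[OF that(1)]]) auto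
      then show "mass s \<phi> (cball y u) \<le> \<eta>" using that(2) by (meson order_trans)
    qed
  qed (use small R(1) in auto)
  then obtain l where l': "l > 0" "\<forall>y. mass s \<phi> (cball y (l / 2)) \<le> \<eta>" "\<not> (\<forall>y. mass s \<phi> (cball y (2 * l)) \<le> \<eta>)" by auto
  from l'(3) obtain y where "\<not> mass s \<phi> (cball y (2 * l)) \<le> \<eta>" by auto
  with l' have l: "l > 0" "\<forall>y. mass s \<phi> (cball y (l / 2)) \<le> \<eta>" "mass s \<phi> (cball y (2 * l)) \<ge> \<eta>" by simp_all
  show ?thesis
  proof (intro exI[of _ "rescale l y \<phi>"] conjI allI)
    show "rescale l y \<phi> \<in> T" by (rule rescale_test[OF t l(1)])
    show "pnorm s (rescale l y \<phi>) = 1" using pnorm_rescale[OF n t l(1), of y s] one s0 by simp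
    show "energy \<gamma> (rescale l y \<phi>) = energy \<gamma> \<phi>" by (rule energy_rescale[OF n t l(1)]) (simp add: g)
    show "mass s (rescale l y \<phi>) (cball z (1/2)) \<le> \<eta>" for z
      using mass_rescale_cball[OF n t l(1), of y s z "1/2"] l(2) s0 by simp
    show "mass s (rescale l y \<phi>) (cball 0 2) \<ge> \<eta>"
      using mass_rescale_cball[OF n t l(1), of y s 0 2] l(3) s0 by (simp add: mult.commute)
  qed
qed

lemma attained_sobolev:
  assumes s0: "s = 0" and g: "\<gamma> = 0"
  shows "HS_mu_attained TYPE('n) \<gamma> s"
proof -
  obtain \<eta> where \<eta>: "0 < \<eta>" "\<eta> < 1" and nv: "\<forall>U. vanishing U \<longrightarrow> (\<forall>k y. mass s (U k) (cball y (1/2)) \<le> \<eta>) \<longrightarrow> (\<forall>k. mass s (U k) (cball 0 2) \<ge> \<eta>) \<longrightarrow> False"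
    using no_vanishing_spread by blast
  obtain \<phi> where \<phi>: "\<forall>k. \<phi> k \<in> T \<and> pnorm s (\<phi> k) = 1" "(\<lambda>k. energy \<gamma> (\<phi> k)) \<longlonglongrightarrow> HS_mu TYPE('n) \<gamma> s"
    using minimizing_sequence by blast
  have "\<exists>U. \<forall>k. U k \<in> T \<and> pnorm s (U k) = 1 \<and> energy \<gamma> (U k) = energy \<gamma> (\<phi> k) \<and> (\<forall>y. mass s (U k) (cball y (1/2)) \<le> \<eta>) \<and> mass s (U k) (cball 0 2) \<ge> \<eta>"
  proof (rule choice, rule allI)
    fix k
    have "\<phi> k \<in> T" "pnorm s (\<phi> k) = 1" using \<phi>(1) by simp_all
    from normalized_affine[OF s0 g this \<eta>] show "\<exists>\<psi>. \<psi> \<in> T \<and> pnorm s \<psi> = 1 \<and> energy \<gamma> \<psi> = energy \<gamma> (\<phi> k) \<and> (\<forall>y. mass s \<psi> (cball y (1/2)) \<le> \<eta>) \<and> mass s \<psi> (cball 0 2) \<ge> \<eta>" .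
  qed
  then obtain U where U: "\<forall>k. U k \<in> T \<and> pnorm s (U k) = 1 \<and> energy \<gamma> (U k) = energy \<gamma> (\<phi> k) \<and> (\<forall>y. mass s (U k) (cball y (1/2)) \<le> \<eta>) \<and> mass s (U k) (cball 0 2) \<ge> \<eta>" ..
  then have "(\<lambda>k. energy \<gamma> (U k)) \<longlonglongrightarrow> HS_mu TYPE('n) \<gamma> s" using \<phi>(2) by simp
  then have "HS_mu_attained TYPE('n) \<gamma> s \<or> (\<exists>r::nat \<Rightarrow> nat. strict_mono r \<and> vanishing (\<lambda>k. U (r k)))"
    using U by (intro attained_or_vanishing) auto
  moreover have False if "vanishing (\<lambda>k. U (r k))" for r :: "nat \<Rightarrow> nat"
    using nv[rule_format, OF that] U by auto
  ultimately show ?thesis by blast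
qed

text \<open>The Sobolev extremal serves as a competitor: subtracting its positive Hardy term shows
  that mu lies strictly below the Sobolev constant, which is the gap needed in the annulus.\<close>

lemma attained_hardy:
  assumes s0: "s = 0" and g: "\<gamma> > 0"
  shows "HS_mu_attained TYPE('n) \<gamma> s"
proof -
  interpret z: hs_problem dim 0 0 by unfold_locales (rule n hardy_constant_pos order_refl zero_less_numeral)+
  have "HS_mu_attained TYPE('n) 0 0" by (rule z.attained_sobolev) auto
  then obtain \<phi> u G where a: "D12_approx \<phi> (u :: real^'n \<Rightarrow> real) G" and pos: "pnorm 0 u > 0"
    and eq: "(\<integral>x. (norm (G x))\<^sup>2 \<partial>lborel) - 0 * pnorm 2 u = HS_mu TYPE('n) 0 0 * pnorm 0 u powr (2 / crit_exp TYPE('n) 0)"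
    by (rule z.attainedE)
  have "\<gamma> * pnorm 2 u > 0" using g pnorm_2_pos[OF a] pos s0 by simp
  then have "HS_mu TYPE('n) \<gamma> s * pnorm s u powr (2 / crit_exp TYPE('n) s) < HS_mu TYPE('n) 0 0 * pnorm s u powr (2 / crit_exp TYPE('n) s)"
    using mu_D12[OF a] eq s0 by simp
  then have "HS_mu TYPE('n) \<gamma> s < HS_mu TYPE('n) 0 0" using pos s0 by (simp add: mult_less_cancel_right)
  then show ?thesis by (intro attained_if_annulus annulus_hardy[OF s0 g]) auto
qed

text \<open>Translating a near-minimizer of the Sobolev quotient to infinity keeps its norm and
  Dirichlet integral, as s = 0, and makes the Hardy term arbitrarily small.\<close>

lemma mu_le_sobolev:
  assumes s0: "s = 0" and g: "\<gamma> \<le> 0"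
  shows "HS_mu TYPE('n) \<gamma> s \<le> HS_mu TYPE('n) 0 0"
proof (rule field_le_epsilon)
  interpret z: hs_problem dim 0 0 by unfold_locales (rule n hardy_constant_pos order_refl zero_less_numeral)+
  fix e :: real assume e: "e > 0"
  obtain \<phi> where t: "\<phi> \<in> T" and one: "pnorm 0 \<phi> = 1" and en: "energy 0 \<phi> < HS_mu TYPE('n) 0 0 + e"
    using z.near_minimizer[OF e] by blast
  obtain R where R: "R > 0" "\<forall>x. norm x > R \<longrightarrow> \<phi> x = 0 \<and> grad \<phi> x = 0" using C1c_support[OF test_functions_C1c[OF t]] by blast
  note [measurable] = test_functions_measurable[OF t]
  define I where "I = (\<integral>x. (\<phi> x)\<^sup>2 \<partial>lborel)"
  \<comment> \<open>Any direction would do. A shift by R + j + 1 moves the support, contained in the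
    ball of radius R, to distance at least j + 1 from the origin.\<close>
  define b :: "nat \<Rightarrow> real^'n" where "b j = (R + real (Suc j)) *\<^sub>R axis undefined 1" for j
  have nb: "norm (b j) = R + real (Suc j)" for j using R(1) by (simp add: b_def norm_axis_1 abs_of_pos)
  have le: "HS_mu TYPE('n) \<gamma> s \<le> energy 0 \<phi> + (- \<gamma>) * (I * (inverse (real (Suc j)) * inverse (real (Suc j))))" for j
  proof -
    have tb: "rescale 1 (b j) \<phi> \<in> T" by (rule rescale_test[OF t]) simp
    have rb: "rescale 1 (b j) \<phi> = (\<lambda>x. \<phi> (x + b j))" by (rule ext) (simp add: rescale_def)
    have "pnorm 2 (rescale 1 (b j) \<phi>) \<le> (1 / (real (Suc j))\<^sup>2) * (\<integral>x. (rescale 1 (b j) \<phi> x)\<^sup>2 \<partial>lborel)"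
    proof (rule pnorm_2_le_away[OF n tb])
      fix x assume "rescale 1 (b j) \<phi> x \<noteq> 0"
      then have "norm (x + b j) \<le> R" using R(2) unfolding rb by (metis not_less)
      then show "real (Suc j) \<le> norm x" using nb[of j] norm_triangle_ineq4[of "x + b j" x] by simp
    qed simp
    also have "(\<integral>x. (rescale 1 (b j) \<phi> x)\<^sup>2 \<partial>lborel) = I"
      unfolding rb I_def using integral_translate[of "\<lambda>x. (\<phi> x)\<^sup>2" "b j"] by simp
    finally have p2: "pnorm 2 (rescale 1 (b j) \<phi>) \<le> I * (inverse (real (Suc j)) * inverse (real (Suc j)))"
      by (simp add: power2_eq_square divide_inverse mult.commute)
    have "HS_mu TYPE('n) \<gamma> s * pnorm s (rescale 1 (b j) \<phi>) powr (2 / crit_exp TYPE('n) s) \<le> energy \<gamma> (rescale 1 (b j) \<phi>)" by (rule mu_test[OF tb])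
    also have "pnorm s (rescale 1 (b j) \<phi>) = 1" using pnorm_rescale[OF n t, of 1 "b j" s] one s0 by simp
    also have "energy \<gamma> (rescale 1 (b j) \<phi>) = energy 0 \<phi> + (- \<gamma>) * pnorm 2 (rescale 1 (b j) \<phi>)"
      using dirichlet_rescale[OF t, of 1 "b j"] by (simp add: energy_def)
    also have "\<dots> \<le> energy 0 \<phi> + (- \<gamma>) * (I * (inverse (real (Suc j)) * inverse (real (Suc j))))"
      using g by (intro add_left_mono mult_left_mono p2) auto
    finally show ?thesis by simp
  qed
  have "(\<lambda>j. energy 0 \<phi> + (- \<gamma>) * (I * (inverse (real (Suc j)) * inverse (real (Suc j))))) \<longlonglongrightarrow> energy 0 \<phi> + (- \<gamma>) * (I * (0 * 0))"
    by (intro tendsto_add tendsto_mult tendsto_const LIMSEQ_inverse_real_of_nat)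
  then have "HS_mu TYPE('n) \<gamma> s \<le> energy 0 \<phi> + (- \<gamma>) * (I * (0 * 0))" by (rule LIMSEQ_le_const) (use le in blast)
  then show "HS_mu TYPE('n) \<gamma> s \<le> HS_mu TYPE('n) 0 0 + e" using en by simp
qed

text \<open>For an extremal u the term -\<gamma> times its Hardy integral is strictly positive, so
  mu ||u||^2 would exceed the Dirichlet integral of u, hence S ||u||^2, with S the Sobolev constant.
  But mu \<le> S.\<close>

lemma not_attained:
  assumes s0: "s = 0" and g: "\<gamma> < 0"
  shows "\<not> HS_mu_attained TYPE('n) \<gamma> s"
proof
  interpret z: hs_problem dim 0 0 by unfold_locales (rule n hardy_constant_pos order_refl zero_less_numeral)+
  assume "HS_mu_attained TYPE('n) \<gamma> s"
  then obtain \<phi> u G where a: "D12_approx \<phi> (u :: real^'n \<Rightarrow> real) G" and pos: "pnorm s u > 0"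
    and eq: "(\<integral>x. (norm (G x))\<^sup>2 \<partial>lborel) - \<gamma> * pnorm 2 u = HS_mu TYPE('n) \<gamma> s * pnorm s u powr (2 / crit_exp TYPE('n) s)"
    by (rule attainedE)
  have "\<gamma> * pnorm 2 u < 0" using g pnorm_2_pos[OF a pos] by (simp add: mult_neg_pos)
  moreover have "HS_mu TYPE('n) 0 0 * pnorm s u powr (2 / crit_exp TYPE('n) s) \<le> (\<integral>x. (norm (G x))\<^sup>2 \<partial>lborel)"
    using z.mu_D12[OF a] s0 by simp
  moreover have "HS_mu TYPE('n) \<gamma> s * pnorm s u powr (2 / crit_exp TYPE('n) s) \<le> HS_mu TYPE('n) 0 0 * pnorm s u powr (2 / crit_exp TYPE('n) s)"
    using g by (intro mult_right_mono mu_le_sobolev[OF s0]) auto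
  ultimately show False using eq by linarith
qed

end

theorem proposition1p2:
  fixes s \<gamma> :: real
  assumes "CARD('n::finite) \<ge> 3"
    and "0 \<le> s" and "s < 2"
    and "\<gamma> < (real CARD('n) - 2)\<^sup>2 / 4"
  shows "(s > 0 \<or> (s = 0 \<and> \<gamma> \<ge> 0) \<longrightarrow> HS_mu_attained TYPE('n) \<gamma> s) \<and>
         (s = 0 \<and> \<gamma> < 0 \<longrightarrow> \<not> HS_mu_attained TYPE('n) \<gamma> s)"
proof -
  interpret hs_problem "TYPE('n)" \<gamma> s by unfold_locales (use assms in auto)
  have "HS_mu_attained TYPE('n) \<gamma> s" if "s > 0"
    by (rule attained_if_annulus) (rule annulus_subcritical[OF that])
  moreover have "HS_mu_attained TYPE('n) \<gamma> s" if "s = 0" "\<gamma> \<ge> 0"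
    using attained_sobolev[OF that(1)] attained_hardy[OF that(1)] that(2) by (cases "\<gamma> = 0") auto
  moreover have "\<not> HS_mu_attained TYPE('n) \<gamma> s" if "s = 0" "\<gamma> < 0"
    by (rule not_attained[OF that])
  ultimately show ?thesis by blast
qed

end
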